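(* Let $\Sigma$ be a hyperelliptic Riemann surface of genus $g\geq 3$ with a fixed nonsingular even spin structure $\xi_\epsilon$. For any Weierstrass point $P$ of $\Sigma$, the spin group $\mathtt{G}_P=\{\sigma^{\mathsf{W}_P}:\mathsf{W}_P\text{ a spin chain at }P\}$, acting by permutations on the $g$-element set $\{\mathcal{A}_P\}$, is isomorphic to the alternating group $\mathtt{A}_g\triangleleft\mathtt{S}_g$.
   Context: Setting. $\Sigma$ is a compact hyperelliptic Riemann surface of genus $g$. $\xi_\epsilon$ is a nonsingular even spin bundle: a line bundle with $\xi_\epsilon^{\otimes 2}\cong K_\Sigma$ and $h^0(\xi_\epsilon)=0$. For each $Q\in\Sigma$ there is, up to scalar, a unique meromorphic section of $\xi_\epsilon$ whose only pole is a simple pole at $Q$; its zero divisor $\mathcal{A}_Q$ is an effective divisor of degree $g$, and $\{\mathcal{A}_Q\}$ denotes the set of points of $\mathcal{A}_Q$. One has $R\in\{\mathcal{A}_Q\}$ iff $Q\in\{\mathcal{A}_R\}$. Spin graph. $\{\mathcal{S}_P\}$ is the smallest set of points containing $P$ such that $Q\in\{\mathcal{S}_P\}$ implies $\{\mathcal{A}_Q\}\subset\{\mathcal{S}_P\}$. The spin graph $\mathcal{S}_P$ has vertex set $\{\mathcal{S}_P\}$ and an edge $QR$ whenever $R\in\{\mathcal{A}_Q\}$. If $P$ is a Weierstrass point, then $\{\mathcal{S}_P\}=\{P,P_1,\dots,P_g\}$ consists of $g+1$ distinct Weierstrass points, and $\{\mathcal{A}_Q\}=\{\mathcal{S}_P\}\setminus\{Q\}$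 for every vertex $Q$; so any two distinct vertices are joined by an edge. The faces of $\mathcal{S}_P$ are the triangles $\{Q,R,S\}$ on three distinct vertices. Transport along an edge. For a face $F=\{Q,R,S\}$, the bijection $\sigma^F_{QR}:\{\mathcal{A}_Q\}\to\{\mathcal{A}_R\}$ is given by $S\mapsto Q$, $R\mapsto S$, and $T\mapsto T$ for every other $T\in\{\mathcal{A}_Q\}$. Spin chains. A spin chain at $P$ is $\mathsf{W}_P=\{\mathsf{L}_P=PQ_1Q_2\dots Q_NP;\,F_1,\dots,F_{N+1}\}$, where $\mathsf{L}_P$ is a loop (closed walk along edges of the graph) at $P$ and $F_1,\dots,F_{N+1}$ are faces with $PQ_1\subset F_1$, $Q_{i-1}Q_i\subset F_i$ for $2\le i\le N$, and $Q_NP\subset F_{N+1}$. Its permutation of $\{\mathcal{A}_P\}$ is $\sigma^{\mathsf{W}_P}=\sigma^{F_{N+1}}_{Q_NP}\circ\sigma^{F_N}_{Q_{N-1}Q_N}\circ\dots\circ\sigma^{F_2}_{Q_1Q_2}\circ\sigma^{F_1}_{PQ_1}$. *)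

theory Defs
  imports
    "HOL-Complex_Analysis.Complex_Analysis"
    "HOL-Algebra.Sym_Groups"
    "HOL-Library.Extended_Nat"
    "HOL-Library.Function_Algebras"
begin

section \<open>Riemann surfaces\<close>

type_synonym 'a chart = "'a set \<times> ('a \<Rightarrow> complex)"

definition coord_expr :: "'a chart \<Rightarrow> ('a \<Rightarrow> complex) \<Rightarrow> complex \<Rightarrow> complex" where
  "coord_expr c f = f \<circ> inv_into (fst c) (snd c)"

definition is_chart :: "('a::topological_space) chart \<Rightarrow> bool" where
  "is_chart c \<longleftrightarrow> open (fst c) \<and> open (snd c ` fst c) \<and>
     homeomorphism (fst c) (snd c ` fst c) (snd c) (inv_into (fst c) (snd c))"

definition holo_atlas :: "('a::topological_space) chart set \<Rightarrow> bool" where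
  "holo_atlas A \<longleftrightarrow>
     (\<forall>c\<in>A. is_chart c) \<and> (\<Union>c\<in>A. fst c) = UNIV \<and>
     (\<forall>c\<in>A. \<forall>d\<in>A. coord_expr c (snd d) holomorphic_on snd c ` (fst c \<inter> fst d))"

text \<open>The surface is the whole type, with the complex structure given by an atlas \<open>A\<close>, which
  need not be maximal.\<close>

definition riemann_surface :: "('a::t2_space) chart set \<Rightarrow> bool" where
  "riemann_surface A \<longleftrightarrow> connected (UNIV :: 'a set) \<and> holo_atlas A"

definition compact_riemann_surface :: "('a::t2_space) chart set \<Rightarrow> bool" where
  "compact_riemann_surface A \<longleftrightarrow> riemann_surface A \<and> compact (UNIV :: 'a set)"

definition holo_on_surface :: "'a chart set \<Rightarrow> ('a \<Rightarrow> complex) \<Rightarrow> 'a set \<Rightarrow> bool" where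
  "holo_on_surface A f W \<longleftrightarrow>
     (\<forall>c\<in>A. coord_expr c f holomorphic_on snd c ` (fst c \<inter> W))"

text \<open>Meromorphic functions are complex-valued functions which by convention take the value
  \<open>0\<close> at their poles and have no removable singularities.\<close>

definition mero_on_surface :: "'a chart set \<Rightarrow> ('a \<Rightarrow> complex) \<Rightarrow> 'a set \<Rightarrow> bool" where
  "mero_on_surface A f W \<longleftrightarrow>
     (\<forall>c\<in>A. coord_expr c f nicely_meromorphic_on snd c ` (fst c \<inter> W))"

text \<open>Only meaningful if \<open>f\<close> is meromorphic and not identically zero near \<open>p\<close>.\<close>

definition order_at :: "'a chart set \<Rightarrow> ('a \<Rightarrow> complex) \<Rightarrow> 'a \<Rightarrow> int" where
  "order_at A f p =
     (let c = (SOME c. c \<in> A \<and> p \<in> fst c) in zorder (coord_expr c f) (snd c p))"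


section \<open>Holomorphic line bundles\<close>

text \<open>A line bundle is given by an open cover and transition functions. A section is a family
  of functions \<open>s i\<close> on the members of the cover with \<open>s i = transition i j * s j\<close> on overlaps,
  extended by \<open>0\<close> so that equality of sections is equality of families.\<close>

record ('a, 'i) line_bundle =
  indices :: "'i set"
  patch :: "'i \<Rightarrow> 'a set"
  transition :: "'i \<Rightarrow> 'i \<Rightarrow> 'a \<Rightarrow> complex"

definition is_line_bundle ::
    "('a::topological_space) chart set \<Rightarrow> ('a, 'i) line_bundle \<Rightarrow> bool" where
  "is_line_bundle A L \<longleftrightarrow>
     (\<forall>i\<in>indices L. open (patch L i)) \<and> (\<Union>i\<in>indices L. patch L i) = UNIV \<and>
     (\<forall>i\<in>indices L. \<forall>j\<in>indices L.
        holo_on_surface A (transition L i j) (patch L i \<inter> patch L j) \<and>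
        (\<forall>p \<in> patch L i \<inter> patch L j. transition L i j p \<noteq> 0)) \<and>
     (\<forall>i\<in>indices L. \<forall>j\<in>indices L. \<forall>k\<in>indices L.
        \<forall>p \<in> patch L i \<inter> patch L j \<inter> patch L k.
          transition L i j p * transition L j k p = transition L i k p)"

text \<open>\<open>h i j\<close> is the isomorphism written in the trivialisation \<open>j\<close> of \<open>M\<close> and \<open>i\<close> of \<open>L\<close>.\<close>

definition bundle_iso ::
    "'a chart set \<Rightarrow> ('a, 'i) line_bundle \<Rightarrow> ('a, 'j) line_bundle \<Rightarrow> bool" where
  "bundle_iso A L M \<longleftrightarrow>
     (\<exists>h :: 'i \<Rightarrow> 'j \<Rightarrow> 'a \<Rightarrow> complex.
        (\<forall>i\<in>indices L. \<forall>j\<in>indices M.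
           holo_on_surface A (h i j) (patch L i \<inter> patch M j) \<and>
           (\<forall>p \<in> patch L i \<inter> patch M j. h i j p \<noteq> 0)) \<and>
        (\<forall>i\<in>indices L. \<forall>i'\<in>indices L. \<forall>j\<in>indices M. \<forall>j'\<in>indices M.
           \<forall>p \<in> patch L i \<inter> patch L i' \<inter> patch M j \<inter> patch M j'.
             h i j p * transition M j j' p = transition L i i' p * h i' j' p))"

definition bundle_square :: "('a, 'i) line_bundle \<Rightarrow> ('a, 'i) line_bundle" where
  "bundle_square L =
     \<lparr>indices = indices L, patch = patch L, transition = (\<lambda>i j p. (transition L i j p)\<^sup>2)\<rparr>"

text \<open>The cotangent bundle, trivialised over a chart \<open>c\<close> by the differential \<open>dz\<^sub>c\<close> of its
  coordinate; the transition function from \<open>d\<close> to \<open>c\<close> is therefore \<open>dz\<^sub>d / dz\<^sub>c\<close>.\<close>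

definition canonical_bundle :: "'a chart set \<Rightarrow> ('a, 'a chart) line_bundle" where
  "canonical_bundle A =
     \<lparr>indices = A, patch = fst,
      transition = (\<lambda>c d p. deriv (coord_expr c (snd d)) (snd c p))\<rparr>"

definition section_family :: "('a, 'i) line_bundle \<Rightarrow> ('i \<Rightarrow> 'a \<Rightarrow> complex) \<Rightarrow> bool" where
  "section_family L s \<longleftrightarrow>
     (\<forall>i p. \<not> (i \<in> indices L \<and> p \<in> patch L i) \<longrightarrow> s i p = 0) \<and>
     (\<forall>i\<in>indices L. \<forall>j\<in>indices L. \<forall>p \<in> patch L i \<inter> patch L j.
        s i p = transition L i j p * s j p)"

definition holo_sections ::
    "'a chart set \<Rightarrow> ('a, 'i) line_bundle \<Rightarrow> ('i \<Rightarrow> 'a \<Rightarrow> complex) set" where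
  "holo_sections A L =
     {s. section_family L s \<and> (\<forall>i\<in>indices L. holo_on_surface A (s i) (patch L i))}"

definition mero_sections ::
    "'a chart set \<Rightarrow> ('a, 'i) line_bundle \<Rightarrow> ('i \<Rightarrow> 'a \<Rightarrow> complex) set" where
  "mero_sections A L =
     {s. section_family L s \<and> (\<forall>i\<in>indices L. mero_on_surface A (s i) (patch L i))}"

definition section_order ::
    "'a chart set \<Rightarrow> ('a, 'i) line_bundle \<Rightarrow> ('i \<Rightarrow> 'a \<Rightarrow> complex) \<Rightarrow> 'a \<Rightarrow> int" where
  "section_order A L s p = order_at A (s (SOME i. i \<in> indices L \<and> p \<in> patch L i)) p"

interpretation sections: vector_space
  "\<lambda>(a::complex) (s :: 'i \<Rightarrow> 'a \<Rightarrow> complex). (\<lambda>i p. a * s i p)"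
  by unfold_locales (auto simp: fun_eq_iff algebra_simps)

text \<open>Since \<open>sections.dim\<close> is not informative for infinite-dimensional spaces, these are given
  dimension \<open>\<infinity>\<close>.\<close>

definition h0 :: "'a chart set \<Rightarrow> ('a, 'i) line_bundle \<Rightarrow> enat" where
  "h0 A L =
     (if \<exists>B. finite B \<and> sections.span B = holo_sections A L
      then enat (sections.dim (holo_sections A L)) else \<infinity>)"


section \<open>Hyperelliptic surfaces, Weierstrass points and spin bundles\<close>

definition genus :: "'a chart set \<Rightarrow> enat" where
  "genus A = h0 A (canonical_bundle A)"

text \<open>A surface of genus at least two is hyperelliptic if it carries a meromorphic function of
  degree two, that is, one with exactly two poles counted with multiplicity.\<close>

definition pole_set :: "'a chart set \<Rightarrow> ('a \<Rightarrow> complex) \<Rightarrow> 'a set" where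
  "pole_set A f = {p. \<exists>c\<in>A. p \<in> fst c \<and> is_pole (coord_expr c f) (snd c p)}"

definition hyperelliptic :: "('a::t2_space) chart set \<Rightarrow> bool" where
  "hyperelliptic A \<longleftrightarrow> compact_riemann_surface A \<and> genus A \<ge> 2 \<and>
     (\<exists>f. mero_on_surface A f UNIV \<and> finite (pole_set A f) \<and>
          (\<Sum>p\<in>pole_set A f. - order_at A f p) = 2)"

text \<open>\<open>P\<close> is a Weierstrass point if some pole order at most the genus occurs at \<open>P\<close>, that is,
  if the gap sequence at \<open>P\<close> is not \<open>1, \<dots>, g\<close>.\<close>

definition weierstrass_point :: "'a chart set \<Rightarrow> 'a \<Rightarrow> bool" where
  "weierstrass_point A P \<longleftrightarrow>
     (\<exists>f. mero_on_surface A f UNIV \<and> pole_set A f = {P} \<and>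
          enat (nat (- order_at A f P)) \<le> genus A)"

definition spin_bundle ::
    "('a::topological_space) chart set \<Rightarrow> ('a, 'i) line_bundle \<Rightarrow> bool" where
  "spin_bundle A L \<longleftrightarrow>
     is_line_bundle A L \<and> bundle_iso A (bundle_square L) (canonical_bundle A)"

definition nonsingular_even_spin_bundle ::
    "('a::topological_space) chart set \<Rightarrow> ('a, 'i) line_bundle \<Rightarrow> bool" where
  "nonsingular_even_spin_bundle A L \<longleftrightarrow> spin_bundle A L \<and> h0 A L = 0"

definition simple_pole_section ::
    "'a chart set \<Rightarrow> ('a, 'i) line_bundle \<Rightarrow> 'a \<Rightarrow> ('i \<Rightarrow> 'a \<Rightarrow> complex) \<Rightarrow> bool" where
  "simple_pole_section A L Q s \<longleftrightarrow>
     s \<in> mero_sections A L \<and> s \<noteq> 0 \<and> section_order A L s Q = -1 \<and>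
     (\<forall>R. R \<noteq> Q \<longrightarrow> section_order A L s R \<ge> 0)"

text \<open>For a nonsingular even spin bundle the section below is unique up to a scalar, so that its
  zero divisor does not depend on the choice.\<close>

definition spin_divisor :: "'a chart set \<Rightarrow> ('a, 'i) line_bundle \<Rightarrow> 'a \<Rightarrow> 'a \<Rightarrow> nat" where
  "spin_divisor A L Q =
     (let s = (SOME s. simple_pole_section A L Q s) in (\<lambda>R. nat (section_order A L s R)))"

definition spin_points :: "'a chart set \<Rightarrow> ('a, 'i) line_bundle \<Rightarrow> 'a \<Rightarrow> 'a set" where
  "spin_points A L Q = {R. spin_divisor A L Q R > 0}"


section \<open>Spin graphs, spin chains and the spin group\<close>

inductive_set spin_vertices :: "'a chart set \<Rightarrow> ('a, 'i) line_bundle \<Rightarrow> 'a \<Rightarrow> 'a set"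
  for A L P where
  base: "P \<in> spin_vertices A L P"
| step: "Q \<in> spin_vertices A L P \<Longrightarrow> R \<in> spin_points A L Q \<Longrightarrow> R \<in> spin_vertices A L P"

definition spin_edge ::
    "'a chart set \<Rightarrow> ('a, 'i) line_bundle \<Rightarrow> 'a \<Rightarrow> 'a \<Rightarrow> 'a \<Rightarrow> bool" where
  "spin_edge A L P Q R \<longleftrightarrow>
     Q \<in> spin_vertices A L P \<and> R \<in> spin_vertices A L P \<and> R \<in> spin_points A L Q"

definition spin_faces :: "'a chart set \<Rightarrow> ('a, 'i) line_bundle \<Rightarrow> 'a \<Rightarrow> 'a set set" where
  "spin_faces A L P =
     {{Q, R, S} | Q R S. Q \<noteq> R \<and> R \<noteq> S \<and> Q \<noteq> S \<and>
        spin_edge A L P Q R \<and> spin_edge A L P R S \<and> spin_edge A L P S Q}"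

text \<open>The third vertex \<open>S\<close> of the face \<open>F = {Q, R, S}\<close> is sent to \<open>Q\<close>, and \<open>R\<close> to \<open>S\<close>.\<close>

definition edge_transport :: "'a set \<Rightarrow> 'a \<Rightarrow> 'a \<Rightarrow> 'a \<Rightarrow> 'a" where
  "edge_transport F Q R T =
     (let S = (THE S. S \<in> F - {Q, R})
      in if T = S then Q else if T = R then S else T)"

text \<open>A chain is given by the points of the walk, endpoints included, and the list of faces.\<close>

definition spin_chain ::
    "'a chart set \<Rightarrow> ('a, 'i) line_bundle \<Rightarrow> 'a \<Rightarrow> 'a list \<Rightarrow> 'a set list \<Rightarrow> bool" where
  "spin_chain A L P ps Fs \<longleftrightarrow>
     (\<exists>Qs. ps = P # Qs @ [P]) \<and> length ps = Suc (length Fs) \<and>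
     (\<forall>n < length Fs. spin_edge A L P (ps ! n) (ps ! Suc n) \<and>
        Fs ! n \<in> spin_faces A L P \<and> {ps ! n, ps ! Suc n} \<subseteq> Fs ! n)"

fun chain_transport :: "'a list \<Rightarrow> 'a set list \<Rightarrow> 'a \<Rightarrow> 'a" where
  "chain_transport (Q # R # ps) (F # Fs) = chain_transport (R # ps) Fs \<circ> edge_transport F Q R"
| "chain_transport _ _ = id"

text \<open>Outside \<open>{\<A>\<^sub>P}\<close> the permutation is the identity, as required by \<open>permutes\<close>.\<close>

definition chain_perm ::
    "'a chart set \<Rightarrow> ('a, 'i) line_bundle \<Rightarrow> 'a \<Rightarrow> 'a list \<Rightarrow> 'a set list \<Rightarrow> 'a \<Rightarrow> 'a" where
  "chain_perm A L P ps Fs T = (if T \<in> spin_points A L P then chain_transport ps Fs T else T)"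

definition spin_group :: "'a chart set \<Rightarrow> ('a, 'i) line_bundle \<Rightarrow> 'a \<Rightarrow> ('a \<Rightarrow> 'a) monoid" where
  "spin_group A L P =
     \<lparr>carrier = {chain_perm A L P ps Fs | ps Fs. spin_chain A L P ps Fs},
      mult = (\<circ>), one = id\<rparr>"

end

theory Submission
  imports Defs
begin

text \<open>
A hyperelliptic surface carries a function f of degree 2; after a Moebius transformation f has two
simple poles and P is not one of them. Let J be the sheet involution. A sheaf of functions on the
fibres of f that are unique up to sign and exist locally has a global element, because the plane is
simply connected. Let W be a nowhere vanishing twisted function off the poles. Applied to the norms
\<open>\<plusminus>v \<cdot> (v \<circ> J)\<close> of its local square roots v, and then to square roots with prescribed norm, this
yields a global square root s of \<open>W \<cdot> \<Prod>p\<in>T. (f - f p)\<close> for a set T of branch points.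

For W = 1 this is a function y with \<open>y\<^sup>2 = \<Prod>p\<in>B. (f - f p)\<close>, B being the set of all branch points. Hence the
differentials \<open>f\<^sup>k df / y\<close> for \<open>k < card B div 2 - 1\<close> span the holomorphic ones, so that card B = 2g + 2, and P lies in B. For the
form W = df / y, seen in the square of the spin bundle, s is a section of the spin bundle with simple zeros on
T, and multiplication by \<open>y / \<Prod>p\<in>T. (f - f p)\<close> replaces T by its complement in B. As there are no holomorphic sections,
T and its complement have g + 1 elements each. So for Q in T the section s / (f - f Q) has a simple pole at Q
and zeros T - {Q}: the spin graph is complete on T. An edge transport is then a 3-cycle
of T, which gives even permutations only, and the loops of length 2 give all 3-cycles.
\<close>

section \<open>Orders of germs\<close>

text \<open>Over an unbranched value the two sheets carry independent signs, so local roots of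
  \<open>W\<close> are not unique up to one sign and cannot be glued over the plane directly. Their
  norms are unique up to one sign; once a norm is fixed globally, the roots with the prescribed norm
  are again unique up to a common sign. Hence the gluing is done twice. The set \<open>T\<close>
  records what the fixed norm \<open>n\<close> does at branch points: there \<open>n p\<close> is
  \<open>W p\<close> or \<open>- W p\<close>, and \<open>T\<close> collects the points of the second
  kind.

  Neither Riemann-Roch nor Riemann-Hurwitz is used. That the number of branch points is even follows
  from the order of \<open>y^2\<close> at a pole, the genus from an explicit basis, and the size of
  \<open>T\<close> from two negativity conditions: the orders \<open>k\<close> and \<open>k'\<close>
  at the poles of \<open>f\<close>, for \<open>T\<close> and for its complement, satisfy
  \<open>k + k' = -2\<close>, and neither can be nonnegative without producing a holomorphic
  section.

  Keeping \<open>P\<close> away from the poles makes it a point of the affine curve. A function with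
  a pole of low order at \<open>P\<close> can then be multiplied by a power of
  \<open>f - f P\<close> and compared with its image under \<open>J\<close>.\<close>

definition germ_order :: "(complex \<Rightarrow> complex) \<Rightarrow> int \<Rightarrow> bool" where
  "germ_order G n \<longleftrightarrow> (\<exists>H. H analytic_on {0} \<and> H 0 \<noteq> 0 \<and> (\<forall>\<^sub>F t in at 0. G t = t powi n * H t))"

lemma analytic_at_nonzero:
  fixes H :: "complex \<Rightarrow> complex"
  assumes "H analytic_on {a}" "H a \<noteq> 0"
  shows "\<forall>\<^sub>F t in nhds a. H t \<noteq> 0"
proof -
  have "isCont H a" using assms(1) by (rule analytic_at_imp_isCont)
  hence "(H \<longlongrightarrow> H a) (nhds a)" by (simp add: isCont_def tendsto_at_iff_tendsto_nhds)
  thus ?thesis using assms(2) tendsto_imp_eventually_ne by blast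
qed

lemma analytic_at_eventually:
  assumes "G analytic_on {a}" shows "\<forall>\<^sub>F t in nhds a. G analytic_on {t}"
proof -
  obtain S where S: "open S" "a \<in> S" "G holomorphic_on S" using assms by (auto simp: analytic_at)
  show ?thesis using eventually_nhds_in_open[OF S(1,2)]
    by eventually_elim (use S analytic_at in blast)
qed

lemma germ_orderI:
  assumes "H analytic_on {0}" "H 0 \<noteq> 0" "\<forall>\<^sub>F t in at 0. G t = t powi n * H t"
  shows "germ_order G n"
  using assms unfolding germ_order_def by blast

lemma germ_order_cong:
  assumes "germ_order G n" "\<forall>\<^sub>F t in at 0. G t = G' t"
  shows "germ_order G' n"
proof -
  obtain H where H: "H analytic_on {0}" "H 0 \<noteq> 0" "\<forall>\<^sub>F t in at 0. G t = t powi n * H t"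
    using assms unfolding germ_order_def by blast
  have "\<forall>\<^sub>F t in at 0. G' t = t powi n * H t" using H(3) assms(2) by eventually_elim simp
  with H show ?thesis unfolding germ_order_def by blast
qed

lemma germ_order_cong_iff:
  assumes "\<forall>\<^sub>F t in at 0. G t = G' t"
  shows "germ_order G n \<longleftrightarrow> germ_order G' n"
proof -
  have "\<forall>\<^sub>F t in at 0. G' t = G t" using assms by eventually_elim simp
  with assms show ?thesis using germ_order_cong[of G n G'] germ_order_cong[of G' n G] by metis
qed

lemma germ_order_nonzero: 
  assumes "germ_order G n" shows "\<forall>\<^sub>F t in at 0. G t \<noteq> 0"
proof -
  obtain H where H: "H analytic_on {0}" "H 0 \<noteq> 0" "\<forall>\<^sub>F t in at 0. G t = t powi n * H t"
    using assms unfolding germ_order_def by blast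
  have "\<forall>\<^sub>F t in at 0. H t \<noteq> 0"
    using analytic_at_nonzero[OF H(1,2)] by (simp add: eventually_nhds_conv_at)
  moreover have "\<forall>\<^sub>F t in at 0. t \<noteq> (0::complex)" by (simp add: eventually_at_filter)
  ultimately show ?thesis using H(3) by eventually_elim auto
qed

lemma germ_order_mult:
  assumes "germ_order G n" "germ_order G' n'" shows "germ_order (\<lambda>t. G t * G' t) (n + n')"
proof -
  obtain H where H: "H analytic_on {0}" "H 0 \<noteq> 0" "\<forall>\<^sub>F t in at 0. G t = t powi n * H t"
    using assms unfolding germ_order_def by blast
  obtain H' where H': "H' analytic_on {0}" "H' 0 \<noteq> 0" "\<forall>\<^sub>F t in at 0. G' t = t powi n' * H' t"
    using assms unfolding germ_order_def by blast
  have "\<forall>\<^sub>F t in at 0. t \<noteq> (0::complex)" by (simp add: eventually_at_filter)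
  then have "\<forall>\<^sub>F t in at 0. G t * G' t = t powi (n + n') * (H t * H' t)"
    using H(3) H'(3) by eventually_elim (simp add: power_int_add)
  with H H' show ?thesis by (intro germ_orderI[where H = "\<lambda>t. H t * H' t"]) (auto intro: analytic_intros)
qed

lemma germ_order_inverse:
  assumes "germ_order G n" shows "germ_order (\<lambda>t. inverse (G t)) (- n)"
proof -
  obtain H where H: "H analytic_on {0}" "H 0 \<noteq> 0" "\<forall>\<^sub>F t in at 0. G t = t powi n * H t"
    using assms unfolding germ_order_def by blast
  have "\<forall>\<^sub>F t in at 0. inverse (G t) = t powi (-n) * inverse (H t)"
    using H(3) by eventually_elim (simp add: power_int_minus)
  with H show ?thesis by (intro germ_orderI[where H = "\<lambda>t. inverse (H t)"]) (auto intro: analytic_intros)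
qed

lemma germ_order_divide:
  assumes "germ_order G n" "germ_order G' n'" shows "germ_order (\<lambda>t. G t / G' t) (n - n')"
  using germ_order_mult[OF assms(1) germ_order_inverse[OF assms(2)]] by (simp add: field_simps)

lemma germ_order_analytic: 
  assumes "H analytic_on {0}" "H 0 \<noteq> 0" shows "germ_order H 0"
  using assms by (intro germ_orderI[where H=H]) auto

lemma germ_order_powi: "germ_order (\<lambda>t. t powi n) n"
  by (rule germ_orderI[where H="\<lambda>_. 1"]) auto

lemma germ_order_const: "c \<noteq> 0 \<Longrightarrow> germ_order (\<lambda>_. c) 0"
  by (rule germ_order_analytic) auto

lemma germ_order_power:
  assumes "germ_order G n" shows "germ_order (\<lambda>t. G t ^ k) (int k * n)"
proof (induction k)
  case 0 thus ?case using germ_order_const[of 1] by simp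
next
  case (Suc k) thus ?case using germ_order_mult[OF assms Suc] by (simp add: algebra_simps)
qed

lemma germ_order_prod:
  assumes "finite I" "\<And>i. i \<in> I \<Longrightarrow> germ_order (G i) (n i)"
  shows "germ_order (\<lambda>t. \<Prod>i\<in>I. G i t) (\<Sum>i\<in>I. n i)"
  using assms
proof (induction I rule: finite_induct)
  case empty thus ?case using germ_order_const[of 1] by simp
next
  case (insert x F) thus ?case using germ_order_mult[of "G x" "n x"] by simp
qed

lemma germ_order_zorder:
  assumes "germ_order G n" shows "zorder G 0 = n"
proof -
  obtain H where H: "H analytic_on {0}" "H 0 \<noteq> 0" "\<forall>\<^sub>F t in at 0. G t = t powi n * H t"
    using assms unfolding germ_order_def by blast
  obtain S where S: "open S" "0 \<in> S" "H holomorphic_on S" using H(1) by (auto simp: analytic_at)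
  obtain T where T: "open T" "0 \<in> T" "\<And>t. t \<in> T \<Longrightarrow> t \<noteq> 0 \<Longrightarrow> G t = t powi n * H t"
    using H(3) by (auto simp: eventually_at_topological)
  show ?thesis
    by (rule zorder_eqI[of "S \<inter> T" _ H])
       (use S T H(2) in \<open>auto intro: holomorphic_on_subset\<close>)
qed

lemma germ_order_unique: "germ_order G n \<Longrightarrow> germ_order G m \<Longrightarrow> n = m"
  using germ_order_zorder by blast

lemma germ_order_meromorphic:
  assumes "germ_order G n" shows "G meromorphic_on {0}"
proof -
  obtain H where H: "H analytic_on {0}" "H 0 \<noteq> 0" "\<forall>\<^sub>F t in at 0. G t = t powi n * H t"
    using assms unfolding germ_order_def by blast
  have "(\<lambda>t. t powi n * H t) meromorphic_on {0}"
    by (intro meromorphic_on_mult meromorphic_on_powi meromorphic_on_id analytic_on_imp_meromorphic_on[OF H(1)])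
  moreover have "G meromorphic_on {0} \<longleftrightarrow> (\<lambda>t. t powi n * H t) meromorphic_on {0}"
    by (rule meromorphic_on_cong) (use H(3) in auto)
  ultimately show ?thesis by simp
qed

lemma meromorphic_germ_order:
  assumes "G meromorphic_on {0}"
  shows "(\<forall>\<^sub>F t in at 0. G t = 0) \<or> germ_order G (zorder G 0)"
proof (rule disjCI)
  assume *: "\<not> germ_order G (zorder G 0)"
  show "\<forall>\<^sub>F t in at 0. G t = 0"
  proof (rule ccontr)
    assume "\<not> (\<forall>\<^sub>F t in at 0. G t = 0)"
    hence fr: "\<exists>\<^sub>F t in at 0. G t \<noteq> 0" by (simp add: frequently_def)
    have "isolated_singularity_at G 0" "not_essential G 0" using assms by (auto simp: meromorphic_at_iff)
    from zorder_exist[OF this fr] obtain r where r: "zor_poly G 0 0 \<noteq> 0" "r > 0"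
      "zor_poly G 0 holomorphic_on cball 0 r"
      "\<forall>w\<in>cball 0 r - {0}. G w = zor_poly G 0 w * (w - 0) powi zorder G 0" by auto
    have "\<forall>\<^sub>F w in at 0. w \<in> ball 0 r - {0::complex}" using r by (intro eventually_at_in_open) auto
    hence "\<forall>\<^sub>F w in at 0. G w = w powi zorder G 0 * zor_poly G 0 w"
      by eventually_elim (use r in auto)
    moreover have "zor_poly G 0 analytic_on {0}"
      using r by (metis analytic_at ball_subset_cball centre_in_ball holomorphic_on_subset open_ball)
    ultimately have "germ_order G (zorder G 0)" using r(1) by (intro germ_orderI)
    with * show False by simp
  qed
qed

lemma analytic_zero_or_order:
  assumes "G analytic_on {0}"
  shows "(\<forall>\<^sub>F t in nhds 0. G t = 0) \<or> (\<exists>n\<ge>0. germ_order G n)"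
proof -
  have "G meromorphic_on {0}" using assms by (rule analytic_on_imp_meromorphic_on)
  then consider "\<forall>\<^sub>F t in at 0. G t = 0" | "germ_order G (zorder G 0)" using meromorphic_germ_order by blast
  thus ?thesis
  proof cases
    case 1
    have "G \<midarrow>0\<rightarrow> G 0" using assms analytic_at_imp_isCont isContD by blast
    moreover have "G \<midarrow>0\<rightarrow> 0" using 1 by (simp add: tendsto_eventually)
    ultimately have "G 0 = 0" using LIM_unique by blast
    with 1 show ?thesis by (simp add: eventually_nhds_conv_at)
  next
    case 2
    have "\<exists>\<^sub>F t in at 0. G t \<noteq> 0" using germ_order_nonzero[OF 2] by (simp add: eventually_frequently)
    hence "zorder G 0 \<ge> 0" using assms zorder_ge_0 by blast
    with 2 show ?thesis by blast
  qed
qed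

lemma germ_order_analytic_iff:
  assumes "G analytic_on {0}" "germ_order G n"
  shows "n \<ge> 0" "n = 0 \<longleftrightarrow> G 0 \<noteq> 0"
proof -
  have ne: "\<forall>\<^sub>F t in at 0. G t \<noteq> 0" using assms(2) germ_order_nonzero by blast
  have fr: "\<exists>\<^sub>F t in at 0. G t \<noteq> 0" using ne by (simp add: eventually_frequently)
  show "n \<ge> 0" using zorder_ge_0[OF assms(1) fr] germ_order_zorder[OF assms(2)] by simp
  show "n = 0 \<longleftrightarrow> G 0 \<noteq> 0" using zorder_eq_0_iff[OF assms(1) fr] germ_order_zorder[OF assms(2)] by simp
qed

lemma germ_order_limit:
  assumes "germ_order G n" "n \<ge> 0"
  shows "\<exists>H. H analytic_on {0} \<and> (\<forall>\<^sub>F t in at 0. G t = H t)"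
proof -
  obtain H where H: "H analytic_on {0}" "H 0 \<noteq> 0" "\<forall>\<^sub>F t in at 0. G t = t powi n * H t"
    using assms unfolding germ_order_def by blast
  have "\<forall>\<^sub>F t in at 0. G t = t ^ nat n * H t"
    using H(3) by eventually_elim (use assms in \<open>simp add: power_int_def\<close>)
  thus ?thesis using H by (intro exI[of _ "\<lambda>t. t ^ nat n * H t"]) (auto intro!: analytic_intros)
qed

text \<open>Dividing \<open>G\<close> by \<open>t powi (n div 2)\<close> leaves a function whose
  square has order 0 or 1. It is therefore bounded near 0 and extends by Riemann's theorem; the
  extension is not identically zero, so it has an integral order, and this forces \<open>n\<close>
  to be even. Analyticity off 0 is assumed because an arbitrary choice of signs would have the same
  square.\<close>

lemma germ_order_sqrt:
  assumes an: "\<forall>\<^sub>F t in at 0. G analytic_on {t}" and sq: "germ_order (\<lambda>t. (G t)\<^sup>2) n"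
  shows "\<exists>k. n = 2 * k \<and> germ_order G k"
proof -
  define m where "m = n div 2"
  define r where "r = n mod 2"
  have r: "n = 2 * m + r" "0 \<le> r" unfolding m_def r_def by auto
  define F where "F = (\<lambda>t. G t * t powi (- m))"
  have "germ_order (\<lambda>t. (G t)\<^sup>2 * (t powi (-m))^2) (n + 2 * (-m))"
    using germ_order_mult[OF sq germ_order_power[OF germ_order_powi[of "-m"], of 2]] by simp
  hence F2: "germ_order (\<lambda>t. (F t)\<^sup>2) r" unfolding F_def power_mult_distrib using r by simp
  from germ_order_limit[OF F2 r(2)] obtain H where H: "H analytic_on {0}" "\<forall>\<^sub>F t in at 0. (F t)\<^sup>2 = H t" by blast
  have t0: "\<forall>\<^sub>F t in at 0. t \<noteq> (0::complex)" by (simp add: eventually_at_filter)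
  have "(H \<longlongrightarrow> H 0) (at 0)" using H(1) analytic_at_imp_isCont isContD by blast
  hence "((\<lambda>t. norm (H t)) \<longlongrightarrow> norm (H 0)) (at 0)" by (rule tendsto_norm)
  hence "\<forall>\<^sub>F t in at 0. norm (H t) < norm (H 0) + 1" by (rule order_tendstoD) simp
  hence bd: "\<forall>\<^sub>F t in at 0. norm (F t) \<le> norm (H 0) + 1" using H(2)
  proof eventually_elim
    case (elim t)
    hence "(norm (F t))\<^sup>2 \<le> norm (H 0) + 1" by (simp flip: norm_power)
    also have "\<dots> \<le> (norm (H 0) + 1)\<^sup>2" by (rule self_le_power) auto
    finally show ?case by (rule power2_le_imp_le) simp
  qed
  have anF: "\<forall>\<^sub>F t in at 0. F analytic_on {t}" using an t0
  proof eventually_elim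
    case (elim t)
    show ?case unfolding F_def
      by (rule analytic_on_mult[OF elim(1) analytic_on_power_int]) (use elim(2) in auto)
  qed
  obtain S where S: "open S" "0 \<in> S" "\<And>t. t \<in> S \<Longrightarrow> t \<noteq> 0 \<Longrightarrow> F analytic_on {t} \<and> norm (F t) \<le> norm (H 0) + 1"
    using eventually_conj[OF anF bd] by (auto simp: eventually_at_topological)
  have "F holomorphic_on S - {0}"
    by (rule analytic_imp_holomorphic, subst analytic_on_analytic_at) (use S(3) in auto)
  then obtain K where K: "K holomorphic_on S" "\<And>z. z \<in> S - {0} \<Longrightarrow> K z = F z"
    using holomorphic_on_extend_bounded[of F S 0] S(1,2) bd by (auto simp: interior_open)
  have Kan: "K analytic_on {0}" using K S by (auto simp: analytic_at)
  have "\<forall>\<^sub>F t in at 0. t \<in> S - {0}" using S by (intro eventually_at_in_open) auto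
  hence KF: "\<forall>\<^sub>F t in at 0. K t = F t" by eventually_elim (use K in auto)
  have "\<not> (\<forall>\<^sub>F t in at 0. K t = 0)"
  proof
    assume "\<forall>\<^sub>F t in at 0. K t = 0"
    hence "\<forall>\<^sub>F t::complex in at 0. False" using KF germ_order_nonzero[OF F2] by eventually_elim auto
    thus False by simp
  qed
  hence "\<exists>k. germ_order K k" using meromorphic_germ_order[OF analytic_on_imp_meromorphic_on[OF Kan]] by blast
  then obtain k where "germ_order K k" by blast
  hence Fk: "germ_order F k" using KF by (rule germ_order_cong)
  have "germ_order G (k + m)"
  proof (rule germ_order_cong[OF germ_order_mult[OF Fk germ_order_powi[of m]]])
    show "\<forall>\<^sub>F t in at 0. F t * t powi m = G t" using t0
      by eventually_elim (simp add: F_def power_int_minus)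
  qed
  moreover have "n = 2 * (k + m)"
    using germ_order_unique[OF sq] germ_order_power[OF calculation, of 2] by simp
  ultimately show ?thesis by blast
qed

section \<open>Local biholomorphisms\<close>

definition local_biholo :: "(complex \<Rightarrow> complex) \<Rightarrow> bool" where
  "local_biholo \<theta> \<longleftrightarrow> \<theta> analytic_on {0} \<and> \<theta> 0 = 0 \<and> deriv \<theta> 0 \<noteq> 0"

text \<open>Equality of filters moves every \<open>eventually\<close> statement through a change of
  coordinate, in both directions at once.\<close>

lemma filtermap_eqI:
  assumes "filterlim f G F" "filterlim g F G" "\<forall>\<^sub>F y in G. f (g y) = y"
  shows "filtermap f F = G"
proof (rule antisym)
  show "filtermap f F \<le> G" using assms(1) by (simp add: filterlim_def)
  have "G = filtermap (\<lambda>y. f (g y)) G" 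
    unfolding filter_eq_iff eventually_filtermap
  proof (intro allI)
    fix P show "eventually P G \<longleftrightarrow> (\<forall>\<^sub>F y in G. P (f (g y)))"
      by (rule eventually_cong[OF assms(3)]) simp
  qed
  also have "\<dots> = filtermap f (filtermap g G)" by (simp add: filtermap_filtermap)
  also have "\<dots> \<le> filtermap f F" using assms(2) by (intro filtermap_mono) (simp add: filterlim_def)
  finally show "G \<le> filtermap f F" .
qed

lemma local_biholo_id: "local_biholo (\<lambda>t. t)" by (auto simp: local_biholo_def)

lemma local_biholo_comp: assumes "local_biholo f" "local_biholo g" shows "local_biholo (\<lambda>t. f (g t))"
proof -
  have "deriv (f \<circ> g) 0 = deriv f (g 0) * deriv g 0"
    using assms by (intro deriv_chain) (auto simp: local_biholo_def analytic_at_imp_isCont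
      analytic_on_imp_differentiable_at)
  moreover have "(f \<circ> g) analytic_on {0}" using assms
    by (intro analytic_on_compose) (auto simp: local_biholo_def)
  ultimately show ?thesis using assms by (auto simp: local_biholo_def o_def)
qed

lemma local_biholo_tendsto: assumes "local_biholo f" shows "filterlim f (nhds 0) (nhds 0)"
proof -
  have "f \<midarrow>0\<rightarrow> f 0" using assms analytic_at_imp_isCont[of f 0] by (simp add: local_biholo_def isCont_def)
  hence "(f \<longlongrightarrow> f 0) (nhds 0)" by (simp only: tendsto_at_iff_tendsto_nhds)
  thus ?thesis using assms by (simp add: local_biholo_def)
qed

lemma local_biholo_inverse: assumes "local_biholo f"
  obtains g where "local_biholo g" "\<forall>\<^sub>F t in nhds 0. g (f t) = t" "\<forall>\<^sub>F t in nhds 0. f (g t) = t"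
proof -
  obtain S where S: "open S" "0 \<in> S" "f holomorphic_on S" using assms by (auto simp: local_biholo_def analytic_at)
  have f0: "f 0 = 0" "deriv f 0 \<noteq> 0" using assms by (auto simp: local_biholo_def)
  obtain r where r: "r > 0" "ball 0 r \<subseteq> S" "open (f ` ball 0 r)" "inj_on f (ball 0 r)"
    using has_complex_derivative_locally_invertible[OF S(3,2,1) f0(2)] by metis
  have hb: "f holomorphic_on ball 0 r" using S(3) r(2) holomorphic_on_subset by blast
  obtain g where g: "g holomorphic_on f ` ball 0 r" "\<And>z. z \<in> ball 0 r \<Longrightarrow> deriv f z * deriv g (f z) = 1"
     "\<And>z. z \<in> ball 0 r \<Longrightarrow> g (f z) = z"
    using holomorphic_has_inverse[OF hb _ r(4)] by auto
  have 0: "(0::complex) \<in> ball 0 r" using r(1) by simp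
  have 1: "0 \<in> f ` ball 0 r" using imageI[OF 0, of f] f0(1) by simp
  have "g analytic_on {0}" using g(1) r(3) 1 analytic_at by blast
  moreover have "g 0 = 0" using g(3)[OF 0] f0 by simp
  moreover have "deriv g 0 \<noteq> 0" using g(2)[OF 0] f0(1) by auto
  ultimately have "local_biholo g" by (simp add: local_biholo_def)
  moreover have "\<forall>\<^sub>F t in nhds 0. g (f t) = t"
    using eventually_nhds_in_open[OF open_ball 0] by eventually_elim (rule g(3))
  moreover have "\<forall>\<^sub>F t in nhds 0. f (g t) = t"
    using eventually_nhds_in_open[OF r(3) 1] by eventually_elim (use g(3) in auto)
  ultimately show ?thesis by (rule that)
qed

lemma local_biholo_filtermap_nhds: assumes "local_biholo f" shows "filtermap f (nhds 0) = nhds 0"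
proof -
  obtain g where g: "local_biholo g" "\<forall>\<^sub>F t in nhds 0. f (g t) = t" using local_biholo_inverse[OF assms] by blast
  show ?thesis by (rule filtermap_eqI[OF local_biholo_tendsto[OF assms] local_biholo_tendsto[OF g(1)] g(2)])
qed

lemma local_biholo_nonzero: assumes "local_biholo f" shows "\<forall>\<^sub>F t in at 0. f t \<noteq> 0"
proof -
  obtain g where g: "local_biholo g" "\<forall>\<^sub>F t in nhds 0. g (f t) = t" using local_biholo_inverse[OF assms] by blast
  have "\<forall>\<^sub>F t in at 0. g (f t) = t" using g(2) by (simp add: eventually_nhds_conv_at)
  moreover have "\<forall>\<^sub>F t in at 0. t \<noteq> (0::complex)" by (simp add: eventually_at_filter)
  ultimately show ?thesis
  proof eventually_elim
    case (elim t)
    show ?case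
    proof
      assume "f t = 0"
      with elim g(1) show False by (simp add: local_biholo_def)
    qed
  qed
qed

lemma local_biholo_tendsto_at: assumes "local_biholo f" shows "filterlim f (at 0) (at 0)"
proof -
  have "at 0 \<le> nhds (0::complex)" by (simp add: at_within_def)
  from filterlim_mono[OF local_biholo_tendsto[OF assms] order_refl this]
  show ?thesis using local_biholo_nonzero[OF assms] by (simp only: filterlim_at UNIV_I simp_thms)
qed

lemma local_biholo_filtermap_at: assumes "local_biholo f" shows "filtermap f (at 0) = at 0"
proof -
  obtain g where g: "local_biholo g" "\<forall>\<^sub>F t in nhds 0. f (g t) = t" using local_biholo_inverse[OF assms] by blast
  show ?thesis
    by (rule filtermap_eqI[OF local_biholo_tendsto_at[OF assms] local_biholo_tendsto_at[OF g(1)]])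
       (use g(2) in \<open>simp only: eventually_nhds_conv_at\<close>)
qed

lemma local_biholo_analytic_iff: assumes "local_biholo f"
  shows "(\<lambda>t. G (f t)) analytic_on {0} \<longleftrightarrow> G analytic_on {0}"
proof -
  have comp: "(\<lambda>t. F (h t)) analytic_on {0}" if "local_biholo h" "F analytic_on {0}" for F h
    using analytic_on_compose[of h "{0}" F] that by (auto simp: local_biholo_def o_def)
  obtain g where g: "local_biholo g" "\<forall>\<^sub>F t in nhds 0. f (g t) = t" using local_biholo_inverse[OF assms] by blast
  show ?thesis
  proof
    assume "(\<lambda>t. G (f t)) analytic_on {0}"
    from comp[OF g(1) this] have "(\<lambda>t. G (f (g t))) analytic_on {0}" .
    moreover have "\<forall>\<^sub>F t in nhds 0. G (f (g t)) = G t" using g(2) by eventually_elim simp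
    ultimately show "G analytic_on {0}" by (simp add: analytic_at_cong[of "\<lambda>t. G (f (g t))" G 0 0])
  qed (rule comp[OF assms])
qed

lemma local_biholo_factor: assumes "local_biholo f" shows "germ_order f 1"
proof -
  have an: "f analytic_on {0}" and f0: "f 0 = 0" "deriv f 0 \<noteq> 0" using assms by (auto simp: local_biholo_def)
  have "f meromorphic_on {0}" using an by (rule analytic_on_imp_meromorphic_on)
  then consider "\<forall>\<^sub>F t in at 0. f t = 0" | "germ_order f (zorder f 0)" using meromorphic_germ_order by blast
  thus ?thesis
  proof cases
    case 1
    have "\<forall>\<^sub>F t::complex in at 0. False" using 1 local_biholo_nonzero[OF assms] by eventually_elim simp
    thus ?thesis by simp
  next
    case 2
    have "zorder f 0 = 1" using zorder_zero_eqI'[OF an, of 1] f0 by simp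
    thus ?thesis using 2 by simp
  qed
qed

lemma local_biholo_germ_order: assumes "local_biholo f" "germ_order G n" shows "germ_order (\<lambda>t. G (f t)) n"
proof -
  obtain H where H: "H analytic_on {0}" "H 0 \<noteq> 0" "\<forall>\<^sub>F t in at 0. G t = t powi n * H t"
    using assms unfolding germ_order_def by blast
  obtain k where k: "k analytic_on {0}" "k 0 \<noteq> 0" "\<forall>\<^sub>F t in at 0. f t = t powi 1 * k t"
    using local_biholo_factor[OF assms(1)] unfolding germ_order_def by blast
  have "\<forall>\<^sub>F t in filtermap f (at 0). G t = t powi n * H t" using H(3) local_biholo_filtermap_at[OF assms(1)] by simp
  hence "\<forall>\<^sub>F t in at 0. G (f t) = (f t) powi n * H (f t)" by (simp add: eventually_filtermap)
  hence "\<forall>\<^sub>F t in at 0. G (f t) = t powi n * (k t powi n * H (f t))" using k(3)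
  proof eventually_elim
    case (elim t)
    have "f t powi n = t powi n * k t powi n" unfolding elim(2) by (simp add: power_int_mult_distrib)
    thus ?case unfolding elim(1) by (simp only: mult.assoc)
  qed
  moreover have "(\<lambda>t. k t powi n * H (f t)) analytic_on {0}"
    by (rule analytic_on_mult[OF analytic_on_power_int])
       (use k H(1) local_biholo_analytic_iff[OF assms(1), of H] in auto)
  moreover have "k 0 powi n * H (f 0) \<noteq> 0" using k H assms(1) by (auto simp: local_biholo_def)
  ultimately show ?thesis by (intro germ_orderI)
qed

lemma local_biholo_germ_order_iff: assumes "local_biholo f" shows "germ_order (\<lambda>t. G (f t)) n \<longleftrightarrow> germ_order G n"
proof
  obtain g where g: "local_biholo g" "\<forall>\<^sub>F t in nhds 0. f (g t) = t" using local_biholo_inverse[OF assms] by blast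
  assume "germ_order (\<lambda>t. G (f t)) n"
  from local_biholo_germ_order[OF g(1) this] have "germ_order (\<lambda>t. G (f (g t))) n" .
  moreover have "\<forall>\<^sub>F t in at 0. G (f (g t)) = G t" using g(2) 
    by (auto simp: eventually_nhds_conv_at elim: eventually_mono)
  ultimately show "germ_order G n" by (rule germ_order_cong)
qed (rule local_biholo_germ_order[OF assms])

text \<open>Write \<open>G\<close> as \<open>t ^ e * H\<close> with \<open>H 0\<close> nonzero. An
  analytic \<open>e\<close>-th root \<open>k\<close> of \<open>H\<close> gives \<open>t * k\<close>,
  whose derivative at 0 is \<open>k 0\<close>.\<close>

lemma germ_order_root:
  assumes "germ_order G (int e)" "e > 0"
  obtains \<theta> where "local_biholo \<theta>" "\<forall>\<^sub>F t in at 0. G t = \<theta> t ^ e"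
proof -
  obtain H where H: "H analytic_on {0}" "H 0 \<noteq> 0" "\<forall>\<^sub>F t in at 0. G t = t powi int e * H t"
    using assms unfolding germ_order_def by blast
  have root: "exp (x / of_nat e) ^ e = exp x" for x :: complex
    using exp_of_nat_mult[of e "x / of_nat e"] assms(2) by simp
  obtain c where c: "c ^ e = H 0" "c \<noteq> 0"
  proof
    show "exp (Ln (H 0) / of_nat e) ^ e = H 0" using root exp_Ln[OF H(2)] by simp
  qed simp
  \<comment> \<open>Division by \<open>H 0\<close> makes the argument of \<open>Ln\<close> equal to
    1 at the base point, away from the branch cut; \<open>c\<close> restores the constant.\<close>
  define k where "k = (\<lambda>t. c * exp (Ln (H t / H 0) / of_nat e))"
  have L: "(\<lambda>t. Ln (H t / H 0)) analytic_on {0}"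
    by (rule analytic_on_ln) (use H in \<open>auto intro!: analytic_intros\<close>)
  have ka: "k analytic_on {0}" unfolding k_def using assms(2) by (intro analytic_intros L) auto
  have k0: "k 0 = c" using H(2) by (simp add: k_def)
  have ke: "\<forall>\<^sub>F t in nhds 0. k t ^ e = H t"
    using analytic_at_nonzero[OF H(1,2)]
  proof eventually_elim
    case (elim t)
    have "k t ^ e = c ^ e * exp (Ln (H t / H 0))" by (simp add: k_def power_mult_distrib root)
    thus ?case using elim H(2) c by simp
  qed
  define \<theta> where "\<theta> = (\<lambda>t. t * k t)"
  have "(\<theta> has_field_derivative (1 * k 0 + deriv k 0 * 0)) (at 0)" unfolding \<theta>_def
    by (rule DERIV_mult) (use ka in \<open>auto intro!: derivative_eq_intros analytic_derivI\<close>)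
  hence "deriv \<theta> 0 = c" using k0 by (auto intro: DERIV_imp_deriv)
  moreover have "\<theta> analytic_on {0}" unfolding \<theta>_def by (intro analytic_intros ka)
  ultimately have "local_biholo \<theta>" using c by (auto simp: local_biholo_def \<theta>_def)
  moreover have "\<forall>\<^sub>F t in at 0. G t = \<theta> t ^ e"
    using H(3) ke[unfolded eventually_nhds_conv_at, THEN conjunct1]
    by eventually_elim (simp add: \<theta>_def power_mult_distrib)
  ultimately show ?thesis using that by blast
qed

text \<open>The chain rule, applied to an analytic left inverse, keeps the derivative from
  vanishing.\<close>

lemma lbhI:
  assumes "f analytic_on {0}" "f 0 = 0" "g analytic_on {0}" "\<forall>\<^sub>F t in nhds 0. g (f t) = t"
  shows "local_biholo f"
proof -
  have d: "f field_differentiable at 0" "g field_differentiable at (f 0)"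
    using assms by (auto intro: analytic_on_imp_differentiable_at)
  have "deriv (g \<circ> f) 0 = deriv g (f 0) * deriv f 0" using d by (rule deriv_chain)
  moreover have "deriv (g \<circ> f) 0 = deriv (\<lambda>t. t) 0"
    by (rule deriv_cong_ev) (use assms(4) in simp_all)
  ultimately have "deriv f 0 \<noteq> 0" by auto
  with assms show ?thesis by (simp add: local_biholo_def)
qed

text \<open>The value at the point is tied to the limit, so absence of a pole already gives
  analyticity; at a pole the value is 0 by convention.\<close>

lemma nicely_meromorphic_iff:
  "G nicely_meromorphic_on {0} \<longleftrightarrow> G analytic_on {0} \<or> (\<exists>n<0. germ_order G n \<and> G 0 = 0)"
proof
  assume nm: "G nicely_meromorphic_on {0}"
  hence m: "G meromorphic_on {0}" by (simp add: nicely_meromorphic_on_def)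
  show "G analytic_on {0} \<or> (\<exists>n<0. germ_order G n \<and> G 0 = 0)"
  proof (cases "is_pole G 0")
    case True
    hence ne: "\<forall>\<^sub>F t in at 0. G t \<noteq> 0" by (rule non_zero_neighbour_pole)
    have "\<not> (\<forall>\<^sub>F t in at 0. G t = 0)"
    proof
      assume "\<forall>\<^sub>F t in at 0. G t = 0"
      hence "\<forall>\<^sub>F t::complex in at 0. False" using ne by eventually_elim simp
      thus False by simp
    qed
    hence g: "germ_order G (zorder G 0)" using meromorphic_germ_order[OF m] by blast
    moreover have "\<not> G \<midarrow>0\<rightarrow> G 0"
      using not_tendsto_and_filterlim_at_infinity[OF at_neq_bot] True unfolding is_pole_def by blast
    hence "G 0 = 0" using nm unfolding nicely_meromorphic_on_def by blast
    moreover have "zorder G 0 < 0"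
      using True m by (intro isolated_pole_imp_neg_zorder) (auto simp: meromorphic_at_iff)
    ultimately show ?thesis by blast
  qed (use nm nicely_meromorphic_on_imp_analytic_at in blast)
next
  assume "G analytic_on {0} \<or> (\<exists>n<0. germ_order G n \<and> G 0 = 0)"
  thus "G nicely_meromorphic_on {0}"
  proof
    assume "\<exists>n<0. germ_order G n \<and> G 0 = 0"
    then obtain n where n: "n < 0" "germ_order G n" "G 0 = 0" by blast
    have m: "G meromorphic_on {0}" using n(2) by (rule germ_order_meromorphic)
    have "is_pole G 0"
      using neg_zorder_imp_is_pole[of G 0] m n germ_order_zorder[OF n(2)]
        germ_order_nonzero[OF n(2)] by (auto simp: meromorphic_at_iff eventually_frequently)
    thus ?thesis using m n(3) by (simp add: nicely_meromorphic_on_def)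
  qed (rule analytic_on_imp_nicely_meromorphic_on)
qed

lemma germ_order_is_pole_iff:
  assumes "germ_order G n" shows "is_pole G 0 \<longleftrightarrow> n < 0"
proof -
  have m: "G meromorphic_on {0}" using assms by (rule germ_order_meromorphic)
  have z: "zorder G 0 = n" using assms by (rule germ_order_zorder)
  have f: "\<exists>\<^sub>F t in at 0. G t \<noteq> 0" using germ_order_nonzero[OF assms] by (simp add: eventually_frequently)
  show ?thesis
  proof
    assume "is_pole G 0"
    thus "n < 0" using isolated_pole_imp_neg_zorder[of G 0] m z by (simp add: meromorphic_at_iff)
  next
    assume "n < 0"
    thus "is_pole G 0" using neg_zorder_imp_is_pole[of G 0] m z f by (simp add: meromorphic_at_iff)
  qed
qed

lemma analytic_shift: "F analytic_on {t} \<Longrightarrow> (\<lambda>s. F (t + s)) analytic_on {0::complex}"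
proof -
  assume F: "F analytic_on {t}"
  have "(\<lambda>s. t + s) analytic_on {0}" by (intro analytic_on_add analytic_on_const analytic_on_ident)
  from analytic_on_compose[OF this, of F] F show ?thesis by (simp add: o_def)
qed

section \<open>Functions on a surface\<close>

definition chart_param :: "'a chart \<Rightarrow> 'a \<Rightarrow> complex \<Rightarrow> 'a" where
  "chart_param c p t = inv_into (fst c) (snd c) (t + snd c p)"

definition chart_at :: "'a chart set \<Rightarrow> 'a \<Rightarrow> 'a chart" where
  "chart_at A p = (SOME c. c \<in> A \<and> p \<in> fst c)"

abbreviation param :: "'a chart set \<Rightarrow> 'a \<Rightarrow> complex \<Rightarrow> 'a" where
  "param A p \<equiv> chart_param (chart_at A p) p"

text \<open>\<open>chart_param c p\<close> is the inverse chart translated so that 0 goes to p. Working with all local parameters, not only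
those of charts, lets a function be put in the normal form \<open>t ^ e\<close>.\<close>

definition local_param :: "'a chart set \<Rightarrow> 'a \<Rightarrow> (complex \<Rightarrow> 'a) \<Rightarrow> bool" where
  "local_param A p \<rho> \<longleftrightarrow> (\<exists>\<theta>. local_biholo \<theta> \<and> (\<forall>\<^sub>F t in nhds 0. \<rho> t = param A p (\<theta> t)))"

definition hol_at :: "'a chart set \<Rightarrow> 'a \<Rightarrow> ('a \<Rightarrow> complex) \<Rightarrow> bool" where
  "hol_at A p F \<longleftrightarrow> (\<lambda>t. F (param A p t)) analytic_on {0}"

text \<open>A relation rather than a function: a germ that vanishes identically near
  \<open>p\<close> has no order, so no default value can enter a computation. The value at
  \<open>p\<close> itself is not looked at.\<close>

definition has_order :: "'a chart set \<Rightarrow> 'a \<Rightarrow> ('a \<Rightarrow> complex) \<Rightarrow> int \<Rightarrow> bool" where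
  "has_order A p F n \<longleftrightarrow> germ_order (\<lambda>t. F (param A p t)) n"

locale surface =
  fixes A :: "('a::t2_space) chart set"
  assumes atlas: "holo_atlas A"
begin

lemma chart_props:
  assumes "c \<in> A"
  shows "open (fst c)" "open (snd c ` fst c)" "inj_on (snd c) (fst c)"
    "continuous_on (fst c) (snd c)" "continuous_on (snd c ` fst c) (inv_into (fst c) (snd c))"
proof -
  have "is_chart c" using assms atlas by (auto simp: holo_atlas_def)
  hence o: "open (fst c)" "open (snd c ` fst c)"
    and h: "homeomorphism (fst c) (snd c ` fst c) (snd c) (inv_into (fst c) (snd c))"
    by (auto simp: is_chart_def)
  show "open (fst c)" "open (snd c ` fst c)" by fact+
  show "continuous_on (fst c) (snd c)" "continuous_on (snd c ` fst c) (inv_into (fst c) (snd c))"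
    using h by (auto simp: homeomorphism_def)
  show "inj_on (snd c) (fst c)" using h by (metis homeomorphism_def inj_on_inverseI)
qed

lemma chart_at: "chart_at A p \<in> A" "p \<in> fst (chart_at A p)"
proof -
  have "p \<in> (\<Union>c\<in>A. fst c)" using atlas by (simp add: holo_atlas_def)
  hence "\<exists>c. c \<in> A \<and> p \<in> fst c" by blast
  from someI_ex[OF this] show "chart_at A p \<in> A" "p \<in> fst (chart_at A p)" by (auto simp: chart_at_def)
qed

lemma chart_param_0: assumes "c \<in> A" "p \<in> fst c" shows "chart_param c p 0 = p"
  using chart_props(3)[OF assms(1)] assms(2) by (simp add: chart_param_def inv_into_f_f)

lemma eventually_in_chart: assumes "c \<in> A" "p \<in> fst c" shows "\<forall>\<^sub>F t in nhds 0. t + snd c p \<in> snd c ` fst c"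
proof -
  have "((\<lambda>t. t + snd c p) \<longlongrightarrow> 0 + snd c p) (nhds 0)" by (intro tendsto_intros filterlim_ident)
  moreover have "0 + snd c p \<in> snd c ` fst c" using assms by simp
  ultimately show ?thesis using topological_tendstoD chart_props(2)[OF assms(1)] by blast
qed

lemma chart_param_tendsto: assumes "c \<in> A" "p \<in> fst c" shows "filterlim (chart_param c p) (nhds p) (nhds 0)"
proof -
  let ?i = "inv_into (fst c) (snd c)"
  have "isCont ?i (snd c p)"
    using chart_props[OF assms(1)] assms(2) by (simp add: continuous_on_eq_continuous_at)
  hence "?i \<midarrow>snd c p\<rightarrow> ?i (snd c p)" by (simp add: isCont_def)
  hence 1: "filterlim ?i (nhds (?i (snd c p))) (nhds (snd c p))" by (simp only: tendsto_at_iff_tendsto_nhds)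
  have "((\<lambda>t. t + snd c p) \<longlongrightarrow> 0 + snd c p) (nhds 0)" by (intro tendsto_intros filterlim_ident)
  hence 2: "filterlim (\<lambda>t. t + snd c p) (nhds (snd c p)) (nhds 0)" by simp
  have "?i (snd c p) = p" using chart_param_0[OF assms] by (simp add: chart_param_def)
  with filterlim_compose[OF 1 2] show ?thesis unfolding chart_param_def by simp
qed

lemma chart_tendsto: assumes "c \<in> A" "p \<in> fst c" 
  shows "filterlim (\<lambda>q. snd c q - snd c p) (nhds 0) (nhds p)"
proof -
  have "isCont (snd c) p"
    using chart_props[OF assms(1)] assms(2) by (simp add: continuous_on_eq_continuous_at)
  hence "snd c \<midarrow>p\<rightarrow> snd c p" by (simp add: isCont_def)
  hence "filterlim (snd c) (nhds (snd c p)) (nhds p)" by (simp only: tendsto_at_iff_tendsto_nhds)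
  hence "((\<lambda>q. snd c q - snd c p) \<longlongrightarrow> snd c p - snd c p) (nhds p)" by (intro tendsto_intros)
  thus ?thesis by simp
qed

lemma snd_chart_param: assumes "c \<in> A" "t + snd c p \<in> snd c ` fst c"
  shows "snd c (chart_param c p t) = t + snd c p" "chart_param c p t \<in> fst c"
  using assms by (auto simp: chart_param_def f_inv_into_f inv_into_into)

lemma chart_param_snd: assumes "c \<in> A" "q \<in> fst c" shows "chart_param c p (snd c q - snd c p) = q"
  using chart_props(3)[OF assms(1)] assms(2) by (simp add: chart_param_def inv_into_f_f)

lemma chart_param_filtermap: assumes "c \<in> A" "p \<in> fst c" shows "filtermap (chart_param c p) (nhds 0) = nhds p"
proof (rule filtermap_eqI[OF chart_param_tendsto[OF assms] chart_tendsto[OF assms]])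
  show "\<forall>\<^sub>F q in nhds p. chart_param c p (snd c q - snd c p) = q"
    using eventually_nhds_in_open[OF chart_props(1)[OF assms(1)] assms(2)]
    by eventually_elim (rule chart_param_snd[OF assms(1)])
qed

lemma transition_image:
  assumes "c \<in> A" "open W" shows "open (snd c ` (fst c \<inter> W))"
proof -
  let ?i = "inv_into (fst c) (snd c)"
  have "snd c ` (fst c \<inter> W) = ?i -` W \<inter> snd c ` fst c"
    using chart_props(3)[OF assms(1)] by (auto simp: inv_into_f_f)
  moreover have "open (?i -` W \<inter> snd c ` fst c)"
    using chart_props(2,5)[OF assms(1)] assms(2) by (metis continuous_on_open_vimage)
  ultimately show ?thesis by simp
qed

lemma transition_analytic:
  assumes "c \<in> A" "d \<in> A" "p \<in> fst c" "p \<in> fst d"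
  shows "(\<lambda>t. snd d (chart_param c p t) - snd d p) analytic_on {0}"
proof -
  have h: "coord_expr c (snd d) holomorphic_on snd c ` (fst c \<inter> fst d)"
    using atlas assms by (auto simp: holo_atlas_def)
  have "coord_expr c (snd d) analytic_on {snd c p}"
    using h transition_image[OF assms(1) chart_props(1)[OF assms(2)]] assms(3,4)
    by (auto simp: analytic_at)
  hence a: "coord_expr c (snd d) analytic_on ((\<lambda>t. t + snd c p) ` {0})" by simp
  have "(coord_expr c (snd d) \<circ> (\<lambda>t. t + snd c p)) analytic_on {0}"
    by (rule analytic_on_compose[OF _ a]) (intro analytic_intros)
  hence "(\<lambda>t. snd d (chart_param c p t)) analytic_on {0}" by (simp add: coord_expr_def o_def chart_param_def)
  thus ?thesis by (intro analytic_on_diff analytic_on_const)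
qed

text \<open>The coordinate changes in the two directions are analytic and inverse to each other near
  \<open>p\<close>.\<close>

lemma transition_local_biholo:
  assumes "c \<in> A" "d \<in> A" "p \<in> fst c" "p \<in> fst d"
  shows "local_biholo (\<lambda>t. snd d (chart_param c p t) - snd d p)"
    and "\<forall>\<^sub>F t in nhds 0. chart_param c p t = chart_param d p (snd d (chart_param c p t) - snd d p)"
proof -
  have *: "\<forall>\<^sub>F t in nhds 0. chart_param c p t \<in> fst d"
    by (rule eventually_compose_filterlim[OF eventually_nhds_in_open[OF chart_props(1)[OF assms(2)] assms(4)]
          chart_param_tendsto[OF assms(1,3)]])
  show 1: "\<forall>\<^sub>F t in nhds 0. chart_param c p t = chart_param d p (snd d (chart_param c p t) - snd d p)"
    using * by eventually_elim (simp add: chart_param_snd[OF assms(2)])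
  show "local_biholo (\<lambda>t. snd d (chart_param c p t) - snd d p)"
  proof (rule lbhI[where g = "\<lambda>t. snd c (chart_param d p t) - snd c p"])
    show "\<forall>\<^sub>F t in nhds 0. snd c (chart_param d p (snd d (chart_param c p t) - snd d p)) - snd c p = t"
      using 1 eventually_in_chart[OF assms(1,3)]
    proof eventually_elim
      case (elim t)
      show ?case unfolding elim(1)[symmetric] using snd_chart_param(1)[OF assms(1) elim(2)] by simp
    qed
  qed (use assms transition_analytic chart_param_0 in auto)
qed

text \<open>The selected chart at \<open>p\<close> may be replaced by any other chart around
  \<open>p\<close>: the transition is absorbed into the local biholomorphism.\<close>

lemma local_param_iff:
  assumes "c \<in> A" "p \<in> fst c"
  shows "local_param A p \<rho> \<longleftrightarrow> (\<exists>\<theta>. local_biholo \<theta> \<and> (\<forall>\<^sub>F t in nhds 0. \<rho> t = chart_param c p (\<theta> t)))"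
proof -
  have aux: "\<exists>\<theta>. local_biholo \<theta> \<and> (\<forall>\<^sub>F t in nhds 0. \<rho> t = chart_param d p (\<theta> t))"
    if "c \<in> A" "p \<in> fst c" "d \<in> A" "p \<in> fst d" "local_biholo \<theta>" "\<forall>\<^sub>F t in nhds 0. \<rho> t = chart_param c p (\<theta> t)" for c d \<theta>
  proof (intro exI conjI)
    let ?\<eta> = "\<lambda>t. snd d (chart_param c p t) - snd d p"
    show "local_biholo (\<lambda>t. ?\<eta> (\<theta> t))" using transition_local_biholo(1)[OF that(1,3,2,4)] that(5) by (rule local_biholo_comp)
    have "\<forall>\<^sub>F t in filtermap \<theta> (nhds 0). chart_param c p t = chart_param d p (?\<eta> t)"
      using transition_local_biholo(2)[OF that(1,3,2,4)] local_biholo_filtermap_nhds[OF that(5)] by simp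
    hence "\<forall>\<^sub>F t in nhds 0. chart_param c p (\<theta> t) = chart_param d p (?\<eta> (\<theta> t))" by (simp add: eventually_filtermap)
    with that(6) show "\<forall>\<^sub>F t in nhds 0. \<rho> t = chart_param d p (?\<eta> (\<theta> t))" by eventually_elim simp
  qed
  show ?thesis using aux[OF assms chart_at] aux[OF chart_at assms] unfolding local_param_def by blast
qed

lemma lparI: "c \<in> A \<Longrightarrow> p \<in> fst c \<Longrightarrow> local_param A p (chart_param c p)"
  using local_param_iff[of c p "chart_param c p"] local_biholo_id by auto

lemma local_param_param: "local_param A p (param A p)" by (rule lparI[OF chart_at])

lemma local_param_comp: assumes "local_param A p \<rho>" "local_biholo \<theta>" shows "local_param A p (\<lambda>t. \<rho> (\<theta> t))"
proof -
  obtain \<eta> where \<eta>: "local_biholo \<eta>" "\<forall>\<^sub>F t in nhds 0. \<rho> t = param A p (\<eta> t)" using assms(1) by (auto simp: local_param_def)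
  have "\<forall>\<^sub>F t in filtermap \<theta> (nhds 0). \<rho> t = param A p (\<eta> t)" using \<eta>(2) local_biholo_filtermap_nhds[OF assms(2)] by simp
  hence "\<forall>\<^sub>F t in nhds 0. \<rho> (\<theta> t) = param A p (\<eta> (\<theta> t))" by (simp add: eventually_filtermap)
  with local_biholo_comp[OF \<eta>(1) assms(2)] show ?thesis unfolding local_param_def by blast
qed

lemma local_param_cong: assumes "local_param A p \<rho>" "\<forall>\<^sub>F t in nhds 0. \<rho>' t = \<rho> t" shows "local_param A p \<rho>'"
proof -
  obtain \<eta> where \<eta>: "local_biholo \<eta>" "\<forall>\<^sub>F t in nhds 0. \<rho> t = param A p (\<eta> t)" using assms(1) by (auto simp: local_param_def)
  have "\<forall>\<^sub>F t in nhds 0. \<rho>' t = param A p (\<eta> t)" using \<eta>(2) assms(2) by eventually_elim simp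
  with \<eta>(1) show ?thesis unfolding local_param_def by blast
qed

lemma local_param_filtermap: assumes "local_param A p \<rho>" shows "filtermap \<rho> (nhds 0) = nhds p"
proof -
  obtain \<eta> where \<eta>: "local_biholo \<eta>" "\<forall>\<^sub>F t in nhds 0. \<rho> t = param A p (\<eta> t)" using assms(1) by (auto simp: local_param_def)
  have "filtermap \<rho> (nhds 0) = filtermap (\<lambda>t. param A p (\<eta> t)) (nhds 0)"
    unfolding filter_eq_iff eventually_filtermap
  proof (intro allI)
    fix P show "(\<forall>\<^sub>F x in nhds 0. P (\<rho> x)) \<longleftrightarrow> (\<forall>\<^sub>F x in nhds 0. P (param A p (\<eta> x)))"
      by (rule eventually_cong[OF \<eta>(2)]) simp
  qed
  also have "\<dots> = filtermap (param A p) (filtermap \<eta> (nhds 0))" by (simp add: filtermap_filtermap)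
  also have "\<dots> = nhds p" by (simp add: local_biholo_filtermap_nhds[OF \<eta>(1)] chart_param_filtermap[OF chart_at])
  finally show ?thesis .
qed

lemma local_param_eventually: assumes "local_param A p \<rho>" shows "(\<forall>\<^sub>F q in nhds p. P q) \<longleftrightarrow> (\<forall>\<^sub>F t in nhds 0. P (\<rho> t))"
  using local_param_filtermap[OF assms] by (metis eventually_filtermap)

lemma local_param_0: assumes "local_param A p \<rho>" shows "\<rho> 0 = p"
proof -
  obtain \<eta> where \<eta>: "local_biholo \<eta>" "\<forall>\<^sub>F t in nhds 0. \<rho> t = param A p (\<eta> t)" using assms(1) by (auto simp: local_param_def)
  from eventually_nhds_x_imp_x[OF \<eta>(2)] show ?thesis using \<eta>(1) chart_param_0[OF chart_at] by (simp add: local_biholo_def)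
qed

lemma local_param_inj: assumes "local_param A p \<rho>" obtains \<sigma> where "\<forall>\<^sub>F t in nhds 0. \<sigma> (\<rho> t) = t" "filterlim \<sigma> (nhds 0) (nhds p)"
  "\<forall>\<^sub>F q in nhds p. \<rho> (\<sigma> q) = q"
proof -
  obtain \<eta> where \<eta>: "local_biholo \<eta>" "\<forall>\<^sub>F t in nhds 0. \<rho> t = param A p (\<eta> t)" using assms(1) by (auto simp: local_param_def)
  obtain \<eta>' where \<eta>': "local_biholo \<eta>'" "\<forall>\<^sub>F t in nhds 0. \<eta>' (\<eta> t) = t" "\<forall>\<^sub>F t in nhds 0. \<eta> (\<eta>' t) = t"
    using local_biholo_inverse[OF \<eta>(1)] .
  let ?c = "chart_at A p"
  define \<sigma> where "\<sigma> = (\<lambda>q. \<eta>' (snd ?c q - snd ?c p))"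
  have "\<forall>\<^sub>F t in filtermap \<eta> (nhds 0). t + snd ?c p \<in> snd ?c ` fst ?c"
    using eventually_in_chart[OF chart_at] local_biholo_filtermap_nhds[OF \<eta>(1)] by simp
  hence "\<forall>\<^sub>F t in nhds 0. \<eta> t + snd ?c p \<in> snd ?c ` fst ?c" by (simp add: eventually_filtermap)
  hence 1: "\<forall>\<^sub>F t in nhds 0. \<sigma> (\<rho> t) = t" using \<eta>(2) \<eta>'(2)
    by eventually_elim (simp add: \<sigma>_def snd_chart_param[OF chart_at(1)])
  have 2: "filterlim \<sigma> (nhds 0) (nhds p)" unfolding \<sigma>_def
    by (rule filterlim_compose[OF local_biholo_tendsto[OF \<eta>'(1)] chart_tendsto[OF chart_at]])
  have "\<forall>\<^sub>F t in nhds 0. \<rho> (\<sigma> (\<rho> t)) = \<rho> t" using 1 by eventually_elim simp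
  hence 3: "\<forall>\<^sub>F q in nhds p. \<rho> (\<sigma> q) = q" by (simp add: local_param_eventually[OF assms])
  from 1 2 3 show ?thesis by (rule that)
qed

lemma local_param_eventually_at: assumes "local_param A p \<rho>" shows "(\<forall>\<^sub>F q in at p. P q) \<longleftrightarrow> (\<forall>\<^sub>F t in at 0. P (\<rho> t))"
proof -
  obtain \<sigma> where \<sigma>: "\<forall>\<^sub>F t in nhds 0. \<sigma> (\<rho> t) = t" using local_param_inj[OF assms] by blast
  have "\<forall>\<^sub>F t in nhds 0. \<rho> t = p \<longleftrightarrow> t = 0" using \<sigma>
  proof eventually_elim
    case (elim t)
    thus ?case using eventually_nhds_x_imp_x[OF \<sigma>] local_param_0[OF assms] by auto
  qed
  hence "(\<forall>\<^sub>F t in nhds 0. \<rho> t \<noteq> p \<longrightarrow> P (\<rho> t)) \<longleftrightarrow> (\<forall>\<^sub>F t in nhds 0. t \<noteq> 0 \<longrightarrow> P (\<rho> t))"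
    by (rule eventually_cong) simp
  thus ?thesis by (simp add: eventually_at_filter local_param_eventually[OF assms])
qed

text \<open>Contradictions between statements on punctured neighbourhoods end here. No point is
  isolated, because a parameter carries the punctured plane near 0 to the surface.\<close>

lemma at_neq_bot_surface: "at (p::'a) \<noteq> bot"
proof
  assume "at p = bot"
  hence "\<forall>\<^sub>F q in at p. False" by simp
  hence "\<forall>\<^sub>F t in at (0::complex). False" by (simp add: local_param_eventually_at[OF local_param_param, of _ p])
  thus False by simp
qed

lemma local_param_hol_at: assumes "local_param A p \<rho>" shows "hol_at A p F \<longleftrightarrow> (\<lambda>t. F (\<rho> t)) analytic_on {0}"
proof -
  obtain \<eta> where \<eta>: "local_biholo \<eta>" "\<forall>\<^sub>F t in nhds 0. \<rho> t = param A p (\<eta> t)" using assms(1) by (auto simp: local_param_def)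
  have "(\<lambda>t. F (\<rho> t)) analytic_on {0} \<longleftrightarrow> (\<lambda>t. F (param A p (\<eta> t))) analytic_on {0}"
  proof (rule analytic_at_cong)
    show "\<forall>\<^sub>F t in nhds 0. F (\<rho> t) = F (param A p (\<eta> t))" using \<eta>(2) by eventually_elim simp
  qed simp
  thus ?thesis using local_biholo_analytic_iff[OF \<eta>(1), of "\<lambda>t. F (param A p t)"] by (simp add: hol_at_def)
qed

lemma local_param_has_order: assumes "local_param A p \<rho>" shows "has_order A p F n \<longleftrightarrow> germ_order (\<lambda>t. F (\<rho> t)) n"
proof -
  obtain \<eta> where \<eta>: "local_biholo \<eta>" "\<forall>\<^sub>F t in nhds 0. \<rho> t = param A p (\<eta> t)" using assms(1) by (auto simp: local_param_def)
  have *: "\<forall>\<^sub>F t in at 0. \<rho> t = param A p (\<eta> t)" using \<eta>(2) by (simp add: eventually_nhds_conv_at)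
  have "\<forall>\<^sub>F t in at 0. F (\<rho> t) = F (param A p (\<eta> t))"
    using * by eventually_elim simp
  hence "germ_order (\<lambda>t. F (\<rho> t)) n \<longleftrightarrow> germ_order (\<lambda>t. F (param A p (\<eta> t))) n" by (rule germ_order_cong_iff)
  thus ?thesis using local_biholo_germ_order_iff[OF \<eta>(1), of "\<lambda>t. F (param A p t)"] by (simp add: has_order_def)
qed

text \<open>Recentring: the derivative stays nonzero near 0, so a parameter at \<open>p\<close> also
  provides parameters at all nearby points. This is how regularity at one point spreads to a
  neighbourhood.\<close>

lemma local_param_shift: assumes "local_param A p \<rho>" shows "\<forall>\<^sub>F t in nhds 0. local_param A (\<rho> t) (\<lambda>s. \<rho> (t + s))"
proof -
  let ?c = "chart_at A p"
  obtain \<eta> where \<eta>: "local_biholo \<eta>" "\<forall>\<^sub>F t in nhds 0. \<rho> t = param A p (\<eta> t)" using assms(1) by (auto simp: local_param_def)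
  have e1: "\<forall>\<^sub>F t in nhds 0. \<forall>\<^sub>F s in nhds t. \<rho> s = param A p (\<eta> s)" using \<eta>(2) by (simp add: eventually_eventually)
  have e2: "\<forall>\<^sub>F t in nhds 0. \<eta> analytic_on {t}" using \<eta>(1) by (intro analytic_at_eventually) (simp add: local_biholo_def)
  have "deriv \<eta> analytic_on {0}" using \<eta>(1) by (intro analytic_deriv) (simp add: local_biholo_def)
  hence e3: "\<forall>\<^sub>F t in nhds 0. deriv \<eta> t \<noteq> 0" by (rule analytic_at_nonzero) (use \<eta>(1) in \<open>simp add: local_biholo_def\<close>)
  have "\<forall>\<^sub>F t in filtermap \<eta> (nhds 0). t + snd ?c p \<in> snd ?c ` fst ?c"
    using eventually_in_chart[OF chart_at] local_biholo_filtermap_nhds[OF \<eta>(1)] by simp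
  hence e4: "\<forall>\<^sub>F t in nhds 0. \<eta> t + snd ?c p \<in> snd ?c ` fst ?c" by (simp add: eventually_filtermap)
  show ?thesis using e1 e2 e3 e4
  proof eventually_elim
    case (elim t)
    define \<theta> where "\<theta> = (\<lambda>s. \<eta> (t + s) - \<eta> t)"
    have r: "\<rho> t = param A p (\<eta> t)" using eventually_nhds_x_imp_x[OF elim(1)] .
    have q: "\<rho> t \<in> fst ?c" "snd ?c (\<rho> t) = \<eta> t + snd ?c p"
      using snd_chart_param[OF chart_at(1) elim(4)] r by auto
    have "\<theta> analytic_on {0}" unfolding \<theta>_def
      by (intro analytic_on_diff analytic_on_const analytic_shift elim(2))
    moreover have "((\<lambda>s. \<eta> (t + s) - \<eta> t) has_field_derivative (deriv \<eta> (t + 0) * (0 + 1) - 0)) (at 0)"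
      by (intro DERIV_diff DERIV_chain2[where f = \<eta>] DERIV_add DERIV_const DERIV_ident)
         (use elim(2) in \<open>auto intro: analytic_derivI\<close>)
    hence "deriv \<theta> 0 = deriv \<eta> t" unfolding \<theta>_def by (auto intro: DERIV_imp_deriv)
    ultimately have lb: "local_biholo \<theta>" using elim(3) by (simp add: local_biholo_def \<theta>_def)
    have "filterlim (\<lambda>s. t + s) (nhds (t + 0)) (nhds 0)" by (intro tendsto_intros filterlim_ident)
    from eventually_compose_filterlim[OF _ this, of "\<lambda>s. \<rho> s = param A p (\<eta> s)"] elim(1)
    have "\<forall>\<^sub>F s in nhds 0. \<rho> (t + s) = param A p (\<eta> (t + s))" by simp
    hence "\<forall>\<^sub>F s in nhds 0. \<rho> (t + s) = chart_param ?c (\<rho> t) (\<theta> s)"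
      by eventually_elim (simp add: chart_param_def \<theta>_def q)
    thus ?case using local_param_iff[OF chart_at(1) q(1)] lb by blast
  qed
qed

lemma hol_at_eventually: assumes "hol_at A p F" shows "\<forall>\<^sub>F q in nhds p. hol_at A q F"
proof -
  have "\<forall>\<^sub>F t in nhds 0. (\<lambda>t. F (param A p t)) analytic_on {t}" 
    using assms by (intro analytic_at_eventually) (simp add: hol_at_def)
  hence "\<forall>\<^sub>F t in nhds 0. hol_at A (param A p t) F" using local_param_shift[OF local_param_param[of p]]
  proof eventually_elim
    case (elim t)
    show ?case using analytic_shift[OF elim(1)] local_param_hol_at[OF elim(2)] by simp
  qed
  thus ?thesis by (simp add: local_param_eventually[OF local_param_param])
qed

lemma hol_at_cong: assumes "\<forall>\<^sub>F q in nhds p. F q = G q" shows "hol_at A p F \<longleftrightarrow> hol_at A p G"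
  unfolding hol_at_def by (rule analytic_at_cong) (use assms local_param_eventually[OF local_param_param] in auto)

lemma has_order_cong: assumes "\<forall>\<^sub>F q in at p. F q = G q" shows "has_order A p F n \<longleftrightarrow> has_order A p G n"
  unfolding has_order_def by (rule germ_order_cong_iff) (use assms in \<open>simp add: local_param_eventually_at[OF local_param_param, of _ p]\<close>)

lemma has_order_eventually: assumes "has_order A p F n" 
  shows "\<forall>\<^sub>F q in at p. hol_at A q F" "\<forall>\<^sub>F q in at p. F q \<noteq> 0"
proof -
  show "\<forall>\<^sub>F q in at p. F q \<noteq> 0"
    using germ_order_nonzero assms by (simp add: has_order_def local_param_eventually_at[OF local_param_param])
  have "isolated_singularity_at (\<lambda>t. F (param A p t)) 0"
    using germ_order_meromorphic assms by (simp add: has_order_def meromorphic_at_iff)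
  hence "\<forall>\<^sub>F t in at 0. (\<lambda>t. F (param A p t)) analytic_on {t}"
    by (simp add: isolated_singularity_at_altdef)
  moreover have "\<forall>\<^sub>F t in at 0. local_param A (param A p t) (\<lambda>s. param A p (t + s))" 
    using local_param_shift[OF local_param_param[of p]] by (simp add: eventually_nhds_conv_at)
  ultimately have "\<forall>\<^sub>F t in at 0. hol_at A (param A p t) F"
  proof eventually_elim
    case (elim t)
    show ?case using analytic_shift[OF elim(1)] local_param_hol_at[OF elim(2)] by simp
  qed
  thus "\<forall>\<^sub>F q in at p. hol_at A q F" by (simp add: local_param_eventually_at[OF local_param_param])
qed

lemma hol_at_tendsto: assumes "hol_at A p F" shows "filterlim F (nhds (F p)) (nhds p)"
proof -
  have "isCont (\<lambda>t. F (param A p t)) 0" using assms unfolding hol_at_def by (rule analytic_at_imp_isCont)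
  hence "((\<lambda>t. F (param A p t)) \<longlongrightarrow> F (param A p 0)) (at 0)" by (simp add: isCont_def)
  hence "((\<lambda>t. F (param A p t)) \<longlongrightarrow> F (param A p 0)) (nhds 0)"
    using tendsto_at_iff_tendsto_nhds[of "\<lambda>t. F (param A p t)" 0] by simp
  thus ?thesis using chart_param_0[OF chart_at, of p] by (simp add: filterlim_iff local_param_eventually[OF local_param_param, of _ p])
qed

lemma hol_at_zero_or_has_order: "hol_at A p F \<Longrightarrow> (\<forall>\<^sub>F q in nhds p. F q = 0) \<or> (\<exists>n\<ge>0. has_order A p F n)"
  using analytic_zero_or_order[of "\<lambda>t. F (param A p t)"] by (simp add: hol_at_def has_order_def local_param_eventually[OF local_param_param])

lemma hol_at_has_order: assumes "hol_at A p F" "has_order A p F n" shows "n \<ge> 0" "n = 0 \<longleftrightarrow> F p \<noteq> 0"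
  using germ_order_analytic_iff[of "\<lambda>t. F (param A p t)" n] assms chart_param_0[OF chart_at, of p] by (auto simp: hol_at_def has_order_def)

lemma hol_at_nonzero_has_order: assumes "hol_at A p F" "F p \<noteq> 0" shows "has_order A p F 0"
  using germ_order_analytic[of "\<lambda>t. F (param A p t)"] assms chart_param_0[OF chart_at, of p] by (auto simp: hol_at_def has_order_def)

lemma has_order_unique: "has_order A p F n \<Longrightarrow> has_order A p F m \<Longrightarrow> n = m"
  unfolding has_order_def by (rule germ_order_unique)

lemma has_order_mult: "has_order A p F n \<Longrightarrow> has_order A p G m \<Longrightarrow> has_order A p (\<lambda>q. F q * G q) (n + m)"
  unfolding has_order_def by (rule germ_order_mult)

lemma has_order_divide: "has_order A p F n \<Longrightarrow> has_order A p G m \<Longrightarrow> has_order A p (\<lambda>q. F q / G q) (n - m)"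
  unfolding has_order_def by (rule germ_order_divide)

lemma has_order_power: "has_order A p F n \<Longrightarrow> has_order A p (\<lambda>q. F q ^ k) (int k * n)"
  unfolding has_order_def by (rule germ_order_power)

lemma has_order_inverse: "has_order A p F n \<Longrightarrow> has_order A p (\<lambda>q. inverse (F q)) (- n)"
  unfolding has_order_def by (rule germ_order_inverse)

lemma has_order_prod: "finite I \<Longrightarrow> (\<And>i. i \<in> I \<Longrightarrow> has_order A p (F i) (n i)) \<Longrightarrow>
    has_order A p (\<lambda>q. \<Prod>i\<in>I. F i q) (\<Sum>i\<in>I. n i)"
  unfolding has_order_def by (rule germ_order_prod)

lemma has_order_const: "c \<noteq> 0 \<Longrightarrow> has_order A p (\<lambda>_. c) 0"
  unfolding has_order_def by (rule germ_order_const)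

lemma hol_at_const: "hol_at A p (\<lambda>_. c)" by (simp add: hol_at_def)

lemma hol_at_add: "hol_at A p F \<Longrightarrow> hol_at A p G \<Longrightarrow> hol_at A p (\<lambda>q. F q + G q)"
  unfolding hol_at_def by (rule analytic_on_add)

lemma hol_at_diff: "hol_at A p F \<Longrightarrow> hol_at A p G \<Longrightarrow> hol_at A p (\<lambda>q. F q - G q)"
  unfolding hol_at_def by (rule analytic_on_diff)

lemma hol_at_mult: "hol_at A p F \<Longrightarrow> hol_at A p G \<Longrightarrow> hol_at A p (\<lambda>q. F q * G q)"
  unfolding hol_at_def by (rule analytic_on_mult)

lemma hol_at_power: "hol_at A p F \<Longrightarrow> hol_at A p (\<lambda>q. F q ^ n)"
  unfolding hol_at_def by (rule analytic_on_power)

lemma hol_at_divide: "hol_at A p F \<Longrightarrow> hol_at A p G \<Longrightarrow> G p \<noteq> 0 \<Longrightarrow> hol_at A p (\<lambda>q. F q / G q)"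
  unfolding hol_at_def by (rule analytic_on_divide) (auto simp: chart_param_0[OF chart_at])

lemma hol_at_inverse: "hol_at A p G \<Longrightarrow> G p \<noteq> 0 \<Longrightarrow> hol_at A p (\<lambda>q. inverse (G q))"
  unfolding hol_at_def by (rule analytic_on_inverse) (auto simp: chart_param_0[OF chart_at])

lemma hol_at_compose: "hol_at A p F \<Longrightarrow> R analytic_on {F p} \<Longrightarrow> hol_at A p (\<lambda>q. R (F q))"
  using analytic_on_compose[of "\<lambda>t. F (param A p t)" "{0}" R] chart_param_0[OF chart_at, of p] by (auto simp: hol_at_def o_def)

lemma has_order_cong_imp: "has_order A p F n \<Longrightarrow> \<forall>\<^sub>F q in at p. F q = G q \<Longrightarrow> has_order A p G n"
  using has_order_cong by blast

end

section \<open>Translation of the notions on an atlas into statements about germs at a point\<close>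

lemma analytic_at_shift_iff: "G analytic_on {a} \<longleftrightarrow> (\<lambda>t. G (t + a)) analytic_on {0::complex}"
proof
  assume "G analytic_on {a}"
  from analytic_shift[OF this] show "(\<lambda>t. G (t + a)) analytic_on {0}" by (simp add: add.commute)
next
  assume *: "(\<lambda>t. G (t + a)) analytic_on {0}"
  have "(\<lambda>s. s - a) analytic_on {a}" by (intro analytic_on_diff analytic_on_const analytic_on_ident)
  from analytic_on_compose[OF this, of "\<lambda>t. G (t + a)"] * show "G analytic_on {a}" by (simp add: o_def)
qed

lemma nicely_meromorphic_at_shift_iff:
  "G nicely_meromorphic_on {a} \<longleftrightarrow> (\<lambda>t. G (t + a)) nicely_meromorphic_on {0::complex}"
proof -
  have "G meromorphic_on {a} \<longleftrightarrow> (\<lambda>t. G (t + a)) meromorphic_on {0}"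
    by (simp add: meromorphic_on_def add.commute)
  moreover have "is_pole G a \<longleftrightarrow> is_pole (\<lambda>t. G (t + a)) 0"
    by (simp add: is_pole_shift_0[of G a] add.commute)
  moreover have "G \<midarrow>a\<rightarrow> G a \<longleftrightarrow> (\<lambda>t. G (t + a)) \<midarrow>0\<rightarrow> G a"
    using LIM_offset_zero_iff[of a G "G a"] by (simp add: add.commute)
  ultimately show ?thesis by (simp add: nicely_meromorphic_on_def)
qed

text \<open>The library extends functions by the value 0 at poles, whereas \<open>mero_at\<close> puts no condition on the value at p.\<close>

definition nmero_at :: "'a chart set \<Rightarrow> 'a \<Rightarrow> ('a \<Rightarrow> complex) \<Rightarrow> bool" where
  "nmero_at A p F \<longleftrightarrow> hol_at A p F \<or> (\<exists>n<0. has_order A p F n \<and> F p = 0)"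

definition mero_at :: "'a::topological_space chart set \<Rightarrow> 'a \<Rightarrow> ('a \<Rightarrow> complex) \<Rightarrow> bool" where
  "mero_at A p F \<longleftrightarrow> (\<forall>\<^sub>F q in at p. F q = 0) \<or> (\<exists>n. has_order A p F n)"

text \<open>Poles receive the value 0, as the convention for meromorphic functions demands.\<close>

definition remove_sing :: "'a chart set \<Rightarrow> ('a \<Rightarrow> complex) \<Rightarrow> 'a \<Rightarrow> complex" where
  "remove_sing A F p = remove_sings (\<lambda>t. F (param A p t)) 0"

lemma eventually_nhds_shift:
  fixes t :: complex
  assumes "\<forall>\<^sub>F v in nhds t. P v" shows "\<forall>\<^sub>F u in nhds 0. P (t + u)"
proof -
  have "filterlim (\<lambda>u. t + u) (nhds (t + 0)) (nhds 0)" by (intro tendsto_intros filterlim_ident)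
  from eventually_compose_filterlim[OF _ this, of P] assms show ?thesis by simp
qed

text \<open>A tube lemma: finitely many of the sets \<open>V\<close> cover the space, and finitely
  many eventual statements hold simultaneously.\<close>

lemma compact_uniform:
  fixes R :: "'a::topological_space \<Rightarrow> 'b \<Rightarrow> bool"
  assumes "compact (UNIV :: 'a set)" "\<And>x. \<exists>V. open V \<and> x \<in> V \<and> (\<forall>\<^sub>F c in F. \<forall>q\<in>V. R q c)"
  shows "\<forall>\<^sub>F c in F. \<forall>q. R q c"
proof -
  have "\<exists>V. \<forall>x. open (V x) \<and> x \<in> V x \<and> (\<forall>\<^sub>F c in F. \<forall>q\<in>V x. R q c)"
    by (rule choice) (use assms(2) in blast)
  then obtain V where V: "\<And>x. open (V x)" "\<And>x. x \<in> V x" "\<And>x. \<forall>\<^sub>F c in F. \<forall>q\<in>V x. R q c"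
    by blast
  have cov: "UNIV \<subseteq> (\<Union>x\<in>UNIV. V x)" using V(2) by blast
  obtain C where C: "C \<subseteq> UNIV" "finite C" "UNIV \<subseteq> (\<Union>x\<in>C. V x)"
    by (rule compactE_image[OF assms(1) _ cov]) (use V(1) in blast)+
  have "\<forall>\<^sub>F c in F. \<forall>x\<in>C. \<forall>q\<in>V x. R q c"
    by (rule eventually_ball_finite[OF C(2)]) (use V(3) in blast)
  thus ?thesis by eventually_elim (use C(3) in blast)
qed

lemma finite_t2_separation:
  fixes S :: "'a::t2_space set"
  assumes "finite S"
  shows "\<exists>W. (\<forall>x\<in>S. open (W x) \<and> x \<in> W x) \<and> (\<forall>x\<in>S. \<forall>y\<in>S. x \<noteq> y \<longrightarrow> W x \<inter> W y = {})"
proof -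
  define sep where "sep = (\<lambda>x (y::'a) UV. open (fst UV) \<and> open (snd UV) \<and> x \<in> fst UV \<and> y \<in> snd UV \<and> fst UV \<inter> snd UV = {})"
  define p where "p = (\<lambda>x y. SOME UV. sep x y UV)"
  have p: "open (fst (p x y)) \<and> open (snd (p x y)) \<and> x \<in> fst (p x y) \<and> y \<in> snd (p x y)
      \<and> fst (p x y) \<inter> snd (p x y) = {}" if ne: "x \<noteq> y" for x y
  proof -
    obtain U V where "open U" "open V" "x \<in> U" "y \<in> V" "U \<inter> V = {}" using hausdorff[OF ne] by blast
    hence "sep x y (U, V)" by (simp add: sep_def)
    hence "sep x y (p x y)" unfolding p_def by (rule someI)
    thus ?thesis by (simp only: sep_def)
  qed
  \<comment> \<open>The pair chosen for \<open>x\<close>, \<open>y\<close> need not be the swap of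
    the pair chosen for \<open>y\<close>, \<open>x\<close>, so both are intersected.\<close>
  define W where "W = (\<lambda>x. \<Inter>y\<in>S - {x}. fst (p x y) \<inter> snd (p y x))"
  show ?thesis
  proof (intro exI[of _ W] conjI ballI impI)
    fix x assume "x \<in> S"
      show "open (W x)" unfolding W_def
      proof (rule open_INT)
        show "finite (S - {x})" using assms by simp
        show "\<forall>y\<in>S - {x}. open (fst (p x y) \<inter> snd (p y x))" 
        proof
          fix y assume "y \<in> S - {x}"
          hence "open (fst (p x y))" "open (snd (p y x))" using p[of x y] p[of y x] by blast+
          thus "open (fst (p x y) \<inter> snd (p y x))" by (rule open_Int)
        qed
      qed
      show "x \<in> W x" unfolding W_def
      proof
        fix y assume "y \<in> S - {x}"
        thus "x \<in> fst (p x y) \<inter> snd (p y x)" using p[of x y] p[of y x] by blast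
      qed
  next
    fix x y assume xy: "x \<in> S" "y \<in> S" "x \<noteq> y"
    have "W x \<subseteq> fst (p x y)" "W y \<subseteq> snd (p x y)" unfolding W_def using xy by blast+
    thus "W x \<inter> W y = {}" using p[OF xy(3)] by blast
  qed
qed

context surface
begin

lemma coord_expr_chart_param: "(\<lambda>t. coord_expr c F (t + snd c p)) = (\<lambda>t. F (chart_param c p t))"
  by (simp add: coord_expr_def chart_param_def)

lemma holo_on_surface_iff:
  assumes "open W" shows "holo_on_surface A F W \<longleftrightarrow> (\<forall>p\<in>W. hol_at A p F)"
proof -
  have "coord_expr c F holomorphic_on snd c ` (fst c \<inter> W) \<longleftrightarrow> (\<forall>p\<in>fst c \<inter> W. hol_at A p F)" if c: "c \<in> A" for c
  proof -
    have "coord_expr c F holomorphic_on snd c ` (fst c \<inter> W) \<longleftrightarrow> coord_expr c F analytic_on snd c ` (fst c \<inter> W)"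
      using analytic_on_open[OF transition_image[OF c assms]] by blast
    also have "\<dots> \<longleftrightarrow> (\<forall>p\<in>fst c \<inter> W. coord_expr c F analytic_on {snd c p})"
      by (subst analytic_on_analytic_at) simp
    also have "\<dots> \<longleftrightarrow> (\<forall>p\<in>fst c \<inter> W. hol_at A p F)"
      using local_param_hol_at[OF lparI[OF c]] by (auto simp: analytic_at_shift_iff[of _ "snd c _"] coord_expr_chart_param)
    finally show ?thesis .
  qed
  thus ?thesis unfolding holo_on_surface_def using chart_at by blast
qed

lemma nmero_at_iff: assumes "local_param A p \<rho>" shows "nmero_at A p F \<longleftrightarrow> (\<lambda>t. F (\<rho> t)) nicely_meromorphic_on {0}"
  unfolding nicely_meromorphic_iff nmero_at_def local_param_hol_at[OF assms] local_param_has_order[OF assms] local_param_0[OF assms] ..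

lemma mero_on_surface_iff:
  assumes "open W" shows "mero_on_surface A F W \<longleftrightarrow> (\<forall>p\<in>W. nmero_at A p F)"
proof -
  have "coord_expr c F nicely_meromorphic_on snd c ` (fst c \<inter> W) \<longleftrightarrow> (\<forall>p\<in>fst c \<inter> W. nmero_at A p F)" if c: "c \<in> A" for c
  proof -
    have "coord_expr c F nicely_meromorphic_on snd c ` (fst c \<inter> W) \<longleftrightarrow> (\<forall>p\<in>fst c \<inter> W. coord_expr c F nicely_meromorphic_on {snd c p})"
      unfolding nicely_meromorphic_on_def by (subst meromorphic_on_meromorphic_at) blast
    also have "\<dots> \<longleftrightarrow> (\<forall>p\<in>fst c \<inter> W. nmero_at A p F)"
      using nmero_at_iff[OF lparI[OF c]] by (auto simp: nicely_meromorphic_at_shift_iff[of _ "snd c _"] coord_expr_chart_param)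
    finally show ?thesis .
  qed
  thus ?thesis unfolding mero_on_surface_def using chart_at by blast
qed

lemma order_at_eq: assumes "has_order A p F n" shows "order_at A F p = n"
proof -
  have "order_at A F p = zorder (coord_expr (chart_at A p) F) (snd (chart_at A p) p)"
    by (simp add: order_at_def chart_at_def Let_def)
  also have "\<dots> = zorder (\<lambda>t. F (param A p t)) 0" by (subst zorder_shift) (simp add: coord_expr_chart_param)
  also have "\<dots> = n" using assms germ_order_zorder by (simp add: has_order_def)
  finally show ?thesis .
qed

lemma pole_set_iff: assumes "nmero_at A p F" shows "p \<in> pole_set A F \<longleftrightarrow> (\<exists>n<0. has_order A p F n)"
proof -
  have *: "is_pole (coord_expr c F) (snd c p) \<longleftrightarrow> (\<exists>n<0. has_order A p F n)" if c: "c \<in> A" "p \<in> fst c" for c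
  proof -
    have "is_pole (coord_expr c F) (snd c p) \<longleftrightarrow> is_pole (\<lambda>t. F (chart_param c p t)) 0"
      by (simp add: is_pole_shift_0[of _ "snd c p"] add.commute coord_expr_chart_param)
    also have "\<dots> \<longleftrightarrow> (\<exists>n<0. has_order A p F n)"
    proof
      assume pole: "is_pole (\<lambda>t. F (chart_param c p t)) 0"
      have "\<not> (\<lambda>t. F (chart_param c p t)) analytic_on {0}" 
        using pole analytic_at_imp_no_pole by blast
      thus "\<exists>n<0. has_order A p F n" using assms local_param_hol_at[OF lparI[OF c]] by (auto simp: nmero_at_def)
    next
      assume "\<exists>n<0. has_order A p F n"
      thus "is_pole (\<lambda>t. F (chart_param c p t)) 0" using local_param_has_order[OF lparI[OF c]] germ_order_is_pole_iff by blast
    qed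
    finally show ?thesis .
  qed
  show ?thesis unfolding pole_set_def using * chart_at by blast
qed

lemma mero_at_iff: "mero_at A p F \<longleftrightarrow> (\<lambda>t. F (param A p t)) meromorphic_on {0}"
proof
  assume "mero_at A p F"
  thus "(\<lambda>t. F (param A p t)) meromorphic_on {0}"
  proof (unfold mero_at_def, elim disjE exE)
    assume "\<forall>\<^sub>F q in at p. F q = 0"
    hence *: "\<forall>\<^sub>F t in at 0. F (param A p t) = 0" by (simp add: local_param_eventually_at[OF local_param_param, of _ p])
    have "(\<lambda>t. F (param A p t)) meromorphic_on {0} \<longleftrightarrow> (\<lambda>t. 0) meromorphic_on {0}"
      by (rule meromorphic_on_cong) (use * in auto)
    thus ?thesis using meromorphic_on_const by blast
  qed (auto simp: has_order_def germ_order_meromorphic)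
next
  assume "(\<lambda>t. F (param A p t)) meromorphic_on {0}"
  from meromorphic_germ_order[OF this] show "mero_at A p F" unfolding mero_at_def has_order_def
    by (auto simp: local_param_eventually_at[OF local_param_param, of _ p])
qed

lemma mero_at_mult: "mero_at A p F \<Longrightarrow> mero_at A p G \<Longrightarrow> mero_at A p (\<lambda>q. F q * G q)"
  unfolding mero_at_iff by (rule meromorphic_on_mult)

lemma hol_at_mero_at: "hol_at A p F \<Longrightarrow> mero_at A p F"
  unfolding mero_at_iff hol_at_def by (rule analytic_on_imp_meromorphic_on)

lemma has_order_mero_at: "has_order A p F n \<Longrightarrow> mero_at A p F" by (auto simp: mero_at_def)

lemma nmero_at_mero_at: "nmero_at A p F \<Longrightarrow> mero_at A p F"
  using hol_at_mero_at has_order_mero_at by (auto simp: nmero_at_def)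

lemma mero_at_hol_at_at: assumes "mero_at A p F" shows "\<forall>\<^sub>F q in at p. hol_at A q F"
  using assms unfolding mero_at_def
proof (elim disjE exE)
  assume z: "\<forall>\<^sub>F q in at p. F q = 0"
  have "\<forall>\<^sub>F q in at p. \<forall>\<^sub>F x in nhds q. F x = 0"
  proof -
    obtain U where U: "open U" "p \<in> U" "\<And>q. q \<in> U \<Longrightarrow> q \<noteq> p \<Longrightarrow> F q = 0"
      using z by (auto simp: eventually_at_topological)
    have "\<forall>\<^sub>F x in nhds q. F x = 0" if "q \<in> U" "q \<noteq> p" for q
      using U that by (auto simp: eventually_nhds intro!: exI[of _ "U - {p}"] open_delete)
    thus ?thesis using U by (auto simp: eventually_at_topological)
  qed
  thus ?thesis by eventually_elim (use hol_at_cong[where F = F and G = "\<lambda>_. 0"] hol_at_const in blast)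
qed (rule has_order_eventually)

lemma remove_sing_hol_at: assumes "hol_at A p F" shows "remove_sing A F p = F p"
  using remove_sings_at_analytic[of "\<lambda>t. F (param A p t)" 0] assms chart_param_0[OF chart_at, of p] by (simp add: remove_sing_def hol_at_def)

lemma remove_sing_eq: assumes "mero_at A p F" shows "\<forall>\<^sub>F q in at p. remove_sing A F q = F q"
  using mero_at_hol_at_at[OF assms] by eventually_elim (rule remove_sing_hol_at)

lemma remove_sing_hol_at': assumes "(\<forall>\<^sub>F q in at p. F q = 0) \<or> (\<exists>n\<ge>0. has_order A p F n)" shows "hol_at A p (remove_sing A F)"
proof -
  have "\<exists>H. H analytic_on {0} \<and> (\<forall>\<^sub>F t in at 0. F (param A p t) = H t)"
    using assms
  proof (elim disjE exE conjE)
    assume "\<forall>\<^sub>F q in at p. F q = 0"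
    thus ?thesis by (intro exI[of _ "\<lambda>_. 0"]) (simp add: local_param_eventually_at[OF local_param_param, of _ p])
  next
    fix n assume "0 \<le> n" "has_order A p F n"
    thus ?thesis using germ_order_limit unfolding has_order_def by blast
  qed
  then obtain H where H: "H analytic_on {0}" "\<forall>\<^sub>F t in at 0. F (param A p t) = H t" by blast
  have "mero_at A p F" using assms by (auto simp: mero_at_def)
  from remove_sing_eq[OF this] have "\<forall>\<^sub>F t in at 0. remove_sing A F (param A p t) = F (param A p t)" by (simp add: local_param_eventually_at[OF local_param_param, of _ p])
  with H(2) have 1: "\<forall>\<^sub>F t in at 0. remove_sing A F (param A p t) = H t" by eventually_elim simp
  have "H \<midarrow>0\<rightarrow> H 0" using H(1) analytic_at_imp_isCont isContD by blast
  hence "(\<lambda>t. F (param A p t)) \<midarrow>0\<rightarrow> H 0" using tendsto_cong[OF H(2)] by blast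
  hence "remove_sing A F p = H 0" unfolding remove_sing_def by (rule remove_sings_eqI)
  with 1 have "\<forall>\<^sub>F t in nhds 0. remove_sing A F (param A p t) = H t" using chart_param_0[OF chart_at, of p] by (simp add: eventually_nhds_conv_at)
  hence "(\<lambda>t. remove_sing A F (param A p t)) analytic_on {0} \<longleftrightarrow> H analytic_on {0}" by (rule analytic_at_cong) simp
  thus ?thesis using H(1) by (simp add: hol_at_def)
qed

lemma remove_sing_has_order: "has_order A p F n \<Longrightarrow> has_order A p (remove_sing A F) n"
  using has_order_cong[OF remove_sing_eq[OF has_order_mero_at]] by blast

lemma remove_sing_pole: assumes "has_order A p F n" "n < 0" shows "remove_sing A F p = 0"
  unfolding remove_sing_def using germ_order_is_pole_iff assms by (simp add: has_order_def)

lemma remove_sing_nmero_at: assumes "mero_at A p F" shows "nmero_at A p (remove_sing A F)"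
proof (cases "\<exists>n<0. has_order A p F n")
  case True
  thus ?thesis using remove_sing_pole remove_sing_has_order unfolding nmero_at_def by blast
next
  case False
  hence "(\<forall>\<^sub>F q in at p. F q = 0) \<or> (\<exists>n\<ge>0. has_order A p F n)" using assms unfolding mero_at_def by (metis not_le_imp_less)
  thus ?thesis using remove_sing_hol_at' unfolding nmero_at_def by blast
qed

lemma remove_sing_cong: assumes "\<forall>\<^sub>F q in at p. F q = G q" shows "remove_sing A F p = remove_sing A G p"
  unfolding remove_sing_def by (rule remove_sings_cong) (use assms in \<open>auto simp: local_param_eventually_at[OF local_param_param, of _ p]\<close>)

text \<open>At a pole both sides are 0; otherwise multiplication by \<open>g\<close> commutes with
  passing to the limit. Cocycle relations that hold off isolated points thereby extend to all
  points.\<close>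

lemma remove_sing_mult: assumes "mero_at A p F" "hol_at A p g" "g p \<noteq> 0" "\<forall>\<^sub>F q in at p. G q = g q * F q"
  shows "remove_sing A G p = g p * remove_sing A F p"
proof (cases "\<exists>n<0. has_order A p F n")
  case True
  then obtain n where n: "n < 0" "has_order A p F n" by blast
  have "has_order A p (\<lambda>q. g q * F q) (0 + n)" by (intro has_order_mult hol_at_nonzero_has_order assms n)
  moreover have "\<forall>\<^sub>F q in at p. g q * F q = G q" using assms(4) by eventually_elim simp
  ultimately have "has_order A p G n" using has_order_cong by simp
  thus ?thesis using n remove_sing_pole by simp
next
  case False
  hence "(\<forall>\<^sub>F q in at p. F q = 0) \<or> (\<exists>n\<ge>0. has_order A p F n)" using assms(1) unfolding mero_at_def by (metis not_le_imp_less)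
  hence h: "hol_at A p (\<lambda>q. g q * remove_sing A F q)" using hol_at_mult[OF assms(2) remove_sing_hol_at'] by blast
  have "\<forall>\<^sub>F q in at p. G q = g q * remove_sing A F q" using remove_sing_eq[OF assms(1)] assms(4) by eventually_elim simp
  hence "remove_sing A G p = remove_sing A (\<lambda>q. g q * remove_sing A F q) p" by (rule remove_sing_cong)
  thus ?thesis using remove_sing_hol_at[OF h] by simp
qed

text \<open>The local biholomorphism whose \<open>e\<close>-th power is \<open>F\<close> is inverted
  and used to reparametrise.\<close>

lemma adapted: assumes "has_order A p F (int e)" "e > 0"
  obtains \<rho> where "local_param A p \<rho>" "\<forall>\<^sub>F t in at 0. F (\<rho> t) = t ^ e"
proof -
  obtain \<theta> where \<theta>: "local_biholo \<theta>" "\<forall>\<^sub>F t in at 0. F (param A p t) = \<theta> t ^ e"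
    using germ_order_root assms unfolding has_order_def by metis
  obtain g where g: "local_biholo g" "\<forall>\<^sub>F t in nhds 0. g (\<theta> t) = t" "\<forall>\<^sub>F t in nhds 0. \<theta> (g t) = t" using local_biholo_inverse[OF \<theta>(1)] .
  have "\<forall>\<^sub>F t in filtermap g (at 0). F (param A p t) = \<theta> t ^ e" using \<theta>(2) local_biholo_filtermap_at[OF g(1)] by simp
  hence 1: "\<forall>\<^sub>F t in at 0. F (param A p (g t)) = \<theta> (g t) ^ e" by (simp add: eventually_filtermap)
  have "\<forall>\<^sub>F t in at 0. \<theta> (g t) = t" using g(3) by (simp add: eventually_nhds_conv_at)
  with 1 have "\<forall>\<^sub>F t in at 0. F (param A p (g t)) = t ^ e" by eventually_elim simp
  with local_param_comp[OF local_param_param g(1)] show ?thesis by (rule that)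
qed

lemma local_param_ball: assumes "local_param A p \<rho>" "\<forall>\<^sub>F t in nhds (0::complex). P t"
  obtains r where "r > (0::real)" "inj_on \<rho> (ball 0 r)" "\<And>s. 0 < s \<Longrightarrow> s \<le> r \<Longrightarrow> open (\<rho> ` ball 0 s)" "\<And>t. t \<in> ball 0 r \<Longrightarrow> P t"
proof -
  obtain \<sigma> where \<sigma>: "\<forall>\<^sub>F t in nhds 0. \<sigma> (\<rho> t) = t" using local_param_inj[OF assms(1)] by blast
  have "\<forall>\<^sub>F t in nhds 0. (\<sigma> (\<rho> t) = t \<and> P t) \<and> local_param A (\<rho> t) (\<lambda>s. \<rho> (t + s))"
    using \<sigma> assms(2) local_param_shift[OF assms(1)] by eventually_elim simp
  then obtain r where r: "r > 0" "\<And>t. dist t 0 < r \<Longrightarrow> (\<sigma> (\<rho> t) = t \<and> P t) \<and> local_param A (\<rho> t) (\<lambda>s. \<rho> (t + s))"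
    unfolding eventually_nhds_metric by blast
  show ?thesis
  proof (rule that[OF r(1)])
    show "inj_on \<rho> (ball 0 r)" by (rule inj_on_inverseI[where g = \<sigma>]) (use r(2) in \<open>auto simp: dist_commute\<close>)
    show "P t" if "t \<in> ball 0 r" for t using r(2) that by (auto simp: dist_commute)
    fix s assume s: "0 < s" "s \<le> r"
    show "open (\<rho> ` ball 0 s)"
    proof (subst open_subopen, intro ballI)
      fix x assume "x \<in> \<rho> ` ball 0 s"
      then obtain t where t: "t \<in> ball 0 s" "x = \<rho> t" by blast
      have l: "local_param A x (\<lambda>u. \<rho> (t + u))" using r(2)[of t] t s by (auto simp: dist_commute)
      have "\<forall>\<^sub>F u in nhds 0. t + u \<in> ball 0 s"
        by (rule eventually_nhds_shift) (rule eventually_nhds_in_open[OF open_ball t(1)])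
      hence "\<forall>\<^sub>F u in nhds 0. \<rho> (t + u) \<in> \<rho> ` ball 0 s" by eventually_elim blast
      hence "\<forall>\<^sub>F y in nhds x. y \<in> \<rho> ` ball 0 s" by (simp add: local_param_eventually[OF l])
      thus "\<exists>T. open T \<and> x \<in> T \<and> T \<subseteq> \<rho> ` ball 0 s" unfolding eventually_nhds by blast
    qed
  qed
qed

text \<open>In an adapted parameter \<open>F\<close> is \<open>t ^ e\<close>, so a small nonzero
  \<open>w\<close> is attained exactly at its \<open>e\<close> distinct roots, where the derivative
  \<open>e * t ^ (e - 1)\<close> does not vanish. The centre is left out because \<open>F p\<close>
  may be junk, as for the reciprocal of a function at its pole.\<close>

lemma local_degree:
  assumes "has_order A p F (int e)" "e > 0" "open W" "p \<in> W"
  obtains U where "open U" "p \<in> U" "U \<subseteq> W"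
    "\<forall>\<^sub>F w in at 0. card {q \<in> U - {p}. F q = w} = e \<and> (\<forall>q\<in>{q \<in> U - {p}. F q = w}. has_order A q (\<lambda>x. F x - w) 1)"
proof -
  obtain \<rho> where \<rho>: "local_param A p \<rho>" "\<forall>\<^sub>F t in at 0. F (\<rho> t) = t ^ e" using adapted[OF assms(1,2)] .
  have e1: "\<forall>\<^sub>F t in nhds 0. t \<noteq> 0 \<longrightarrow> F (\<rho> t) = t ^ e" using \<rho>(2) by (simp add: eventually_at_filter)
  have e2: "\<forall>\<^sub>F t in nhds 0. \<rho> t \<in> W"
    using eventually_nhds_in_open[OF assms(3,4)] by (simp add: local_param_eventually[OF \<rho>(1)])
  from e1 e2 local_param_shift[OF \<rho>(1)]
  have "\<forall>\<^sub>F t in nhds 0. (t \<noteq> 0 \<longrightarrow> F (\<rho> t) = t ^ e) \<and> \<rho> t \<in> W \<and> local_param A (\<rho> t) (\<lambda>s. \<rho> (t + s))"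
    by eventually_elim simp
  from local_param_ball[OF \<rho>(1) this] obtain r where r: "r > 0" "inj_on \<rho> (ball 0 r)"
    "\<And>s. 0 < s \<Longrightarrow> s \<le> r \<Longrightarrow> open (\<rho> ` ball 0 s)"
    "\<And>t. t \<in> ball 0 r \<Longrightarrow> (t \<noteq> 0 \<longrightarrow> F (\<rho> t) = t ^ e) \<and> \<rho> t \<in> W \<and> local_param A (\<rho> t) (\<lambda>s. \<rho> (t + s))" by blast
  define U where "U = \<rho> ` ball 0 r"
  have p0: "\<rho> 0 = p" using local_param_0[OF \<rho>(1)] .
  have b0: "0 \<in> ball (0::complex) r" using r(1) by simp
  have key: "card {q \<in> U - {p}. F q = w} = e \<and> (\<forall>q\<in>{q \<in> U - {p}. F q = w}. has_order A q (\<lambda>x. F x - w) 1)"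
    if w: "w \<noteq> 0" "norm w < r ^ e" for w
  proof -
    have sub: "t \<in> ball 0 r" "t \<noteq> 0" if "t ^ e = w" for t
    proof -
      have "norm t ^ e < r ^ e" using w(2) that by (simp flip: norm_power)
      hence "norm t < r" using r(1) power_less_imp_less_base[of "norm t" e r] by simp
      thus "t \<in> ball 0 r" by simp
      show "t \<noteq> 0" using that w(1) assms(2) by (auto simp: power_0_left)
    qed
    have set: "{q \<in> U - {p}. F q = w} = \<rho> ` {t. t ^ e = w}"
    proof (intro equalityI subsetI)
      fix q assume q: "q \<in> {q \<in> U - {p}. F q = w}"
      then obtain t where t: "t \<in> ball 0 r" "q = \<rho> t" "q \<noteq> p" unfolding U_def by blast
      hence "t \<noteq> 0" using p0 by blast
      hence "t ^ e = w" using r(4)[OF t(1)] t(2) q by simp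
      thus "q \<in> \<rho> ` {t. t ^ e = w}" using t(2) by blast
    next
      fix q assume "q \<in> \<rho> ` {t. t ^ e = w}"
      then obtain t where t: "t ^ e = w" "q = \<rho> t" by blast
      have "q \<noteq> p"
      proof
        assume "q = p"
        hence "\<rho> t = \<rho> 0" using t(2) p0 by simp
        thus False using inj_onD[OF r(2) _ sub(1)[OF t(1)] b0] sub(2)[OF t(1)] by blast
      qed
      thus "q \<in> {q \<in> U - {p}. F q = w}" using r(4)[OF sub(1)[OF t(1)]] sub[OF t(1)] t unfolding U_def by blast
    qed
    have "inj_on \<rho> {t. t ^ e = w}" by (rule inj_on_subset[OF r(2)]) (use sub in blast)
    hence "card (\<rho> ` {t. t ^ e = w}) = card {t. t ^ e = w}" by (rule card_image)
    also have "\<dots> = e" using card_nth_roots[of w e] w(1) assms(2) by simp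
    finally have c: "card {q \<in> U - {p}. F q = w} = e" using set by simp
    have "has_order A q (\<lambda>x. F x - w) 1" if q: "q \<in> {q \<in> U - {p}. F q = w}" for q
    proof -
      obtain t where t: "t ^ e = w" "q = \<rho> t" using q unfolding set by blast
      have tb: "t \<in> ball 0 r - {0}" using sub[OF t(1)] by simp
      have l: "local_param A q (\<lambda>s. \<rho> (t + s))" using r(4)[of t] tb t(2) by simp
      have "\<forall>\<^sub>F v in nhds t. v \<in> ball 0 r - {0}" by (rule eventually_nhds_in_open[OF open_delete[OF open_ball] tb])
      hence "\<forall>\<^sub>F u in nhds 0. t + u \<in> ball 0 r - {0}" by (rule eventually_nhds_shift)
      hence ev: "\<forall>\<^sub>F u in nhds 0. F (\<rho> (t + u)) - w = (t + u) ^ e - w"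
        by eventually_elim (use r(4) in auto)
      have lb: "local_biholo (\<lambda>u. (t + u) ^ e - w)"
      proof -
        have "((\<lambda>u. (t + u) ^ e - w) has_field_derivative of_nat e * t ^ (e - 1)) (at 0)"
          by (auto intro!: derivative_eq_intros)
        hence "deriv (\<lambda>u. (t + u) ^ e - w) 0 = of_nat e * t ^ (e - 1)" by (rule DERIV_imp_deriv)
        moreover have "(\<lambda>u. (t + u) ^ e - w) analytic_on {0}"
          by (intro analytic_on_diff analytic_on_power analytic_on_add analytic_on_const analytic_on_ident)
        ultimately show ?thesis using t(1) sub(2)[OF t(1)] assms(2) unfolding local_biholo_def by simp
      qed
      have "\<forall>\<^sub>F u in at 0. F (\<rho> (t + u)) - w = (t + u) ^ e - w" using ev by (simp only: eventually_nhds_conv_at)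
      from germ_order_cong_iff[OF this] local_biholo_factor[OF lb] have "germ_order (\<lambda>u. F (\<rho> (t + u)) - w) 1" by blast
      thus ?thesis using local_param_has_order[OF l, of "\<lambda>x. F x - w"] by blast
    qed
    with c show ?thesis by blast
  qed
  show ?thesis
  proof (rule that[of U])
    show "open U" unfolding U_def using r(1,3) by blast
    show "p \<in> U" unfolding U_def using imageI[OF b0, of \<rho>] p0 by simp
    show "U \<subseteq> W" unfolding U_def using r(4) by blast
    have "\<forall>\<^sub>F w in at (0::complex). w \<in> ball 0 (r ^ e) - {0}"
      using r(1) by (intro eventually_at_in_open) auto
    thus "\<forall>\<^sub>F w in at 0. card {q \<in> U - {p}. F q = w} = e \<and> (\<forall>q\<in>{q \<in> U - {p}. F q = w}. has_order A q (\<lambda>x. F x - w) 1)"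
    proof eventually_elim
      case (elim w)
      show ?case by (rule key) (use elim in auto)
    qed
  qed
qed

end

section \<open>The degree of a function\<close>

locale compact_surface = surface A for A :: "('a::t2_space) chart set" +
  assumes cpt: "compact (UNIV :: 'a set)" and conn: "connected (UNIV :: 'a set)"

text \<open>\<open>I\<close> is the set of poles, \<open>m\<close> gives the pole orders and
  \<open>e\<close> the ramification indices elsewhere. Demanding an order for \<open>f - f p\<close>
  excludes constant functions. Values of \<open>f\<close> on \<open>I\<close> carry no information,
  so fibres leave \<open>I\<close> out.\<close>

locale surface_function = compact_surface A for A :: "('a::t2_space) chart set" +
  fixes f :: "'a \<Rightarrow> complex" and I :: "'a set" and m e :: "'a \<Rightarrow> nat"
  assumes finI: "finite I"
    and holf: "\<And>p. p \<notin> I \<Longrightarrow> hol_at A p f"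
    and polef: "\<And>p. p \<in> I \<Longrightarrow> 0 < m p \<and> has_order A p f (- int (m p))"
    and ordf: "\<And>p. p \<notin> I \<Longrightarrow> 0 < e p \<and> has_order A p (\<lambda>q. f q - f p) (int (e p))"
begin

definition fibre :: "complex \<Rightarrow> 'a set" where "fibre c = {p. p \<notin> I \<and> f p = c}"

lemma openI: "open (- I)" using finI by (simp add: finite_imp_closed open_Compl)

lemma eventually_notI: "p \<notin> I \<Longrightarrow> \<forall>\<^sub>F q in nhds p. q \<notin> I"
  using eventually_nhds_in_open[OF openI, of p] by simp

lemma eventually_at_notI: "\<forall>\<^sub>F q in at p. q \<notin> I"
proof -
  have "open (- (I - {p}))" by (rule open_Compl[OF finite_imp_closed[OF finite_Diff[OF finI]]])
  hence "\<forall>\<^sub>F q in nhds p. q \<in> - (I - {p})" by (rule eventually_nhds_in_open) simp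
  hence "\<forall>\<^sub>F q in at p. q \<in> - (I - {p})" by (simp only: eventually_nhds_conv_at)
  moreover have "\<forall>\<^sub>F q in at p. q \<noteq> p" by (simp add: eventually_at_filter)
  ultimately show ?thesis by eventually_elim simp
qed

lemma pole_large: assumes "p \<in> I" shows "\<forall>\<^sub>F q in at p. B < norm (f q)"
proof -
  have "is_pole (\<lambda>t. f (param A p t)) 0" using polef[OF assms] germ_order_is_pole_iff by (auto simp: has_order_def)
  hence "filterlim (\<lambda>t. f (param A p t)) at_infinity (at 0)" by (simp add: is_pole_def)
  hence "\<forall>\<^sub>F t in at 0. norm (f (param A p t)) \<ge> max B 0 + 1"
    unfolding filterlim_at_infinity[OF order_refl] by simp
  hence "\<forall>\<^sub>F t in at 0. B < norm (f (param A p t))" by eventually_elim simp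
  thus ?thesis by (simp add: local_param_eventually_at[OF local_param_param, of _ p])
qed

lemma eventually_not_fibre: "\<forall>\<^sub>F q in at p. q \<notin> fibre c"
proof (cases "p \<in> I")
  case True
  show ?thesis using pole_large[OF True, of "norm c"] by eventually_elim (auto simp: fibre_def)
next
  case False
  show ?thesis
  proof (cases "f p = c")
    case True
    have "\<forall>\<^sub>F q in at p. f q - f p \<noteq> 0" using ordf[OF False] has_order_eventually(2) by blast
    thus ?thesis by eventually_elim (use True in \<open>auto simp: fibre_def\<close>)
  next
    case ne: False
    have "\<forall>\<^sub>F q in nhds p. f q \<noteq> c" using hol_at_tendsto[OF holf[OF False]] ne by (rule tendsto_imp_eventually_ne)
    hence "\<forall>\<^sub>F q in at p. f q \<noteq> c" by (simp only: eventually_nhds_conv_at)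
    thus ?thesis by eventually_elim (simp add: fibre_def)
  qed
qed

text \<open>An infinite fibre would accumulate on the compact surface, whereas a small neighbourhood
  of any point, pole or not, meets the fibre at most in that point.\<close>

lemma finite_fibre: "finite (fibre c)"
  using finite_not_islimpt_in_compact[OF cpt, of "fibre c"] eventually_not_fibre
  by (simp add: islimpt_iff_eventually)

text \<open>Properness of \<open>f\<close>: around a point with another value, \<open>f\<close>
  keeps a positive distance from \<open>c\<close>, and near a pole it is large; compactness makes
  this uniform. A statement valid near the fibre over \<open>c\<close> thus holds on all
  neighbouring fibres.\<close>

lemma proper:
  assumes "\<And>p. p \<notin> I \<Longrightarrow> f p = c \<Longrightarrow> \<forall>\<^sub>F q in nhds p. P q"
  shows "\<forall>\<^sub>F c' in nhds c. \<forall>q. q \<in> fibre c' \<longrightarrow> P q"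
proof (rule compact_uniform[OF cpt])
  fix x
  have far: "\<exists>V. open V \<and> x \<in> V \<and> (\<forall>\<^sub>F c' in nhds c. \<forall>q\<in>V. q \<in> fibre c' \<longrightarrow> P q)"
    if "d > 0" "\<forall>\<^sub>F q in nhds x. q \<notin> I \<longrightarrow> d < dist (f q) c" for d
  proof -
    obtain V where V: "open V" "x \<in> V" "\<And>q. q \<in> V \<Longrightarrow> q \<notin> I \<Longrightarrow> d < dist (f q) c"
      using \<open>\<forall>\<^sub>F q in nhds x. q \<notin> I \<longrightarrow> d < dist (f q) c\<close> unfolding eventually_nhds by blast
    have "\<forall>\<^sub>F c' in nhds c. c' \<in> ball c d" using that(1) by (intro eventually_nhds_in_open) auto
    hence "\<forall>\<^sub>F c' in nhds c. \<forall>q\<in>V. q \<in> fibre c' \<longrightarrow> P q"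
    proof eventually_elim
      case (elim c')
      show ?case
      proof (intro ballI impI)
        fix q assume "q \<in> V" "q \<in> fibre c'"
        hence "d < dist c' c" using V(3) by (auto simp: fibre_def)
        thus "P q" using elim by (simp add: dist_commute)
      qed
    qed
    with V show ?thesis by blast
  qed
  show "\<exists>V. open V \<and> x \<in> V \<and> (\<forall>\<^sub>F c' in nhds c. \<forall>q\<in>V. q \<in> fibre c' \<longrightarrow> P q)"
  proof (cases "x \<in> I")
    case True
    have "\<forall>\<^sub>F q in at x. 1 < dist (f q) c" using pole_large[OF True, of "norm c + 1"]
    proof eventually_elim
      case (elim q)
      have "norm (f q) \<le> norm (f q - c) + norm c" by (metis diff_add_cancel norm_triangle_ineq)
      thus ?case using elim by (simp add: dist_norm)
    qed
    hence "\<forall>\<^sub>F q in nhds x. q \<notin> I \<longrightarrow> 1 < dist (f q) c"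
      unfolding eventually_at_filter by eventually_elim (use True in auto)
    thus ?thesis using far[of 1] by simp
  next
    case False
    show ?thesis
    proof (cases "f x = c")
      case True
      obtain V where V: "open V" "x \<in> V" "\<And>q. q \<in> V \<Longrightarrow> P q"
        using assms[OF False True] unfolding eventually_nhds by blast
      thus ?thesis by (intro exI[of _ V]) auto
    next
      case ne: False
      have "\<forall>\<^sub>F y in nhds (f x). y \<in> {y. dist (f x) c / 2 < dist y c}"
        by (rule eventually_nhds_in_open) (use ne in \<open>auto intro!: open_Collect_less continuous_intros\<close>)
      hence "\<forall>\<^sub>F q in nhds x. f q \<in> {y. dist (f x) c / 2 < dist y c}"
        using hol_at_tendsto[OF holf[OF False]] by (rule eventually_compose_filterlim)
      hence "\<forall>\<^sub>F q in nhds x. q \<notin> I \<longrightarrow> dist (f x) c / 2 < dist (f q) c" by eventually_elim simp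
      thus ?thesis using far[of "dist (f x) c / 2"] ne by simp
    qed
  qed
qed

text \<open>Properness again, with the poles in the role of the fibre over infinity.\<close>

lemma proper_inf:
  assumes "\<And>p. p \<in> I \<Longrightarrow> \<forall>\<^sub>F q in at p. P q"
  shows "\<forall>\<^sub>F c' in at_infinity. \<forall>q. q \<in> fibre c' \<longrightarrow> P q"
proof (rule compact_uniform[OF cpt])
  fix x
  show "\<exists>V. open V \<and> x \<in> V \<and> (\<forall>\<^sub>F c' in at_infinity. \<forall>q\<in>V. q \<in> fibre c' \<longrightarrow> P q)"
  proof (cases "x \<in> I")
    case True
    obtain V where V: "open V" "x \<in> V" "\<And>q. q \<in> V \<Longrightarrow> q \<noteq> x \<Longrightarrow> P q"
      using assms[OF True] unfolding eventually_at_topological by auto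
    have "\<forall>\<^sub>F c' in at_infinity. \<forall>q\<in>V. q \<in> fibre c' \<longrightarrow> P q"
      using V(3) True by (intro always_eventually) (auto simp: fibre_def)
    with V show ?thesis by blast
  next
    case False
    have "\<forall>\<^sub>F y in nhds (f x). y \<in> ball (f x) 1" by (rule eventually_nhds_in_open) auto
    hence "\<forall>\<^sub>F q in nhds x. f q \<in> ball (f x) 1"
      using hol_at_tendsto[OF holf[OF False]] by (rule eventually_compose_filterlim)
    then obtain V where V: "open V" "x \<in> V" "\<And>q. q \<in> V \<Longrightarrow> f q \<in> ball (f x) 1"
      unfolding eventually_nhds by blast
    have "\<forall>\<^sub>F c' in at_infinity. norm (f x) + 1 \<le> norm (c' :: complex)"
      unfolding eventually_at_infinity by blast
    hence "\<forall>\<^sub>F c' in at_infinity. \<forall>q\<in>V. q \<in> fibre c' \<longrightarrow> P q"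
    proof eventually_elim
      case (elim c')
      show ?case
      proof (intro ballI impI)
        fix q assume q: "q \<in> V" "q \<in> fibre c'"
        have "norm c' \<le> norm (c' - f x) + norm (f x)" by (metis diff_add_cancel norm_triangle_ineq)
        moreover have "norm (c' - f x) < 1" using V(3)[OF q(1)] q(2) by (simp add: fibre_def dist_norm norm_minus_commute)
        ultimately show "P q" using elim by simp
      qed
    qed
    with V show ?thesis by blast
  qed
qed

lemma e_eq: assumes "p \<notin> I" "has_order A p (\<lambda>q. f q - f p) 1" shows "e p = 1"
  using has_order_unique[OF assms(2)] ordf[OF assms(1)] by fastforce

definition deg :: "complex \<Rightarrow> nat" where "deg c = (\<Sum>p\<in>fibre c. e p)"

text \<open>The counting step common to values near a finite value and near infinity: the points of
  a nearby fibre fall into disjoint pieces, one for each limit point, and all of them are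
  unramified.\<close>

lemma deg_eqI:
  assumes "finite S" "\<And>p. p \<in> S \<Longrightarrow> 0 < k p"
    and "fibre c' = (\<Union>p\<in>S. V p)" "\<And>p. p \<in> S \<Longrightarrow> card (V p) = k p"
    and "\<And>p q. p \<in> S \<Longrightarrow> q \<in> S \<Longrightarrow> p \<noteq> q \<Longrightarrow> V p \<inter> V q = {}"
    and "\<And>q. q \<in> fibre c' \<Longrightarrow> has_order A q (\<lambda>x. f x - c') 1"
  shows "deg c' = sum k S \<and> (\<forall>q\<in>fibre c'. e q = 1)"
proof -
  have e1: "e q = 1" if "q \<in> fibre c'" for q
    using assms(6)[OF that] that by (intro e_eq) (auto simp: fibre_def)
  then have "deg c' = card (fibre c')" by (simp add: deg_def)
  also have "\<dots> = (\<Sum>p\<in>S. card (V p))" unfolding assms(3)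
  proof (rule card_UN_disjoint[OF assms(1)])
    show "\<forall>p\<in>S. finite (V p)"
    proof
      fix p assume "p \<in> S"
      hence "card (V p) > 0" using assms(2,4) by simp
      thus "finite (V p)" by (rule card_ge_0_finite)
    qed
  qed (use assms(5) in blast)
  also have "\<dots> = sum k S" using assms(4) by simp
  finally show ?thesis using e1 by blast
qed

text \<open>A point \<open>p\<close> over \<open>c\<close> splits into \<open>e p\<close> unramified
  points over a nearby value. The second conclusion makes ramified values isolated, which later
  gives finiteness of the branch points.\<close>

lemma deg_locally_constant: "\<forall>\<^sub>F c' in at c. deg c' = deg c \<and> (\<forall>q\<in>fibre c'. e q = 1)"
proof -
  obtain W where W0: "(\<forall>x\<in>fibre c. open (W x) \<and> x \<in> W x) \<and> (\<forall>x\<in>fibre c. \<forall>y\<in>fibre c. x \<noteq> y \<longrightarrow> W x \<inter> W y = {})"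
    using finite_t2_separation[OF finite_fibre[of c]] by (elim exE)
  have W: "\<And>x. x \<in> fibre c \<Longrightarrow> open (W x) \<and> x \<in> W x"
    "\<And>x y. x \<in> fibre c \<Longrightarrow> y \<in> fibre c \<Longrightarrow> x \<noteq> y \<Longrightarrow> W x \<inter> W y = {}"
    using W0 by blast+
  have "\<exists>U. \<forall>p\<in>fibre c. open (U p) \<and> p \<in> U p \<and> U p \<subseteq> W p \<inter> - I \<and>
    (\<forall>\<^sub>F w in at 0. card {q \<in> U p - {p}. f q - c = w} = e p \<and> (\<forall>q\<in>{q \<in> U p - {p}. f q - c = w}. has_order A q (\<lambda>x. f x - c - w) 1))"
  proof (rule bchoice, intro ballI)
    fix p assume p: "p \<in> fibre c"
    hence "p \<notin> I" "f p = c" by (auto simp: fibre_def)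
    hence o: "has_order A p (\<lambda>q. f q - c) (int (e p))" "0 < e p" "p \<in> W p \<inter> - I" "open (W p \<inter> - I)"
    proof -
      show "has_order A p (\<lambda>q. f q - c) (int (e p))" using ordf[of p] \<open>p \<notin> I\<close> \<open>f p = c\<close> by simp
      show "0 < e p" using ordf[of p] \<open>p \<notin> I\<close> by simp
      show "p \<in> W p \<inter> - I" using W(1)[OF p] \<open>p \<notin> I\<close> by blast
      show "open (W p \<inter> - I)" using W(1)[OF p] openI by (intro open_Int) blast+
    qed
    show "\<exists>U. open U \<and> p \<in> U \<and> U \<subseteq> W p \<inter> - I \<and>
    (\<forall>\<^sub>F w in at 0. card {q \<in> U - {p}. f q - c = w} = e p \<and> (\<forall>q\<in>{q \<in> U - {p}. f q - c = w}. has_order A q (\<lambda>x. f x - c - w) 1))"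
      by (rule local_degree[OF o(1,2,4,3)]) blast
  qed
  then obtain U where U0: "\<forall>p\<in>fibre c. open (U p) \<and> p \<in> U p \<and> U p \<subseteq> W p \<inter> - I \<and>
    (\<forall>\<^sub>F w in at 0. card {q \<in> U p - {p}. f q - c = w} = e p \<and> (\<forall>q\<in>{q \<in> U p - {p}. f q - c = w}. has_order A q (\<lambda>x. f x - c - w) 1))"
    by (elim exE)
  have U: "open (U p) \<and> p \<in> U p \<and> U p \<subseteq> W p \<inter> - I"
    "(\<forall>\<^sub>F w in at 0. card {q \<in> U p - {p}. f q - c = w} = e p \<and> (\<forall>q\<in>{q \<in> U p - {p}. f q - c = w}. has_order A q (\<lambda>x. f x - c - w) 1))" if "p \<in> fibre c" for p
    using bspec[OF U0 that] by blast+
  have "\<forall>\<^sub>F c' in nhds c. \<forall>q. q \<in> fibre c' \<longrightarrow> q \<in> (\<Union>p\<in>fibre c. U p)"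
  proof (rule proper)
    fix p assume "p \<notin> I" "f p = c"
    hence p: "p \<in> fibre c" by (simp add: fibre_def)
    show "\<forall>\<^sub>F q in nhds p. q \<in> (\<Union>p\<in>fibre c. U p)"
      by (rule eventually_nhds_in_open) (use p U(1) in auto)
  qed
  hence e1: "\<forall>\<^sub>F c' in at c. \<forall>q. q \<in> fibre c' \<longrightarrow> q \<in> (\<Union>p\<in>fibre c. U p)" by (simp only: eventually_nhds_conv_at)
  have flim: "filterlim (\<lambda>c'. c' - c) (at 0) (at c)"
  proof (rule filterlim_atI)
    show "((\<lambda>c'. c' - c) \<longlongrightarrow> 0) (at c)" using LIM_zero_iff[of "\<lambda>c'. c'" c "at c"] by simp
  qed (simp add: eventually_at_filter)
  have e2: "\<forall>\<^sub>F c' in at c. \<forall>p\<in>fibre c. card {q \<in> U p - {p}. f q - c = c' - c} = e p \<and> (\<forall>q\<in>{q \<in> U p - {p}. f q - c = c' - c}. has_order A q (\<lambda>x. f x - c - (c' - c)) 1)"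
  proof (rule eventually_ball_finite[OF finite_fibre], intro ballI)
    fix p assume p: "p \<in> fibre c"
    from eventually_compose_filterlim[OF U(2)[OF p] flim]
    show "\<forall>\<^sub>F c' in at c. card {q \<in> U p - {p}. f q - c = c' - c} = e p \<and> (\<forall>q\<in>{q \<in> U p - {p}. f q - c = c' - c}. has_order A q (\<lambda>x. f x - c - (c' - c)) 1)" .
  qed
  have e3: "\<forall>\<^sub>F c' in at c. c' \<noteq> c" by (simp add: eventually_at_filter)
  show ?thesis using e1 e2 e3
  proof eventually_elim
    case (elim c')
    let ?V = "\<lambda>p. {q \<in> U p - {p}. f q - c = c' - c}"
    have V: "fibre c' = (\<Union>p\<in>fibre c. ?V p)"
    proof (intro equalityI subsetI)
      fix q assume q: "q \<in> fibre c'"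
      then obtain p where p: "p \<in> fibre c" "q \<in> U p" using elim(1) by blast
      hence "q \<noteq> p" using q elim(3) by (auto simp: fibre_def)
      thus "q \<in> (\<Union>p\<in>fibre c. ?V p)" using p q by (auto simp: fibre_def)
    next
      fix q assume "q \<in> (\<Union>p\<in>fibre c. ?V p)"
      then obtain p where p: "p \<in> fibre c" "q \<in> U p" "f q = c'" by auto
      thus "q \<in> fibre c'" using U(1)[OF p(1)] by (auto simp: fibre_def)
    qed
    have "deg c' = sum e (fibre c) \<and> (\<forall>q\<in>fibre c'. e q = 1)"
    proof (rule deg_eqI[OF finite_fibre _ V])
      show "?V p \<inter> ?V q = {}" if "p \<in> fibre c" "q \<in> fibre c" "p \<noteq> q" for p q
        using U(1)[OF that(1)] U(1)[OF that(2)] W(2)[OF that] by blast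
      show "has_order A q (\<lambda>x. f x - c') 1" if q: "q \<in> fibre c'" for q
      proof -
        obtain p where "p \<in> fibre c" "q \<in> ?V p" using q unfolding V by blast
        hence "has_order A q (\<lambda>x. f x - c - (c' - c)) 1" using elim(2) by blast
        thus ?thesis by simp
      qed
      show "0 < e p" if "p \<in> fibre c" for p using ordf that unfolding fibre_def by blast
      show "card (?V p) = e p" if "p \<in> fibre c" for p using elim(2) that by blast
    qed
    thus ?case unfolding deg_def[of c] .
  qed
qed

text \<open>The local degree is applied to \<open>1 / f\<close>, which has a zero of order
  \<open>m p\<close> at a pole \<open>p\<close>.\<close>

lemma deg_infinity: "\<forall>\<^sub>F c' in at_infinity. deg c' = sum m I \<and> (\<forall>q\<in>fibre c'. e q = 1)"
proof -
  obtain W where W0: "(\<forall>x\<in>I. open (W x) \<and> x \<in> W x) \<and> (\<forall>x\<in>I. \<forall>y\<in>I. x \<noteq> y \<longrightarrow> W x \<inter> W y = {})"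
    using finite_t2_separation[OF finI] by (elim exE)
  have W: "\<And>x. x \<in> I \<Longrightarrow> open (W x) \<and> x \<in> W x"
    "\<And>x y. x \<in> I \<Longrightarrow> y \<in> I \<Longrightarrow> x \<noteq> y \<Longrightarrow> W x \<inter> W y = {}"
    using W0 by blast+
  have "\<exists>U. \<forall>p\<in>I. open (U p) \<and> p \<in> U p \<and> U p \<subseteq> W p \<and>
    (\<forall>\<^sub>F w in at 0. card {q \<in> U p - {p}. inverse (f q) = w} = m p \<and> (\<forall>q\<in>{q \<in> U p - {p}. inverse (f q) = w}. has_order A q (\<lambda>x. inverse (f x) - w) 1))"
  proof (rule bchoice, intro ballI)
    fix p assume p: "p \<in> I"
    hence o: "has_order A p (\<lambda>q. inverse (f q)) (int (m p))" "0 < m p" "p \<in> W p" "open (W p)"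
      using polef[OF p] has_order_inverse[of p f "- int (m p)"] W(1)[OF p] by auto
    show "\<exists>U. open U \<and> p \<in> U \<and> U \<subseteq> W p \<and>
    (\<forall>\<^sub>F w in at 0. card {q \<in> U - {p}. inverse (f q) = w} = m p \<and> (\<forall>q\<in>{q \<in> U - {p}. inverse (f q) = w}. has_order A q (\<lambda>x. inverse (f x) - w) 1))"
      by (rule local_degree[OF o(1,2,4,3)]) blast
  qed
  then obtain U where U0: "\<forall>p\<in>I. open (U p) \<and> p \<in> U p \<and> U p \<subseteq> W p \<and>
    (\<forall>\<^sub>F w in at 0. card {q \<in> U p - {p}. inverse (f q) = w} = m p \<and> (\<forall>q\<in>{q \<in> U p - {p}. inverse (f q) = w}. has_order A q (\<lambda>x. inverse (f x) - w) 1))"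
    by (elim exE)
  have U: "open (U p) \<and> p \<in> U p \<and> U p \<subseteq> W p"
    "(\<forall>\<^sub>F w in at 0. card {q \<in> U p - {p}. inverse (f q) = w} = m p \<and> (\<forall>q\<in>{q \<in> U p - {p}. inverse (f q) = w}. has_order A q (\<lambda>x. inverse (f x) - w) 1))" if "p \<in> I" for p
    using bspec[OF U0 that] by blast+
  have e1: "\<forall>\<^sub>F c' in at_infinity. \<forall>q. q \<in> fibre c' \<longrightarrow> q \<in> (\<Union>p\<in>I. U p)"
  proof (rule proper_inf)
    fix p assume p: "p \<in> I"
    have "\<forall>\<^sub>F q in nhds p. q \<in> (\<Union>p\<in>I. U p)"
      by (rule eventually_nhds_in_open) (use p U(1) in auto)
    thus "\<forall>\<^sub>F q in at p. q \<in> (\<Union>p\<in>I. U p)" by (simp only: eventually_nhds_conv_at)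
  qed
  have flim: "filterlim inverse (at (0::complex)) at_infinity"
    by (rule filterlim_inverse_at_iff[THEN iffD2]) (rule filterlim_ident)
  have e2: "\<forall>\<^sub>F c' in at_infinity. \<forall>p\<in>I. card {q \<in> U p - {p}. inverse (f q) = inverse c'} = m p \<and> (\<forall>q\<in>{q \<in> U p - {p}. inverse (f q) = inverse c'}. has_order A q (\<lambda>x. inverse (f x) - inverse c') 1)"
  proof (rule eventually_ball_finite[OF finI], intro ballI)
    fix p assume p: "p \<in> I"
    from eventually_compose_filterlim[OF U(2)[OF p] flim]
    show "\<forall>\<^sub>F c' in at_infinity. card {q \<in> U p - {p}. inverse (f q) = inverse c'} = m p \<and> (\<forall>q\<in>{q \<in> U p - {p}. inverse (f q) = inverse c'}. has_order A q (\<lambda>x. inverse (f x) - inverse c') 1)" .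
  qed
  have e3: "\<forall>\<^sub>F c' in at_infinity. c' \<noteq> (0::complex)"
    unfolding eventually_at_infinity by (intro exI[of _ 1]) auto
  show ?thesis using e1 e2 e3
  proof eventually_elim
    case (elim c')
    let ?V = "\<lambda>p. {q \<in> U p - {p}. inverse (f q) = inverse c'}"
    have V: "fibre c' = (\<Union>p\<in>I. ?V p)"
    proof (intro equalityI subsetI)
      fix q assume q: "q \<in> fibre c'"
      then obtain p where p: "p \<in> I" "q \<in> U p" using elim(1) by blast
      hence "q \<noteq> p" using q by (auto simp: fibre_def)
      thus "q \<in> (\<Union>p\<in>I. ?V p)" using p q by (auto simp: fibre_def)
    next
      fix q assume "q \<in> (\<Union>p\<in>I. ?V p)"
      then obtain p where p: "p \<in> I" "q \<in> U p" "q \<noteq> p" "f q = c'" by auto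
      have "q \<notin> I"
      proof
        assume q: "q \<in> I"
        have "q \<in> W p" "q \<in> W q" using U(1)[OF p(1)] p(2) W(1)[OF q] by auto
        thus False using W(2)[OF q p(1,3)] by blast
      qed
      thus "q \<in> fibre c'" using p(4) by (simp add: fibre_def)
    qed
    show "deg c' = sum m I \<and> (\<forall>q\<in>fibre c'. e q = 1)"
    proof (rule deg_eqI[OF finI _ V])
      show "?V p \<inter> ?V q = {}" if "p \<in> I" "q \<in> I" "p \<noteq> q" for p q
        using U(1)[OF that(1)] U(1)[OF that(2)] W(2)[OF that] by blast
      show "has_order A q (\<lambda>x. f x - c') 1" if q: "q \<in> fibre c'" for q
      proof -
        have s: "has_order A q (\<lambda>x. inverse (f x) - inverse c') 1" using q elim(2) unfolding V by blast
        have q': "q \<notin> I" "f q = c'" using q by (auto simp: fibre_def)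
        \<comment> \<open>The factor \<open>- c' * f\<close> is nonzero at \<open>q\<close> and
          turns \<open>1 / f - 1 / c'\<close> into \<open>f - c'\<close>, so the order 1 is
          preserved.\<close>
        have h: "hol_at A q (\<lambda>x. - c' * f x)" by (intro hol_at_mult hol_at_const holf q')
        have "has_order A q (\<lambda>x. - c' * f x) 0" by (rule hol_at_nonzero_has_order[OF h]) (use q' elim(3) in simp)
        from has_order_mult[OF s this] have s2: "has_order A q (\<lambda>x. (inverse (f x) - inverse c') * (- c' * f x)) 1" by simp
        have "\<forall>\<^sub>F x in nhds q. f x \<noteq> 0"
          by (rule tendsto_imp_eventually_ne[OF hol_at_tendsto[OF holf[OF q'(1)]]]) (use q' elim(3) in simp)
        hence "\<forall>\<^sub>F x in at q. f x \<noteq> 0" by (simp only: eventually_nhds_conv_at)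
        hence "\<forall>\<^sub>F x in at q. (inverse (f x) - inverse c') * (- c' * f x) = f x - c'"
          by eventually_elim (use elim(3) in \<open>simp add: field_simps\<close>)
        from has_order_cong_imp[OF s2 this] show ?thesis .
      qed
      show "0 < m p" if "p \<in> I" for p using polef that by blast
      show "card (?V p) = m p" if "p \<in> I" for p using elim(2) that by blast
    qed
  qed
qed

text \<open>A locally constant function on the connected plane is constant; its value is read off
  near infinity.\<close>

lemma deg_eq: "deg c = sum m I"
proof -
  have const: "deg c = deg c'" for c c'
  proof (rule connected_local_const[where f = deg and A = UNIV and a = c and b = c'])
    show "\<forall>a\<in>UNIV. \<forall>\<^sub>F b in at a within UNIV. deg a = deg b"
    proof
      fix a show "\<forall>\<^sub>F b in at a within UNIV. deg a = deg b"
        using deg_locally_constant[of a] by eventually_elim simp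
    qed
  qed (rule connected_UNIV UNIV_I)+
  obtain B where "\<And>c'. B \<le> norm c' \<Longrightarrow> deg c' = sum m I"
    using deg_infinity unfolding eventually_at_infinity by meson
  hence "deg (of_real \<bar>B\<bar>) = sum m I" by simp
  thus ?thesis using const by metis
qed

end

text \<open>The constant is \<open>t powi n\<close> times \<open>c * t ^ nat (-n)\<close>, which
  vanishes at 0 and so leaves the leading coefficient unchanged.\<close>

lemma germ_order_minus_const:
  assumes "germ_order G n" "n < 0" shows "germ_order (\<lambda>t. G t - c) n"
proof -
  obtain H where H: "H analytic_on {0}" "H 0 \<noteq> 0" "\<forall>\<^sub>F t in at 0. G t = t powi n * H t"
    using assms unfolding germ_order_def by blast
  have "\<forall>\<^sub>F t in at 0. t \<noteq> (0::complex)" by (simp add: eventually_at_filter)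
  with H(3) have "\<forall>\<^sub>F t in at 0. G t - c = t powi n * (H t - c * t ^ nat (-n))"
  proof eventually_elim
    case (elim t)
    have "t powi n * t ^ nat (-n) = t powi (n + - n)"
      using assms(2) elim(2) power_int_add[of t n "-n"] by (simp add: power_int_def)
    hence "t powi n * t ^ nat (-n) = 1" by simp
    thus ?case unfolding elim(1) by (simp add: algebra_simps)
  qed
  moreover have "(\<lambda>t. H t - c * t ^ nat (-n)) analytic_on {0}"
    by (intro analytic_on_diff H(1) analytic_on_mult analytic_on_const analytic_on_power analytic_on_ident)
  ultimately show ?thesis using H(2) assms(2) by (intro germ_orderI) (auto simp: zero_power)
qed

section \<open>The sheet involution\<close>

text \<open>With two distinct simple poles nothing ramifies over infinity: all ramification is
  visible over the finite plane, and the sheet exchange swaps the punctured neighbourhoods of the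
  poles.\<close>

locale double_cover = surface_function A f I m e
  for A :: "('a::t2_space) chart set" and f I m e +
  fixes i1 i2 :: 'a
  assumes I_eq: "I = {i1, i2}" and i12: "i1 \<noteq> i2" and m1: "m i1 = 1" and m2: "m i2 = 1"
begin

lemma fibre_f: "p \<notin> I \<Longrightarrow> p \<in> fibre (f p)" by (simp add: fibre_def)

lemma sum_fibre: "(\<Sum>p\<in>fibre c. e p) = 2"
proof -
  have "sum m I = 2" unfolding I_eq using i12 m1 m2 by simp
  thus ?thesis using deg_eq[of c] by (simp add: deg_def)
qed

lemma e_pos: "p \<in> fibre c \<Longrightarrow> 0 < e p" using ordf by (simp add: fibre_def)

lemma fibre_cases:
  obtains (single) p where "fibre c = {p}" "e p = 2"
    | (double) p q where "p \<noteq> q" "fibre c = {p, q}" "e p = 1" "e q = 1"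
proof -
  have "card (fibre c) = (\<Sum>p\<in>fibre c. 1)" by simp
  also have "\<dots> \<le> (\<Sum>p\<in>fibre c. e p)" by (rule sum_mono) (use e_pos in fastforce)
  finally have "card (fibre c) \<le> 2" using sum_fibre by simp
  moreover have "card (fibre c) \<noteq> 0" using sum_fibre[of c] finite_fibre by auto
  ultimately consider "card (fibre c) = 1" | "card (fibre c) = 2" by linarith
  thus thesis
  proof cases
    case 1
    then obtain p where "fibre c = {p}" by (auto simp: card_1_singleton_iff)
    thus ?thesis using single sum_fibre[of c] by simp
  next
    case 2
    then obtain p q where pq: "fibre c = {p, q}" "p \<noteq> q" by (auto simp: card_2_iff)
    have "e p + e q = 2" using sum_fibre[of c] pq by simp
    moreover have "0 < e p" "0 < e q" using e_pos[of _ c] pq by auto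
    ultimately have "e p = 1" "e q = 1" by linarith+
    thus ?thesis using double pq by blast
  qed
qed

text \<open>At the two poles J is junk; they are never used as its arguments.\<close>

definition J :: "'a \<Rightarrow> 'a" where
  "J p = (if e p = 2 then p else (THE q. q \<in> fibre (f p) \<and> q \<noteq> p))"

lemma J_fibre: assumes "p \<notin> I"
  shows "(fibre (f p) = {p} \<and> e p = 2 \<and> J p = p) \<or> (J p \<noteq> p \<and> fibre (f p) = {p, J p} \<and> e p = 1 \<and> e (J p) = 1)"
proof (rule fibre_cases[of "f p"])
  fix x assume x: "fibre (f p) = {x}" "e x = 2"
  hence "x = p" using fibre_f[OF assms] by simp
  thus ?thesis using x by (simp add: J_def)
next
  fix x y assume xy: "x \<noteq> y" "fibre (f p) = {x, y}" "e x = 1" "e y = 1"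
  have "p = x \<or> p = y" using fibre_f[OF assms] xy(2) by simp
  thus ?thesis
  proof
    assume p: "p = x"
    have "(THE q. q \<in> fibre (f p) \<and> q \<noteq> p) = y" by (rule the_equality) (use xy p in auto)
    hence "J p = y" using xy(3) p by (simp add: J_def)
    thus ?thesis using xy p by simp
  next
    assume p: "p = y"
    have "(THE q. q \<in> fibre (f p) \<and> q \<noteq> p) = x" by (rule the_equality) (use xy p in auto)
    hence "J p = x" using xy(4) p by (simp add: J_def)
    thus ?thesis using xy p by auto
  qed
qed

lemma J_props: assumes "p \<notin> I"
  shows "J p \<notin> I" "f (J p) = f p" "fibre (f p) = {p, J p}" "e (J p) = e p" "J p = p \<longleftrightarrow> e p = 2" "e p = 1 \<or> e p = 2"
proof -
  have "J p \<in> fibre (f p)" using J_fibre[OF assms] by auto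
  thus "J p \<notin> I" "f (J p) = f p" by (auto simp: fibre_def)
  show "fibre (f p) = {p, J p}" "e (J p) = e p" "J p = p \<longleftrightarrow> e p = 2" "e p = 1 \<or> e p = 2" using J_fibre[OF assms] by auto
qed

lemma J_J: assumes "p \<notin> I" shows "J (J p) = p"
proof (cases "J p = p")
  case False
  have "fibre (f p) = {J p, J (J p)}" using J_props(3)[OF J_props(1)[OF assms]] J_props(2)[OF assms] by simp
  moreover have "J (J p) \<noteq> J p"
    using J_props(5)[OF J_props(1)[OF assms]] J_props(4,5)[OF assms] False by simp
  moreover have "p \<in> fibre (f p)" using fibre_f[OF assms] .
  ultimately show ?thesis using False by auto
qed simp

lemma J_unique: "p \<notin> I \<Longrightarrow> q \<notin> I \<Longrightarrow> f q = f p \<Longrightarrow> q \<noteq> p \<Longrightarrow> J p = q"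
  using J_props(3)[of p] fibre_f[of q] by auto

definition adapted_param :: "'a \<Rightarrow> (complex \<Rightarrow> 'a) \<Rightarrow> bool" where
  "adapted_param p \<rho> \<longleftrightarrow> local_param A p \<rho> \<and> (\<forall>\<^sub>F t in nhds 0. \<rho> t \<notin> I \<and> f (\<rho> t) = f p + t ^ e p)"

lemma adapted_param_exists: assumes "p \<notin> I" obtains \<rho> where "adapted_param p \<rho>"
proof -
  have o: "has_order A p (\<lambda>q. f q - f p) (int (e p))" "0 < e p" using ordf[OF assms] by auto
  obtain \<rho> where \<rho>: "local_param A p \<rho>" "\<forall>\<^sub>F t in at 0. f (\<rho> t) - f p = t ^ e p" using adapted[OF o] .
  have "\<forall>\<^sub>F t in nhds 0. f (\<rho> t) - f p = t ^ e p"
    using \<rho>(2) local_param_0[OF \<rho>(1)] o(2) by (simp add: eventually_nhds_conv_at zero_power)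
  moreover have "\<forall>\<^sub>F t in nhds 0. \<rho> t \<notin> I" using eventually_notI[OF assms] by (simp add: local_param_eventually[OF \<rho>(1)])
  ultimately have "\<forall>\<^sub>F t in nhds 0. \<rho> t \<notin> I \<and> f (\<rho> t) = f p + t ^ e p"
    by eventually_elim (auto simp: algebra_simps)
  with \<rho>(1) show ?thesis using that by (simp add: adapted_param_def)
qed

text \<open>At a ramified point \<open>f - f p\<close> is \<open>t ^ 2\<close>, so the other point
  of the fibre is the one with parameter \<open>- t\<close>. At an unramified pair, points with
  equal parameter \<open>t\<close> near \<open>p\<close> and near \<open>J p\<close> have equal
  values of \<open>f\<close>. Hence \<open>J\<close> is holomorphic, and conditions at
  \<open>J p\<close> can be pulled back to \<open>p\<close>.\<close>

lemma adapted_param_J: assumes p: "p \<notin> I" and \<rho>: "adapted_param p \<rho>"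
  shows "local_param A (J p) (\<lambda>t. J (\<rho> t))" "e p = 2 \<Longrightarrow> \<forall>\<^sub>F t in nhds 0. J (\<rho> t) = \<rho> (- t)"
proof -
  have l: "local_param A p \<rho>" and ev: "\<forall>\<^sub>F t in nhds 0. \<rho> t \<notin> I \<and> f (\<rho> t) = f p + t ^ e p" using \<rho> by (auto simp: adapted_param_def)
  show two: "\<forall>\<^sub>F t in nhds 0. J (\<rho> t) = \<rho> (- t)" if e: "e p = 2"
  proof -
    obtain \<sigma> where \<sigma>: "\<forall>\<^sub>F t in nhds 0. \<sigma> (\<rho> t) = t" using local_param_inj[OF l] by blast
    have um: "filterlim uminus (nhds (0::complex)) (nhds 0)"
      using tendsto_minus[OF filterlim_ident, of "0::complex"] by simp
    note evs = ev \<sigma> eventually_compose_filterlim[OF ev um] eventually_compose_filterlim[OF \<sigma> um]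
    show ?thesis using evs
    proof eventually_elim
      case (elim t)
      show ?case
      proof (cases "t = 0")
        case True
        thus ?thesis using local_param_0[OF l] J_props(5)[OF p] e by simp
      next
        case False
        have "\<rho> (- t) \<noteq> \<rho> t"
        proof
          assume "\<rho> (- t) = \<rho> t"
          hence "- t = t" using elim(2,4) by simp
          thus False using False by simp
        qed
        thus ?thesis using elim(1,3) e by (intro J_unique) auto
      qed
    qed
  qed
  show "local_param A (J p) (\<lambda>t. J (\<rho> t))"
  proof (cases "e p = 2")
    case True
    have "local_biholo uminus" by (auto simp: local_biholo_def intro!: analytic_intros)
    from local_param_comp[OF l this] have "local_param A p (\<lambda>t. \<rho> (- t))" .
    hence "local_param A (J p) (\<lambda>t. \<rho> (- t))" using J_props(5)[OF p] True by simp
    thus ?thesis using two[OF True] by (rule local_param_cong)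
  next
    case False
    hence e1: "e p = 1" using J_props(6)[OF p] by simp
    have ne: "p \<noteq> J p" using J_props(5)[OF p] False by simp
    obtain \<rho>' where \<rho>': "adapted_param (J p) \<rho>'" using adapted_param_exists[OF J_props(1)[OF p]] .
    have l': "local_param A (J p) \<rho>'" and ev': "\<forall>\<^sub>F t in nhds 0. \<rho>' t \<notin> I \<and> f (\<rho>' t) = f (J p) + t ^ e (J p)"
      using \<rho>' by (auto simp: adapted_param_def)
    \<comment> \<open>Disjoint neighbourhoods guarantee that the two parameters give different
      points of one fibre.\<close>
    obtain U V where UV: "open U" "open V" "p \<in> U" "J p \<in> V" "U \<inter> V = {}" using hausdorff[OF ne] by blast
    have 1: "\<forall>\<^sub>F t in nhds 0. \<rho> t \<in> U" using eventually_nhds_in_open[OF UV(1,3)] by (simp add: local_param_eventually[OF l])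
    have 2: "\<forall>\<^sub>F t in nhds 0. \<rho>' t \<in> V" using eventually_nhds_in_open[OF UV(2,4)] by (simp add: local_param_eventually[OF l'])
    have "\<forall>\<^sub>F t in nhds 0. J (\<rho> t) = \<rho>' t" using 1 2 ev ev'
    proof eventually_elim
      case (elim t)
      have "f (\<rho>' t) = f (\<rho> t)" using elim(3,4) J_props(2,4)[OF p] by simp
      moreover have "\<rho>' t \<noteq> \<rho> t" using elim(1,2) UV(5) by auto
      ultimately show ?case using elim(3,4) by (intro J_unique) auto
    qed
    thus ?thesis by (rule local_param_cong[OF l'])
  qed
qed

lemma J_hol_at: assumes "p \<notin> I" "hol_at A (J p) F" shows "hol_at A p (\<lambda>q. F (J q))"
proof -
  obtain \<rho> where \<rho>: "adapted_param p \<rho>" using adapted_param_exists[OF assms(1)] .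
  hence l: "local_param A p \<rho>" by (simp add: adapted_param_def)
  show ?thesis using assms(2) unfolding local_param_hol_at[OF l] local_param_hol_at[OF adapted_param_J(1)[OF assms(1) \<rho>]] .
qed

lemma J_eventually: assumes "p \<notin> I" "\<forall>\<^sub>F q in nhds (J p). P q" shows "\<forall>\<^sub>F q in nhds p. P (J q)"
proof -
  obtain \<rho> where \<rho>: "adapted_param p \<rho>" using adapted_param_exists[OF assms(1)] .
  hence l: "local_param A p \<rho>" by (simp add: adapted_param_def)
  show ?thesis using assms(2) unfolding local_param_eventually[OF l] local_param_eventually[OF adapted_param_J(1)[OF assms(1) \<rho>]] .
qed

lemma has_order_I: "p \<in> I \<Longrightarrow> has_order A p f (- 1)"
  using polef[of p] m1 m2 I_eq by auto

lemma adapted_param_I: assumes "p \<in> I" obtains \<rho> where "local_param A p \<rho>" "\<forall>\<^sub>F t in at 0. \<rho> t \<notin> I \<and> f (\<rho> t) = inverse t"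
proof -
  have "has_order A p (\<lambda>q. inverse (f q)) (int 1)" using has_order_inverse[OF has_order_I[OF assms]] by simp
  from adapted[OF this] obtain \<rho> where \<rho>: "local_param A p \<rho>" "\<forall>\<^sub>F t in at 0. inverse (f (\<rho> t)) = t ^ 1" by auto
  have "\<forall>\<^sub>F t in at 0. \<rho> t \<notin> I" using eventually_at_notI[of p] by (simp add: local_param_eventually_at[OF \<rho>(1)])
  with \<rho>(2) have "\<forall>\<^sub>F t in at 0. \<rho> t \<notin> I \<and> f (\<rho> t) = inverse t"
    by eventually_elim (metis inverse_inverse_eq power_one_right)
  with \<rho>(1) show ?thesis by (rule that)
qed

text \<open>In parameters with \<open>f = 1 / t\<close> at both poles, \<open>J\<close> keeps
  \<open>t\<close> and changes the pole. Only punctured neighbourhoods are involved, since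
  \<open>J\<close> is junk at the poles.\<close>

lemma J_inf: assumes "a \<in> I" "b \<in> I" "a \<noteq> b" "\<forall>\<^sub>F q in at b. P q" shows "\<forall>\<^sub>F q in at a. P (J q)"
proof -
  obtain \<rho> where \<rho>: "local_param A a \<rho>" "\<forall>\<^sub>F t in at 0. \<rho> t \<notin> I \<and> f (\<rho> t) = inverse t" using adapted_param_I[OF assms(1)] .
  obtain \<rho>' where \<rho>': "local_param A b \<rho>'" "\<forall>\<^sub>F t in at 0. \<rho>' t \<notin> I \<and> f (\<rho>' t) = inverse t" using adapted_param_I[OF assms(2)] .
  obtain U V where UV: "open U" "open V" "a \<in> U" "b \<in> V" "U \<inter> V = {}" using hausdorff[OF assms(3)] by blast
  have "\<forall>\<^sub>F q in at a. q \<in> U" "\<forall>\<^sub>F q in at b. q \<in> V" using UV by (auto intro!: eventually_at_in_open')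
  hence 1: "\<forall>\<^sub>F t in at 0. \<rho> t \<in> U" and 2: "\<forall>\<^sub>F t in at 0. \<rho>' t \<in> V"
    by (auto simp: local_param_eventually_at[OF \<rho>(1)] local_param_eventually_at[OF \<rho>'(1)])
  have 3: "\<forall>\<^sub>F t in at 0. P (\<rho>' t)" using assms(4) by (simp add: local_param_eventually_at[OF \<rho>'(1)])
  have "\<forall>\<^sub>F t in at 0. P (J (\<rho> t))" using 1 2 3 \<rho>(2) \<rho>'(2)
  proof eventually_elim
    case (elim t)
    have "\<rho>' t \<noteq> \<rho> t" using elim(1,2) UV(5) by auto
    hence "J (\<rho> t) = \<rho>' t" using elim(4,5) by (intro J_unique) auto
    thus ?case using elim(3) by simp
  qed
  thus ?thesis by (simp add: local_param_eventually_at[OF \<rho>(1)])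
qed

lemma f_tendsto_at: assumes "p \<notin> I" shows "filterlim f (at (f p)) (at p)"
proof (rule filterlim_atI)
  have "at p \<le> nhds p" by (simp add: at_within_def)
  thus "(f \<longlongrightarrow> f p) (at p)" by (rule filterlim_mono[OF hol_at_tendsto[OF holf[OF assms]] order_refl])
  have "\<forall>\<^sub>F q in at p. f q - f p \<noteq> 0" using ordf[OF assms] has_order_eventually(2) by blast
  thus "\<forall>\<^sub>F q in at p. f q \<noteq> f p" by eventually_elim simp
qed

lemma f_tendsto_inf: assumes "p \<in> I" shows "filterlim f at_infinity (at p)"
  unfolding filterlim_at_infinity[OF order_refl]
proof (intro allI impI)
  fix r :: real
  show "\<forall>\<^sub>F x in at p. r \<le> norm (f x)" using pole_large[OF assms, of r] by eventually_elim simp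
qed

section \<open>Branch points, and functions that descend to the plane\<close>

definition branch :: "'a set" where "branch = {p. p \<notin> I \<and> e p = 2}"

lemma eventually_not_branch: "\<forall>\<^sub>F q in at p. q \<notin> branch"
proof (cases "p \<in> I")
  case True
  have "\<forall>\<^sub>F q in at p. deg (f q) = sum m I \<and> (\<forall>x\<in>fibre (f q). e x = 1)"
    using deg_infinity f_tendsto_inf[OF True] by (rule eventually_compose_filterlim)
  with eventually_at_notI[of p] show ?thesis by eventually_elim (use fibre_f in \<open>auto simp: branch_def\<close>)
next
  case False
  have "\<forall>\<^sub>F q in at p. deg (f q) = deg (f p) \<and> (\<forall>x\<in>fibre (f q). e x = 1)"
    using deg_locally_constant f_tendsto_at[OF False] by (rule eventually_compose_filterlim)
  with eventually_at_notI[of p] show ?thesis by eventually_elim (use fibre_f in \<open>auto simp: branch_def\<close>)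
qed

lemma finite_branch: "finite branch"
  using finite_not_islimpt_in_compact[OF cpt, of branch] eventually_not_branch by (simp add: islimpt_iff_eventually)

lemma inj_on_branch: "inj_on f branch"
proof (rule inj_onI)
  fix p q assume pq: "p \<in> branch" "q \<in> branch" "f p = f q"
  hence "fibre (f p) = {p}" using J_fibre[of p] by (auto simp: branch_def)
  thus "p = q" using fibre_f[of q] pq by (auto simp: branch_def)
qed

lemma has_order_f_minus: assumes "p \<notin> I" shows "has_order A p (\<lambda>q. f q - c) (if f p = c then int (e p) else 0)"
proof (cases "f p = c")
  case False
  have "hol_at A p (\<lambda>q. f q - c)" by (intro hol_at_diff holf[OF assms] hol_at_const)
  from hol_at_nonzero_has_order[OF this] show ?thesis using False by simp
qed (use ordf[OF assms] in auto)

lemma has_order_f_minus_I: assumes "p \<in> I" shows "has_order A p (\<lambda>q. f q - c) (- 1)"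
  using germ_order_minus_const[of "\<lambda>t. f (param A p t)" "-1" c] has_order_I[OF assms] by (simp add: has_order_def)

text \<open>Over an unramified value the quotient function \<open>R\<close> is \<open>G\<close> read
  in a parameter in which \<open>f\<close> is a translate of the coordinate. Over a ramified value
  it is continuous, and holomorphic on a punctured disc because ramified values are isolated, so the
  singularity is removable.\<close>

lemma descend:
  assumes "\<And>p. p \<notin> I \<Longrightarrow> hol_at A p G" "\<And>p. p \<notin> I \<Longrightarrow> G (J p) = G p"
  shows "\<exists>R. R holomorphic_on UNIV \<and> (\<forall>p. p \<notin> I \<longrightarrow> G p = R (f p))"
proof -
  define R where "R = (\<lambda>z. G (SOME p. p \<in> fibre z))"
  have Rf: "G p = R (f p)" if p: "p \<notin> I" for p
  proof -
    have "(SOME q. q \<in> fibre (f p)) \<in> fibre (f p)" using fibre_f[OF p] by (rule someI)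
    thus ?thesis unfolding R_def using J_props(3)[OF p] assms(2)[OF p] by auto
  qed
  have ex: "\<exists>p. p \<in> fibre z" for z by (rule fibre_cases[of z]) auto
  have Rr: "\<exists>K. K analytic_on {0} \<and> (\<forall>\<^sub>F t in nhds 0. R (z + t ^ e p) = K t)" if p: "p \<in> fibre z" for z p
  proof -
    have pI: "p \<notin> I" "f p = z" using p by (auto simp: fibre_def)
    obtain \<rho> where \<rho>: "local_param A p \<rho>" "\<forall>\<^sub>F t in nhds 0. \<rho> t \<notin> I \<and> f (\<rho> t) = f p + t ^ e p"
      using adapted_param_exists[OF pI(1)] unfolding adapted_param_def by blast
    have "(\<lambda>t. G (\<rho> t)) analytic_on {0}" using assms(1)[OF pI(1)] local_param_hol_at[OF \<rho>(1)] by simp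
    moreover have "\<forall>\<^sub>F t in nhds 0. R (z + t ^ e p) = G (\<rho> t)" using \<rho>(2)
      by eventually_elim (use Rf pI(2) in auto)
    ultimately show ?thesis by blast
  qed
  have an1: "R analytic_on {z}" if p: "p \<in> fibre z" "e p = 1" for z p
  proof -
    obtain K where K: "K analytic_on {0}" "\<forall>\<^sub>F t in nhds 0. R (z + t ^ e p) = K t" using Rr[OF p(1)] by blast
    have ev: "\<forall>\<^sub>F t in nhds 0. R (t + z) = K t" using K(2) by eventually_elim (simp add: p(2) add.commute)
    have "(\<lambda>t. R (t + z)) analytic_on {0} \<longleftrightarrow> K analytic_on {0}" using ev by (rule analytic_at_cong) simp
    thus ?thesis using K(1) by (simp add: analytic_at_shift_iff[of R z])
  qed
  have "R analytic_on {z}" for z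
  proof -
    obtain p where p: "p \<in> fibre z" using ex by blast
    show ?thesis
    proof (cases "e p = 1")
      case False
      hence e2: "e p = 2" using p J_props(6)[of p] by (auto simp: fibre_def)
      obtain K where K: "K analytic_on {0}" "\<forall>\<^sub>F t in nhds 0. R (z + t ^ e p) = K t" using Rr[OF p] by blast
      \<comment> \<open>Here \<open>f = z + t ^ 2\<close>, so \<open>t\<close> is recovered as a
        square root of \<open>w - z\<close>. The principal root is not holomorphic at the branch
        value, but its continuity there suffices.\<close>
      have cs: "filterlim (\<lambda>w. csqrt (w - z)) (nhds 0) (nhds z)"
      proof -
        have "((\<lambda>w. norm (csqrt (w - z))) \<longlongrightarrow> 0) (nhds z)"
        proof -
          have "((\<lambda>w. sqrt (norm (w - z))) \<longlongrightarrow> sqrt (norm (z - z))) (nhds z)"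
            by (intro tendsto_intros filterlim_ident)
          thus ?thesis by (simp add: norm_csqrt)
        qed
        thus ?thesis by (rule tendsto_norm_zero_cancel)
      qed
      have ev: "\<forall>\<^sub>F w in nhds z. R w = K (csqrt (w - z))"
        using eventually_compose_filterlim[OF K(2) cs] by eventually_elim (simp add: e2)
      have "isCont K 0" using K(1) by (rule analytic_at_imp_isCont)
      hence "(K \<longlongrightarrow> K 0) (nhds 0)" using tendsto_at_iff_tendsto_nhds[of K 0] by (simp add: isCont_def)
      from filterlim_compose[OF this cs] have "((\<lambda>w. K (csqrt (w - z))) \<longlongrightarrow> K 0) (nhds z)" .
      moreover have "R z = K 0" using eventually_nhds_x_imp_x[OF ev] by simp
      ultimately have "(R \<longlongrightarrow> R z) (nhds z)" using filterlim_cong[OF refl refl ev] by simp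
      hence cont: "isCont R z" using tendsto_at_iff_tendsto_nhds[of R z] by (simp add: isCont_def)
      have "\<forall>\<^sub>F c' in at z. R analytic_on {c'}" using deg_locally_constant[of z]
      proof eventually_elim
        case (elim c')
        obtain q where "q \<in> fibre c'" using ex by blast
        thus ?case using an1 elim by blast
      qed
      then obtain S where S: "open S" "z \<in> S" "\<And>c'. c' \<in> S \<Longrightarrow> c' \<noteq> z \<Longrightarrow> R analytic_on {c'}"
        unfolding eventually_at_topological by blast
      have h: "R analytic_on S - {z}" by (subst analytic_on_analytic_at) (use S(3) in blast)
      have "continuous_on S R"
        unfolding continuous_on_eq_continuous_at[OF S(1)]
      proof
        fix x assume "x \<in> S"
        thus "isCont R x" using cont S(3)[of x] analytic_at_imp_isCont by (cases "x = z") auto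
      qed
      from no_isolated_singularity[OF this analytic_imp_holomorphic[OF h] S(1)]
      have "R holomorphic_on S" by simp
      thus ?thesis using S(1,2) analytic_at by blast
    qed (use an1 p in blast)
  qed
  hence "R analytic_on UNIV" by (subst analytic_on_analytic_at) blast
  hence "R holomorphic_on UNIV" by (rule analytic_imp_holomorphic)
  thus ?thesis using Rf by blast
qed

text \<open>A pole order of at most \<open>k\<close> at both poles of \<open>f\<close>, as
  \<open>f\<close> has simple poles. Stated as a bound, it survives sums with cancellation and
  functions that vanish identically, neither of which has a predictable order.\<close>

definition growth :: "int \<Rightarrow> ('a \<Rightarrow> complex) \<Rightarrow> bool" where
  "growth k G \<longleftrightarrow> (\<exists>C. \<forall>i\<in>I. \<forall>\<^sub>F q in at i. norm (G q) \<le> C * norm (f q) powi k)"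

lemma growthI: assumes "\<And>i. i \<in> I \<Longrightarrow> \<exists>C. \<forall>\<^sub>F q in at i. norm (G q) \<le> C * norm (f q) powi k" shows "growth k G"
proof -
  obtain C1 where C1: "\<forall>\<^sub>F q in at i1. norm (G q) \<le> C1 * norm (f q) powi k" using assms[of i1] I_eq by auto
  obtain C2 where C2: "\<forall>\<^sub>F q in at i2. norm (G q) \<le> C2 * norm (f q) powi k" using assms[of i2] I_eq by auto
  have le: "C1 * norm (f q) powi k \<le> max C1 C2 * norm (f q) powi k" "C2 * norm (f q) powi k \<le> max C1 C2 * norm (f q) powi k" for q
    by (intro mult_right_mono; simp)+
  have "\<forall>\<^sub>F q in at i1. norm (G q) \<le> max C1 C2 * norm (f q) powi k"
    using C1 by eventually_elim (use le(1) order_trans in blast)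
  moreover have "\<forall>\<^sub>F q in at i2. norm (G q) \<le> max C1 C2 * norm (f q) powi k"
    using C2 by eventually_elim (use le(2) order_trans in blast)
  ultimately have "\<forall>\<^sub>F q in at i. norm (G q) \<le> max C1 C2 * norm (f q) powi k" if "i \<in> I" for i
    using that I_eq by auto
  thus ?thesis unfolding growth_def by blast
qed

lemma growth_has_order:
  assumes "\<And>i. i \<in> I \<Longrightarrow> (\<forall>\<^sub>F q in at i. G q = 0) \<or> (\<exists>n\<ge>-k. has_order A i G n)" shows "growth k G"
proof (rule growthI)
  fix i assume i: "i \<in> I"
  from assms[OF i] show "\<exists>C. \<forall>\<^sub>F q in at i. norm (G q) \<le> C * norm (f q) powi k"
  proof (elim disjE exE conjE)
    assume z: "\<forall>\<^sub>F q in at i. G q = 0"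
    have "\<forall>\<^sub>F q in at i. norm (G q) \<le> 0 * norm (f q) powi k" using z by eventually_elim simp
    thus ?thesis by blast
  next
  fix n assume n: "- k \<le> n" "has_order A i G n"
  obtain \<rho> where \<rho>: "local_param A i \<rho>" "\<forall>\<^sub>F t in at 0. \<rho> t \<notin> I \<and> f (\<rho> t) = inverse t" using adapted_param_I[OF i] .
  have "germ_order (\<lambda>t. G (\<rho> t)) n" using n(2) local_param_has_order[OF \<rho>(1)] by simp
  from germ_order_mult[OF this germ_order_powi[of k]] have "germ_order (\<lambda>t. G (\<rho> t) * t powi k) (n + k)" .
  from germ_order_limit[OF this] n(1)
  obtain H where H: "H analytic_on {0}" "\<forall>\<^sub>F t in at 0. G (\<rho> t) * t powi k = H t" by fastforce
  have "H \<midarrow>0\<rightarrow> H 0" using H(1) analytic_at_imp_isCont isContD by blast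
  hence "((\<lambda>t. norm (H t)) \<longlongrightarrow> norm (H 0)) (at 0)" by (rule tendsto_norm)
  hence "\<forall>\<^sub>F t in at 0. norm (H t) < norm (H 0) + 1" by (rule order_tendstoD) simp
  moreover have "\<forall>\<^sub>F t in at 0. t \<noteq> (0::complex)" by (simp add: eventually_at_filter)
  ultimately have "\<forall>\<^sub>F t in at 0. norm (G (\<rho> t)) \<le> (norm (H 0) + 1) * norm (f (\<rho> t)) powi k"
    using H(2) \<rho>(2)
  proof eventually_elim
    case (elim t)
    have "G (\<rho> t) = H t * t powi (- k)" using elim(3)[symmetric] elim(2) by (simp add: power_int_minus)
    hence "norm (G (\<rho> t)) = norm (H t) * norm t powi (- k)" by (simp add: norm_mult norm_power_int)
    moreover have "norm (f (\<rho> t)) powi k = norm t powi (- k)"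
      using elim(4) by (simp add: norm_inverse power_int_inverse power_int_minus)
    ultimately show ?case using elim(1) by (simp add: mult_right_mono)
  qed
  thus "\<exists>C. \<forall>\<^sub>F q in at i. norm (G q) \<le> C * norm (f q) powi k" unfolding local_param_eventually_at[OF \<rho>(1)] by blast
  qed
qed

lemma growth_mult: assumes "growth k G" "growth l H" shows "growth (k + l) (\<lambda>q. G q * H q)"
proof (rule growthI)
  fix i assume i: "i \<in> I"
  obtain C D where C: "\<forall>\<^sub>F q in at i. norm (G q) \<le> C * norm (f q) powi k"
    and D: "\<forall>\<^sub>F q in at i. norm (H q) \<le> D * norm (f q) powi l" using assms i unfolding growth_def by blast
  have "\<forall>\<^sub>F q in at i. 0 < norm (f q)" by (rule pole_large[OF i])
  with C D have "\<forall>\<^sub>F q in at i. norm (G q * H q) \<le> C * D * norm (f q) powi (k + l)"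
  proof eventually_elim
    case (elim q)
    have "norm (G q) * norm (H q) \<le> (C * norm (f q) powi k) * (D * norm (f q) powi l)"
      by (rule mult_mono[OF elim(1,2)]) (use elim(1) norm_ge_zero order_trans in blast, simp)
    also have "\<dots> = C * D * norm (f q) powi (k + l)" using elim(3) by (simp add: power_int_add)
    finally show ?case by (simp add: norm_mult)
  qed
  thus "\<exists>C. \<forall>\<^sub>F q in at i. norm (G q * H q) \<le> C * norm (f q) powi (k + l)" by blast
qed

lemma growth_diff: assumes "growth k G" "growth k H" shows "growth k (\<lambda>q. G q - H q)"
proof (rule growthI)
  fix i assume i: "i \<in> I"
  obtain C D where C: "\<forall>\<^sub>F q in at i. norm (G q) \<le> C * norm (f q) powi k"
    and D: "\<forall>\<^sub>F q in at i. norm (H q) \<le> D * norm (f q) powi k" using assms i unfolding growth_def by blast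
  from C D have "\<forall>\<^sub>F q in at i. norm (G q - H q) \<le> (C + D) * norm (f q) powi k"
  proof eventually_elim
    case (elim q)
    have "norm (G q - H q) \<le> norm (G q) + norm (H q)" by (rule norm_triangle_ineq4)
    thus ?case using elim by (simp add: distrib_right)
  qed
  thus "\<exists>C. \<forall>\<^sub>F q in at i. norm (G q - H q) \<le> C * norm (f q) powi k" by blast
qed

lemma growth_J: assumes "growth k G" shows "growth k (\<lambda>q. G (J q))"
proof (rule growthI)
  fix i assume i: "i \<in> I"
  obtain j where j: "j \<in> I" "i \<noteq> j" using i i12 I_eq by auto
  obtain C where C: "\<forall>\<^sub>F q in at j. norm (G q) \<le> C * norm (f q) powi k"
    using assms j unfolding growth_def by blast
  from J_inf[OF i j C] eventually_at_notI[of i]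
  have "\<forall>\<^sub>F q in at i. norm (G (J q)) \<le> C * norm (f q) powi k"
    by eventually_elim (simp add: J_props(2))
  thus "\<exists>C. \<forall>\<^sub>F q in at i. norm (G (J q)) \<le> C * norm (f q) powi k" by blast
qed

text \<open>The function descends to an entire function of polynomial growth, and Liouville's
  theorem applies. For negative \<open>k\<close> the entire function tends to 0 at infinity and is
  zero.\<close>

lemma invariant_poly:
  assumes "\<And>p. p \<notin> I \<Longrightarrow> hol_at A p G" "\<And>p. p \<notin> I \<Longrightarrow> G (J p) = G p" "growth k G"
  shows "\<exists>R. (\<forall>p. p \<notin> I \<longrightarrow> G p = poly R (f p)) \<and> (R = 0 \<or> int (degree R) \<le> k)"
proof -
  obtain h where h: "h holomorphic_on UNIV" "\<And>p. p \<notin> I \<Longrightarrow> G p = h (f p)" using descend[OF assms(1,2)] by blast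
  obtain C where C: "\<And>i. i \<in> I \<Longrightarrow> \<forall>\<^sub>F q in at i. norm (G q) \<le> C * norm (f q) powi k"
    using assms(3) unfolding growth_def by blast
  have "\<forall>\<^sub>F c' in at_infinity. \<forall>q. q \<in> fibre c' \<longrightarrow> norm (G q) \<le> C * norm (f q) powi k"
    by (rule proper_inf) (rule C)
  hence ev: "\<forall>\<^sub>F z in at_infinity. norm (h z) \<le> C * norm z powi k"
  proof eventually_elim
    case (elim z)
    obtain q where q: "q \<in> fibre z" by (rule fibre_cases[of z]) auto
    have "norm (G q) \<le> C * norm (f q) powi k" using elim q by blast
    thus ?case using q h(2)[of q] by (simp add: fibre_def)
  qed
  show ?thesis
  proof (cases "k \<ge> 0")
    case True
    obtain B where B: "\<And>z. B \<le> norm z \<Longrightarrow> norm (h z) \<le> C * norm z powi k"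
      using ev unfolding eventually_at_infinity by blast
    hence B': "\<And>z. B \<le> norm z \<Longrightarrow> norm (h z) \<le> C * norm z ^ nat k" using True by (simp add: power_int_def)
    \<comment> \<open>The Taylor polynomial at 0, with which Liouville's theorem identifies
      \<open>h\<close>.\<close>
    define R where "R = (\<Sum>j\<le>nat k. monom ((deriv ^^ j) h 0 / fact j) j)"
    have "h z = poly R z" for z :: complex
      using Liouville_polynomial[OF h(1) B', where \<xi> = z] unfolding R_def poly_sum poly_monom by simp
    moreover have "degree R \<le> nat k" unfolding R_def
      by (rule degree_sum_le) (auto intro: order_trans[OF degree_monom_le])
    ultimately show ?thesis using h(2) True by (intro exI[of _ R]) auto
  next
    case False
    have "(h \<longlongrightarrow> 0) at_infinity"
    proof (rule Lim_null_comparison[OF ev])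
      have l: "((\<lambda>z::complex. inverse (norm z)) \<longlongrightarrow> 0) at_infinity"
        by (rule tendsto_inverse_0_at_top[OF filterlim_at_infinity_imp_norm_at_top[OF filterlim_ident]])
      have "((\<lambda>z::complex. C * inverse (norm z) ^ nat (- k)) \<longlongrightarrow> C * 0 ^ nat (- k)) at_infinity"
        by (intro tendsto_intros l)
      thus "((\<lambda>z::complex. C * norm z powi k) \<longlongrightarrow> 0) at_infinity"
        using False by (simp add: power_int_def zero_power)
    qed
    from Liouville_weak_0[OF h(1) this] have "h z = 0" for z .
    thus ?thesis using h(2) by (intro exI[of _ 0]) auto
  qed
qed

end

section \<open>Functions determined up to sign\<close>

text \<open>\<open>adm z \<phi>\<close> is a condition on the germ of \<open>\<phi>\<close> along the fibre over z.\<close>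

locale sign_torsor =
  fixes fibre :: "complex \<Rightarrow> 'b set" and adm :: "complex \<Rightarrow> ('b \<Rightarrow> complex) \<Rightarrow> bool"
  assumes disj: "\<And>z w q. q \<in> fibre z \<Longrightarrow> q \<in> fibre w \<Longrightarrow> z = w"
    and cong: "\<And>z \<phi> \<psi>. adm z \<phi> \<Longrightarrow> \<forall>\<^sub>F w in nhds z. \<forall>q\<in>fibre w. \<psi> q = \<phi> q \<Longrightarrow> adm z \<psi>"
    and neg: "\<And>z \<phi>. adm z \<phi> \<Longrightarrow> adm z (\<lambda>q. - \<phi> q)"
    and exist: "\<And>z. \<exists>\<phi>. \<forall>\<^sub>F w in nhds z. adm w \<phi>"
    and uniq: "\<And>z \<phi> \<psi>. adm z \<phi> \<Longrightarrow> adm z \<psi> \<Longrightarrow>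
      (\<forall>\<^sub>F w in nhds z. \<forall>q\<in>fibre w. \<phi> q = \<psi> q) \<or> (\<forall>\<^sub>F w in nhds z. \<forall>q\<in>fibre w. \<phi> q = - \<psi> q)"
    and nontriv: "\<And>z \<phi>. adm z \<phi> \<Longrightarrow> \<not> (\<forall>\<^sub>F w in nhds z. \<forall>q\<in>fibre w. \<phi> q = 0)"
begin

text \<open>The points at which the germs agree and those at which they are opposite form two open
  sets covering \<open>S\<close>. They are disjoint on \<open>S\<close> because a germ in both would
  vanish, so connectedness leaves only one of them.\<close>

lemma sign_constant:
  assumes "connected S" "\<And>z. z \<in> S \<Longrightarrow> adm z \<phi>" "\<And>z. z \<in> S \<Longrightarrow> adm z \<psi>"
  shows "(\<forall>z\<in>S. \<forall>q\<in>fibre z. \<phi> q = \<psi> q) \<or> (\<forall>z\<in>S. \<forall>q\<in>fibre z. \<phi> q = - \<psi> q)"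
proof -
  define P where "P = {z. \<forall>\<^sub>F w in nhds z. \<forall>q\<in>fibre w. \<phi> q = \<psi> q}"
  define N where "N = {z. \<forall>\<^sub>F w in nhds z. \<forall>q\<in>fibre w. \<phi> q = - \<psi> q}"
  have op: "open {z. \<forall>\<^sub>F w in nhds z. Q w}" for Q :: "complex \<Rightarrow> bool"
  proof (subst open_subopen, intro ballI)
    fix x assume "x \<in> {z. \<forall>\<^sub>F w in nhds z. Q w}"
    then obtain T where T: "open T" "x \<in> T" "\<forall>w\<in>T. Q w" unfolding eventually_nhds by blast
    hence "T \<subseteq> {z. \<forall>\<^sub>F w in nhds z. Q w}" unfolding eventually_nhds by blast
    thus "\<exists>T. open T \<and> x \<in> T \<and> T \<subseteq> {z. \<forall>\<^sub>F w in nhds z. Q w}" using T by blast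
  qed
  have "open P" "open N" unfolding P_def N_def by (rule op)+
  moreover have "S \<subseteq> P \<union> N" using uniq[OF assms(2,3)] by (auto simp: P_def N_def)
  moreover have "P \<inter> N \<inter> S = {}"
  proof (rule ccontr)
    assume "P \<inter> N \<inter> S \<noteq> {}"
    then obtain z where z: "z \<in> P" "z \<in> N" "z \<in> S" by blast
    have "\<forall>\<^sub>F w in nhds z. \<forall>q\<in>fibre w. \<phi> q = 0"
      using z(1)[unfolded P_def mem_Collect_eq] z(2)[unfolded N_def mem_Collect_eq]
    proof eventually_elim
      case (elim w)
      show ?case
      proof
        fix q assume "q \<in> fibre w"
        hence "\<psi> q = - \<psi> q" "\<phi> q = \<psi> q" using elim by auto
        thus "\<phi> q = 0" by simp
      qed
    qed
    with nontriv[OF assms(2)[OF z(3)]] show False by blast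
  qed
  ultimately have "P \<inter> S = {} \<or> N \<inter> S = {}" using connectedD[OF assms(1)] by blast
  hence "S \<subseteq> N \<or> S \<subseteq> P" using \<open>S \<subseteq> P \<union> N\<close> by blast
  thus ?thesis
  proof
    assume S: "S \<subseteq> N"
    have "\<forall>q\<in>fibre z. \<phi> q = - \<psi> q" if "z \<in> S" for z
    proof -
      have "\<forall>\<^sub>F w in nhds z. \<forall>q\<in>fibre w. \<phi> q = - \<psi> q" using S that by (auto simp: N_def)
      thus ?thesis by (rule eventually_nhds_x_imp_x)
    qed
    thus ?thesis by blast
  next
    assume S: "S \<subseteq> P"
    have "\<forall>q\<in>fibre z. \<phi> q = \<psi> q" if "z \<in> S" for z
    proof -
      have "\<forall>\<^sub>F w in nhds z. \<forall>q\<in>fibre w. \<phi> q = \<psi> q" using S that by (auto simp: P_def)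
      thus ?thesis by (rule eventually_nhds_x_imp_x)
    qed
    thus ?thesis by blast
  qed
qed

text \<open>On the connected overlap the two solutions agree up to a single sign; if it is -1,
  \<open>\<psi>\<close> is replaced by its negative. The result leaves \<open>\<phi>\<close>
  unchanged over \<open>S\<close>, which later lets solutions be extended step by step.\<close>

lemma glue:
  assumes "open S" "open T" "connected (S \<inter> T)" "\<forall>z\<in>S. adm z \<phi>" "\<forall>z\<in>T. adm z \<psi>"
  shows "\<exists>\<eta>. (\<forall>z\<in>S \<union> T. adm z \<eta>) \<and> (\<forall>z\<in>S. \<forall>q\<in>fibre z. \<eta> q = \<phi> q)"
proof -
  have "\<exists>\<psi>'. (\<forall>z\<in>T. adm z \<psi>') \<and> (\<forall>z\<in>S \<inter> T. \<forall>q\<in>fibre z. \<phi> q = \<psi>' q)"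
  proof -
    have "(\<forall>z\<in>S \<inter> T. \<forall>q\<in>fibre z. \<phi> q = \<psi> q) \<or> (\<forall>z\<in>S \<inter> T. \<forall>q\<in>fibre z. \<phi> q = - \<psi> q)"
      by (rule sign_constant[OF assms(3)]) (use assms(4,5) in auto)
    thus ?thesis
    proof
      assume "\<forall>z\<in>S \<inter> T. \<forall>q\<in>fibre z. \<phi> q = - \<psi> q"
      thus ?thesis using assms(5) neg by (intro exI[of _ "\<lambda>q. - \<psi> q"]) auto
    qed (use assms(5) in blast)
  qed
  then obtain \<psi>' where \<psi>': "\<forall>z\<in>T. adm z \<psi>'" "\<forall>z\<in>S \<inter> T. \<forall>q\<in>fibre z. \<phi> q = \<psi>' q" by blast
  define \<eta> where "\<eta> = (\<lambda>q. if \<exists>z\<in>S. q \<in> fibre z then \<phi> q else \<psi>' q)"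
  have onS: "\<eta> q = \<phi> q" if "z \<in> S" "q \<in> fibre z" for z q using that by (auto simp: \<eta>_def)
  have onT: "\<eta> q = \<psi>' q" if "z \<in> T" "q \<in> fibre z" for z q
  proof (cases "z \<in> S")
    case True
    thus ?thesis using onS[OF True that(2)] \<psi>'(2) that by auto
  next
    case False
    hence "\<not> (\<exists>z\<in>S. q \<in> fibre z)" using disj that(2) by blast
    thus ?thesis by (simp add: \<eta>_def)
  qed
  have "adm z \<eta>" if "z \<in> S" for z
  proof (rule cong)
    show "adm z \<phi>" using assms(4) that by blast
    show "\<forall>\<^sub>F w in nhds z. \<forall>q\<in>fibre w. \<eta> q = \<phi> q"
      using eventually_nhds_in_open[OF assms(1) that] by eventually_elim (use onS in blast)
  qed
  moreover have "adm z \<eta>" if "z \<in> T" for z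
  proof (rule cong)
    show "adm z \<psi>'" using \<psi>'(1) that by blast
    show "\<forall>\<^sub>F w in nhds z. \<forall>q\<in>fibre w. \<eta> q = \<psi>' q"
      using eventually_nhds_in_open[OF assms(2) that] by eventually_elim (use onT in blast)
  qed
  ultimately show ?thesis using onS by blast
qed

text \<open>Open rectangles are chosen because the intersection of two of them is convex, hence
  connected, as \<open>glue\<close> requires.\<close>

definition open_rect :: "real \<Rightarrow> real \<Rightarrow> real \<Rightarrow> real \<Rightarrow> complex set" where
  "open_rect s t u v = box (Complex s u) (Complex t v)"

lemma open_rect_mem: "z \<in> open_rect s t u v \<longleftrightarrow> s < Re z \<and> Re z < t \<and> u < Im z \<and> Im z < v"
  by (simp add: open_rect_def in_box_complex_iff)

lemma open_rect_open: "open (open_rect s t u v)" unfolding open_rect_def by (rule open_box)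

lemma open_rect_Int_connected: "connected (open_rect s t u v \<inter> open_rect s' t' u' v')"
  unfolding open_rect_def by (intro convex_connected convex_Int convex_box)

definition has_sec :: "complex set \<Rightarrow> bool" where "has_sec S \<longleftrightarrow> (\<exists>\<phi>. \<forall>z\<in>S. adm z \<phi>)"

lemma has_sec_mono: "has_sec S \<Longrightarrow> T \<subseteq> S \<Longrightarrow> has_sec T"
  unfolding has_sec_def by blast

lemma has_sec_open_rect_Un:
  assumes "has_sec (open_rect s t u v)" "has_sec (open_rect s' t' u' v')" "X \<subseteq> open_rect s t u v \<union> open_rect s' t' u' v'"
  shows "has_sec X"
proof -
  obtain \<phi> where \<phi>: "\<forall>z\<in>open_rect s t u v. adm z \<phi>" using assms(1) unfolding has_sec_def by blast
  obtain \<psi> where \<psi>: "\<forall>z\<in>open_rect s' t' u' v'. adm z \<psi>" using assms(2) unfolding has_sec_def by blast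
  from glue[OF open_rect_open open_rect_open open_rect_Int_connected \<phi> \<psi>] assms(3) show ?thesis unfolding has_sec_def by blast
qed

text \<open>Bisection along the real direction: neighbourhoods of adjacent segments are glued, and
  the smaller margin \<open>d\<close> is kept. Short segments lie in a disc on which a solution
  exists.\<close>

lemma strip: assumes "a \<le> b"
  shows "\<exists>d>0. has_sec (open_rect (a - d) (b + d) (y - d) (y + d))"
  using assms
proof (induct rule: Bolzano)
  case (trans a b c)
  obtain d1 where d1: "d1 > 0" "has_sec (open_rect (a - d1) (b + d1) (y - d1) (y + d1))" using trans(1) by blast
  obtain d2 where d2: "d2 > 0" "has_sec (open_rect (b - d2) (c + d2) (y - d2) (y + d2))" using trans(2) by blast
  have "has_sec (open_rect (a - min d1 d2) (c + min d1 d2) (y - min d1 d2) (y + min d1 d2))"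
    by (rule has_sec_open_rect_Un[OF d1(2) d2(2)]) (use d1(1) d2(1) in \<open>auto simp: open_rect_mem\<close>)
  thus ?case using d1(1) d2(1) by (intro exI[of _ "min d1 d2"]) auto
next
  case (local x)
  obtain \<phi> where "\<forall>\<^sub>F w in nhds (Complex x y). adm w \<phi>" using exist by blast
  then obtain r where r: "r > 0" "\<And>w. dist w (Complex x y) < r \<Longrightarrow> adm w \<phi>" unfolding eventually_nhds_metric by blast
  show ?case
  proof (rule exI[of _ "r/4"], rule conjI[rotated], intro allI impI)
    fix a b assume ab: "a \<le> x \<and> x \<le> b \<and> b - a < r/4"
    have "adm z \<phi>" if "z \<in> open_rect (a - r/4) (b + r/4) (y - r/4) (y + r/4)" for z
    proof (rule r(2))
      have "dist z (Complex x y) \<le> \<bar>Re (z - Complex x y)\<bar> + \<bar>Im (z - Complex x y)\<bar>"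
        unfolding dist_norm by (rule cmod_le)
      also have "\<dots> < r" using that ab by (auto simp: open_rect_mem)
      finally show "dist z (Complex x y) < r" .
    qed
    thus "\<exists>d>0. has_sec (open_rect (a - d) (b + d) (y - d) (y + d))" using r(1) unfolding has_sec_def by (intro exI[of _ "r/4"]) auto
  qed (use r(1) in simp)
qed

text \<open>The same bisection along the imaginary direction, with horizontal strips as the local
  pieces.\<close>

lemma rectangle: assumes "a \<le> b" "u \<le> v"
  shows "\<exists>d>0. has_sec (open_rect (a - d) (b + d) (u - d) (v + d))"
  using assms(2)
proof (induct rule: Bolzano)
  case (trans u v w)
  obtain d1 where d1: "d1 > 0" "has_sec (open_rect (a - d1) (b + d1) (u - d1) (v + d1))" using trans(1) by blast
  obtain d2 where d2: "d2 > 0" "has_sec (open_rect (a - d2) (b + d2) (v - d2) (w + d2))" using trans(2) by blast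
  have "has_sec (open_rect (a - min d1 d2) (b + min d1 d2) (u - min d1 d2) (w + min d1 d2))"
    by (rule has_sec_open_rect_Un[OF d1(2) d2(2)]) (use d1(1) d2(1) in \<open>auto simp: open_rect_mem\<close>)
  thus ?case using d1(1) d2(1) by (intro exI[of _ "min d1 d2"]) auto
next
  case (local y)
  obtain d where d: "d > 0" "has_sec (open_rect (a - d) (b + d) (y - d) (y + d))" using strip[OF assms(1)] by blast
  show ?case
  proof (rule exI[of _ "d/2"], rule conjI[rotated], intro allI impI)
    fix u v assume uv: "u \<le> y \<and> y \<le> v \<and> v - u < d/2"
    have "has_sec (open_rect (a - d/2) (b + d/2) (u - d/2) (v + d/2))"
      by (rule has_sec_mono[OF d(2)]) (use uv d(1) in \<open>auto simp: open_rect_mem\<close>)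
    thus "\<exists>d>0. has_sec (open_rect (a - d) (b + d) (u - d) (v + d))" using d(1) by (intro exI[of _ "d/2"]) auto
  qed (use d(1) in simp)
qed

text \<open>The plane is exhausted by squares. Solutions on different squares need not match in
  sign, so each is built by dependent choice as an extension of the preceding one.\<close>

lemma global_section: "\<exists>\<phi>. \<forall>z. adm z \<phi>"
proof -
  define B where "B = (\<lambda>n::nat. open_rect (- real n) (real n) (- real n) (real n))"
  have Bsub: "B n \<subseteq> B m" if "n \<le> m" for n m using that by (auto simp: B_def open_rect_mem)
  have sec: "has_sec (B n)" for n
  proof -
    obtain d where "d > 0" "has_sec (open_rect (- real n - d) (real n + d) (- real n - d) (real n + d))"
      using rectangle[of "- real n" "real n" "- real n" "real n"] by auto
    thus ?thesis by (elim has_sec_mono) (auto simp: B_def open_rect_mem)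
  qed
  have "\<exists>F. \<forall>n. (\<forall>z\<in>B n. adm z (F n)) \<and> (\<forall>z\<in>B n. \<forall>q\<in>fibre z. F (Suc n) q = F n q)"
  proof (rule dependent_nat_choice)
    show "\<exists>\<phi>. \<forall>z\<in>B 0. adm z \<phi>" using sec unfolding has_sec_def .
    fix \<phi> n assume \<phi>: "\<forall>z\<in>B n. adm z \<phi>"
    obtain \<psi> where \<psi>: "\<forall>z\<in>B (Suc n). adm z \<psi>" using sec unfolding has_sec_def by blast
    have "B n \<union> B (Suc n) = B (Suc n)" using Bsub[of n "Suc n"] by auto
    thus "\<exists>\<eta>. (\<forall>z\<in>B (Suc n). adm z \<eta>) \<and> (\<forall>z\<in>B n. \<forall>q\<in>fibre z. \<eta> q = \<phi> q)"
      using glue[OF open_rect_open open_rect_open open_rect_Int_connected \<phi>[unfolded B_def] \<psi>[unfolded B_def]] unfolding B_def by simp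
  qed
  then obtain F where F: "\<And>n z. z \<in> B n \<Longrightarrow> adm z (F n)" "\<And>n z q. z \<in> B n \<Longrightarrow> q \<in> fibre z \<Longrightarrow> F (Suc n) q = F n q"
    by blast
  have Fm: "F m q = F n q" if "n \<le> m" "z \<in> B n" "q \<in> fibre z" for m n z q
    using that(1)
  proof (induct m rule: dec_induct)
    case (step m)
    have "z \<in> B m" using Bsub[OF step(1)] that(2) by blast
    thus ?case using F(2)[OF _ that(3)] step(3) by simp
  qed simp
  \<comment> \<open>The first square over which \<open>q\<close> lies; from there on all
    \<open>F n\<close> have the same value at \<open>q\<close>.\<close>
  define k where "k = (\<lambda>q. LEAST n. \<exists>z\<in>B n. q \<in> fibre z)"
  define \<phi> where "\<phi> = (\<lambda>q. F (k q) q)"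
  have \<phi>: "\<phi> q = F n q" if "z \<in> B n" "q \<in> fibre z" for q n z
  proof -
    have ex: "\<exists>z\<in>B n. q \<in> fibre z" using that by blast
    hence "k q \<le> n" unfolding k_def by (rule Least_le)
    moreover have "\<exists>z\<in>B (k q). q \<in> fibre z" unfolding k_def using ex by (rule LeastI)
    ultimately show ?thesis using Fm unfolding \<phi>_def by metis
  qed
  have "adm z \<phi>" for z
  proof -
    define n where "n = nat \<lceil>norm z + 1\<rceil>"
    have "\<bar>Re z\<bar> < real n" "\<bar>Im z\<bar> < real n" unfolding n_def
      using abs_Re_le_cmod[of z] abs_Im_le_cmod[of z] by linarith+
    hence z: "z \<in> B n" by (auto simp: B_def open_rect_mem)
    show ?thesis
    proof (rule cong[OF F(1)[OF z]])
      have "\<forall>\<^sub>F w in nhds z. w \<in> B n" using z unfolding B_def by (intro eventually_nhds_in_open open_rect_open)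
      thus "\<forall>\<^sub>F w in nhds z. \<forall>q\<in>fibre w. \<phi> q = F n q" by eventually_elim (use \<phi> in blast)
    qed
  qed
  thus ?thesis by blast
qed

end

context surface
begin

text \<open>The product \<open>(a - b) * (a + b)\<close> vanishes near \<open>p\<close>, whereas a
  product of two germs that have orders has an order. So one factor vanishes identically.\<close>

lemma sign_local:
  assumes "hol_at A p a" "hol_at A p b" "\<forall>\<^sub>F q in nhds p. (a q)\<^sup>2 = (b q)\<^sup>2"
  shows "\<exists>\<sigma>\<in>{1,-1}. \<forall>\<^sub>F q in nhds p. a q = \<sigma> * b q"
proof -
  have z: "\<forall>\<^sub>F q in nhds p. (a q - b q) * (a q + b q) = 0"
    using assms(3) by eventually_elim (simp add: algebra_simps power2_eq_square)
  consider "\<forall>\<^sub>F q in nhds p. a q - b q = 0" | n where "has_order A p (\<lambda>q. a q - b q) n"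
    using hol_at_zero_or_has_order[OF hol_at_diff[OF assms(1,2)]] by blast
  thus ?thesis
  proof cases
    case 1
    have "\<forall>\<^sub>F q in nhds p. a q = 1 * b q" using 1 by eventually_elim simp
    thus ?thesis by blast
  next
    case n: 2
    consider "\<forall>\<^sub>F q in nhds p. a q + b q = 0" | m where "has_order A p (\<lambda>q. a q + b q) m"
      using hol_at_zero_or_has_order[OF hol_at_add[OF assms(1,2)]] by blast
    thus ?thesis
    proof cases
      case 1
      have "\<forall>\<^sub>F q in nhds p. a q = -1 * b q" using 1 by eventually_elim (simp add: add_eq_0_iff)
      thus ?thesis by blast
    next
      case 2
      have "\<forall>\<^sub>F q in at p. (a q - b q) * (a q + b q) \<noteq> 0" by (rule has_order_eventually(2)[OF has_order_mult[OF n 2]])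
      moreover have "\<forall>\<^sub>F q in at p. (a q - b q) * (a q + b q) = 0" using z by (simp only: eventually_nhds_conv_at)
      ultimately have "\<forall>\<^sub>F q in at p. False" by eventually_elim simp
      thus ?thesis using at_neq_bot_surface by simp
    qed
  qed
qed

lemma analytic_root: assumes "(a::complex) \<noteq> 0"
  obtains R where "R analytic_on {a}" "\<forall>\<^sub>F w in nhds a. (R w)\<^sup>2 = w"
proof
  define R where "R = (\<lambda>w. csqrt a * exp (Ln (w / a) / 2))"
  have L: "(\<lambda>w. Ln (w / a)) analytic_on {a}"
    by (rule analytic_on_ln) (use assms in \<open>auto intro!: analytic_on_divide\<close>)
  show "R analytic_on {a}" unfolding R_def by (intro analytic_intros L) auto
  have "\<forall>\<^sub>F w in nhds a. w \<in> - {0}" using assms by (intro eventually_nhds_in_open) auto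
  thus "\<forall>\<^sub>F w in nhds a. (R w)\<^sup>2 = w"
  proof eventually_elim
    case (elim w)
    have "(exp (Ln (w / a) / 2))\<^sup>2 = exp (Ln (w / a))" by (simp flip: exp_double)
    also have "\<dots> = w / a" using elim assms by simp
    finally show ?case using assms by (simp add: R_def power_mult_distrib)
  qed
qed

end

section \<open>Square roots of twisted functions\<close>

text \<open>A section of a line bundle is a function v on the surface, its value at q being taken in a trivialisation that is
chosen for each point q separately and without any continuity; \<open>twist p q\<close> is the transition from the trivialisation of q to that
of p, so that v is holomorphic at p when \<open>twist p q * v q\<close> is so in q. The function W is a section of the square of the bundle.\<close>

locale twisted = double_cover A f I m e i1 i2
  for A :: "('a::t2_space) chart set" and f I m e i1 i2 +
  fixes twist :: "'a \<Rightarrow> 'a \<Rightarrow> complex" and W :: "'a \<Rightarrow> complex"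
  assumes twist_nz: "\<And>p. \<forall>\<^sub>F q in nhds p. twist p q \<noteq> 0"
    and twist_hol_at: "\<And>p. \<forall>\<^sub>F p' in nhds p. hol_at A p' (\<lambda>q. twist p q / twist p' q)"
    and W_hol_at: "\<And>p. p \<notin> I \<Longrightarrow> hol_at A p (\<lambda>q. (twist p q)\<^sup>2 * W q)"
    and W_nz: "\<And>p. p \<notin> I \<Longrightarrow> W p \<noteq> 0"
begin

definition hol_section :: "'a \<Rightarrow> ('a \<Rightarrow> complex) \<Rightarrow> bool" where "hol_section p v \<longleftrightarrow> hol_at A p (\<lambda>q. twist p q * v q)"

lemma twist_pp: "twist p p \<noteq> 0" using eventually_nhds_x_imp_x[OF twist_nz] .

text \<open>Changing from the trivialisation of \<open>p\<close> to that of a nearby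
  \<open>p'\<close> multiplies by a nonvanishing holomorphic function.\<close>

lemma hol_section_eventually: assumes "hol_section p v" shows "\<forall>\<^sub>F q in nhds p. hol_section q v"
proof -
  have "\<forall>\<^sub>F q in nhds p. \<forall>\<^sub>F x in nhds q. twist p x \<noteq> 0"
    unfolding eventually_eventually by (rule twist_nz)
  thus ?thesis using twist_hol_at[of p] hol_at_eventually[OF assms[unfolded hol_section_def]]
  proof eventually_elim
  case (elim p')
  have "twist p p' / twist p' p' \<noteq> 0" using eventually_nhds_x_imp_x[OF elim(1)] twist_pp by simp
  from hol_at_divide[OF elim(3) elim(2) this] have h: "hol_at A p' (\<lambda>q. twist p q * v q / (twist p q / twist p' q))" .
  have "\<forall>\<^sub>F q in nhds p'. twist p q * v q / (twist p q / twist p' q) = twist p' q * v q" using elim(1)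
    by eventually_elim simp
  from hol_at_cong[OF this] h show ?case by (simp add: hol_section_def)
  qed
qed

lemma hol_section_cong: assumes "\<forall>\<^sub>F q in nhds p. v q = w q" shows "hol_section p v \<longleftrightarrow> hol_section p w"
  unfolding hol_section_def by (rule hol_at_cong) (use assms in \<open>auto elim: eventually_mono\<close>)

lemma hol_section_mult: "hol_section p v \<Longrightarrow> hol_at A p g \<Longrightarrow> hol_section p (\<lambda>q. v q * g q)"
  unfolding hol_section_def using hol_at_mult[of p "\<lambda>q. twist p q * v q" g] by (simp add: mult.assoc)

lemma hol_section_sign:
  assumes "hol_section p v" "hol_section p w" "\<forall>\<^sub>F q in nhds p. (v q)\<^sup>2 = (w q)\<^sup>2"
  shows "\<exists>\<sigma>\<in>{1,-1}. \<forall>\<^sub>F q in nhds p. v q = \<sigma> * w q"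
proof -
  have "\<forall>\<^sub>F q in nhds p. (twist p q * v q)\<^sup>2 = (twist p q * w q)\<^sup>2"
    using assms(3) by eventually_elim (simp add: power_mult_distrib)
  from sign_local[OF assms(1,2)[unfolded hol_section_def] this] obtain \<sigma> where \<sigma>: "\<sigma> \<in> {1,-1}"
    "\<forall>\<^sub>F q in nhds p. twist p q * v q = \<sigma> * (twist p q * w q)" by blast
  have "\<forall>\<^sub>F q in nhds p. v q = \<sigma> * w q" using \<sigma>(2) twist_nz[of p] by eventually_elim (simp add: mult.left_commute)
  with \<sigma>(1) show ?thesis by blast
qed

text \<open>In the trivialisation at \<open>p\<close> the function \<open>W\<close> becomes
  holomorphic and nonzero, so it has an analytic root; division by \<open>twist p q\<close> carries
  this back to the trivialisation of each \<open>q\<close>.\<close>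

lemma local_root: assumes "p \<notin> I"
  shows "\<exists>v. hol_section p v \<and> (\<forall>\<^sub>F q in nhds p. (v q)\<^sup>2 = W q)"
proof -
  define G where "G = (\<lambda>q. (twist p q)\<^sup>2 * W q)"
  have G: "hol_at A p G" "G p \<noteq> 0" using W_hol_at W_nz twist_pp assms by (auto simp: G_def)
  obtain R where R: "R analytic_on {G p}" "\<forall>\<^sub>F w in nhds (G p). (R w)\<^sup>2 = w" using analytic_root[OF G(2)] .
  define v where "v = (\<lambda>q. R (G q) / twist p q)"
  have "\<forall>\<^sub>F q in nhds p. R (G q) = twist p q * v q" using twist_nz[of p] by eventually_elim (simp add: v_def)
  from hol_at_cong[OF this] hol_at_compose[OF G(1) R(1)] have "hol_section p v" by (simp add: hol_section_def)
  moreover have "\<forall>\<^sub>F q in nhds p. (R (G q))\<^sup>2 = G q" using R(2) hol_at_tendsto[OF G(1)] by (rule eventually_compose_filterlim)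
  hence "\<forall>\<^sub>F q in nhds p. (v q)\<^sup>2 = W q" using twist_nz[of p]
    by eventually_elim (simp add: v_def power_divide G_def)
  ultimately show ?thesis by blast
qed

text \<open>A fibre is finite, so germs chosen at its points live on disjoint neighbourhoods and
  combine into one function. The second premise says that \<open>Q\<close> depends only on
  germs.\<close>

lemma fibre_choice:
  assumes "\<And>p. p \<in> fibre z \<Longrightarrow> \<exists>v. Q p v" "\<And>p v w. Q p v \<Longrightarrow> \<forall>\<^sub>F q in nhds p. w q = (v q :: complex) \<Longrightarrow> Q p w"
  shows "\<exists>v. \<forall>p\<in>fibre z. Q p v"
proof -
  obtain V where V: "\<And>p. p \<in> fibre z \<Longrightarrow> Q p (V p)" using assms(1) by metis
  obtain N where N: "\<forall>x\<in>fibre z. open (N x) \<and> x \<in> N x" "\<forall>x\<in>fibre z. \<forall>y\<in>fibre z. x \<noteq> y \<longrightarrow> N x \<inter> N y = {}"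
    using finite_t2_separation[OF finite_fibre[of z]] by (elim exE conjE)
  define v where "v = (\<lambda>q. V (SOME x. x \<in> fibre z \<and> q \<in> N x) q)"
  have "Q p v" if p: "p \<in> fibre z" for p
  proof (rule assms(2)[OF V[OF p]])
    have "\<forall>\<^sub>F q in nhds p. q \<in> N p" using N(1) p by (intro eventually_nhds_in_open) auto
    thus "\<forall>\<^sub>F q in nhds p. v q = V p q"
    proof eventually_elim
      case (elim q)
      have "(SOME x. x \<in> fibre z \<and> q \<in> N x) = p" by (rule some_equality) (use N(2) p elim in auto)
      thus ?case by (simp add: v_def)
    qed
  qed
  thus ?thesis by blast
qed

lemma proper_fibre:
  assumes "\<And>p. p \<in> fibre z \<Longrightarrow> \<forall>\<^sub>F q in nhds p. P q"
  shows "\<forall>\<^sub>F w in nhds z. \<forall>q\<in>fibre w. P q"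
  using proper[of z P] assms by (auto simp: fibre_def)

lemma fibre_J: "p \<in> fibre z \<Longrightarrow> J p \<in> fibre z" using J_props(1,2)[of p] by (auto simp: fibre_def)

definition root_at :: "'a \<Rightarrow> ('a \<Rightarrow> complex) \<Rightarrow> bool" where
  "root_at p v \<longleftrightarrow> hol_section p v \<and> (\<forall>\<^sub>F q in nhds p. (v q)\<^sup>2 = W q)"

lemma root_at_eventually: "root_at p v \<Longrightarrow> \<forall>\<^sub>F q in nhds p. root_at q v"
proof -
  assume r: "root_at p v"
  have "\<forall>\<^sub>F q in nhds p. hol_section q v" using r hol_section_eventually by (simp add: root_at_def)
  moreover have "\<forall>\<^sub>F q in nhds p. \<forall>\<^sub>F x in nhds q. (v x)\<^sup>2 = W x" using r by (simp add: root_at_def eventually_eventually)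
  ultimately show ?thesis unfolding root_at_def by eventually_elim simp
qed

text \<open>Over an unbranched point the roots on the two sheets are chosen independently, so norms are unique up to sign
only; the factor \<open>\<delta>\<close> admits both signs over a branch point as well.\<close>

definition is_norm :: "complex \<Rightarrow> ('a \<Rightarrow> complex) \<Rightarrow> bool" where
  "is_norm z n \<longleftrightarrow> (\<exists>\<delta>\<in>{1,-1}. \<exists>v. (\<forall>p\<in>fibre z. root_at p v) \<and> (\<forall>\<^sub>F w in nhds z. \<forall>q\<in>fibre w. n q = \<delta> * (v q * v (J q))))"

lemma fibre_roots: "\<exists>v. \<forall>p\<in>fibre z. root_at p v"
proof (rule fibre_choice)
  fix p assume "p \<in> fibre z"
  thus "\<exists>v. root_at p v" using local_root[of p] by (simp add: fibre_def root_at_def)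
next
  fix p v w assume r: "root_at p v" and e: "\<forall>\<^sub>F q in nhds p. w q = v q"
  have "hol_section p w" using r hol_section_cong[OF e] by (simp add: root_at_def)
  moreover have "\<forall>\<^sub>F q in nhds p. (v q)\<^sup>2 = W q" using r by (simp add: root_at_def)
  with e have "\<forall>\<^sub>F q in nhds p. (w q)\<^sup>2 = W q" by eventually_elim simp
  ultimately show "root_at p w" by (simp add: root_at_def)
qed

lemma is_norm_exist: "\<exists>n. \<forall>\<^sub>F w in nhds z. is_norm w n"
proof -
  obtain v where v: "\<forall>p\<in>fibre z. root_at p v" using fibre_roots by blast
  have "\<forall>\<^sub>F w in nhds z. \<forall>q\<in>fibre w. root_at q v"
    by (rule proper_fibre) (use v root_at_eventually in blast)
  hence "\<forall>\<^sub>F w in nhds z. is_norm w (\<lambda>q. 1 * (v q * v (J q)))"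
  proof eventually_elim
    case (elim w)
    show ?case unfolding is_norm_def
      by (rule bexI[of _ 1], rule exI[of _ v]) (use elim in auto)
  qed
  thus ?thesis by blast
qed

text \<open>If the roots differ by the signs \<open>s\<close> at \<open>p\<close> and
  \<open>t\<close> at \<open>J p\<close>, the products \<open>v q * v (J q)\<close> differ by
  \<open>s * t\<close> on both sheets, because \<open>J\<close> merely swaps the two
  factors.\<close>

lemma is_norm_uniq: assumes "is_norm z n" "is_norm z n'"
  shows "(\<forall>\<^sub>F w in nhds z. \<forall>q\<in>fibre w. n q = n' q) \<or> (\<forall>\<^sub>F w in nhds z. \<forall>q\<in>fibre w. n q = - n' q)"
proof -
  obtain \<delta> v where v: "\<delta> \<in> {1,-1}" "\<forall>p\<in>fibre z. root_at p v" "\<forall>\<^sub>F w in nhds z. \<forall>q\<in>fibre w. n q = \<delta> * (v q * v (J q))"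
    using assms(1) unfolding is_norm_def by blast
  obtain \<delta>' v' where v': "\<delta>' \<in> {1,-1}" "\<forall>p\<in>fibre z. root_at p v'" "\<forall>\<^sub>F w in nhds z. \<forall>q\<in>fibre w. n' q = \<delta>' * (v' q * v' (J q))"
    using assms(2) unfolding is_norm_def by blast
  have sg: "\<exists>\<sigma>\<in>{1,-1}. \<forall>\<^sub>F q in nhds p. v q = \<sigma> * v' q" if p: "p \<in> fibre z" for p
  proof (rule hol_section_sign)
    have r: "root_at p v" "root_at p v'" using v(2) v'(2) p by auto
    thus "hol_section p v" "hol_section p v'" by (auto simp: root_at_def)
    have "\<forall>\<^sub>F q in nhds p. (v q)\<^sup>2 = W q" "\<forall>\<^sub>F q in nhds p. (v' q)\<^sup>2 = W q" using r by (auto simp: root_at_def)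
    thus "\<forall>\<^sub>F q in nhds p. (v q)\<^sup>2 = (v' q)\<^sup>2" by eventually_elim simp
  qed
  obtain p where p: "p \<in> fibre z" by (rule fibre_cases[of z]) auto
  hence pI: "p \<notin> I" "f p = z" by (auto simp: fibre_def)
  obtain s where s: "s \<in> {1,-1}" "\<forall>\<^sub>F q in nhds p. v q = s * v' q" using sg[OF p] by blast
  obtain t where t: "t \<in> {1,-1}" "\<forall>\<^sub>F q in nhds (J p). v q = t * v' q" using sg[OF fibre_J[OF p]] by blast
  have "\<forall>\<^sub>F q in nhds p. v (J q) = t * v' (J q)" using J_eventually[OF pI(1) t(2)] .
  with s(2) have a: "\<forall>\<^sub>F q in nhds p. v q * v (J q) = s * t * (v' q * v' (J q))" by eventually_elim simp
  have "\<forall>\<^sub>F q in nhds (J p). v (J q) = s * v' (J q)"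
    using J_eventually[OF J_props(1)[OF pI(1)], of "\<lambda>q. v q = s * v' q"] s(2) J_J[OF pI(1)] by simp
  with t(2) have b: "\<forall>\<^sub>F q in nhds (J p). v q * v (J q) = s * t * (v' q * v' (J q))" by eventually_elim simp
  have "\<forall>\<^sub>F w in nhds z. \<forall>q\<in>fibre w. v q * v (J q) = s * t * (v' q * v' (J q))"
  proof (rule proper_fibre)
    fix x assume "x \<in> fibre z"
    hence "x = p \<or> x = J p" using J_props(3)[OF pI(1)] pI(2) by auto
    thus "\<forall>\<^sub>F q in nhds x. v q * v (J q) = s * t * (v' q * v' (J q))" using a b by auto
  qed
  with v(3) v'(3) have ev: "\<forall>\<^sub>F w in nhds z. \<forall>q\<in>fibre w. n q = (\<delta> * \<delta>' * s * t) * n' q"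
  proof eventually_elim
    case (elim w)
    show ?case
    proof
      fix q assume q: "q \<in> fibre w"
      have "n q = \<delta> * (s * t * (v' q * v' (J q)))" using elim(1,3) q by simp
      also have "\<dots> = (\<delta> * \<delta>' * s * t) * (\<delta>' * (v' q * v' (J q)))" using v'(1) by auto
      also have "\<dots> = (\<delta> * \<delta>' * s * t) * n' q" using elim(2) q by simp
      finally show "n q = (\<delta> * \<delta>' * s * t) * n' q" .
    qed
  qed
  have "\<delta> * \<delta>' * s * t = 1 \<or> \<delta> * \<delta>' * s * t = -1" using v(1) v'(1) s(1) t(1) by auto
  thus ?thesis
  proof
    assume "\<delta> * \<delta>' * s * t = 1"
    thus ?thesis using ev by simp
  next
    assume "\<delta> * \<delta>' * s * t = -1"
    thus ?thesis using ev by simp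
  qed
qed

text \<open>At a fixed point of \<open>J\<close> the two factors coincide and their product is
  \<open>W p\<close>, so only the sign \<open>\<delta>\<close> is left.\<close>

lemma is_norm_at: assumes "is_norm z n" "p \<in> fibre z"
  shows "n p \<noteq> 0" "J p = p \<Longrightarrow> n p = W p \<or> n p = - W p"
proof -
  obtain \<delta> v where v: "\<delta> \<in> {1,-1}" "\<forall>p\<in>fibre z. root_at p v" "\<forall>\<^sub>F w in nhds z. \<forall>q\<in>fibre w. n q = \<delta> * (v q * v (J q))"
    using assms(1) unfolding is_norm_def by blast
  have n: "n p = \<delta> * (v p * v (J p))" using eventually_nhds_x_imp_x[OF v(3)] assms(2) by blast
  have sq: "(v q)\<^sup>2 = W q" if "q \<in> fibre z" for q
  proof -
    have "\<forall>\<^sub>F x in nhds q. (v x)\<^sup>2 = W x" using v(2) that by (simp add: root_at_def)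
    thus ?thesis by (rule eventually_nhds_x_imp_x)
  qed
  have nz: "v q \<noteq> 0" if "q \<in> fibre z" for q
    using sq[OF that] W_nz[of q] that by (auto simp: fibre_def)
  show "n p \<noteq> 0" using n v(1) nz[OF assms(2)] nz[OF fibre_J[OF assms(2)]] by auto
  show "n p = W p \<or> n p = - W p" if "J p = p"
    using n v(1) sq[OF assms(2)] that by (auto simp: power2_eq_square)
qed

lemma norm_exists: "\<exists>n. \<forall>z. is_norm z n"
proof -
  interpret sign_torsor fibre is_norm
  proof
    fix z w q assume "q \<in> fibre z" "q \<in> fibre w" thus "z = w" by (auto simp: fibre_def)
  next
    fix z \<phi> \<psi> assume a: "is_norm z \<phi>" and e: "\<forall>\<^sub>F w in nhds z. \<forall>q\<in>fibre w. \<psi> q = \<phi> q"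
    obtain \<delta> v where v: "\<delta> \<in> {1,-1}" "\<forall>p\<in>fibre z. root_at p v" "\<forall>\<^sub>F w in nhds z. \<forall>q\<in>fibre w. \<phi> q = \<delta> * (v q * v (J q))"
      using a unfolding is_norm_def by blast
    have "\<forall>\<^sub>F w in nhds z. \<forall>q\<in>fibre w. \<psi> q = \<delta> * (v q * v (J q))" using e v(3) by eventually_elim simp
    with v(1,2) show "is_norm z \<psi>" unfolding is_norm_def by blast
  next
    fix z \<phi> assume a: "is_norm z \<phi>"
    obtain \<delta> v where v: "\<delta> \<in> {1,-1}" "\<forall>p\<in>fibre z. root_at p v" "\<forall>\<^sub>F w in nhds z. \<forall>q\<in>fibre w. \<phi> q = \<delta> * (v q * v (J q))"
      using a unfolding is_norm_def by blast
    have "\<forall>\<^sub>F w in nhds z. \<forall>q\<in>fibre w. - \<phi> q = (- \<delta>) * (v q * v (J q))" using v(3) by eventually_elim simp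
    moreover have "- \<delta> \<in> {1,-1}" using v(1) by auto
    ultimately show "is_norm z (\<lambda>q. - \<phi> q)" using v(2) unfolding is_norm_def by blast
  next
    fix z \<phi> assume a: "is_norm z \<phi>"
    obtain p where p: "p \<in> fibre z" by (rule fibre_cases[of z]) auto
    show "\<not> (\<forall>\<^sub>F w in nhds z. \<forall>q\<in>fibre w. \<phi> q = 0)"
    proof
      assume "\<forall>\<^sub>F w in nhds z. \<forall>q\<in>fibre w. \<phi> q = 0"
      from eventually_nhds_x_imp_x[OF this] show False using is_norm_at(1)[OF a p] p by blast
    qed
  qed (fact is_norm_exist is_norm_uniq)+
  show ?thesis by (rule global_section)
qed

end

section \<open>Products over branch points and their local roots\<close>

context double_cover
begin

definition branch_poly :: "'a set \<Rightarrow> complex \<Rightarrow> complex" where "branch_poly T w = (\<Prod>p\<in>T. w - f p)"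

lemma branch_poly_analytic: "branch_poly T analytic_on {z}"
  unfolding branch_poly_def by (intro analytic_on_prod analytic_on_diff analytic_on_ident analytic_on_const)

lemma fibre_eventually:
  assumes "\<forall>\<^sub>F w in nhds z. \<forall>q\<in>fibre w. P q" "p \<in> fibre z"
  shows "\<forall>\<^sub>F q in nhds p. P q"
proof -
  have p: "p \<notin> I" "f p = z" using assms(2) by (auto simp: fibre_def)
  have "filterlim f (nhds z) (nhds p)" using hol_at_tendsto[OF holf[OF p(1)]] p(2) by simp
  from eventually_compose_filterlim[OF assms(1) this] eventually_notI[OF p(1)]
  show ?thesis by eventually_elim (use fibre_f in blast)
qed

lemma branch_fibre: "p \<in> branch \<Longrightarrow> fibre (f p) = {p}" using J_fibre[of p] by (auto simp: branch_def)

lemma branch_poly_nz: assumes "T \<subseteq> branch" "\<And>p. p \<in> T \<Longrightarrow> f p \<noteq> z" shows "branch_poly T z \<noteq> 0"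
proof -
  have "finite T" using assms(1) finite_branch finite_subset by blast
  thus ?thesis using assms(2) by (auto simp: branch_poly_def)
qed

text \<open>The local correction that turns a root of \<open>W\<close> with norm
  \<open>\<delta> * n\<close> into one with norm \<open>n\<close>, at the cost of the product over
  \<open>T\<close>. Up to a factor \<open>r1\<close> without zero at \<open>z\<close>, whose root is
  taken later, \<open>\<kappa>\<close> is constant 1 at a branch point outside \<open>T\<close>, an
  odd coordinate at a branch point in \<open>T\<close>, and a sign on one sheet over an unramified
  value.\<close>

lemma square_root_multiplier:
  assumes T: "T \<subseteq> branch" and \<delta>: "\<delta> \<in> {1, -1 :: complex}" and br: "\<And>p. p \<in> branch \<Longrightarrow> f p = z \<Longrightarrow> p \<in> T \<longleftrightarrow> \<delta> = -1"
  shows "\<exists>\<kappa> r1. r1 analytic_on {z} \<and> r1 z \<noteq> 0 \<and> (\<forall>p\<in>fibre z. hol_at A p \<kappa> \<and>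
    (\<forall>\<^sub>F q in nhds p. (\<kappa> q)\<^sup>2 * r1 (f q) = branch_poly T (f q) \<and> \<kappa> q * \<kappa> (J q) * r1 (f q) = \<delta> * branch_poly T (f q)))"
proof (rule fibre_cases[of z])
  fix p assume p: "fibre z = {p}" "e p = 2"
  have pI: "p \<notin> I" "f p = z" using p(1) by (auto simp: fibre_def)
  have pB: "p \<in> branch" using pI p by (simp add: branch_def)
  show ?thesis
  proof (cases "\<delta> = -1")
    case False
    hence d1: "\<delta> = 1" using \<delta> by auto
    have "branch_poly T z \<noteq> 0"
    proof (rule branch_poly_nz[OF T])
      fix x assume x: "x \<in> T"
      show "f x \<noteq> z"
      proof
        assume "f x = z"
        hence "x = p" using branch_fibre[of x] x T p(1) by auto
        thus False using br[OF pB pI(2)] x False by simp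
      qed
    qed
    thus ?thesis using branch_poly_analytic d1 by (intro exI[of _ "\<lambda>_. 1"] exI[of _ "branch_poly T"]) (simp add: hol_at_const)
  next
    case True
    have pT: "p \<in> T" using br[OF pB pI(2)] True by simp
    have finT: "finite T" using T finite_branch finite_subset by blast
    have split: "branch_poly T w = (w - z) * branch_poly (T - {p}) w" for w
      unfolding branch_poly_def using prod.remove[OF finT pT, of "\<lambda>x. w - f x"] pI(2) by simp
    have nz: "branch_poly (T - {p}) z \<noteq> 0"
    proof (rule branch_poly_nz)
      fix x assume x: "x \<in> T - {p}"
      thus "f x \<noteq> z" using branch_fibre[of x] T p(1) by auto
    qed (use T in blast)
    obtain \<rho> where \<rho>: "adapted_param p \<rho>" using adapted_param_exists[OF pI(1)] .
    have l: "local_param A p \<rho>" and ev: "\<forall>\<^sub>F t in nhds 0. \<rho> t \<notin> I \<and> f (\<rho> t) = f p + t ^ e p" using \<rho> by (auto simp: adapted_param_def)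
    \<comment> \<open>The inverse of the adapted parameter is a coordinate with square
      \<open>f - z\<close> that changes sign under \<open>J\<close>.\<close>
    obtain \<sigma> where \<sigma>: "\<forall>\<^sub>F t in nhds 0. \<sigma> (\<rho> t) = t" using local_param_inj[OF l] by blast
    have "(\<lambda>t. \<sigma> (\<rho> t)) analytic_on {0} \<longleftrightarrow> (\<lambda>t. t) analytic_on {0}" by (rule analytic_at_cong[OF \<sigma>]) simp
    hence h: "hol_at A p \<sigma>" using local_param_hol_at[OF l] by simp
    have um: "filterlim uminus (nhds (0::complex)) (nhds 0)"
      using tendsto_minus[OF filterlim_ident, of "0::complex"] by simp
    have "\<forall>\<^sub>F t in nhds 0. (\<sigma> (\<rho> t))\<^sup>2 = f (\<rho> t) - z \<and> \<sigma> (J (\<rho> t)) = - \<sigma> (\<rho> t)"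
      using ev \<sigma> eventually_compose_filterlim[OF \<sigma> um] adapted_param_J(2)[OF pI(1) \<rho> p(2)]
      by eventually_elim (simp add: p(2) pI(2))
    hence "\<forall>\<^sub>F q in nhds p. (\<sigma> q)\<^sup>2 = f q - z \<and> \<sigma> (J q) = - \<sigma> q" by (simp only: local_param_eventually[OF l])
    hence "\<forall>\<^sub>F q in nhds p. (\<sigma> q)\<^sup>2 * branch_poly (T - {p}) (f q) = branch_poly T (f q) \<and>
        \<sigma> q * \<sigma> (J q) * branch_poly (T - {p}) (f q) = \<delta> * branch_poly T (f q)"
    proof eventually_elim
      case (elim q)
      have "\<sigma> q * \<sigma> (J q) = -1 * (\<sigma> q)\<^sup>2" using elim by (simp add: power2_eq_square)
      hence "\<sigma> q * \<sigma> (J q) = \<delta> * (f q - z)" using elim True by simp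
      thus ?case using elim by (simp add: split)
    qed
    thus ?thesis using h p(1) nz branch_poly_analytic by (intro exI[of _ \<sigma>] exI[of _ "branch_poly (T - {p})"]) simp
  qed
next
  fix p q assume pq: "p \<noteq> q" "fibre z = {p, q}" "e p = 1" "e q = 1"
  have I: "p \<notin> I" "f p = z" "q \<notin> I" "f q = z" using pq(2) by (auto simp: fibre_def)
  have nz: "branch_poly T z \<noteq> 0"
  proof (rule branch_poly_nz[OF T])
    fix x assume x: "x \<in> T"
    thus "f x \<noteq> z" using branch_fibre[of x] T pq(1,2) by (metis insert_iff singletonD subsetD)
  qed
  have Jpq: "J p = q" "J q = p" using J_unique[of p q] J_unique[of q p] I pq(1) by auto
  obtain U V where UV: "open U" "open V" "p \<in> U" "q \<in> V" "U \<inter> V = {}" using hausdorff[OF pq(1)] by blast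
  \<comment> \<open>Over an unramified value the sign \<open>\<delta>\<close> is placed on one sheet
    alone: squares do not notice it, while the norm picks it up once.\<close>
  define \<kappa> where "\<kappa> = (\<lambda>x. if x \<in> U then 1 else \<delta>)"
  have eU: "\<forall>\<^sub>F x in nhds p. x \<in> U" and eV: "\<forall>\<^sub>F x in nhds q. x \<in> V"
    using eventually_nhds_in_open UV by auto
  have kU: "\<forall>\<^sub>F x in nhds p. \<kappa> x = 1" using eU by eventually_elim (simp add: \<kappa>_def)
  have kV: "\<forall>\<^sub>F x in nhds q. \<kappa> x = \<delta>" using eV by eventually_elim (use UV(5) in \<open>auto simp: \<kappa>_def\<close>)
  have d2: "\<delta>\<^sup>2 = 1" using \<delta> by auto
  have hp: "hol_at A p \<kappa>" "hol_at A q \<kappa>" using hol_at_cong[OF kU] hol_at_cong[OF kV] hol_at_const by auto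
  have "\<forall>\<^sub>F x in nhds p. \<kappa> (J x) = \<delta>" using J_eventually[OF I(1)] kV Jpq by simp
  with kU have a: "\<forall>\<^sub>F x in nhds p. (\<kappa> x)\<^sup>2 * branch_poly T (f x) = branch_poly T (f x) \<and> \<kappa> x * \<kappa> (J x) * branch_poly T (f x) = \<delta> * branch_poly T (f x)"
    by eventually_elim simp
  have "\<forall>\<^sub>F x in nhds q. \<kappa> (J x) = 1" using J_eventually[OF I(3)] kU Jpq by simp
  with kV have b: "\<forall>\<^sub>F x in nhds q. (\<kappa> x)\<^sup>2 * branch_poly T (f x) = branch_poly T (f x) \<and> \<kappa> x * \<kappa> (J x) * branch_poly T (f x) = \<delta> * branch_poly T (f x)"
    by eventually_elim (simp add: d2)
  show ?thesis using a b hp pq(2) nz branch_poly_analytic by (intro exI[of _ \<kappa>] exI[of _ "branch_poly T"]) simp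
qed

lemma branch_poly_f_nz: assumes "T \<subseteq> branch" "p \<notin> I" shows "\<forall>\<^sub>F q in at p. branch_poly T (f q) \<noteq> 0"
  using eventually_not_branch[of p] eventually_at_notI[of p]
proof eventually_elim
  case (elim q)
  show ?case
  proof (rule branch_poly_nz[OF assms(1)])
    fix x assume x: "x \<in> T"
    show "f x \<noteq> f q"
    proof
      assume "f x = f q"
      hence "q = x" using branch_fibre[of x] x assms(1) fibre_f[OF elim(2)] by auto
      thus False using x assms(1) elim(1) by blast
    qed
  qed
qed

end

context twisted
begin

text \<open>At a branch point p we have \<open>J p = p\<close>, so n is the norm of a root of W there iff \<open>n p = W p\<close>. If \<open>n p = - W p\<close>, the additional
factor \<open>f - f p\<close> is the square of an anti-invariant function and corrects the sign.\<close>

lemma square_root_section: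
  assumes n: "\<And>z. is_norm z n" and T: "T = {p \<in> branch. n p = - W p}"
  shows "\<exists>s. \<forall>p. p \<notin> I \<longrightarrow> hol_section p s \<and>
    (\<forall>\<^sub>F q in nhds p. (s q)\<^sup>2 = W q * branch_poly T (f q) \<and> s q * s (J q) = n q * branch_poly T (f q))"
proof -
  define E where "E = (\<lambda>s q. (s q)\<^sup>2 = W q * branch_poly T (f q) \<and> s q * s (J q) = n q * branch_poly T (f q))"
  define sec where "sec = (\<lambda>p s. hol_section p s \<and> (\<forall>\<^sub>F q in nhds p. E s q))"
  have TB: "T \<subseteq> branch" using T by blast
  have nnz: "n q \<noteq> 0" if "q \<notin> I" for q using is_norm_at(1)[OF n fibre_f[OF that]] .
  have eventually_nz: "\<forall>\<^sub>F q in at p. n q * branch_poly T (f q) \<noteq> 0" if "p \<notin> I" for p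
    using branch_poly_f_nz[OF TB that] eventually_at_notI[of p] by eventually_elim (use nnz in auto)
  have sec_eventually: "\<forall>\<^sub>F q in nhds p. sec q s" if "sec p s" for p s
  proof -
    have "\<forall>\<^sub>F q in nhds p. hol_section q s" using that hol_section_eventually by (simp add: sec_def)
    moreover have "\<forall>\<^sub>F q in nhds p. \<forall>\<^sub>F x in nhds q. E s x" using that by (simp add: sec_def eventually_eventually)
    ultimately show ?thesis unfolding sec_def by eventually_elim simp
  qed
  have ne_at: "\<not> (\<forall>\<^sub>F q in at p. s q * s (J q) = 0)" if "p \<notin> I" "sec p s" for p s
  proof
    assume "\<forall>\<^sub>F q in at p. s q * s (J q) = 0"
    moreover have "\<forall>\<^sub>F q in nhds p. E s q" using that(2) by (simp add: sec_def)
    hence "\<forall>\<^sub>F q in at p. E s q" by (simp only: eventually_nhds_conv_at)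
    ultimately have "\<forall>\<^sub>F q in at p. False" using eventually_nz[OF that(1)]
    proof eventually_elim
      case (elim q)
      have "s q * s (J q) = n q * branch_poly T (f q)" using elim(2) by (simp only: E_def)
      thus ?case using elim(1,3) by metis
    qed
    thus False using at_neq_bot_surface by simp
  qed
  interpret tor: sign_torsor fibre "\<lambda>z s. \<forall>p\<in>fibre z. sec p s"
  proof
    fix z w q assume "q \<in> fibre z" "q \<in> fibre w" thus "z = w" by (auto simp: fibre_def)
  next
    fix z \<phi> \<psi> assume a: "\<forall>p\<in>fibre z. sec p \<phi>" and e: "\<forall>\<^sub>F w in nhds z. \<forall>q\<in>fibre w. \<psi> q = \<phi> q"
    show "\<forall>p\<in>fibre z. sec p \<psi>"
    proof
      fix p assume p: "p \<in> fibre z"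
      hence pI: "p \<notin> I" by (simp add: fibre_def)
      have s: "sec p \<phi>" using a p by blast
      have e1: "\<forall>\<^sub>F q in nhds p. \<psi> q = \<phi> q" using fibre_eventually[OF e p] .
      have e2: "\<forall>\<^sub>F q in nhds p. \<psi> (J q) = \<phi> (J q)" using J_eventually[OF pI fibre_eventually[OF e fibre_J[OF p]]] .
      have "hol_section p \<psi>" using s hol_section_cong[OF e1] by (simp add: sec_def)
      moreover have "\<forall>\<^sub>F q in nhds p. E \<phi> q" using s by (simp add: sec_def)
      with e1 e2 have "\<forall>\<^sub>F q in nhds p. E \<psi> q" by eventually_elim (simp add: E_def)
      ultimately show "sec p \<psi>" by (simp add: sec_def)
    qed
  next
    fix z \<phi> assume a: "\<forall>p\<in>fibre z. sec p \<phi>"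
    show "\<forall>p\<in>fibre z. sec p (\<lambda>q. - \<phi> q)"
    proof
      fix p assume "p \<in> fibre z"
      hence s: "hol_section p \<phi>" "\<forall>\<^sub>F q in nhds p. E \<phi> q" using a by (auto simp: sec_def)
      have "hol_section p (\<lambda>q. \<phi> q * (-1))" by (rule hol_section_mult[OF s(1) hol_at_const])
      moreover have "\<forall>\<^sub>F q in nhds p. E (\<lambda>q. - \<phi> q) q" using s(2) by eventually_elim (simp add: E_def)
      ultimately show "sec p (\<lambda>q. - \<phi> q)" by (simp add: sec_def)
    qed
  next
    fix z
    obtain \<delta> v where v: "\<delta> \<in> {1,-1}" "\<forall>p\<in>fibre z. root_at p v" "\<forall>\<^sub>F w in nhds z. \<forall>q\<in>fibre w. n q = \<delta> * (v q * v (J q))"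
      using n[of z] unfolding is_norm_def by blast
    \<comment> \<open>At a branch point \<open>n p = \<delta> * W p\<close>, so the sign of the
      local presentation of \<open>n\<close> decides membership in \<open>T\<close>.\<close>
    have br: "p \<in> T \<longleftrightarrow> \<delta> = -1" if p: "p \<in> branch" "f p = z" for p
    proof -
      have pf: "p \<in> fibre z" "p \<notin> I" "J p = p" using p J_props(5)[of p] by (auto simp: branch_def fibre_def)
      have "n p = \<delta> * (v p * v (J p))" using eventually_nhds_x_imp_x[OF v(3)] pf(1) by blast
      moreover have "\<forall>\<^sub>F x in nhds p. (v x)\<^sup>2 = W x" using v(2) pf(1) by (simp add: root_at_def)
      from eventually_nhds_x_imp_x[OF this] have "v p * v p = W p" by (simp add: power2_eq_square)
      ultimately have "n p = \<delta> * W p" using pf(3) by simp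
      thus ?thesis using T p(1) W_nz[OF pf(2)] v(1) by auto
    qed
    obtain \<kappa> r1 where \<kappa>: "r1 analytic_on {z}" "r1 z \<noteq> 0" "\<forall>p\<in>fibre z. hol_at A p \<kappa> \<and>
      (\<forall>\<^sub>F q in nhds p. (\<kappa> q)\<^sup>2 * r1 (f q) = branch_poly T (f q) \<and> \<kappa> q * \<kappa> (J q) * r1 (f q) = \<delta> * branch_poly T (f q))"
      using square_root_multiplier[OF TB v(1) br] by blast
    obtain R where R: "R analytic_on {r1 z}" "\<forall>\<^sub>F w in nhds (r1 z). (R w)\<^sup>2 = w" using analytic_root[OF \<kappa>(2)] .
    \<comment> \<open>\<open>v\<close> contributes \<open>W\<close>, and the bracket contributes the
      product over \<open>T\<close>, with \<open>R\<close> supplying the root of the nonvanishing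
      factor \<open>r1\<close>.\<close>
    define s where "s = (\<lambda>q. v q * (\<kappa> q * R (r1 (f q))))"
    have "sec p s" if p: "p \<in> fibre z" for p
    proof -
      have pI: "p \<notin> I" "f p = z" using p by (auto simp: fibre_def)
      have h1: "hol_at A p (\<lambda>q. r1 (f q))" using hol_at_compose[OF holf[OF pI(1)]] \<kappa>(1) pI(2) by simp
      have h2: "hol_at A p (\<lambda>q. R (r1 (f q)))" using hol_at_compose[OF h1] R(1) pI(2) by simp
      have "hol_section p v" using v(2) p by (simp add: root_at_def)
      hence 1: "hol_section p s" unfolding s_def using h2 \<kappa>(3) p by (intro hol_section_mult hol_at_mult) auto
      have a1: "\<forall>\<^sub>F q in nhds p. n q = \<delta> * (v q * v (J q))" using fibre_eventually[OF v(3) p] .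
      have a2: "\<forall>\<^sub>F q in nhds p. (\<kappa> q)\<^sup>2 * r1 (f q) = branch_poly T (f q) \<and> \<kappa> q * \<kappa> (J q) * r1 (f q) = \<delta> * branch_poly T (f q)"
        using \<kappa>(3) p by blast
      have "filterlim (\<lambda>q. r1 (f q)) (nhds (r1 z)) (nhds p)" using hol_at_tendsto[OF h1] pI(2) by simp
      from eventually_compose_filterlim[OF R(2) this] have a3: "\<forall>\<^sub>F q in nhds p. (R (r1 (f q)))\<^sup>2 = r1 (f q)" .
      have a4: "\<forall>\<^sub>F q in nhds p. (v q)\<^sup>2 = W q" using v(2) p by (simp add: root_at_def)
      have "\<forall>\<^sub>F q in nhds p. E s q" using a1 a2 a3 a4 eventually_notI[OF pI(1)]
      proof eventually_elim
        case (elim q)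
        have "(s q)\<^sup>2 = (v q)\<^sup>2 * ((\<kappa> q)\<^sup>2 * (R (r1 (f q)))\<^sup>2)" by (simp add: s_def power_mult_distrib)
        also have "\<dots> = W q * branch_poly T (f q)" using elim(2,3,4) by simp
        finally have e1: "(s q)\<^sup>2 = W q * branch_poly T (f q)" .
        have "s q * s (J q) = (v q * v (J q)) * (\<kappa> q * \<kappa> (J q) * (R (r1 (f q)))\<^sup>2)"
          using J_props(2)[OF elim(5)] by (simp add: s_def power2_eq_square)
        also have "\<dots> = (v q * v (J q)) * (\<delta> * branch_poly T (f q))" using elim(2,3) by simp
        also have "\<dots> = n q * branch_poly T (f q)" using elim(1) by simp
        finally show ?case using e1 by (simp add: E_def)
      qed
      with 1 show ?thesis by (simp add: sec_def)
    qed
    hence "\<forall>\<^sub>F w in nhds z. \<forall>q\<in>fibre w. sec q s" using proper_fibre[of z "\<lambda>q. sec q s"] sec_eventually by blast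
    thus "\<exists>s. \<forall>\<^sub>F w in nhds z. \<forall>p\<in>fibre w. sec p s" by blast
  next
    fix z s s' assume s: "\<forall>p\<in>fibre z. sec p s" "\<forall>p\<in>fibre z. sec p s'"
    have sg: "\<exists>\<sigma>\<in>{1,-1}. \<forall>\<^sub>F q in nhds p. s q = \<sigma> * s' q" if p: "p \<in> fibre z" for p
    proof (rule hol_section_sign)
      have r: "sec p s" "sec p s'" using s p by auto
      thus "hol_section p s" "hol_section p s'" by (auto simp: sec_def)
      have "\<forall>\<^sub>F q in nhds p. E s q" "\<forall>\<^sub>F q in nhds p. E s' q" using r by (auto simp: sec_def)
      thus "\<forall>\<^sub>F q in nhds p. (s q)\<^sup>2 = (s' q)\<^sup>2" by eventually_elim (simp add: E_def)
    qed
    obtain p where p: "p \<in> fibre z" by (rule fibre_cases[of z]) auto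
    hence pI: "p \<notin> I" "f p = z" by (auto simp: fibre_def)
    obtain \<sigma> where \<sigma>: "\<sigma> \<in> {1,-1}" "\<forall>\<^sub>F q in nhds p. s q = \<sigma> * s' q" using sg[OF p] by blast
    obtain \<tau> where \<tau>: "\<tau> \<in> {1,-1}" "\<forall>\<^sub>F q in nhds (J p). s q = \<tau> * s' q" using sg[OF fibre_J[OF p]] by blast
    have j: "\<forall>\<^sub>F q in nhds p. s (J q) = \<tau> * s' (J q)" using J_eventually[OF pI(1) \<tau>(2)] .
    \<comment> \<open>Opposite signs on the two sheets would reverse the norm; but the norm is
      prescribed and does not vanish near \<open>p\<close> away from \<open>p\<close>.\<close>
    have "\<sigma> = \<tau>"
    proof (rule ccontr)
      assume "\<sigma> \<noteq> \<tau>"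
      hence st: "\<sigma> * \<tau> = -1" using \<sigma>(1) \<tau>(1) by auto
      have es: "\<forall>\<^sub>F q in nhds p. E s q" "\<forall>\<^sub>F q in nhds p. E s' q" using s p by (auto simp: sec_def)
      have "\<forall>\<^sub>F q in nhds p. s q * s (J q) = 0" using es \<sigma>(2) j
      proof eventually_elim
        case (elim q)
        have "s q * s (J q) = (\<sigma> * \<tau>) * (s' q * s' (J q))" using elim(3,4) by simp
        also have "\<dots> = - (s q * s (J q))" using elim(1,2) st by (simp add: E_def)
        finally show ?case by simp
      qed
      hence "\<forall>\<^sub>F q in at p. s q * s (J q) = 0" by (simp only: eventually_nhds_conv_at)
      thus False using ne_at[OF pI(1)] s(1) p by blast
    qed
    have "\<forall>\<^sub>F w in nhds z. \<forall>q\<in>fibre w. s q = \<sigma> * s' q"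
    proof (rule proper_fibre)
      fix x assume "x \<in> fibre z"
      hence "x = p \<or> x = J p" using J_props(3)[OF pI(1)] pI(2) by auto
      thus "\<forall>\<^sub>F q in nhds x. s q = \<sigma> * s' q" using \<sigma>(2) \<tau>(2) \<open>\<sigma> = \<tau>\<close> by auto
    qed
    thus "(\<forall>\<^sub>F w in nhds z. \<forall>q\<in>fibre w. s q = s' q) \<or> (\<forall>\<^sub>F w in nhds z. \<forall>q\<in>fibre w. s q = - s' q)"
      using \<sigma>(1) by auto
  next
    fix z s assume s: "\<forall>p\<in>fibre z. sec p s"
    obtain p where p: "p \<in> fibre z" by (rule fibre_cases[of z]) auto
    hence pI: "p \<notin> I" by (auto simp: fibre_def)
    show "\<not> (\<forall>\<^sub>F w in nhds z. \<forall>q\<in>fibre w. s q = 0)"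
    proof
      assume "\<forall>\<^sub>F w in nhds z. \<forall>q\<in>fibre w. s q = 0"
      from fibre_eventually[OF this p] have "\<forall>\<^sub>F q in nhds p. s q * s (J q) = 0" by eventually_elim simp
      hence "\<forall>\<^sub>F q in at p. s q * s (J q) = 0" by (simp only: eventually_nhds_conv_at)
      thus False using ne_at[OF pI] s p by blast
    qed
  qed
  obtain s where s: "\<And>z p. p \<in> fibre z \<Longrightarrow> sec p s" using tor.global_section by blast
  show ?thesis
  proof (intro exI[of _ s] allI impI)
    fix p assume "p \<notin> I"
    hence "sec p s" using s fibre_f by blast
    thus "hol_section p s \<and> (\<forall>\<^sub>F q in nhds p. (s q)\<^sup>2 = W q * branch_poly T (f q) \<and> s q * s (J q) = n q * branch_poly T (f q))"
      by (simp add: sec_def E_def)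
  qed
qed

end

section \<open>The equation of the curve\<close>

context double_cover
begin

text \<open>For the trivial bundle and \<open>W = 1\<close> the constant -1 is a norm: take the
  roots \<open>v = 1\<close> with sign -1. It differs from \<open>W\<close> at every branch point,
  so \<open>T\<close> consists of all of them, and norm -1 is what makes the root odd under
  \<open>J\<close>.\<close>

lemma y_exists: "\<exists>y. \<forall>p. p \<notin> I \<longrightarrow> hol_at A p y \<and> (y p)\<^sup>2 = branch_poly branch (f p) \<and> y (J p) = - y p"
proof -
  interpret triv: twisted A f I m e i1 i2 "\<lambda>_ _. 1" "\<lambda>_. 1"
    by unfold_locales (auto simp: hol_at_const)
  have adm: "triv.is_norm z (\<lambda>_. -1)" for z
    unfolding triv.is_norm_def
    by (rule bexI[of _ "-1"], rule exI[of _ "\<lambda>_. 1"]) (auto simp: triv.root_at_def triv.hol_section_def hol_at_const)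
  have branch: "branch = {p \<in> branch. (-1::complex) = - 1}" by simp
  obtain s where s: "\<And>p. p \<notin> I \<Longrightarrow> triv.hol_section p s \<and>
      (\<forall>\<^sub>F q in nhds p. (s q)\<^sup>2 = 1 * branch_poly branch (f q) \<and> s q * s (J q) = -1 * branch_poly branch (f q))"
    using triv.square_root_section[OF adm branch] by blast
  show ?thesis
  proof (intro exI[of _ s] allI impI)
    fix p assume p: "p \<notin> I"
    have "\<forall>\<^sub>F q in nhds p. (s q)\<^sup>2 = 1 * branch_poly branch (f q) \<and> s q * s (J q) = -1 * branch_poly branch (f q)" using s[OF p] by blast
    from eventually_nhds_x_imp_x[OF this] have 1: "(s p)\<^sup>2 = branch_poly branch (f p)" "s p * s (J p) = - branch_poly branch (f p)" by auto
    have "\<forall>\<^sub>F q in nhds (J p). (s q)\<^sup>2 = 1 * branch_poly branch (f q) \<and> s q * s (J q) = -1 * branch_poly branch (f q)"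
      using s[OF J_props(1)[OF p]] by blast
    from eventually_nhds_x_imp_x[OF this] have 2: "(s (J p))\<^sup>2 = branch_poly branch (f p)" using J_props(2)[OF p] by auto
    \<comment> \<open>Both squares equal the product over \<open>branch\<close>, and the mixed term
      is minus twice that product.\<close>
    have "(s (J p) + s p)\<^sup>2 = (s (J p))\<^sup>2 + (s p)\<^sup>2 + 2 * (s p * s (J p))" by (simp add: power2_sum)
    also have "\<dots> = 0" unfolding 1 2 by simp
    finally have "(s (J p) + s p)\<^sup>2 = 0" .
    hence "s (J p) = - s p" by (simp add: eq_neg_iff_add_eq_0)
    thus "hol_at A p s \<and> (s p)\<^sup>2 = branch_poly branch (f p) \<and> s (J p) = - s p" using 1(1) s[OF p] by (simp add: triv.hol_section_def)
  qed
qed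

end

text \<open>Differentiating \<open>t powi n * H\<close> gives \<open>t powi (n - 1)\<close> times
  \<open>n * H + t * deriv H\<close>, whose value at 0 is nonzero exactly because \<open>n\<close>
  is.\<close>

lemma germ_order_deriv:
  assumes "germ_order (\<lambda>t. F t - a) n" "n \<noteq> 0" shows "germ_order (deriv F) (n - 1)"
proof -
  obtain H where H: "H analytic_on {0}" "H 0 \<noteq> 0" "\<forall>\<^sub>F t in at 0. F t - a = t powi n * H t"
    using assms unfolding germ_order_def by blast
  obtain S where S: "open S" "0 \<in> S" "\<And>t. t \<in> S \<Longrightarrow> t \<noteq> 0 \<Longrightarrow> F t - a = t powi n * H t"
    using H(3) unfolding eventually_at_topological by blast
  have "\<forall>\<^sub>F t in nhds 0. H analytic_on {t}" using H(1) by (rule analytic_at_eventually)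
  hence 1: "\<forall>\<^sub>F t in at 0. H analytic_on {t}" by (simp only: eventually_nhds_conv_at)
  have 2: "\<forall>\<^sub>F t in at 0. t \<in> S - {0}" using S by (intro eventually_at_in_open) auto
  have "\<forall>\<^sub>F t in at 0. deriv F t = t powi (n - 1) * (of_int n * H t + t * deriv H t)"
    using 1 2
  proof eventually_elim
    case (elim t)
    have ev: "\<forall>\<^sub>F u in nhds t. F u = a + u powi n * H u"
      using eventually_nhds_in_open[OF open_delete[OF S(1)] elim(2)]
    proof eventually_elim
      case (elim u)
      thus ?case using S(3)[of u] by (simp add: algebra_simps)
    qed
    have "((\<lambda>u. a + u powi n * H u) has_field_derivative
        (0 + (of_int n * t powi (n - 1) * H t + deriv H t * t powi n))) (at t)"
      using elim by (intro DERIV_add DERIV_const DERIV_mult DERIV_power_int[OF DERIV_ident, simplified] analytic_derivI) auto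
    hence "deriv (\<lambda>u. a + u powi n * H u) t = of_int n * t powi (n - 1) * H t + deriv H t * t powi n"
      by (simp add: DERIV_imp_deriv)
    hence "deriv F t = of_int n * t powi (n - 1) * H t + deriv H t * t powi n"
      using deriv_cong_ev[OF ev refl] by simp
    moreover have "t powi n = t powi (n - 1) * t" using elim(2) power_int_add_1[of t "n - 1"] by simp
    ultimately show ?case by (simp add: algebra_simps)
  qed
  moreover have "(\<lambda>t. of_int n * H t + t * deriv H t) analytic_on {0}"
    by (intro analytic_on_add analytic_on_mult analytic_on_const analytic_on_ident H(1) analytic_deriv)
  ultimately show ?thesis using H(2) assms(2) by (intro germ_orderI) auto
qed

lemma sum_fun2: "(\<Sum>k\<in>K. (F k :: 'b \<Rightarrow> 'c \<Rightarrow> complex)) i p = (\<Sum>k\<in>K. F k i p)"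
  by (induction K rule: infinite_finite_induct) auto

lemma poly_as_sum:
  assumes "R = 0 \<or> degree R < n" shows "poly R (z::complex) = (\<Sum>k<n. coeff R k * z ^ k)"
proof (cases "R = 0")
  case False
  hence "degree R < n" using assms by simp
  hence "(\<Sum>k<n. coeff R k * z ^ k) = (\<Sum>k\<le>degree R. coeff R k * z ^ k)"
    by (intro sum.mono_neutral_right) (auto simp: coeff_eq_0)
  thus ?thesis by (simp add: poly_altdef)
qed simp

text \<open>Dimension from a family with coefficients indexed by numbers, the form in which
  polynomials supply it; the library speaks of sets of vectors, so the family must also be shown to
  be injective.\<close>

lemma sections_dim_eq:
  assumes V: "V = range (\<lambda>a. \<Sum>k<n. (\<lambda>i p. a k * b k i p :: complex))"
    and ind: "\<And>a k. (\<Sum>k<n. (\<lambda>i p. a k * b k i p)) = 0 \<Longrightarrow> k < n \<Longrightarrow> a k = (0::complex)"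
  shows "sections.dim V = n"
proof -
  have inj: "inj_on b {..<n}"
  proof (rule inj_onI)
    fix k l assume kl: "k \<in> {..<n}" "l \<in> {..<n}" "b k = b l"
    show "k = l"
    proof (rule ccontr)
      assume ne: "k \<noteq> l"
      \<comment> \<open>Two equal members with different indices would give the nontrivial relation
        with coefficients 1 and -1.\<close>
      define a where "a = (\<lambda>j. if j = k then 1 else if j = l then -1 else (0::complex))"
      have "(\<Sum>j<n. a j * b j i p) = 0" for i p
      proof -
        have "(\<Sum>j<n. a j * b j i p) = (\<Sum>j\<in>{k,l}. a j * b j i p)"
          by (rule sum.mono_neutral_right) (use kl in \<open>auto simp: a_def\<close>)
        thus ?thesis using ne kl(3) by (simp add: a_def)
      qed
      hence "(\<Sum>j<n. (\<lambda>i p. a j * b j i p)) = 0" by (intro ext) (simp add: sum_fun2)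
      from ind[OF this, of k] kl(1) show False by (simp add: a_def)
    qed
  qed
  have re: "(\<Sum>v\<in>b ` {..<n}. (\<lambda>i p. u v * v i p)) = (\<Sum>k<n. (\<lambda>i p. u (b k) * b k i p))" for u :: "_ \<Rightarrow> complex"
    using sum.reindex[OF inj, of "\<lambda>v. (\<lambda>i p. u v * v i p)"] by (simp add: o_def)
  have sp: "sections.span (b ` {..<n}) = V"
  proof -
    have "sections.span (b ` {..<n}) = range (\<lambda>u. \<Sum>v\<in>b ` {..<n}. (\<lambda>i p. u v * v i p))"
      by (rule sections.span_finite) simp
    also have "\<dots> = V"
    proof (intro equalityI subsetI)
      fix x assume "x \<in> range (\<lambda>u. \<Sum>v\<in>b ` {..<n}. (\<lambda>i p. u v * v i p))"
      then obtain u where "x = (\<Sum>v\<in>b ` {..<n}. (\<lambda>i p. u v * v i p))" by blast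
      thus "x \<in> V" unfolding V using re[of u] by (intro range_eqI[of _ _ "\<lambda>k. u (b k)"]) simp
    next
      fix x assume "x \<in> V"
      then obtain a where a: "x = (\<Sum>k<n. (\<lambda>i p. a k * b k i p))" unfolding V by blast
      define u where "u = (\<lambda>v. a (inv_into {..<n} b v))"
      have "u (b k) = a k" if "k < n" for k using inj that by (simp add: u_def inv_into_f_f)
      hence "x = (\<Sum>k<n. (\<lambda>i p. u (b k) * b k i p))" unfolding a by (intro sum.cong) auto
      thus "x \<in> range (\<lambda>u. \<Sum>v\<in>b ` {..<n}. (\<lambda>i p. u v * v i p))" using re[of u] by (intro range_eqI[of _ _ u]) simp
    qed
    finally show ?thesis .
  qed
  have indep: "sections.independent (b ` {..<n})"
  proof (rule sections.independent_if_scalars_zero)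
    fix u v assume z: "(\<Sum>x\<in>b ` {..<n}. (\<lambda>i p. u x * x i p)) = 0" and v: "v \<in> b ` {..<n}"
    obtain k where k: "k < n" "v = b k" using v by auto
    have "(\<Sum>k<n. (\<lambda>i p. u (b k) * b k i p)) = 0" using z re[of u] by simp
    from ind[OF this k(1)] show "u v = 0" using k(2) by simp
  qed simp
  show ?thesis
  proof (rule sections.dim_unique[OF _ _ indep])
    show "b ` {..<n} \<subseteq> V" using sections.span_superset[of "b ` {..<n}"] sp by simp
    show "V \<subseteq> sections.span (b ` {..<n})" using sp by simp
    show "card (b ` {..<n}) = n" using inj by (simp add: card_image)
  qed
qed

context surface
begin

lemma has_order_sqrt:
  assumes "\<forall>\<^sub>F q in at p. hol_at A q v" "has_order A p (\<lambda>q. (v q)\<^sup>2) n"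
  shows "\<exists>k. n = 2 * k \<and> has_order A p v k"
proof -
  have "\<forall>\<^sub>F t in at 0. hol_at A (param A p t) v" using assms(1) by (simp add: local_param_eventually_at[OF local_param_param, of _ p])
  moreover have "\<forall>\<^sub>F t in at 0. local_param A (param A p t) (\<lambda>s. param A p (t + s))"
    using local_param_shift[OF local_param_param[of p]] by (simp only: eventually_nhds_conv_at)
  ultimately have "\<forall>\<^sub>F t in at 0. (\<lambda>t. v (param A p t)) analytic_on {t}"
  proof eventually_elim
    case (elim t)
    have "(\<lambda>s. v (param A p (t + s))) analytic_on {0}" using local_param_hol_at[OF elim(2)] elim(1) by simp
    thus ?case using analytic_at_shift_iff[of "\<lambda>t. v (param A p t)" t] by (simp add: add.commute)
  qed
  from germ_order_sqrt[OF this] assms(2) show ?thesis by (simp add: has_order_def)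
qed

section \<open>Holomorphic differentials\<close>

text \<open>The coefficient of the differential of \<open>f\<close> with respect to the coordinate
  differential of the chart \<open>c\<close>.\<close>

definition chart_deriv :: "'a chart \<Rightarrow> ('a \<Rightarrow> complex) \<Rightarrow> 'a \<Rightarrow> complex" where
  "chart_deriv c f q = deriv (coord_expr c f) (snd c q)"

lemma chart_deriv_chart_param: assumes "c \<in> A" "p \<in> fst c" shows "\<forall>\<^sub>F t in nhds 0. chart_deriv c F (chart_param c p t) = deriv (\<lambda>t. F (chart_param c p t)) t"
  using eventually_in_chart[OF assms]
proof eventually_elim
  case (elim t)
  have "deriv (\<lambda>t. F (chart_param c p t)) t = deriv (\<lambda>t. coord_expr c F (t + snd c p)) t" by (simp only: coord_expr_chart_param)
  also have "\<dots> = deriv (coord_expr c F) (t + snd c p)"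
    by (simp add: deriv_def DERIV_shift)
  finally show ?case by (simp add: chart_deriv_def snd_chart_param[OF assms(1) elim])
qed

lemma chart_deriv_has_order: assumes "c \<in> A" "p \<in> fst c" "has_order A p (\<lambda>q. F q - a) n" "n \<noteq> 0"
  shows "has_order A p (chart_deriv c F) (n - 1)"
proof -
  have "germ_order (\<lambda>t. F (chart_param c p t) - a) n" using local_param_has_order[OF lparI[OF assms(1,2)], of "\<lambda>q. F q - a"] assms(3) by simp
  hence g: "germ_order (deriv (\<lambda>t. F (chart_param c p t))) (n - 1)" using assms(4) by (rule germ_order_deriv)
  have "\<forall>\<^sub>F t in at 0. chart_deriv c F (chart_param c p t) = deriv (\<lambda>t. F (chart_param c p t)) t"
    using chart_deriv_chart_param[OF assms(1,2)] by (simp only: eventually_nhds_conv_at)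
  from germ_order_cong_iff[OF this] g have "germ_order (\<lambda>t. chart_deriv c F (chart_param c p t)) (n - 1)" by simp
  thus ?thesis using local_param_has_order[OF lparI[OF assms(1,2)]] by blast
qed

abbreviation kt :: "'a chart \<Rightarrow> 'a chart \<Rightarrow> 'a \<Rightarrow> complex" where "kt c d \<equiv> chart_deriv c (snd d)"

lemma kt_hol_at: assumes "c \<in> A" "d \<in> A" "p \<in> fst c" "p \<in> fst d"
  shows "hol_at A p (kt c d)" "kt c d p \<noteq> 0"
proof -
  have l: "local_biholo (\<lambda>t. snd d (chart_param c p t) - snd d p)" using transition_local_biholo(1)[OF assms] .
  have an: "(\<lambda>t. snd d (chart_param c p t)) analytic_on {0}"
  proof -
    have "(\<lambda>t. (snd d (chart_param c p t) - snd d p) + snd d p) analytic_on {0}"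
      using l by (intro analytic_on_add analytic_on_const) (simp add: local_biholo_def)
    thus ?thesis by simp
  qed
  have "(\<lambda>t. kt c d (chart_param c p t)) analytic_on {0} \<longleftrightarrow> deriv (\<lambda>t. snd d (chart_param c p t)) analytic_on {0}"
    by (rule analytic_at_cong[OF chart_deriv_chart_param[OF assms(1,3)]]) simp
  thus "hol_at A p (kt c d)" using local_param_hol_at[OF lparI[OF assms(1,3)]] analytic_deriv[OF an] by simp
  have "((\<lambda>t. snd d (chart_param c p t) - snd d p) has_field_derivative deriv (\<lambda>t. snd d (chart_param c p t)) 0 - 0) (at 0)"
    by (intro DERIV_diff DERIV_const analytic_derivI[OF an])
  hence "deriv (\<lambda>t. snd d (chart_param c p t) - snd d p) 0 = deriv (\<lambda>t. snd d (chart_param c p t)) 0"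
    by (simp add: DERIV_imp_deriv)
  hence "deriv (\<lambda>t. snd d (chart_param c p t)) 0 \<noteq> 0" using l by (simp add: local_biholo_def)
  thus "kt c d p \<noteq> 0" using eventually_nhds_x_imp_x[OF chart_deriv_chart_param[OF assms(1,3)], of "snd d"] chart_param_0[OF assms(1,3)] by simp
qed

text \<open>The chain rule; it makes these coefficients transform like a section of the canonical
  bundle.\<close>

lemma chart_deriv_cocycle: assumes "c \<in> A" "d \<in> A" "p \<in> fst c" "p \<in> fst d" "hol_at A p F"
  shows "chart_deriv c F p = kt c d p * chart_deriv d F p"
proof -
  let ?\<theta> = "\<lambda>t. snd d (chart_param c p t) - snd d p"
  have l: "local_biholo ?\<theta>" using transition_local_biholo(1)[OF assms(1-4)] .
  have an: "(\<lambda>t. F (chart_param d p t)) analytic_on {0}" using local_param_hol_at[OF lparI[OF assms(2,4)]] assms(5) by simp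
  have *: "\<forall>\<^sub>F t in nhds 0. F (chart_param c p t) = ((\<lambda>t. F (chart_param d p t)) \<circ> ?\<theta>) t"
    using transition_local_biholo(2)[OF assms(1-4)] by eventually_elim simp
  have "deriv (\<lambda>t. F (chart_param c p t)) 0 = deriv ((\<lambda>t. F (chart_param d p t)) \<circ> ?\<theta>) 0" by (rule deriv_cong_ev[OF * refl])
  also have "\<dots> = deriv (\<lambda>t. F (chart_param d p t)) (?\<theta> 0) * deriv ?\<theta> 0"
    using l an by (intro deriv_chain) (auto simp: local_biholo_def intro: analytic_on_imp_differentiable_at)
  also have "deriv ?\<theta> 0 = deriv (\<lambda>t. snd d (chart_param c p t)) 0"
  proof -
    have an: "(\<lambda>t. snd d (chart_param c p t)) analytic_on {0}"
    proof -
      have "(\<lambda>t. ?\<theta> t + snd d p) analytic_on {0}"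
        using l by (intro analytic_on_add analytic_on_const) (simp add: local_biholo_def)
      thus ?thesis by simp
    qed
    have "(?\<theta> has_field_derivative deriv (\<lambda>t. snd d (chart_param c p t)) 0 - 0) (at 0)"
      by (intro DERIV_diff DERIV_const analytic_derivI[OF an])
    thus ?thesis by (simp add: DERIV_imp_deriv)
  qed
  finally show ?thesis
    using eventually_nhds_x_imp_x[OF chart_deriv_chart_param[OF assms(1,3)], of F] eventually_nhds_x_imp_x[OF chart_deriv_chart_param[OF assms(1,3)], of "snd d"]
      eventually_nhds_x_imp_x[OF chart_deriv_chart_param[OF assms(2,4)], of F] chart_param_0[OF assms(1,3)] chart_param_0[OF assms(2,4)] by simp
qed

end

lemma (in surface) eventually_fst: assumes "c \<in> A" "p \<in> fst c" shows "\<forall>\<^sub>F q in at p. q \<in> fst c"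
  using eventually_nhds_in_open[OF chart_props(1)[OF assms(1)] assms(2)] by (simp only: eventually_nhds_conv_at)

text \<open>The pair \<open>f\<close>, \<open>y\<close> satisfies the affine equation of the curve,
  and \<open>J\<close> acts as the sign change of \<open>y\<close>.\<close>

locale hyperelliptic_curve = double_cover A f I m e i1 i2
  for A :: "('a::t2_space) chart set" and f I m e i1 i2 +
  fixes y :: "'a \<Rightarrow> complex"
  assumes y_hol_at: "\<And>p. p \<notin> I \<Longrightarrow> hol_at A p y"
    and y_sq: "\<And>p. p \<notin> I \<Longrightarrow> (y p)\<^sup>2 = branch_poly branch (f p)"
    and y_J: "\<And>p. p \<notin> I \<Longrightarrow> y (J p) = - y p"
begin

text \<open>The factor \<open>f - f x\<close> for a branch point \<open>x\<close> vanishes only at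
  \<open>x\<close>, and doubly there.\<close>

lemma branch_poly_has_order: assumes "T \<subseteq> branch" "p \<notin> I" shows "has_order A p (\<lambda>q. branch_poly T (f q)) (if p \<in> T then 2 else 0)"
proof -
  have fin: "finite T" using assms(1) finite_branch finite_subset by blast
  have "has_order A p (\<lambda>q. \<Prod>x\<in>T. f q - f x) (\<Sum>x\<in>T. if x = p then 2 else 0)"
  proof (rule has_order_prod[OF fin])
    fix x assume x: "x \<in> T"
    have "f p = f x \<longleftrightarrow> x = p"
      using branch_fibre[of x] fibre_f[OF assms(2)] x assms(1) by auto
    moreover have "e p = 2" if "x = p" using that x assms(1) by (auto simp: branch_def)
    ultimately show "has_order A p (\<lambda>q. f q - f x) (if x = p then 2 else 0)"
      using has_order_f_minus[OF assms(2), of "f x"] by (auto split: if_splits)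
  qed
  thus ?thesis using fin by (simp add: branch_poly_def)
qed

lemma branch_poly_has_order_I: assumes "T \<subseteq> branch" "p \<in> I" shows "has_order A p (\<lambda>q. branch_poly T (f q)) (- int (card T))"
proof -
  have fin: "finite T" using assms(1) finite_branch finite_subset by blast
  have "has_order A p (\<lambda>q. \<Prod>x\<in>T. f q - f x) (\<Sum>x\<in>T. -1)"
    by (rule has_order_prod[OF fin]) (rule has_order_f_minus_I[OF assms(2)])
  thus ?thesis by (simp add: branch_poly_def)
qed

lemma y_eventually_hol_at: "\<forall>\<^sub>F q in at p. hol_at A q y"
  using eventually_at_notI[of p] by eventually_elim (rule y_hol_at)

lemma y_eventually_sq: "\<forall>\<^sub>F q in at p. branch_poly branch (f q) = (y q)\<^sup>2"
  using eventually_at_notI[of p] by eventually_elim (simp add: y_sq)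

lemma y_has_order: assumes "p \<notin> I" shows "has_order A p y (if p \<in> branch then 1 else 0)"
proof -
  have "has_order A p (\<lambda>q. (y q)\<^sup>2) (if p \<in> branch then 2 else 0)"
    using has_order_cong_imp[OF branch_poly_has_order[OF order_refl assms] y_eventually_sq] .
  from has_order_sqrt[OF y_eventually_hol_at this] show ?thesis by (auto split: if_splits)
qed

text \<open>This number will turn out to be the genus plus one; \<open>- h\<close> is the order of
  \<open>y\<close> at the poles of \<open>f\<close>.\<close>

definition h :: int where "h = int (card branch) div 2"

text \<open>At a simple pole of \<open>f\<close> the square of \<open>y\<close> has order minus the
  number of branch points; being the order of a square, it is even.\<close>

lemma y_has_order_I': assumes "p \<in> I" shows "int (card branch) = 2 * h \<and> has_order A p y (- h)"
proof -
  have "has_order A p (\<lambda>q. (y q)\<^sup>2) (- int (card branch))"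
    using has_order_cong_imp[OF branch_poly_has_order_I[OF order_refl assms] y_eventually_sq] .
  from has_order_sqrt[OF y_eventually_hol_at this] obtain k where k: "- int (card branch) = 2 * k" "has_order A p y k" by blast
  hence "k = - h" by (simp add: h_def)
  with k show ?thesis by simp
qed

lemma card_branch: "int (card branch) = 2 * h" using y_has_order_I'[of i1] by (simp add: I_eq)

lemma y_has_order_I: "p \<in> I \<Longrightarrow> has_order A p y (- h)" using y_has_order_I' by blast

lemma y_nz: "p \<notin> I \<Longrightarrow> p \<notin> branch \<Longrightarrow> y p \<noteq> 0"
  using hol_at_has_order(2)[OF y_hol_at y_has_order[of p]] by simp

text \<open>The product E y is invariant, hence a polynomial in f. It vanishes at all 2h branch points, but has degree
less than 2h.\<close>

lemma antiinvariant_zero: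
  assumes E: "\<And>p. p \<notin> I \<Longrightarrow> hol_at A p E" "\<And>p. p \<notin> I \<Longrightarrow> E (J p) = - E p" and b: "growth k E" "k < h" and p: "p \<notin> I"
  shows "E p = 0"
proof -
  have Br0: "E p = 0" if "p \<in> branch" for p
  proof -
    have "p \<notin> I" "J p = p" using that J_props(5)[of p] by (auto simp: branch_def)
    thus ?thesis using E(2)[of p] by simp
  qed
  have "growth h y" by (rule growth_has_order) (use y_has_order_I in auto)
  with b(1) have bb: "growth (k + h) (\<lambda>q. E q * y q)" by (rule growth_mult)
  have inv: "E (J q) * y (J q) = E q * y q" if "q \<notin> I" for q using E(2)[OF that] y_J[OF that] by simp
  obtain R where R: "\<forall>p. p \<notin> I \<longrightarrow> E p * y p = poly R (f p)" "R = 0 \<or> int (degree R) \<le> k + h"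
    using invariant_poly[OF hol_at_mult[OF E(1) y_hol_at] inv bb] by blast
  have "R = 0"
  proof (rule ccontr)
    assume R0: "R \<noteq> 0"
    have "f ` branch \<subseteq> {x. poly R x = 0}" using R(1) Br0 by (force simp: branch_def)
    hence "card (f ` branch) \<le> card {x. poly R x = 0}" using R0 poly_roots_finite by (intro card_mono) auto
    also have "\<dots> \<le> degree R" using card_poly_roots_bound[OF R0] .
    finally have "int (card branch) \<le> k + h" using R(2) R0 card_image[OF inj_on_branch] by simp
    thus False using b(2) card_branch by simp
  qed
  hence "E p * y p = 0" using R(1) p by simp
  thus ?thesis using y_nz[OF p] Br0 by auto
qed

text \<open>The differential \<open>df / y\<close>. The quotient is 0/0 at branch points, so the
  singularity has to be removed there and at the poles.\<close>

definition omega :: "'a chart \<Rightarrow> 'a \<Rightarrow> complex" where "omega c = remove_sing A (\<lambda>q. chart_deriv c f q / y q)"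

context
  fixes c assumes c: "c \<in> A"
begin

text \<open>At a pole the order is \<open>-2 - (- h)\<close>, at a branch point
  \<open>1 - 1\<close>, and elsewhere neither factor vanishes. Thus the only zeros or poles lie over
  infinity.\<close>

lemma omega_pre_has_order: assumes "p \<in> fst c" shows "has_order A p (\<lambda>q. chart_deriv c f q / y q) (if p \<in> I then h - 2 else 0)"
proof (cases "p \<in> I")
  case True
  have "has_order A p (\<lambda>q. f q - 0) (- 1)" using has_order_I[OF True] by simp
  from chart_deriv_has_order[OF c assms this] have "has_order A p (chart_deriv c f) (-1 - 1)" by simp
  from has_order_divide[OF this y_has_order_I[OF True]] show ?thesis using True by simp
next
  case False
  have "has_order A p (\<lambda>q. f q - f p) (int (e p))" "int (e p) \<noteq> 0" using ordf[OF False] by auto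
  from chart_deriv_has_order[OF c assms this] have "has_order A p (chart_deriv c f) (int (e p) - 1)" .
  from has_order_divide[OF this y_has_order[OF False]] show ?thesis using False J_props(6)[OF False]
    by (auto simp: branch_def split: if_splits)
qed

lemma omega_has_order: "p \<in> fst c \<Longrightarrow> has_order A p (omega c) (if p \<in> I then h - 2 else 0)"
  unfolding omega_def by (rule remove_sing_has_order[OF omega_pre_has_order])

lemma omega_hol_at: assumes "p \<in> fst c" "p \<notin> I" shows "hol_at A p (omega c)" "omega c p \<noteq> 0"
proof -
  have s: "has_order A p (\<lambda>q. chart_deriv c f q / y q) 0" using omega_pre_has_order[OF assms(1)] assms(2) by simp
  thus h: "hol_at A p (omega c)" unfolding omega_def by (intro remove_sing_hol_at') auto
  have "has_order A p (omega c) 0" using omega_has_order[OF assms(1)] assms(2) by simp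
  from hol_at_has_order(2)[OF h this] show "omega c p \<noteq> 0" by simp
qed

end

lemma omega_cocycle: assumes "c \<in> A" "d \<in> A" "p \<in> fst c" "p \<in> fst d" shows "omega c p = kt c d p * omega d p"
  unfolding omega_def
proof (rule remove_sing_mult)
  show "mero_at A p (\<lambda>q. chart_deriv d f q / y q)" using has_order_mero_at[OF omega_pre_has_order] assms by blast
  show "hol_at A p (kt c d)" "kt c d p \<noteq> 0" using kt_hol_at[OF assms] by auto
  have "\<forall>\<^sub>F q in at p. q \<in> fst c" "\<forall>\<^sub>F q in at p. q \<in> fst d"
    using eventually_fst assms by blast+
  with eventually_at_notI[of p] show "\<forall>\<^sub>F q in at p. chart_deriv c f q / y q = kt c d q * (chart_deriv d f q / y q)"
    by eventually_elim (simp add: chart_deriv_cocycle[OF assms(1,2)] holf)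
qed

lemma K_simps: "indices (canonical_bundle A) = A" "patch (canonical_bundle A) = fst"
  "transition (canonical_bundle A) = kt"
  by (simp_all add: canonical_bundle_def chart_deriv_def fun_eq_iff)

lemma holo_sections_K_iff:
  "s \<in> holo_sections A (canonical_bundle A) \<longleftrightarrow> (\<forall>c p. \<not> (c \<in> A \<and> p \<in> fst c) \<longrightarrow> s c p = 0) \<and>
    (\<forall>c\<in>A. \<forall>d\<in>A. \<forall>p\<in>fst c \<inter> fst d. s c p = kt c d p * s d p) \<and> (\<forall>c\<in>A. \<forall>p\<in>fst c. hol_at A p (s c))"
proof -
  have "(\<forall>c\<in>A. holo_on_surface A (s c) (fst c)) \<longleftrightarrow> (\<forall>c\<in>A. \<forall>p\<in>fst c. hol_at A p (s c))"
    by (intro ball_cong refl holo_on_surface_iff chart_props(1))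
  thus ?thesis by (simp only: holo_sections_def section_family_def K_simps mem_Collect_eq conj_assoc)
qed

lemma I_closed_eq: assumes "\<And>q. q \<notin> I \<Longrightarrow> q \<in> fst c \<Longrightarrow> F q = G q" "c \<in> A" "p \<in> fst c" "hol_at A p F" "hol_at A p G"
  shows "F p = G p"
proof -
  have "\<forall>\<^sub>F q in at p. q \<in> fst c" using eventually_fst assms(2,3) by blast
  with eventually_at_notI[of p] have "\<forall>\<^sub>F q in at p. F q = G q" by eventually_elim (use assms(1) in blast)
  hence "remove_sing A F p = remove_sing A G p" by (rule remove_sing_cong)
  thus ?thesis using remove_sing_hol_at assms(4,5) by simp
qed

text \<open>The candidates for a basis of the holomorphic differentials. At each pole
  \<open>f ^ k\<close> costs \<open>k\<close> of the order \<open>h - 2\<close> of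
  \<open>omega\<close>.\<close>

definition omega_pow :: "nat \<Rightarrow> 'a chart \<Rightarrow> 'a \<Rightarrow> complex" where
  "omega_pow k c p = (if c \<in> A \<and> p \<in> fst c then remove_sing A (\<lambda>q. f q ^ k * omega c q) p else 0)"

lemma omega_pow_ord:
  assumes "c \<in> A" "p \<in> fst c" "p \<in> I" shows "has_order A p (\<lambda>q. f q ^ k * omega c q) (h - 2 - int k)"
proof -
  have "has_order A p (\<lambda>q. f q ^ k) (int k * (-1))" by (rule has_order_power[OF has_order_I[OF assms(3)]])
  from has_order_mult[OF this omega_has_order[OF assms(1,2)]] show ?thesis using assms(3) by simp
qed

lemma omega_pow_hol_at: assumes "c \<in> A" "p \<in> fst c" "int k \<le> h - 2" shows "hol_at A p (remove_sing A (\<lambda>q. f q ^ k * omega c q))"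
proof (cases "p \<in> I")
  case True
  show ?thesis by (rule remove_sing_hol_at') (use omega_pow_ord[OF assms(1,2) True, of k] assms(3) in auto)
next
  case False
  have hh: "hol_at A p (\<lambda>q. f q ^ k * omega c q)" by (intro hol_at_mult hol_at_power holf omega_hol_at assms False)
  from hol_at_zero_or_has_order[OF this] show ?thesis by (intro remove_sing_hol_at') (auto simp: eventually_nhds_conv_at)
qed

lemma omega_pow_value: assumes "c \<in> A" "p \<in> fst c" "p \<notin> I" shows "omega_pow k c p = f p ^ k * omega c p"
proof -
  have "hol_at A p (\<lambda>q. f q ^ k * omega c q)" by (intro hol_at_mult hol_at_power holf omega_hol_at assms)
  thus ?thesis using assms by (simp add: omega_pow_def remove_sing_hol_at)
qed

lemma omega_pow_section: assumes "int k \<le> h - 2" shows "omega_pow k \<in> holo_sections A (canonical_bundle A)"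
proof -
  have "omega_pow k c p = kt c d p * omega_pow k d p" if "c \<in> A" "d \<in> A" "p \<in> fst c \<inter> fst d" for c d p
  proof -
    have "remove_sing A (\<lambda>q. f q ^ k * omega c q) p = kt c d p * remove_sing A (\<lambda>q. f q ^ k * omega d q) p"
    proof (rule remove_sing_mult)
      have p: "p \<in> fst c" "p \<in> fst d" using that by auto
      show "hol_at A p (kt c d)" "kt c d p \<noteq> 0" using kt_hol_at[OF that(1,2) p] by auto
      show "mero_at A p (\<lambda>q. f q ^ k * omega d q)"
        using omega_pow_ord[OF that(2) p(2), of k] has_order_mero_at hol_at_mero_at[OF hol_at_mult[OF hol_at_power[OF holf] omega_hol_at(1)[OF that(2) p(2)]]] by blast
      have "\<forall>\<^sub>F q in at p. q \<in> fst c" "\<forall>\<^sub>F q in at p. q \<in> fst d"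
        using eventually_fst that(1,2) p by blast+
      thus "\<forall>\<^sub>F q in at p. f q ^ k * omega c q = kt c d q * (f q ^ k * omega d q)"
        by eventually_elim (simp add: omega_cocycle[OF that(1,2)])
    qed
    thus ?thesis using that by (simp add: omega_pow_def)
  qed
  moreover have "hol_at A p (omega_pow k c)" if c: "c \<in> A" and p: "p \<in> fst c" for c p
  proof -
    have "\<forall>\<^sub>F q in nhds p. q \<in> fst c" using eventually_nhds_in_open[OF chart_props(1)[OF c] p] .
    hence "\<forall>\<^sub>F q in nhds p. omega_pow k c q = remove_sing A (\<lambda>q. f q ^ k * omega c q) q" by eventually_elim (simp add: omega_pow_def c)
    thus ?thesis using hol_at_cong omega_pow_hol_at[OF c p assms] by blast
  qed
  moreover have "omega_pow k c p = 0" if "\<not> (c \<in> A \<and> p \<in> fst c)" for c p using that by (simp only: omega_pow_def if_False)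
  ultimately show ?thesis unfolding holo_sections_K_iff by blast
qed

text \<open>The quotient of a differential by \<open>omega\<close> is a function holomorphic off the
  poles with growth \<open>h - 2\<close>. Its anti-invariant part has growth below \<open>h\<close>
  and vanishes; what remains is invariant, hence a polynomial in \<open>f\<close>.\<close>

lemma holo_sections_K_poly:
  assumes s: "s \<in> holo_sections A (canonical_bundle A)"
  obtains R where "R = 0 \<or> int (degree R) \<le> h - 2"
    "\<And>c p. c \<in> A \<Longrightarrow> p \<in> fst c \<Longrightarrow> p \<notin> I \<Longrightarrow> s c p = poly R (f p) * omega c p"
proof -
  have s_coc: "s c p = kt c d p * s d p" if "c \<in> A" "d \<in> A" "p \<in> fst c" "p \<in> fst d" for c d p
    using s that unfolding holo_sections_K_iff by blast
  have s_hol_at: "hol_at A p (s c)" if "c \<in> A" "p \<in> fst c" for c p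
    using s that unfolding holo_sections_K_iff by blast
  \<comment> \<open>Numerator and denominator both transform by \<open>kt\<close>, so the quotient
    does not depend on the chart.\<close>
  define G where "G = (\<lambda>q. s (chart_at A q) q / omega (chart_at A q) q)"
  have Gc: "G q = s c q / omega c q" if "c \<in> A" "q \<in> fst c" for c q
    using s_coc[OF chart_at(1) that(1) chart_at(2) that(2)] omega_cocycle[OF chart_at(1) that(1) chart_at(2) that(2)]
      kt_hol_at(2)[OF chart_at(1) that(1) chart_at(2) that(2)] by (simp add: G_def)
  have Gev: "\<forall>\<^sub>F q in nhds p. s c q / omega c q = G q" if "c \<in> A" "p \<in> fst c" for c p
    using eventually_nhds_in_open[OF chart_props(1)[OF that(1)] that(2)] by eventually_elim (use Gc that(1) in auto)
  have G_hol_at: "hol_at A p G" if "p \<notin> I" for p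
  proof -
    have "hol_at A p (\<lambda>q. s (chart_at A p) q / omega (chart_at A p) q)"
      by (intro hol_at_divide s_hol_at omega_hol_at chart_at that)
    thus ?thesis using hol_at_cong[OF Gev[OF chart_at]] by simp
  qed
  have G_growth: "growth (h - 2) G"
  proof (rule growth_has_order)
    fix i assume i: "i \<in> I"
    let ?c = "chart_at A i"
    have ev: "\<forall>\<^sub>F q in at i. s ?c q / omega ?c q = G q" using Gev[OF chart_at] by (simp only: eventually_nhds_conv_at)
    have omega: "has_order A i (omega ?c) (h - 2)" using omega_has_order[OF chart_at, of i] i by simp
    from hol_at_zero_or_has_order[OF s_hol_at[OF chart_at]]
    show "(\<forall>\<^sub>F q in at i. G q = 0) \<or> (\<exists>n\<ge>-(h - 2). has_order A i G n)"
    proof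
      assume "\<forall>\<^sub>F q in nhds i. s ?c q = 0"
      hence "\<forall>\<^sub>F q in at i. s ?c q = 0" by (simp only: eventually_nhds_conv_at)
      with ev have "\<forall>\<^sub>F q in at i. G q = 0" by eventually_elim simp
      thus ?thesis ..
    next
      assume "\<exists>n\<ge>0. has_order A i (s ?c) n"
      then obtain n where n: "n \<ge> 0" "has_order A i (s ?c) n" by blast
      have "has_order A i G (n - (h - 2))" using has_order_cong_imp[OF has_order_divide[OF n(2) omega] ev] .
      thus ?thesis using n(1) by force
    qed
  qed
  have E0: "G p - G (J p) = 0" if "p \<notin> I" for p
  proof (rule antiinvariant_zero[where E = "\<lambda>p. G p - G (J p)" and k = "h - 2"])
    show "hol_at A p (\<lambda>p. G p - G (J p))" if "p \<notin> I" for p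
      by (intro hol_at_diff G_hol_at that J_hol_at J_props)
    show "G (J p) - G (J (J p)) = - (G p - G (J p))" if "p \<notin> I" for p by (simp add: J_J[OF that])
    show "growth (h - 2) (\<lambda>p. G p - G (J p))" by (intro growth_diff growth_J G_growth)
  qed (use that in auto)
  have inv: "G (J p) = G p" if "p \<notin> I" for p using E0[OF that] by simp
  obtain R where R: "\<forall>p. p \<notin> I \<longrightarrow> G p = poly R (f p)" "R = 0 \<or> int (degree R) \<le> h - 2"
    using invariant_poly[OF G_hol_at inv G_growth] by blast
  show thesis
  proof (rule that[OF R(2)])
    fix c p assume cp: "c \<in> A" "p \<in> fst c" "p \<notin> I"
    have "poly R (f p) = s c p / omega c p" using R(1) cp(3) Gc[OF cp(1,2)] by simp
    thus "s c p = poly R (f p) * omega c p" using omega_hol_at(2)[OF cp] by simp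
  qed
qed

text \<open>The exponents run from 0 to \<open>h - 2\<close>. They span by the description through
  polynomials, and are independent because \<open>omega\<close> has no zeros off the poles and
  \<open>f\<close> takes every value.\<close>

lemma dim_K: "sections.dim (holo_sections A (canonical_bundle A)) = nat (h - 1)"
proof -
  define n where "n = nat (h - 1)"
  have kn: "int k \<le> h - 2" if "k < n" for k using that by (simp add: n_def)
  have fin: "(\<Sum>k<n. (\<lambda>i p. a k * omega_pow k i p)) \<in> holo_sections A (canonical_bundle A)" for a
  proof -
    define u where "u = (\<lambda>c p. \<Sum>k<n. a k * omega_pow k c p)"
    have o: "\<And>c p. \<not> (c \<in> A \<and> p \<in> fst c) \<Longrightarrow> omega_pow k c p = 0"
      "\<And>c d p. c \<in> A \<Longrightarrow> d \<in> A \<Longrightarrow> p \<in> fst c \<inter> fst d \<Longrightarrow> omega_pow k c p = kt c d p * omega_pow k d p"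
      "\<And>c p. c \<in> A \<Longrightarrow> p \<in> fst c \<Longrightarrow> hol_at A p (omega_pow k c)" if "k < n" for k
      using omega_pow_section[OF kn[OF that]] unfolding holo_sections_K_iff by blast+
    have "u c p = 0" if "\<not> (c \<in> A \<and> p \<in> fst c)" for c p
      unfolding u_def by (rule sum.neutral) (use o(1)[OF _ that] in auto)
    moreover have "u c p = kt c d p * u d p" if "c \<in> A" "d \<in> A" "p \<in> fst c \<inter> fst d" for c d p
      unfolding u_def sum_distrib_left
    proof (rule sum.cong[OF refl])
      fix k assume "k \<in> {..<n}"
      hence "omega_pow k c p = kt c d p * omega_pow k d p" using o(2)[OF _ that] by simp
      thus "a k * omega_pow k c p = kt c d p * (a k * omega_pow k d p)" by (simp only: mult.left_commute)
    qed
    moreover have hj: "hol_at A p (\<lambda>p. \<Sum>k<j. a k * omega_pow k c p)" if "c \<in> A" "p \<in> fst c" "j \<le> n" for c p j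
      using that(3)
    proof (induct j)
      case (Suc j)
      thus ?case using hol_at_add[OF Suc(1) hol_at_mult[OF hol_at_const o(3)[OF _ that(1,2)]]] by simp
    qed (simp add: hol_at_const)
    have "hol_at A p (u c)" if "c \<in> A" "p \<in> fst c" for c p unfolding u_def by (rule hj[OF that order_refl])
    ultimately have "u \<in> holo_sections A (canonical_bundle A)" unfolding holo_sections_K_iff by blast
    moreover have "(\<Sum>k<n. (\<lambda>i p. a k * omega_pow k i p)) = u"
      by (intro ext) (simp add: sum_fun2 u_def)
    ultimately show ?thesis by simp
  qed
  show ?thesis unfolding n_def[symmetric]
  proof (rule sections_dim_eq[where b = omega_pow])
    show "holo_sections A (canonical_bundle A) = range (\<lambda>a. \<Sum>k<n. (\<lambda>i p. a k * omega_pow k i p))"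
    proof (intro equalityI subsetI)
      fix s assume s: "s \<in> holo_sections A (canonical_bundle A)"
      obtain R where R: "R = 0 \<or> int (degree R) \<le> h - 2"
        "\<And>c p. c \<in> A \<Longrightarrow> p \<in> fst c \<Longrightarrow> p \<notin> I \<Longrightarrow> s c p = poly R (f p) * omega c p"
        using holo_sections_K_poly[OF s] by blast
      have R': "R = 0 \<or> degree R < n" using R(1) by (auto simp: n_def)
      define u where "u = (\<Sum>k<n. (\<lambda>i p. coeff R k * omega_pow k i p))"
      have u: "u \<in> holo_sections A (canonical_bundle A)" unfolding u_def by (rule fin)
      have "s c p = u c p" for c p
      proof (cases "c \<in> A \<and> p \<in> fst c")
        case False
        hence "s c p = 0" "u c p = 0" using s u unfolding holo_sections_K_iff by blast+
        thus ?thesis by simp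
      next
        case True
        show ?thesis
        proof (rule I_closed_eq)
          show "s c q = u c q" if q: "q \<notin> I" "q \<in> fst c" for q
          proof -
            have "u c q = (\<Sum>k<n. coeff R k * (f q ^ k * omega c q))"
              using omega_pow_value[OF _ q(2,1)] True by (simp add: u_def sum_fun2)
            also have "\<dots> = poly R (f q) * omega c q"
              by (simp add: poly_as_sum[OF R'] sum_distrib_right mult.assoc)
            finally show ?thesis using R(2) True q by simp
          qed
          show "hol_at A p (s c)" using s True unfolding holo_sections_K_iff by blast
          show "hol_at A p (u c)" using u True unfolding holo_sections_K_iff by blast
        qed (use True in auto)
      qed
      hence "s = u" by blast
      thus "s \<in> range (\<lambda>a. \<Sum>k<n. (\<lambda>i p. a k * omega_pow k i p))" unfolding u_def by blast
    next
      fix s assume "s \<in> range (\<lambda>a. \<Sum>k<n. (\<lambda>i p. a k * omega_pow k i p))"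
      thus "s \<in> holo_sections A (canonical_bundle A)" using fin by blast
    qed
  next
    fix a :: "nat \<Rightarrow> complex" and k
    assume z: "(\<Sum>k<n. (\<lambda>i p. a k * omega_pow k i p)) = 0" and k: "k < n"
    define R where "R = (\<Sum>k<n. monom (a k) k)"
    have co: "coeff R k = a k" if "k < n" for k using that by (simp add: R_def coeff_sum)
    have "poly R w = 0" for w
    proof -
      obtain p where p: "p \<in> fibre w" by (rule fibre_cases[of w]) auto
      hence pI: "p \<notin> I" "f p = w" by (auto simp: fibre_def)
      let ?c = "chart_at A p"
      have "0 = (\<Sum>k<n. (\<lambda>i p. a k * omega_pow k i p)) ?c p" unfolding z by simp
      also have "\<dots> = (\<Sum>k<n. a k * (w ^ k * omega ?c p))"
        using omega_pow_value[OF chart_at pI(1)] pI(2) by (simp add: sum_fun2)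
      also have "\<dots> = poly R w * omega ?c p"
        by (simp add: R_def poly_sum poly_monom sum_distrib_right mult.assoc)
      finally show ?thesis using omega_hol_at(2)[OF chart_at pI(1)] by simp
    qed
    hence "R = 0" using poly_all_0_iff_0 by blast
    thus "a k = 0" using co[OF k] by simp
  qed
qed

end

text \<open>Both alternatives are open conditions and cannot hold together, so connectedness
  decides. Punctured neighbourhoods make the statement insensitive to poles and to arbitrary values
  at single points.\<close>

lemma (in compact_surface) identity_principle:
  fixes v :: "'a \<Rightarrow> complex"
  assumes "\<And>p. (\<forall>\<^sub>F q in at p. v q = 0) \<or> (\<forall>\<^sub>F q in at p. v q \<noteq> 0)"
  shows "(\<forall>p. \<forall>\<^sub>F q in at p. v q = 0) \<or> (\<forall>p. \<forall>\<^sub>F q in at p. v q \<noteq> 0)"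
proof -
  have op: "open {p::'a. \<forall>\<^sub>F q in at p. Q (v q)}" for Q
  proof (subst open_subopen, intro ballI)
    fix x assume "x \<in> {p. \<forall>\<^sub>F q in at p. Q (v q)}"
    then obtain U where U: "open U" "x \<in> U" "\<And>q. q \<in> U \<Longrightarrow> q \<noteq> x \<Longrightarrow> Q (v q)"
      unfolding mem_Collect_eq eventually_at_topological by blast
    have "\<forall>\<^sub>F q in at p. Q (v q)" if p: "p \<in> U" for p
    proof (cases "p = x")
      case True
      thus ?thesis using U unfolding eventually_at_topological by blast
    next
      case False
      have "p \<in> U - {x}" using p False by simp
      hence "\<forall>\<^sub>F q in nhds p. q \<in> U - {x}" by (rule eventually_nhds_in_open[OF open_delete[OF U(1)]])
      hence "\<forall>\<^sub>F q in at p. q \<in> U - {x}" by (simp only: eventually_nhds_conv_at)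
      thus ?thesis by eventually_elim (use U(3) in blast)
    qed
    thus "\<exists>T. open T \<and> x \<in> T \<and> T \<subseteq> {p. \<forall>\<^sub>F q in at p. Q (v q)}" using U(1,2) by blast
  qed
  let ?Z = "{p. \<forall>\<^sub>F q in at p. v q = 0}" let ?N = "{p. \<forall>\<^sub>F q in at p. v q \<noteq> 0}"
  have "?Z \<inter> ?N \<inter> UNIV = {}"
  proof (rule ccontr)
    assume "?Z \<inter> ?N \<inter> UNIV \<noteq> {}"
    then obtain p where "\<forall>\<^sub>F q in at p. v q = 0" "\<forall>\<^sub>F q in at p. v q \<noteq> 0" by blast
    hence "\<forall>\<^sub>F q in at p. False" by eventually_elim simp
    thus False using at_neq_bot_surface by simp
  qed
  moreover have "UNIV \<subseteq> ?Z \<union> ?N" using assms by blast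
  ultimately have "?Z \<inter> UNIV = {} \<or> ?N \<inter> UNIV = {}"
    using connectedD[OF conn op[of "\<lambda>z. z = 0"] op[of "\<lambda>z. z \<noteq> 0"]] by blast
  thus ?thesis using assms by blast
qed

section \<open>Sections of the spin bundle\<close>

text \<open>\<open>hh\<close> is the isomorphism from the square of \<open>L\<close> to the
  canonical bundle in local trivialisations; through it \<open>omega\<close> becomes a section of
  that square.\<close>

locale spin = hyperelliptic_curve A f I m e i1 i2 y
  for A :: "('a::t2_space) chart set" and f I m e i1 i2 y +
  fixes L :: "('a, 'i) line_bundle" and hh :: "'i \<Rightarrow> 'a chart \<Rightarrow> 'a \<Rightarrow> complex"
  assumes lb: "is_line_bundle A L"
    and hh_hol_at: "\<And>i c. i \<in> indices L \<Longrightarrow> c \<in> A \<Longrightarrow> holo_on_surface A (hh i c) (patch L i \<inter> fst c)"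
    and hh_nz: "\<And>i c p. i \<in> indices L \<Longrightarrow> c \<in> A \<Longrightarrow> p \<in> patch L i \<Longrightarrow> p \<in> fst c \<Longrightarrow> hh i c p \<noteq> 0"
    and hh_coc: "\<And>i i' c d p. i \<in> indices L \<Longrightarrow> i' \<in> indices L \<Longrightarrow> c \<in> A \<Longrightarrow> d \<in> A \<Longrightarrow>
      p \<in> patch L i \<Longrightarrow> p \<in> patch L i' \<Longrightarrow> p \<in> fst c \<Longrightarrow> p \<in> fst d \<Longrightarrow>
      hh i c p * kt c d p = (transition L i i' p)\<^sup>2 * hh i' d p"
    and no_sections: "holo_sections A L = {0}"
begin

abbreviation "tr \<equiv> transition L"

definition patch_of :: "'a \<Rightarrow> 'i" where "patch_of p = (SOME i. i \<in> indices L \<and> p \<in> patch L i)"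

lemma patch_of: "patch_of p \<in> indices L" "p \<in> patch L (patch_of p)"
proof -
  have "p \<in> (\<Union>i\<in>indices L. patch L i)" using lb by (simp add: is_line_bundle_def)
  hence "\<exists>i. i \<in> indices L \<and> p \<in> patch L i" by blast
  from someI_ex[OF this] show "patch_of p \<in> indices L" "p \<in> patch L (patch_of p)" by (auto simp: patch_of_def)
qed

lemma patch_open: "i \<in> indices L \<Longrightarrow> open (patch L i)" using lb by (simp add: is_line_bundle_def)

lemma eventually_patch: "i \<in> indices L \<Longrightarrow> p \<in> patch L i \<Longrightarrow> \<forall>\<^sub>F q in nhds p. q \<in> patch L i"
  by (rule eventually_nhds_in_open[OF patch_open])

lemma tr_hol_at: assumes "i \<in> indices L" "j \<in> indices L" "p \<in> patch L i" "p \<in> patch L j"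
  shows "hol_at A p (tr i j)" "tr i j p \<noteq> 0"
proof -
  have o: "open (patch L i \<inter> patch L j)" using patch_open assms by (intro open_Int) auto
  have "holo_on_surface A (tr i j) (patch L i \<inter> patch L j) \<and> (\<forall>p \<in> patch L i \<inter> patch L j. tr i j p \<noteq> 0)"
    using lb assms(1,2) unfolding is_line_bundle_def by blast
  thus "hol_at A p (tr i j)" "tr i j p \<noteq> 0" using holo_on_surface_iff[OF o] assms(3,4) by blast+
qed

lemma tr_coc: assumes "i \<in> indices L" "j \<in> indices L" "k \<in> indices L" "p \<in> patch L i" "p \<in> patch L j" "p \<in> patch L k"
  shows "tr i j p * tr j k p = tr i k p"
  using lb assms unfolding is_line_bundle_def by blast

definition twist :: "'a \<Rightarrow> 'a \<Rightarrow> complex" where "twist p q = tr (patch_of p) (patch_of q) q"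

definition W :: "'a \<Rightarrow> complex" where "W q = hh (patch_of q) (chart_at A q) q * omega (chart_at A q) q"

text \<open>\<open>W\<close> uses a patch and a chart chosen separately at each point. The square of
  the twist cancels the choice of patch, and the common cocycle of \<open>omega\<close> and
  \<open>hh\<close> cancels the choice of chart, leaving an expression in fixed
  trivialisations.\<close>

lemma W_twist: assumes "q \<in> patch L (patch_of p)" "c \<in> A" "q \<in> fst c"
  shows "(twist p q)\<^sup>2 * W q = hh (patch_of p) c q * omega c q"
proof -
  have "(twist p q)\<^sup>2 * hh (patch_of q) (chart_at A q) q = hh (patch_of p) c q * kt c (chart_at A q) q"
    using hh_coc[OF patch_of(1)[of p] patch_of(1)[of q] assms(2) chart_at(1)[of q] assms(1) patch_of(2) assms(3) chart_at(2)] by (simp add: twist_def)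
  moreover have "omega c q = kt c (chart_at A q) q * omega (chart_at A q) q"
    using omega_cocycle[OF assms(2) chart_at(1) assms(3) chart_at(2)] .
  ultimately show ?thesis by (simp add: W_def mult.assoc[symmetric])
qed

lemma twist_eventually_nz: "\<forall>\<^sub>F q in nhds p. twist p q \<noteq> 0"
  using eventually_patch[OF patch_of] by eventually_elim (use tr_hol_at(2)[OF patch_of(1) patch_of(1)] patch_of in \<open>auto simp: twist_def\<close>)

lemma W_twist_eventually: "\<forall>\<^sub>F q in nhds p. hh (patch_of p) (chart_at A p) q * omega (chart_at A p) q = (twist p q)\<^sup>2 * W q"
  using eventually_patch[OF patch_of] eventually_nhds_in_open[OF chart_props(1)[OF chart_at(1)] chart_at(2)]
  by eventually_elim (rule W_twist[symmetric, OF _ chart_at(1)])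

lemma hh_chart_hol: "hol_at A p (hh (patch_of p) (chart_at A p))"
proof -
  have "open (patch L (patch_of p) \<inter> fst (chart_at A p))" using patch_open patch_of chart_props(1) chart_at by (intro open_Int) blast+
  thus ?thesis using holo_on_surface_iff hh_hol_at[OF patch_of(1) chart_at(1)] patch_of(2) chart_at(2) by blast
qed

lemma W_has_order: "has_order A p (\<lambda>q. (twist p q)\<^sup>2 * W q) (if p \<in> I then h - 2 else 0)"
proof -
  have "has_order A p (hh (patch_of p) (chart_at A p)) 0"
    by (rule hol_at_nonzero_has_order[OF hh_chart_hol hh_nz[OF patch_of(1) chart_at(1) patch_of(2) chart_at(2)]])
  from has_order_mult[OF this omega_has_order[OF chart_at]] 
  have s: "has_order A p (\<lambda>q. hh (patch_of p) (chart_at A p) q * omega (chart_at A p) q) (if p \<in> I then h - 2 else 0)" by simp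
  show ?thesis by (rule has_order_cong_imp[OF s]) (use W_twist_eventually[of p] in \<open>simp only: eventually_nhds_conv_at\<close>)
qed

sublocale twisted A f I m e i1 i2 twist W
proof
  show "\<forall>\<^sub>F q in nhds p. twist p q \<noteq> 0" for p by (rule twist_eventually_nz)
  show "\<forall>\<^sub>F p' in nhds p. hol_at A p' (\<lambda>q. twist p q / twist p' q)" for p
    using eventually_patch[OF patch_of[of p]]
  proof eventually_elim
    case (elim p')
    have "\<forall>\<^sub>F q in nhds p'. twist p q / twist p' q = tr (patch_of p) (patch_of p') q"
      using eventually_patch[OF patch_of(1) elim] eventually_patch[OF patch_of[of p']]
    proof eventually_elim
      case (elim q)
      have "tr (patch_of p) (patch_of p') q * tr (patch_of p') (patch_of q) q = tr (patch_of p) (patch_of q) q"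
        by (rule tr_coc) (use patch_of elim in auto)
      moreover have "tr (patch_of p') (patch_of q) q \<noteq> 0" by (rule tr_hol_at(2)) (use patch_of elim in auto)
      ultimately show ?case by (simp add: twist_def field_simps)
    qed
    from hol_at_cong[OF this] tr_hol_at(1)[OF patch_of(1) patch_of(1) elim patch_of(2)] show ?case by simp
  qed
  fix p assume p: "p \<notin> I"
  have "hol_at A p (\<lambda>q. hh (patch_of p) (chart_at A p) q * omega (chart_at A p) q)"
    by (intro hol_at_mult hh_chart_hol omega_hol_at chart_at p)
  thus "hol_at A p (\<lambda>q. (twist p q)\<^sup>2 * W q)" using hol_at_cong[OF W_twist_eventually] by simp
  show "W p \<noteq> 0" unfolding W_def
    using hh_nz[OF patch_of(1) chart_at(1) patch_of(2) chart_at(2)] omega_hol_at(2)[OF chart_at p] by simp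
qed

section \<open>Functions with pointwise trivialisations and genuine sections\<close>

definition section_has_order :: "'a \<Rightarrow> ('a \<Rightarrow> complex) \<Rightarrow> int \<Rightarrow> bool" where "section_has_order p v k \<longleftrightarrow> has_order A p (\<lambda>q. twist p q * v q) k"

lemma section_has_order_mult: "section_has_order p v k \<Longrightarrow> has_order A p g n \<Longrightarrow> section_has_order p (\<lambda>q. v q * g q) (k + n)"
  unfolding section_has_order_def using has_order_mult[of p "\<lambda>q. twist p q * v q" k g n] by (simp add: mult.assoc)

lemma section_has_order_unique: "section_has_order p v k \<Longrightarrow> section_has_order p v l \<Longrightarrow> k = l" unfolding section_has_order_def by (rule has_order_unique)

lemma section_has_order_nz: assumes "section_has_order p v k" shows "\<forall>\<^sub>F q in at p. v q \<noteq> 0"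
  using has_order_eventually(2)[OF assms[unfolded section_has_order_def]] by eventually_elim simp

lemma eventually_at_of_nhds: "\<forall>\<^sub>F q in nhds p. Q q \<Longrightarrow> \<forall>\<^sub>F q in at (p::'a). Q q" by (simp only: eventually_nhds_conv_at)

lemma section_germ: assumes "i \<in> indices L" "p \<in> patch L i"
  shows "\<forall>\<^sub>F q in nhds p. tr i (patch_of q) q * v q = tr i (patch_of p) q * (twist p q * v q)"
  using eventually_patch[OF patch_of[of p]] eventually_patch[OF assms]
proof eventually_elim
  case (elim q)
  have "tr i (patch_of p) q * tr (patch_of p) (patch_of q) q = tr i (patch_of q) q" by (rule tr_coc) (use patch_of assms elim in auto)
  thus ?case by (simp add: twist_def mult.assoc[symmetric])
qed

text \<open>From pointwise values to a family on the patches. Removing singularities supplies the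
  conventional value 0 at poles and repairs arbitrary values at isolated points.\<close>

definition glue_section :: "('a \<Rightarrow> complex) \<Rightarrow> 'i \<Rightarrow> 'a \<Rightarrow> complex" where
  "glue_section v i p = (if i \<in> indices L \<and> p \<in> patch L i then remove_sing A (\<lambda>q. tr i (patch_of q) q * v q) p else 0)"

definition mero_section_at :: "'a \<Rightarrow> ('a \<Rightarrow> complex) \<Rightarrow> bool" where
  "mero_section_at p v \<longleftrightarrow> (\<forall>\<^sub>F q in at p. v q = 0) \<or> (\<exists>k. section_has_order p v k)"

lemma germ_has_order: assumes "i \<in> indices L" "p \<in> patch L i" "section_has_order p v k"
  shows "has_order A p (\<lambda>q. tr i (patch_of q) q * v q) k"
proof -
  have "has_order A p (tr i (patch_of p)) 0" using tr_hol_at[OF assms(1) patch_of(1) assms(2) patch_of(2)] by (rule hol_at_nonzero_has_order)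
  from has_order_mult[OF this assms(3)[unfolded section_has_order_def]]
  have s: "has_order A p (\<lambda>q. tr i (patch_of p) q * (twist p q * v q)) k" by simp
  have "\<forall>\<^sub>F q in nhds p. tr i (patch_of p) q * (twist p q * v q) = tr i (patch_of q) q * v q"
    using section_germ[OF assms(1,2), of v] by eventually_elim (rule sym)
  from has_order_cong_imp[OF s eventually_at_of_nhds[OF this]] show ?thesis .
qed

lemma germ_mero_at: assumes "i \<in> indices L" "p \<in> patch L i" "mero_section_at p v" shows "mero_at A p (\<lambda>q. tr i (patch_of q) q * v q)"
  using assms(3) unfolding mero_section_at_def
proof (elim disjE exE)
  assume "\<forall>\<^sub>F q in at p. v q = 0"
  hence "\<forall>\<^sub>F q in at p. tr i (patch_of q) q * v q = 0" by eventually_elim simp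
  thus ?thesis by (simp add: mero_at_def)
qed (use germ_has_order[OF assms(1,2)] has_order_mero_at in blast)

lemma glue_section_near: assumes "i \<in> indices L" "p \<in> patch L i"
  shows "\<forall>\<^sub>F q in nhds p. glue_section v i q = remove_sing A (\<lambda>q. tr i (patch_of q) q * v q) q"
  using eventually_patch[OF assms] by eventually_elim (simp add: glue_section_def assms(1))

lemma glue_section_family: assumes "\<And>p. mero_section_at p v" shows "section_family L (glue_section v)"
proof -
  have "glue_section v i p = tr i j p * glue_section v j p" if ij: "i \<in> indices L" "j \<in> indices L" and p: "p \<in> patch L i \<inter> patch L j" for i j p
  proof -
    have pp: "p \<in> patch L i" "p \<in> patch L j" using p by auto
    have "remove_sing A (\<lambda>q. tr i (patch_of q) q * v q) p = tr i j p * remove_sing A (\<lambda>q. tr j (patch_of q) q * v q) p"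
    proof (rule remove_sing_mult)
      show "mero_at A p (\<lambda>q. tr j (patch_of q) q * v q)" using germ_mero_at[OF ij(2) pp(2) assms] .
      show "hol_at A p (tr i j)" "tr i j p \<noteq> 0" using tr_hol_at[OF ij pp] by auto
      have "\<forall>\<^sub>F q in nhds p. tr i (patch_of q) q * v q = tr i j q * (tr j (patch_of q) q * v q)"
        using eventually_patch[OF ij(1) pp(1)] eventually_patch[OF ij(2) pp(2)]
      proof eventually_elim
        case (elim q)
        have "tr i j q * tr j (patch_of q) q = tr i (patch_of q) q" by (rule tr_coc) (use patch_of ij elim in auto)
        thus ?case by (simp add: mult.assoc[symmetric])
      qed
      thus "\<forall>\<^sub>F q in at p. tr i (patch_of q) q * v q = tr i j q * (tr j (patch_of q) q * v q)" by (rule eventually_at_of_nhds)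
    qed
    thus ?thesis using ij pp by (simp add: glue_section_def)
  qed
  moreover have "glue_section v i p = 0" if "\<not> (i \<in> indices L \<and> p \<in> patch L i)" for i p
    using that by (simp only: glue_section_def if_False)
  ultimately show ?thesis unfolding section_family_def by blast
qed

lemma glue_section_mero: assumes "\<And>p. mero_section_at p v" shows "glue_section v \<in> mero_sections A L"
proof -
  have "mero_on_surface A (glue_section v i) (patch L i)" if i: "i \<in> indices L" for i
    unfolding mero_on_surface_iff[OF patch_open[OF i]]
  proof
    fix p assume p: "p \<in> patch L i"
    have "nmero_at A p (remove_sing A (\<lambda>q. tr i (patch_of q) q * v q))" by (rule remove_sing_nmero_at[OF germ_mero_at[OF i p assms]])
    moreover have "has_order A p (glue_section v i) n \<longleftrightarrow> has_order A p (remove_sing A (\<lambda>q. tr i (patch_of q) q * v q)) n" for n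
      by (rule has_order_cong[OF eventually_at_of_nhds[OF glue_section_near[OF i p]]])
    moreover have "hol_at A p (glue_section v i) \<longleftrightarrow> hol_at A p (remove_sing A (\<lambda>q. tr i (patch_of q) q * v q))" by (rule hol_at_cong[OF glue_section_near[OF i p]])
    moreover have "glue_section v i p = remove_sing A (\<lambda>q. tr i (patch_of q) q * v q) p" using eventually_nhds_x_imp_x[OF glue_section_near[OF i p]] .
    ultimately show "nmero_at A p (glue_section v i)" by (simp add: nmero_at_def)
  qed
  thus ?thesis using glue_section_family[OF assms] by (simp add: mero_sections_def)
qed

lemma glue_section_has_order: assumes "i \<in> indices L" "p \<in> patch L i" "section_has_order p v k" shows "has_order A p (glue_section v i) k"
proof -
  have "has_order A p (remove_sing A (\<lambda>q. tr i (patch_of q) q * v q)) k" using remove_sing_has_order[OF germ_has_order[OF assms]] .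
  thus ?thesis using has_order_cong[OF eventually_at_of_nhds[OF glue_section_near[OF assms(1,2)]]] by blast
qed

lemma glue_section_order: assumes "section_has_order p v k" shows "section_order A L (glue_section v) p = k"
  using order_at_eq[OF glue_section_has_order[OF patch_of assms]] by (simp add: section_order_def patch_of_def)

lemma glue_section_eq: assumes "mero_section_at p v" shows "\<forall>\<^sub>F q in at p. glue_section v (patch_of p) q = twist p q * v q"
  using remove_sing_eq[OF germ_mero_at[OF patch_of assms]] eventually_at_of_nhds[OF glue_section_near[OF patch_of[of p], of v]]
  by eventually_elim (simp add: twist_def)

text \<open>After gluing, such a function is a holomorphic section of \<open>L\<close>, hence zero.
  The conclusion is restricted to punctured neighbourhoods because the hypothesis says nothing about
  \<open>v\<close> at the points themselves.\<close>

lemma no_holo: assumes "\<And>p. (\<forall>\<^sub>F q in at p. v q = 0) \<or> (\<exists>k\<ge>0. section_has_order p v k)"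
  shows "\<forall>\<^sub>F q in at p. v q = 0"
proof -
  have t: "mero_section_at p v" for p using assms[of p] by (auto simp: mero_section_at_def)
  have "holo_on_surface A (glue_section v i) (patch L i)" if i: "i \<in> indices L" for i
    unfolding holo_on_surface_iff[OF patch_open[OF i]]
  proof
    fix p assume p: "p \<in> patch L i"
    have "hol_at A p (remove_sing A (\<lambda>q. tr i (patch_of q) q * v q))"
    proof (rule remove_sing_hol_at')
      from assms[of p] show "(\<forall>\<^sub>F q in at p. tr i (patch_of q) q * v q = 0) \<or> (\<exists>n\<ge>0. has_order A p (\<lambda>q. tr i (patch_of q) q * v q) n)"
      proof
        assume "\<forall>\<^sub>F q in at p. v q = 0"
        hence "\<forall>\<^sub>F q in at p. tr i (patch_of q) q * v q = 0" by eventually_elim simp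
        thus ?thesis ..
      qed (use germ_has_order[OF i p] in blast)
    qed
    thus "hol_at A p (glue_section v i)" using hol_at_cong[OF glue_section_near[OF i p]] by blast
  qed
  hence "glue_section v \<in> holo_sections A L" using glue_section_family[OF t] by (simp add: holo_sections_def)
  hence z: "glue_section v = 0" using no_sections by blast
  have "\<forall>\<^sub>F q in at p. twist p q * v q = 0" using glue_section_eq[OF t, of p] by eventually_elim (simp add: z)
  with eventually_at_of_nhds[OF twist_eventually_nz[of p]] show ?thesis by eventually_elim simp
qed

lemma section_has_order_positive_False:
  assumes "\<And>p. \<exists>k\<ge>0. section_has_order p v k" shows False
proof -
  have "\<forall>\<^sub>F q in at i1. v q = 0" by (rule no_holo) (use assms in blast)
  moreover obtain k where "section_has_order i1 v k" using assms by blast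
  hence "\<forall>\<^sub>F q in at i1. v q \<noteq> 0" by (rule section_has_order_nz)
  ultimately have "\<forall>\<^sub>F q in at i1. False" by eventually_elim simp
  thus False using at_neq_bot_surface by simp
qed

text \<open>Each pole of f contributes order k, since W has order h - 2 and the product over T order - card T there.\<close>

definition half_section :: "'a set \<Rightarrow> int \<Rightarrow> ('a \<Rightarrow> complex) \<Rightarrow> bool" where
  "half_section T k s \<longleftrightarrow> T \<subseteq> branch \<and> 2 * k = h - 2 - int (card T) \<and>
     (\<forall>p. section_has_order p s (if p \<in> I then k else if p \<in> T then 1 else 0))"

text \<open>The square root of \<open>W\<close> times the product over \<open>T\<close> is
  constructed only off the poles of \<open>f\<close>. Its order at a pole is half that of its
  square, as it is holomorphic nearby.\<close>

lemma half_section_exists: "\<exists>T k s. half_section T k s"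
proof -
  obtain n where n: "\<And>z. is_norm z n" using norm_exists by blast
  define T where "T = {p \<in> branch. n p = - W p}"
  have TB: "T \<subseteq> branch" by (auto simp: T_def)
  obtain s where s: "\<And>p. p \<notin> I \<Longrightarrow> hol_section p s \<and>
    (\<forall>\<^sub>F q in nhds p. (s q)\<^sup>2 = W q * branch_poly T (f q) \<and> s q * s (J q) = n q * branch_poly T (f q))"
    using square_root_section[OF n T_def] by blast
  have sq: "(s q)\<^sup>2 = W q * branch_poly T (f q)" if q: "q \<notin> I" for q
  proof -
    have "\<forall>\<^sub>F q in nhds q. (s q)\<^sup>2 = W q * branch_poly T (f q) \<and> s q * s (J q) = n q * branch_poly T (f q)" using s[OF q] by blast
    from eventually_nhds_x_imp_x[OF this] show ?thesis by blast
  qed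
  have eventually_hol_at: "\<forall>\<^sub>F q in at p. hol_at A q (\<lambda>x. twist p x * s x)" for p
    using eventually_at_of_nhds[OF twist_hol_at[of p]] eventually_at_notI[of p]
  proof eventually_elim
    case (elim q)
    have t: "hol_at A q (\<lambda>x. twist q x * s x)" using s[OF elim(2)] by (simp add: hol_section_def)
    have "\<forall>\<^sub>F x in nhds q. twist p x / twist q x * (twist q x * s x) = twist p x * s x" using twist_eventually_nz[of q]
      by eventually_elim simp
    from hol_at_cong[OF this] hol_at_mult[OF elim(1) t] show ?case by simp
  qed
  have eventually_sq: "\<forall>\<^sub>F q in at p. (twist p q)\<^sup>2 * W q * branch_poly T (f q) = (twist p q * s q)\<^sup>2" for p
    using eventually_at_notI[of p] by eventually_elim (simp add: sq power_mult_distrib)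
  have sI: "has_order A p (\<lambda>q. (twist p q * s q)\<^sup>2) (h - 2 - int (card T))" if p: "p \<in> I" for p
    using has_order_cong_imp[OF has_order_mult[OF W_has_order branch_poly_has_order_I[OF TB p]] eventually_sq] p by simp
  have sX: "has_order A p (\<lambda>q. (twist p q * s q)\<^sup>2) (if p \<in> T then 2 else 0)" if p: "p \<notin> I" for p
    using has_order_cong_imp[OF has_order_mult[OF W_has_order branch_poly_has_order[OF TB p]] eventually_sq] p by simp
  have i1: "i1 \<in> I" using I_eq by simp
  \<comment> \<open>The square has the same order at both poles, so one \<open>k\<close> serves for
    both.\<close>
  from has_order_sqrt[OF eventually_hol_at sI[OF i1]] obtain k where k: "h - 2 - int (card T) = 2 * k" by blast
  have "section_has_order p s (if p \<in> I then k else if p \<in> T then 1 else 0)" for p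
  proof (cases "p \<in> I")
    case True
    from has_order_sqrt[OF eventually_hol_at sI[OF True]] k show ?thesis using True by (auto simp: section_has_order_def)
  next
    case False
    from has_order_sqrt[OF eventually_hol_at sX[OF False]] show ?thesis using False by (auto simp: section_has_order_def split: if_splits)
  qed
  thus ?thesis using TB k unfolding half_section_def by (intro exI[of _ T] exI[of _ k] exI[of _ s]) simp
qed

text \<open>The factor \<open>y / branch_poly T (f q)\<close> has order \<open>1 - 2\<close> on
  \<open>T\<close>, 1 on the other branch points and \<open>card T - h\<close> at the poles; the
  first cancels the simple zeros on \<open>T\<close>.\<close>

lemma half_section_compl: assumes "half_section T k s"
  shows "\<exists>k' s'. half_section (branch - T) k' s'"
proof -
  have T: "T \<subseteq> branch" "2 * k = h - 2 - int (card T)" and s: "\<And>p. section_has_order p s (if p \<in> I then k else if p \<in> T then 1 else 0)"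
    using assms by (auto simp: half_section_def)
  have cT: "int (card (branch - T)) = 2 * h - int (card T)"
    using card_Diff_subset[of T branch] T(1) finite_branch finite_subset card_mono[OF finite_branch T(1)] card_branch
    by (metis of_nat_diff)
  define g where "g = (\<lambda>q. y q / branch_poly T (f q))"
  have gI: "has_order A p g (- h - (- int (card T)))" if "p \<in> I" for p
    unfolding g_def by (rule has_order_divide[OF y_has_order_I[OF that] branch_poly_has_order_I[OF T(1) that]])
  have gX: "has_order A p g ((if p \<in> branch then 1 else 0) - (if p \<in> T then 2 else 0))" if "p \<notin> I" for p
    unfolding g_def by (rule has_order_divide[OF y_has_order[OF that] branch_poly_has_order[OF T(1) that]])
  have "section_has_order p (\<lambda>q. s q * g q) (if p \<in> I then k - h + int (card T) else if p \<in> branch - T then 1 else 0)" for p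
  proof (cases "p \<in> I")
    case True
    thus ?thesis using section_has_order_mult[OF s gI[OF True]] by (simp add: algebra_simps)
  next
    case False
    thus ?thesis using section_has_order_mult[OF s gX[OF False]] T(1) by (auto split: if_splits)
  qed
  moreover have "2 * (k - h + int (card T)) = h - 2 - int (card (branch - T))" using T(2) cT by simp
  ultimately show ?thesis unfolding half_section_def by blast
qed

text \<open>Otherwise all orders would be nonnegative and the spin bundle would have a nonzero
  holomorphic section.\<close>

lemma half_section_neg: assumes "half_section T k s" shows "k < 0"
proof (rule ccontr)
  assume "\<not> k < 0"
  hence "\<exists>l\<ge>0. section_has_order p s l" for p using assms unfolding half_section_def
    by (intro exI[of _ "if p \<in> I then k else if p \<in> T then 1 else 0"]) auto
  thus False by (rule section_has_order_positive_False)
qed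

text \<open>Adding \<open>2 * k = h - 2 - card T\<close> and the same equation for the complement,
  of size \<open>2 * h - card T\<close>, gives \<open>k + k' = -2\<close>. Both are negative, so
  both are -1, and then \<open>card T = h\<close>.\<close>

lemma half_section_card: assumes "half_section T k s" shows "int (card T) = h" "k = -1"
proof -
  obtain k' s' where c: "half_section (branch - T) k' s'" using half_section_compl[OF assms] by blast
  have T: "T \<subseteq> branch" "2 * k = h - 2 - int (card T)" using assms by (auto simp: half_section_def)
  have cT: "int (card (branch - T)) = 2 * h - int (card T)"
    using card_Diff_subset[of T branch] T(1) finite_branch finite_subset card_mono[OF finite_branch T(1)] card_branch
    by (metis of_nat_diff)
  have "2 * k' = h - 2 - int (card (branch - T))" using c by (auto simp: half_section_def)
  thus "int (card T) = h" "k = -1" using T(2) cT half_section_neg[OF assms] half_section_neg[OF c] by linarith+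
qed

text \<open>The divisor \<open>f - f Q\<close> has a double zero at \<open>Q\<close>, which turns
  the simple zero there into a simple pole, and simple poles over infinity, which cancel the order
  -1 of \<open>s\<close>.\<close>

lemma pole_section: assumes hs: "half_section T k s" and Q: "Q \<in> T"
  shows "section_has_order p (\<lambda>q. s q / (f q - f Q)) (if p = Q then -1 else if p \<in> T then 1 else 0)"
proof -
  have T: "T \<subseteq> branch" using hs by (simp add: half_section_def)
  have s: "section_has_order p s (if p \<in> I then -1 else if p \<in> T then 1 else 0)"
    using hs half_section_card(2)[OF hs] by (simp add: half_section_def)
  have QI: "Q \<notin> I" "e Q = 2" using Q T by (auto simp: branch_def)
  have "section_has_order p (\<lambda>q. s q * inverse (f q - f Q)) (if p = Q then -1 else if p \<in> T then 1 else 0)"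
  proof (cases "p \<in> I")
    case True
    have "p \<noteq> Q" "p \<notin> T" using True QI T by (auto simp: branch_def)
    thus ?thesis using section_has_order_mult[OF s has_order_inverse[OF has_order_f_minus_I[OF True, of "f Q"]]] True by simp
  next
    case False
    have "f p = f Q \<longleftrightarrow> p = Q" using branch_fibre[of Q] fibre_f[OF False] Q T by auto
    thus ?thesis using section_has_order_mult[OF s has_order_inverse[OF has_order_f_minus[OF False, of "f Q"]]] False QI(2) Q by auto
  qed
  thus ?thesis by (simp add: divide_inverse)
qed

lemma simple_pole_exists: assumes hs: "half_section T k s" and Q: "Q \<in> T"
  shows "simple_pole_section A L Q (glue_section (\<lambda>q. s q / (f q - f Q)))"
proof -
  let ?v = "\<lambda>q. s q / (f q - f Q)"
  note t = pole_section[OF hs Q]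
  have m: "mero_section_at p ?v" for p using t unfolding mero_section_at_def by blast
  have o: "section_order A L (glue_section ?v) p = (if p = Q then -1 else if p \<in> T then 1 else 0)" for p
    by (rule glue_section_order[OF t])
  have "glue_section ?v \<noteq> 0"
  proof
    assume z: "glue_section ?v = 0"
    have "\<forall>\<^sub>F q in at Q. glue_section ?v (patch_of Q) q \<noteq> 0" by (rule has_order_eventually(2)[OF glue_section_has_order[OF patch_of t]])
    hence "\<forall>\<^sub>F q in at Q. False" by eventually_elim (simp add: z)
    thus False using at_neq_bot_surface by simp
  qed
  thus ?thesis unfolding simple_pole_section_def using glue_section_mero[OF m] o by simp
qed

text \<open>The definition of the spin divisor selects an arbitrary section, so the orders must be
  known for all of them. Subtracting the right multiple of the explicit section removes the pole at
  \<open>Q\<close>; the difference is holomorphic and therefore zero.\<close>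

lemma simple_pole_unique: assumes hs: "half_section T k s" and Q: "Q \<in> T" and S: "simple_pole_section A L Q S"
  shows "section_order A L S p = (if p = Q then -1 else if p \<in> T then 1 else 0)"
proof -
  define v where "v = (\<lambda>q. s q / (f q - f Q))"
  have v: "section_has_order p v (if p = Q then -1 else if p \<in> T then 1 else 0)" for p unfolding v_def by (rule pole_section[OF hs Q])
  have Sm: "S \<in> mero_sections A L" "S \<noteq> 0" and So: "section_order A L S Q = -1" "\<And>R. R \<noteq> Q \<Longrightarrow> section_order A L S R \<ge> 0"
    using S by (auto simp: simple_pole_section_def)
  have Sfam: "section_family L S" and Snm: "\<And>i p. i \<in> indices L \<Longrightarrow> p \<in> patch L i \<Longrightarrow> nmero_at A p (S i)"
    using Sm(1) mero_on_surface_iff[OF patch_open] by (auto simp: mero_sections_def)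
  have S0: "\<And>i p. \<not> (i \<in> indices L \<and> p \<in> patch L i) \<Longrightarrow> S i p = 0"
    and Sc: "\<And>i j p. i \<in> indices L \<Longrightarrow> j \<in> indices L \<Longrightarrow> p \<in> patch L i \<Longrightarrow> p \<in> patch L j \<Longrightarrow> S i p = tr i j p * S j p"
    using Sfam unfolding section_family_def by blast+
  \<comment> \<open>The section \<open>S\<close> is read in the trivialisation selected at each
    point, to be comparable with \<open>v\<close>.\<close>
  define w where "w = (\<lambda>q. S (patch_of q) q)"
  have w_eventually: "\<forall>\<^sub>F q in nhds p. S (patch_of p) q = twist p q * w q" for p
    using eventually_patch[OF patch_of[of p]] by eventually_elim (use Sc[OF patch_of(1) patch_of(1) _ patch_of(2)] in \<open>simp add: twist_def w_def\<close>)
  have gz: "(\<forall>\<^sub>F q in at p. w q = 0) \<or> section_has_order p w (section_order A L S p)" for p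
  proof -
    have "mero_at A p (S (patch_of p))" using nmero_at_mero_at[OF Snm[OF patch_of]] .
    then consider "\<forall>\<^sub>F q in at p. S (patch_of p) q = 0" | n where "has_order A p (S (patch_of p)) n" by (auto simp: mero_at_def)
    thus ?thesis
    proof cases
      case 1
      with eventually_at_of_nhds[OF w_eventually[of p]] eventually_at_of_nhds[OF twist_eventually_nz[of p]]
      have "\<forall>\<^sub>F q in at p. w q = 0" by eventually_elim simp
      thus ?thesis ..
    next
      case 2
      have "section_order A L S p = n" using order_at_eq[OF 2] by (simp add: section_order_def patch_of_def)
      moreover have "section_has_order p w n" unfolding section_has_order_def by (rule has_order_cong_imp[OF 2 eventually_at_of_nhds[OF w_eventually]])
      ultimately show ?thesis by simp
    qed
  qed
  \<comment> \<open>\<open>section_order\<close> is meaningful only where \<open>S\<close> is not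
    locally zero; by the identity principle \<open>S \<noteq> 0\<close> ensures this at every
    point.\<close>
  have "(\<forall>p. \<forall>\<^sub>F q in at p. w q = 0) \<or> (\<forall>p. \<forall>\<^sub>F q in at p. w q \<noteq> 0)"
    by (rule identity_principle) (use gz section_has_order_nz in blast)
  hence wt: "section_has_order p w (section_order A L S p)" for p
  proof
    assume z: "\<forall>p. \<forall>\<^sub>F q in at p. w q = 0"
    have "S (patch_of p) p = 0" for p
    proof -
      have "\<forall>\<^sub>F q in at p. w q = 0" using z by blast
      with eventually_at_of_nhds[OF w_eventually[of p]] have e: "\<forall>\<^sub>F q in at p. S (patch_of p) q = 0" by eventually_elim simp
      from Snm[OF patch_of] consider "hol_at A p (S (patch_of p))" | "S (patch_of p) p = 0" unfolding nmero_at_def by blast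
      thus ?thesis
      proof cases
        case 1
        have "remove_sing A (S (patch_of p)) p = remove_sing A (\<lambda>_. 0) p" by (rule remove_sing_cong[OF e])
        moreover have "remove_sing A (\<lambda>_. 0) p = (\<lambda>_. 0) p" by (rule remove_sing_hol_at[OF hol_at_const])
        ultimately show ?thesis using remove_sing_hol_at[OF 1] by simp
      qed
    qed
    hence "S i p = 0" for i p
      using S0[of i p] Sc[of i "patch_of p" p] patch_of[of p] by (cases "i \<in> indices L \<and> p \<in> patch L i") auto
    hence "S = 0" by (intro ext) simp
    thus ?thesis using Sm(2) by blast
  next
    assume nz: "\<forall>p. \<forall>\<^sub>F q in at p. w q \<noteq> 0"
    have "\<not> (\<forall>\<^sub>F q in at p. w q = 0)"
    proof
      assume "\<forall>\<^sub>F q in at p. w q = 0"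
      moreover have "\<forall>\<^sub>F q in at p. w q \<noteq> 0" using nz by blast
      ultimately have "\<forall>\<^sub>F q in at p. False" by eventually_elim simp
      thus False using at_neq_bot_surface by simp
    qed
    thus ?thesis using gz by blast
  qed
  have wQ: "has_order A Q (\<lambda>q. twist Q q * w q) (-1)" using wt[of Q] So(1) by (simp add: section_has_order_def)
  have vQ: "has_order A Q (\<lambda>q. twist Q q * v q) (-1)" using v[of Q] by (simp add: section_has_order_def)
  \<comment> \<open>The quotient of the two sections has order 0 at \<open>Q\<close>; its value
    there is the ratio of the leading coefficients, hence the constant \<open>c\<close>.\<close>
  define \<phi> where "\<phi> = remove_sing A (\<lambda>q. (twist Q q * w q) / (twist Q q * v q))"
  have q0: "has_order A Q (\<lambda>q. (twist Q q * w q) / (twist Q q * v q)) 0" using has_order_divide[OF wQ vQ] by simp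
  have \<phi>h: "hol_at A Q \<phi>" unfolding \<phi>_def by (rule remove_sing_hol_at') (use q0 in auto)
  have "has_order A Q \<phi> 0" unfolding \<phi>_def by (rule remove_sing_has_order[OF q0])
  define c where "c = \<phi> Q"
  have c0: "c \<noteq> 0" unfolding c_def using hol_at_has_order(2)[OF \<phi>h \<open>has_order A Q \<phi> 0\<close>] by simp
  have \<phi>ev: "\<forall>\<^sub>F q in at Q. \<phi> q = (twist Q q * w q) / (twist Q q * v q)" unfolding \<phi>_def by (rule remove_sing_eq[OF has_order_mero_at[OF q0]])
  have vnz: "\<forall>\<^sub>F q in at Q. twist Q q * v q \<noteq> 0" by (rule has_order_eventually(2)[OF vQ])
  have z: "\<forall>\<^sub>F q in at p. w q - c * v q = 0" for p
  proof (rule no_holo)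
    fix p
    show "(\<forall>\<^sub>F q in at p. w q - c * v q = 0) \<or> (\<exists>k\<ge>0. section_has_order p (\<lambda>q. w q - c * v q) k)"
    proof (cases "p = Q")
      case True
      have ev: "\<forall>\<^sub>F q in at Q. (\<phi> q - c) * (twist Q q * v q) = twist Q q * (w q - c * v q)"
        using \<phi>ev vnz by eventually_elim (simp add: field_simps)
      have hd: "hol_at A Q (\<lambda>q. \<phi> q - c)" by (intro hol_at_diff \<phi>h hol_at_const)
      from hol_at_zero_or_has_order[OF this] show ?thesis
      proof
        assume "\<forall>\<^sub>F q in nhds Q. \<phi> q - c = 0"
        from eventually_at_of_nhds[OF this] ev eventually_at_of_nhds[OF twist_eventually_nz[of Q]]
        have "\<forall>\<^sub>F q in at Q. w q - c * v q = 0" by eventually_elim simp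
        thus ?thesis using True by simp
      next
        assume "\<exists>n\<ge>0. has_order A Q (\<lambda>q. \<phi> q - c) n"
        then obtain n where n: "n \<ge> 0" "has_order A Q (\<lambda>q. \<phi> q - c) n" by blast
        have "n \<noteq> 0" using hol_at_has_order(2)[OF hd n(2)] by (simp add: c_def)
        moreover have "section_has_order Q (\<lambda>q. w q - c * v q) (n + -1)" unfolding section_has_order_def
          by (rule has_order_cong_imp[OF has_order_mult[OF n(2) vQ] ev])
        ultimately show ?thesis using True n(1) by (intro disjI2 exI[of _ "n + -1"]) auto
      qed
    next
      case False
      have w': "has_order A p (\<lambda>q. twist p q * w q) (section_order A L S p)" using wt[of p] by (simp add: section_has_order_def)
      have v': "has_order A p (\<lambda>q. twist p q * v q) (if p \<in> T then 1 else 0)" using v[of p] False by (simp add: section_has_order_def)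
      have "hol_at A p (remove_sing A (\<lambda>q. twist p q * w q))" by (rule remove_sing_hol_at') (use w' So(2)[OF False] in auto)
      moreover have "hol_at A p (remove_sing A (\<lambda>q. twist p q * v q))" by (rule remove_sing_hol_at', rule disjI2, rule exI, rule conjI[OF _ v']) simp
      ultimately have hd: "hol_at A p (\<lambda>q. remove_sing A (\<lambda>q. twist p q * w q) q - c * remove_sing A (\<lambda>q. twist p q * v q) q)"
        by (intro hol_at_diff hol_at_mult hol_at_const)
      have ev: "\<forall>\<^sub>F q in at p. remove_sing A (\<lambda>q. twist p q * w q) q - c * remove_sing A (\<lambda>q. twist p q * v q) q = twist p q * (w q - c * v q)"
        using remove_sing_eq[OF has_order_mero_at[OF w']] remove_sing_eq[OF has_order_mero_at[OF v']] by eventually_elim (simp add: algebra_simps)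
      from hol_at_zero_or_has_order[OF hd] show ?thesis
      proof
        assume "\<forall>\<^sub>F q in nhds p. remove_sing A (\<lambda>q. twist p q * w q) q - c * remove_sing A (\<lambda>q. twist p q * v q) q = 0"
        from eventually_at_of_nhds[OF this] ev eventually_at_of_nhds[OF twist_eventually_nz[of p]]
        have "\<forall>\<^sub>F q in at p. w q - c * v q = 0" by eventually_elim simp
        thus ?thesis ..
      next
        assume "\<exists>n\<ge>0. has_order A p (\<lambda>q. remove_sing A (\<lambda>q. twist p q * w q) q - c * remove_sing A (\<lambda>q. twist p q * v q) q) n"
        thus ?thesis using has_order_cong[OF ev] unfolding section_has_order_def by blast
      qed
    qed
  qed
  have "section_has_order p (\<lambda>q. v q * c) ((if p = Q then -1 else if p \<in> T then 1 else 0) + 0)" by (rule section_has_order_mult[OF v has_order_const[OF c0]])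
  hence "has_order A p (\<lambda>q. twist p q * (v q * c)) (if p = Q then -1 else if p \<in> T then 1 else 0)" by (simp add: section_has_order_def)
  moreover have "\<forall>\<^sub>F q in at p. twist p q * (v q * c) = twist p q * w q" using z[of p] by eventually_elim simp
  ultimately have "section_has_order p w (if p = Q then -1 else if p \<in> T then 1 else 0)" unfolding section_has_order_def by (rule has_order_cong_imp)
  thus ?thesis using section_has_order_unique[OF wt] by blast
qed

lemma spin_points_eq: assumes hs: "half_section T k s" and Q: "Q \<in> T" shows "spin_points A L Q = T - {Q}"
proof -
  define S where "S = (SOME s. simple_pole_section A L Q s)"
  have "simple_pole_section A L Q S"
    unfolding S_def using someI[of "\<lambda>s. simple_pole_section A L Q s", OF simple_pole_exists[OF hs Q]] .
  from simple_pole_unique[OF hs Q this] have "section_order A L S p > 0 \<longleftrightarrow> p \<in> T - {Q}" for p by simp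
  moreover have "spin_points A L Q = {R. section_order A L S R > 0}"
    by (auto simp: spin_points_def spin_divisor_def S_def[symmetric] Let_def)
  ultimately show ?thesis by blast
qed

text \<open>Either \<open>T\<close> or its complement among the branch points contains
  \<open>P\<close>, and both carry a half section.\<close>

lemma branch_configuration: assumes "P \<in> branch"
  shows "\<exists>T. P \<in> T \<and> int (card T) = h \<and> finite T \<and> (\<forall>Q\<in>T. spin_points A L Q = T - {Q})"
proof -
  obtain T k s where T: "half_section T k s" using half_section_exists by blast
  have "\<exists>T k s. P \<in> T \<and> half_section T k s"
  proof (cases "P \<in> T")
    case False
    obtain k' s' where "half_section (branch - T) k' s'" using half_section_compl[OF T] by blast
    thus ?thesis using assms False by (intro exI[of _ "branch - T"]) auto
  qed (use T in blast)
  then obtain T k s where T: "P \<in> T" "half_section T k s" by blast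
  have "finite T" using T(2) finite_branch finite_subset unfolding half_section_def by blast
  thus ?thesis using T(1) half_section_card(1)[OF T(2)] spin_points_eq[OF T(2)] by (intro exI[of _ T]) simp
qed

end

context hyperelliptic_curve
begin

section \<open>Weierstrass points\<close>

text \<open>If P is not a branch point, then \<open>E = F (f - f P) ^ n\<close> vanishes at J P but not at P, and the anti-invariant
part of E contradicts \<open>antiinvariant_zero\<close>.\<close>

lemma weierstrass_branch:
  assumes P: "P \<notin> I" and F: "\<And>q. q \<noteq> P \<Longrightarrow> hol_at A q F" and n: "0 < n" "int n < h" and FP: "has_order A P F (- int n)"
  shows "P \<in> branch"
proof (rule ccontr)
  assume "P \<notin> branch"
  hence e1: "e P = 1" and JP: "J P \<noteq> P" using P J_props(5,6)[OF P] by (auto simp: branch_def)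
  \<comment> \<open>The power \<open>n\<close> cancels the pole of \<open>F\<close> at
    \<open>P\<close>, and it creates a zero at \<open>J P\<close>, where \<open>F\<close> is
    holomorphic.\<close>
  define D where "D = (\<lambda>q. (f q - f P) ^ n)"
  define E where "E = remove_sing A (\<lambda>q. F q * D q)"
  have "has_order A P (\<lambda>q. f q - f P) 1" using has_order_f_minus[OF P, of "f P"] e1 by simp
  from has_order_power[OF this, of n] have "has_order A P D (int n)" by (simp add: D_def)
  from has_order_mult[OF FP this] have s0: "has_order A P (\<lambda>q. F q * D q) 0" by simp
  have D_hol_at: "hol_at A q D" if "q \<notin> I" for q unfolding D_def by (intro hol_at_power hol_at_diff holf that hol_at_const)
  have E_val: "E q = F q * D q" if "q \<notin> I" "q \<noteq> P" for q
    unfolding E_def by (rule remove_sing_hol_at[OF hol_at_mult[OF F[OF that(2)] D_hol_at[OF that(1)]]])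
  have EP_hol_at: "hol_at A P E" unfolding E_def by (rule remove_sing_hol_at') (use s0 in auto)
  have E_hol_at: "hol_at A q E" if q: "q \<notin> I" for q
  proof (cases "q = P")
    case False
    have hh: "hol_at A q (\<lambda>q. F q * D q)" by (intro hol_at_mult F False D_hol_at q)
    from hol_at_zero_or_has_order[OF this] show ?thesis unfolding E_def by (intro remove_sing_hol_at') (auto simp: eventually_nhds_conv_at)
  qed (use EP_hol_at in simp)
  have sE: "has_order A P E 0" unfolding E_def by (rule remove_sing_has_order[OF s0])
  have EP: "E P \<noteq> 0" using hol_at_has_order(2)[OF EP_hol_at sE] by simp
  have PJ: "J P \<notin> I" "f (J P) = f P" using J_props(1,2)[OF P] by auto
  have EJP: "E (J P) = 0" using E_val[OF PJ(1) JP] PJ(2) n(1) by (simp add: D_def zero_power)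
  have bE: "growth (int n) E"
  proof (rule growth_has_order)
    fix i assume i: "i \<in> I"
    have iP: "i \<noteq> P" using i P by blast
    from has_order_power[OF has_order_f_minus_I[OF i, of "f P"], of n] have d: "has_order A i D (- int n)" by (simp add: D_def)
    have g: "mero_at A i (\<lambda>q. F q * D q)" by (rule mero_at_mult[OF hol_at_mero_at[OF F[OF iP]] has_order_mero_at[OF d]])
    have ev: "\<forall>\<^sub>F q in at i. E q = F q * D q" unfolding E_def by (rule remove_sing_eq[OF g])
    from hol_at_zero_or_has_order[OF F[OF iP]]
    show "(\<forall>\<^sub>F q in at i. E q = 0) \<or> (\<exists>k\<ge>- int n. has_order A i E k)"
    proof
      assume "\<forall>\<^sub>F q in nhds i. F q = 0"
      hence "\<forall>\<^sub>F q in at i. F q = 0" by (simp only: eventually_nhds_conv_at)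
      with ev have "\<forall>\<^sub>F q in at i. E q = 0" by eventually_elim simp
      thus ?thesis ..
    next
      assume "\<exists>k\<ge>0. has_order A i F k"
      then obtain k where k: "k \<ge> 0" "has_order A i F k" by blast
      have "has_order A i E (k + - int n)" unfolding E_def by (rule remove_sing_has_order[OF has_order_mult[OF k(2) d]])
      thus ?thesis using k(1) by (intro disjI2 exI[of _ "k + - int n"]) simp
    qed
  qed
  have "E P - E (J P) = 0"
  proof (rule antiinvariant_zero[where E = "\<lambda>p. E p - E (J p)" and k = "int n"])
    show "hol_at A p (\<lambda>p. E p - E (J p))" if "p \<notin> I" for p
      by (intro hol_at_diff E_hol_at that J_hol_at J_props)
    show "E (J p) - E (J (J p)) = - (E p - E (J p))" if "p \<notin> I" for p by (simp add: J_J[OF that])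
    show "growth (int n) (\<lambda>p. E p - E (J p))" by (intro growth_diff growth_J bE)
  qed (use n P in auto)
  thus False using EP EJP by simp
qed

end

section \<open>Normalisation of the function of degree two\<close>

context compact_surface
begin

text \<open>Ramification indices exist because \<open>f - f p\<close> is nowhere locally zero: by
  the identity principle it would vanish near a pole too, and there is at least one pole.\<close>

lemma surface_function_intro:
  assumes finI: "finite I" "I \<noteq> {}" and h: "\<And>p. p \<notin> I \<Longrightarrow> hol_at A p f"
    and pole: "\<And>p. p \<in> I \<Longrightarrow> 0 < m p \<and> has_order A p f (- int (m p))"
  shows "surface_function A f I m (\<lambda>p. nat (order_at A (\<lambda>q. f q - f p) p))"
proof
  fix p assume p: "p \<notin> I"
  define v where "v = (\<lambda>q. f q - f p)"
  have vI: "has_order A q v (- int (m q))" if "q \<in> I" for q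
    using pole[OF that] germ_order_minus_const[of "\<lambda>t. f (param A q t)" "- int (m q)" "f p"] by (simp add: has_order_def v_def)
  have gz: "(\<forall>\<^sub>F x in at q. v x = 0) \<or> (\<exists>n. has_order A q v n)" for q
  proof (cases "q \<in> I")
    case False
    have "hol_at A q v" unfolding v_def by (intro hol_at_diff h False hol_at_const)
    from hol_at_mero_at[OF this] show ?thesis by (simp add: mero_at_def)
  qed (use vI in blast)
  have "(\<forall>q. \<forall>\<^sub>F x in at q. v x = 0) \<or> (\<forall>q. \<forall>\<^sub>F x in at q. v x \<noteq> 0)"
    by (rule identity_principle) (use gz has_order_eventually(2) in blast)
  moreover have "\<not> (\<forall>q. \<forall>\<^sub>F x in at q. v x = 0)"
  proof
    assume z: "\<forall>q. \<forall>\<^sub>F x in at q. v x = 0"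
    obtain q where q: "q \<in> I" using finI(2) by blast
    have "\<forall>\<^sub>F x in at q. v x = 0" using z by blast
    hence "\<forall>\<^sub>F x in at q. False" using has_order_eventually(2)[OF vI[OF q]] by eventually_elim simp
    thus False using at_neq_bot_surface by simp
  qed
  ultimately have nz: "\<forall>\<^sub>F x in at p. v x \<noteq> 0" by blast
  have vh: "hol_at A p v" unfolding v_def by (intro hol_at_diff h p hol_at_const)
  from hol_at_zero_or_has_order[OF this] obtain n where n: "n \<ge> 0" "has_order A p v n"
  proof
    assume "\<forall>\<^sub>F x in nhds p. v x = 0"
    hence "\<forall>\<^sub>F x in at p. v x = 0" by (simp only: eventually_nhds_conv_at)
    hence "\<forall>\<^sub>F x in at p. False" using nz by eventually_elim simp
    thus ?thesis using at_neq_bot_surface by simp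
  qed blast
  have "n \<noteq> 0" using hol_at_has_order(2)[OF vh n(2)] by (simp add: v_def)
  moreover have "order_at A v p = n" by (rule order_at_eq[OF n(2)])
  ultimately show "0 < nat (order_at A (\<lambda>q. f q - f p) p) \<and> has_order A p (\<lambda>q. f q - f p) (int (nat (order_at A (\<lambda>q. f q - f p) p)))"
    using n by (simp add: v_def[symmetric])
qed (use assms in auto)

end

context surface_function
begin

text \<open>Every sufficiently large value has an unramified fibre, which then consists of two
  points. Taking it larger in modulus than \<open>f P\<close> keeps \<open>P\<close> out of the
  fibre.\<close>

lemma two_simple_fibre:
  assumes deg: "sum m I = 2" "I \<noteq> {}"
  shows "\<exists>c p0 p1. p0 \<noteq> p1 \<and> fibre c = {p0, p1} \<and> e p0 = 1 \<and> e p1 = 1 \<and> P \<notin> fibre c"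
proof -
  have "\<forall>\<^sub>F c' in at_infinity. (deg c' = sum m I \<and> (\<forall>q\<in>fibre c'. e q = 1)) \<and> norm (f P) + 1 \<le> norm (c' :: complex)"
  proof -
    have "\<forall>\<^sub>F c' in at_infinity. norm (f P) + 1 \<le> norm (c' :: complex)" unfolding eventually_at_infinity by blast
    with deg_infinity show ?thesis by (rule eventually_conj)
  qed
  then obtain B where B: "\<And>c'::complex. B \<le> norm c' \<Longrightarrow> (deg c' = sum m I \<and> (\<forall>q\<in>fibre c'. e q = 1)) \<and> norm (f P) + 1 \<le> norm c'"
    unfolding eventually_at_infinity by blast
  define c :: complex where "c = of_real \<bar>B\<bar>"
  have c: "deg c = sum m I" "\<And>q. q \<in> fibre c \<Longrightarrow> e q = 1" "norm (f P) + 1 \<le> norm c" using B[of c] by (auto simp: c_def)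
  have "card (fibre c) = deg c" using c(2) by (simp add: deg_def)
  hence "card (fibre c) = 2" using c(1) deg by simp
  then obtain p0 p1 where "fibre c = {p0, p1}" "p0 \<noteq> p1" by (auto simp: card_2_iff)
  moreover have "P \<notin> fibre c" using c(3) by (auto simp: fibre_def)
  ultimately show ?thesis using c(2) by blast
qed

text \<open>Composition with \<open>1 / (f - c)\<close> for such a value \<open>c\<close> makes the
  two points of the fibre the poles and the old poles zeros.\<close>

lemma moebius_double_cover:
  assumes deg: "sum m I = 2" "I \<noteq> {}"
  shows "\<exists>f' p0 p1 e'. P \<notin> {p0, p1} \<and> double_cover A f' {p0, p1} (\<lambda>_. 1) e' p0 p1"
proof -
  obtain c p0 p1 where c: "p0 \<noteq> p1" "fibre c = {p0, p1}" "e p0 = 1" "e p1 = 1" "P \<notin> fibre c"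
    using two_simple_fibre[OF deg] by blast
  define v where "v = (\<lambda>q. inverse (f q - c))"
  \<comment> \<open>The value 0 at the old poles, the limit of \<open>v\<close>, is inserted by hand
    because \<open>f\<close> is arbitrary there.\<close>
  define f' where "f' = (\<lambda>q. if q \<in> I then 0 else v q)"
  have fibI: "p \<notin> I" "f p = c" if "p \<in> {p0, p1}" for p using that c(2) by (auto simp: fibre_def)
  have ev: "\<forall>\<^sub>F q in at p. f' q = v q" for p using eventually_at_notI[of p] by eventually_elim (simp add: f'_def)
  have h1: "hol_at A p f'" if p: "p \<notin> {p0, p1}" for p
  proof (cases "p \<in> I")
    case True
    have "germ_order (\<lambda>t. f (param A p t) - c) (- int (m p))"
      using germ_order_minus_const[of "\<lambda>t. f (param A p t)" "- int (m p)" c] polef[OF True] by (simp add: has_order_def)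
    hence "has_order A p (\<lambda>q. f q - c) (- int (m p))" by (simp add: has_order_def)
    from has_order_inverse[OF this] have s: "has_order A p v (int (m p))" by (simp add: v_def)
    have rh: "hol_at A p (remove_sing A v)" by (rule remove_sing_hol_at') (use s in auto)
    have "remove_sing A v p = 0" using hol_at_has_order(2)[OF rh remove_sing_has_order[OF s]] polef[OF True] by simp
    hence v0: "f' p = remove_sing A v p" using True by (simp add: f'_def)
    have "\<forall>\<^sub>F q in at p. f' q = remove_sing A v q" using ev[of p] remove_sing_eq[OF has_order_mero_at[OF s]] by eventually_elim simp
    with v0 have "\<forall>\<^sub>F q in nhds p. f' q = remove_sing A v q" by (simp only: eventually_nhds_conv_at)
    from hol_at_cong[OF this] rh show ?thesis by simp
  next
    case False
    have ne: "f p - c \<noteq> 0" using p c(2) False by (auto simp: fibre_def)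
    have "hol_at A p v" unfolding v_def by (rule hol_at_inverse[OF hol_at_diff[OF holf[OF False] hol_at_const] ne])
    moreover have "\<forall>\<^sub>F q in nhds p. f' q = v q" using eventually_notI[OF False] by eventually_elim (simp add: f'_def)
    ultimately show ?thesis using hol_at_cong by blast
  qed
  have h2: "has_order A p f' (- 1)" if p: "p \<in> {p0, p1}" for p
  proof -
    have "has_order A p (\<lambda>q. f q - c) 1" using ordf[OF fibI(1)[OF p]] fibI(2)[OF p] c(3,4) p by auto
    from has_order_inverse[OF this] have "has_order A p v (-1)" by (simp add: v_def)
    thus ?thesis using has_order_cong[OF ev] by blast
  qed
  interpret g: surface_function A f' "{p0, p1}" "\<lambda>_. 1" "\<lambda>p. nat (order_at A (\<lambda>q. f' q - f' p) p)"
    by (rule surface_function_intro) (use h1 h2 in auto)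
  have "double_cover A f' {p0, p1} (\<lambda>_. 1) (\<lambda>p. nat (order_at A (\<lambda>q. f' q - f' p) p)) p0 p1"
    by unfold_locales (use c(1) in auto)
  thus ?thesis using c(2,5) by blast
qed

end

text \<open>A finite value of \<open>h0\<close> includes a finite spanning set. Without it dimension
  0 would prove nothing, as an infinite basis has cardinality 0 too.\<close>

lemma h0_zero_imp: assumes "h0 A L = 0" shows "holo_sections A L = {0}"
proof -
  let ?V = "holo_sections A L"
  from assms have ex: "\<exists>B. finite B \<and> sections.span B = ?V" and d: "sections.dim ?V = 0"
    by (auto simp: h0_def zero_enat_def split: if_splits)
  obtain B0 where B0: "finite B0" "sections.span B0 = ?V" using ex by blast
  obtain B where B: "B \<subseteq> ?V" "sections.independent B" "?V \<subseteq> sections.span B" "card B = sections.dim ?V"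
    by (rule sections.basis_exists)
  have "finite B" using sections.independent_span_bound[OF B0(1) B(2)] B(1) B0(2) by simp
  hence "B = {}" using B(4) d by simp
  hence "?V \<subseteq> {0}" using B(3) by simp
  moreover have "0 \<in> ?V" using sections.span_zero[of B0] B0(2) by simp
  ultimately show ?thesis by blast
qed

lemma weierstrass_configuration:
  fixes A :: "('a::t2_space) chart set" and L :: "('a, 'i) line_bundle"
  assumes hyp: "hyperelliptic A" and g: "genus A = enat g" "g \<ge> 2"
    and L: "nonsingular_even_spin_bundle A L" and wp: "weierstrass_point A P"
  shows "\<exists>T. P \<in> T \<and> card T = g + 1 \<and> finite T \<and> (\<forall>Q\<in>T. spin_points A L Q = T - {Q})"
proof -
  have crs: "holo_atlas A" "connected (UNIV :: 'a set)" "compact (UNIV :: 'a set)"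
    using hyp by (auto simp: hyperelliptic_def compact_riemann_surface_def riemann_surface_def)
  interpret compact_surface A using crs by unfold_locales auto
  obtain f0 where f0: "mero_on_surface A f0 UNIV" "finite (pole_set A f0)" "(\<Sum>p\<in>pole_set A f0. - order_at A f0 p) = 2"
    using hyp unfolding hyperelliptic_def by blast
  have nm: "nmero_at A p f0" for p using f0(1) mero_on_surface_iff[OF open_UNIV] by blast
  define m where "m = (\<lambda>p. nat (- order_at A f0 p))"
  have pole: "0 < m p \<and> has_order A p f0 (- int (m p))" if p: "p \<in> pole_set A f0" for p
  proof -
    obtain n where n: "n < 0" "has_order A p f0 n" using p pole_set_iff[OF nm] by blast
    thus ?thesis using order_at_eq[OF n(2)] by (simp add: m_def)
  qed
  have hol_at: "hol_at A p f0" if "p \<notin> pole_set A f0" for p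
    using that nm[of p] pole_set_iff[OF nm, of p] unfolding nmero_at_def by blast
  have ne: "pole_set A f0 \<noteq> {}" using f0(3) by auto
  have "int (sum m (pole_set A f0)) = (\<Sum>p\<in>pole_set A f0. - order_at A f0 p)"
    unfolding of_nat_sum
  proof (rule sum.cong[OF refl])
    fix p assume p: "p \<in> pole_set A f0"
    show "int (m p) = - order_at A f0 p" using pole[OF p] by (simp add: m_def)
  qed
  hence "int (sum m (pole_set A f0)) = 2" using f0(3) by (simp only:)
  hence deg: "sum m (pole_set A f0) = 2" by linarith
  interpret m0: surface_function A f0 "pole_set A f0" m "\<lambda>p. nat (order_at A (\<lambda>q. f0 q - f0 p) p)"
    by (rule surface_function_intro) (use f0(2) ne hol_at pole in auto)
  obtain f p0 p1 e where PI: "P \<notin> {p0, p1}" and d2: "double_cover A f {p0, p1} (\<lambda>_. 1) e p0 p1"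
    using m0.moebius_double_cover[OF deg ne] by blast
  interpret d: double_cover A f "{p0, p1}" "\<lambda>_. 1" e p0 p1 by (rule d2)
  obtain y where y: "\<forall>p. p \<notin> {p0, p1} \<longrightarrow> hol_at A p y \<and> (y p)\<^sup>2 = d.branch_poly d.branch (f p) \<and> y (d.J p) = - y p"
    using d.y_exists by blast
  interpret d: hyperelliptic_curve A f "{p0, p1}" "\<lambda>_. 1" e p0 p1 y by unfold_locales (use y in auto)
  have "genus A = enat (sections.dim (holo_sections A (canonical_bundle A)))"
    using g(1) by (auto simp: genus_def h0_def split: if_splits)
  \<comment> \<open>The genus is \<open>nat (h - 1)\<close>; being positive, it is not the result of
    truncation.\<close>
  hence hg: "d.h = int g + 1" using d.dim_K g by simp
  obtain F where F: "mero_on_surface A F UNIV" "pole_set A F = {P}" "enat (nat (- order_at A F P)) \<le> genus A"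
    using wp unfolding weierstrass_point_def by blast
  have Fnm: "nmero_at A p F" for p using F(1) mero_on_surface_iff[OF open_UNIV] by blast
  have Fhol: "hol_at A q F" if "q \<noteq> P" for q
    using that F(2) Fnm[of q] pole_set_iff[OF Fnm, of q] unfolding nmero_at_def by blast
  obtain k where k: "k < 0" "has_order A P F k" using F(2) pole_set_iff[OF Fnm, of P] by blast
  define n where "n = nat (- k)"
  have n: "0 < n" "has_order A P F (- int n)" using k by (auto simp: n_def)
  have "n \<le> g" using F(3) g(1) order_at_eq[OF k(2)] by (simp add: n_def)
  \<comment> \<open>A pole order at most the genus is exactly a pole order below
    \<open>h\<close>.\<close>
  hence "int n < d.h" using hg by linarith
  hence PB: "P \<in> d.branch" using d.weierstrass_branch[OF PI Fhol n(1) _ n(2)] by blast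
  have Lb: "is_line_bundle A L" and Liso: "bundle_iso A (bundle_square L) (canonical_bundle A)" and L0: "h0 A L = 0"
    using L by (auto simp: nonsingular_even_spin_bundle_def spin_bundle_def)
  have sq: "indices (bundle_square L) = indices L" "patch (bundle_square L) = patch L"
    "transition (bundle_square L) i j p = (transition L i j p)\<^sup>2" for i j p
    by (simp_all add: bundle_square_def)
  obtain hh where hh: "\<forall>i\<in>indices L. \<forall>j\<in>A. holo_on_surface A (hh i j) (patch L i \<inter> fst j) \<and> (\<forall>p \<in> patch L i \<inter> fst j. hh i j p \<noteq> 0)"
    "\<forall>i\<in>indices L. \<forall>i'\<in>indices L. \<forall>j\<in>A. \<forall>j'\<in>A. \<forall>p \<in> patch L i \<inter> patch L i' \<inter> fst j \<inter> fst j'.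
             hh i j p * chart_deriv j (snd j') p = (transition L i i' p)\<^sup>2 * hh i' j' p"
    using Liso unfolding bundle_iso_def sq d.K_simps by blast
  interpret s: spin A f "{p0, p1}" "\<lambda>_. 1" e p0 p1 y L hh
    by unfold_locales (use Lb hh h0_zero_imp[OF L0] in blast)+
  obtain T where T: "P \<in> T" "int (card T) = d.h" "finite T" "\<forall>Q\<in>T. spin_points A L Q = T - {Q}"
    using s.branch_configuration[OF PB] by blast
  have "card T = g + 1" using T(2) hg by simp
  with T show ?thesis by blast
qed

section \<open>The spin group\<close>

text \<open>The cycle sending \<open>a\<close> to \<open>b\<close>, \<open>b\<close> to
  \<open>c\<close> and \<open>c\<close> to \<open>a\<close>, in the form to which
  \<open>cycle_of_list [a, b, c]\<close> unfolds.\<close>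

definition cyc3 :: "'a \<Rightarrow> 'a \<Rightarrow> 'a \<Rightarrow> 'a \<Rightarrow> 'a" where
  "cyc3 a b c = Transposition.transpose a b \<circ> Transposition.transpose b c"

lemma cyc3_apply:
  assumes "a \<noteq> b" "b \<noteq> c" "a \<noteq> c"
  shows "cyc3 a b c x = (if x = a then b else if x = b then c else if x = c then a else x)"
  using assms by (auto simp: cyc3_def Transposition.transpose_def)

lemma cyc3_permutes: assumes "{a, b, c} \<subseteq> X" shows "cyc3 a b c permutes X"
  unfolding cyc3_def using assms by (intro permutes_compose permutes_swap_id) auto

lemma cyc3_even: assumes "a \<noteq> b" "b \<noteq> c" shows "evenperm (cyc3 a b c)"
  unfolding cyc3_def using assms by (simp add: evenperm_comp permutation_swap_id evenperm_swap)

text \<open>Induction over products of transpositions: injectivity of \<open>b\<close> carries a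
  nontrivial transposition to a nontrivial one.\<close>

lemma evenperm_map_permutation:
  assumes "finite X" "inj_on b X" "p permutes X"
  shows "evenperm (map_permutation X b p) \<longleftrightarrow> evenperm p"
  using assms(3,1)
proof (induction p rule: permutes_induct)
  case id
  show ?case unfolding map_permutation_id'[OF assms(2)] by (simp only: evenperm_id)
next
  case (swap x y p)
  have mp: "permutation (map_permutation X b p)"
  proof -
    have "map_permutation X b p permutes (b ` X)"
      by (rule map_permutation_permutes[of b X "b ` X"]) (use assms(2) swap in \<open>auto simp: bij_betw_def\<close>)
    thus ?thesis using assms(1) permutation_permutes by blast
  qed
  have pp: "permutation p" using swap assms(1) permutation_permutes by blast
  have "map_permutation X b (Transposition.transpose x y \<circ> p) = Transposition.transpose (b x) (b y) \<circ> map_permutation X b p"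
    using map_permutation_compose'[OF assms(2), of p "Transposition.transpose x y"] map_permutation_transpose[OF assms(2)] swap by simp
  moreover have "b x = b y \<longleftrightarrow> x = y" using assms(2) swap by (auto dest: inj_onD)
  ultimately show ?case
    using evenperm_comp[OF permutation_swap_id mp, of "b x" "b y"] evenperm_comp[OF permutation_swap_id pp, of x y] swap(4,5)
    by (simp only: evenperm_swap)
qed

text \<open>A recursive form of the indexed condition in \<open>spin_chain\<close>. The endpoints
  are left free, so that an induction can strip off the first edge.\<close>

fun walk :: "('a \<Rightarrow> 'a \<Rightarrow> 'b \<Rightarrow> bool) \<Rightarrow> 'a list \<Rightarrow> 'b list \<Rightarrow> bool" where
  "walk C (Q # R # ps) (F # Fs) \<longleftrightarrow> C Q R F \<and> walk C (R # ps) Fs"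
| "walk C [Q] [] \<longleftrightarrow> True"
| "walk C _ _ \<longleftrightarrow> False"

lemma walk_iff:
  "walk C ps Fs \<longleftrightarrow> length ps = Suc (length Fs) \<and> (\<forall>n<length Fs. C (ps ! n) (ps ! Suc n) (Fs ! n))"
  by (induction C ps Fs rule: walk.induct) (auto simp: less_Suc_eq_0_disj)

text \<open>The common endpoint is listed by both walks and kept once, hence the
  \<open>tl\<close>.\<close>

lemma walk_append:
  "walk C ps Fs \<Longrightarrow> walk C ps' Fs' \<Longrightarrow> last ps = hd ps' \<Longrightarrow> walk C (ps @ tl ps') (Fs @ Fs')"
proof (induction C ps Fs rule: walk.induct)
  case (2 C Q)
  thus ?case by (cases ps') auto
qed auto

lemma chain_transport_append:
  "walk C ps Fs \<Longrightarrow> walk C ps' Fs' \<Longrightarrow> last ps = hd ps' \<Longrightarrow>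
    chain_transport (ps @ tl ps') (Fs @ Fs') = chain_transport ps' Fs' \<circ> chain_transport ps Fs"
proof (induction C ps Fs rule: walk.induct)
  case (1 C Q R ps F Fs)
  thus ?case by (simp add: o_assoc)
next
  case (2 C Q)
  thus ?case by (cases ps') auto
qed auto

section \<open>Spin chains on a complete graph\<close>

locale spin_configuration =
  fixes A :: "('a::t2_space) chart set" and L :: "('a, 'i) line_bundle" and T :: "'a set" and P :: 'a and g :: nat
  assumes PT: "P \<in> T" and cT: "card T = g + 1" and finT: "finite T"
    and pts: "\<And>Q. Q \<in> T \<Longrightarrow> spin_points A L Q = T - {Q}"
begin

lemma vertices: "spin_vertices A L P = T"
proof (intro equalityI subsetI)
  fix x assume "x \<in> spin_vertices A L P"
  thus "x \<in> T"
  proof induction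
    case (step Q R)
    thus ?case using pts[OF step(3)] by blast
  qed (rule PT)
next
  fix x assume x: "x \<in> T"
  show "x \<in> spin_vertices A L P"
  proof (cases "x = P")
    case False
    hence "x \<in> spin_points A L P" using pts[OF PT] x by blast
    thus ?thesis by (rule spin_vertices.step[OF spin_vertices.base])
  qed (simp add: spin_vertices.base)
qed

lemma edge: "spin_edge A L P Q R \<longleftrightarrow> Q \<in> T \<and> R \<in> T \<and> Q \<noteq> R"
  using pts[of Q] by (auto simp: spin_edge_def vertices)

lemma faces: "F \<in> spin_faces A L P \<longleftrightarrow> (\<exists>Q R S. F = {Q, R, S} \<and> Q \<noteq> R \<and> R \<noteq> S \<and> Q \<noteq> S \<and> {Q, R, S} \<subseteq> T)"
  unfolding spin_faces_def edge by blast

definition face_step :: "'a \<Rightarrow> 'a \<Rightarrow> 'a set \<Rightarrow> bool" where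
  "face_step Q R F \<longleftrightarrow> spin_edge A L P Q R \<and> F \<in> spin_faces A L P \<and> {Q, R} \<subseteq> F"

lemma chain_walk: "spin_chain A L P ps Fs \<longleftrightarrow> (\<exists>Qs. ps = P # Qs @ [P]) \<and> walk face_step ps Fs"
  unfolding spin_chain_def walk_iff face_step_def by blast

lemma face_stepI: assumes "Q \<noteq> R" "R \<noteq> S" "Q \<noteq> S" "{Q, R, S} \<subseteq> T" shows "face_step Q R {Q, R, S}"
  unfolding face_step_def edge faces using assms by blast

lemma face_stepE: assumes "face_step Q R F"
  obtains S where "F = {Q, R, S}" "Q \<noteq> R" "R \<noteq> S" "Q \<noteq> S" "{Q, R, S} \<subseteq> T"
proof -
  have QR: "Q \<noteq> R" "{Q, R} \<subseteq> F" and Ff: "F \<in> spin_faces A L P" using assms unfolding face_step_def edge by simp_all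
  obtain X Y Z where F: "F = {X, Y, Z}" "X \<noteq> Y" "Y \<noteq> Z" "X \<noteq> Z" "{X, Y, Z} \<subseteq> T"
    using Ff unfolding faces by (elim exE conjE)
  have "card F = 3" using F by simp
  hence "card (F - {Q, R}) = 1" using QR by (subst card_Diff_subset) simp_all
  then obtain S where S: "F - {Q, R} = {S}" by (auto simp: card_1_singleton_iff)
  have "F = {Q, R} \<union> (F - {Q, R})" using QR(2) by blast
  hence "F = {Q, R, S}" unfolding S by (simp add: insert_commute)
  moreover have "R \<noteq> S" "Q \<noteq> S" using S by blast+
  moreover have "F \<subseteq> T" using F(1,5) by simp
  ultimately show ?thesis using QR(1) by (intro that[of S]) (simp_all only: not_False_eq_True)
qed

lemma edge_transport_eq: assumes "Q \<noteq> R" "R \<noteq> S" "Q \<noteq> S" "x \<noteq> Q"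
  shows "edge_transport {Q, R, S} Q R x = cyc3 Q R S x"
proof -
  have "(THE X. X \<in> {Q, R, S} - {Q, R}) = S" by (rule the_equality) (use assms in auto)
  thus ?thesis using assms by (auto simp: edge_transport_def cyc3_apply)
qed

text \<open>As a permutation of T the 3-cycle \<open>Q \<mapsto> R \<mapsto> S \<mapsto> Q\<close> extends the transport from Q to R, which leaves Q out.\<close>

lemma walk_perm:
  "walk face_step ps Fs \<Longrightarrow> \<exists>\<pi>. \<pi> permutes T \<and> evenperm \<pi> \<and> \<pi> (hd ps) = last ps \<and> (\<forall>x. x \<noteq> hd ps \<longrightarrow> chain_transport ps Fs x = \<pi> x)"
proof (induction "face_step" ps Fs rule: walk.induct)
  case (1 Q R ps F Fs)
  obtain \<pi> where \<pi>: "\<pi> permutes T" "evenperm \<pi>" "\<pi> R = last (R # ps)"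
    "\<forall>x. x \<noteq> R \<longrightarrow> chain_transport (R # ps) Fs x = \<pi> x" using 1 by auto
  have "face_step Q R F" using 1 by simp
  then obtain S where S: "F = {Q, R, S}" "Q \<noteq> R" "R \<noteq> S" "Q \<noteq> S" "{Q, R, S} \<subseteq> T" by (rule face_stepE)
  have c: "cyc3 Q R S permutes T" "evenperm (cyc3 Q R S)" using cyc3_permutes[OF S(5)] cyc3_even[OF S(2,3)] by auto
  have "\<pi> \<circ> cyc3 Q R S permutes T" by (rule permutes_compose[OF c(1) \<pi>(1)])
  moreover have "evenperm (\<pi> \<circ> cyc3 Q R S)"
    using evenperm_comp[of \<pi> "cyc3 Q R S"] \<pi>(1,2) c finT permutation_permutes by blast
  moreover have "(\<pi> \<circ> cyc3 Q R S) Q = last (Q # R # ps)" using \<pi>(3) S by (simp add: cyc3_apply)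
  moreover have "chain_transport (Q # R # ps) (F # Fs) x = (\<pi> \<circ> cyc3 Q R S) x" if "x \<noteq> Q" for x
  proof -
    \<comment> \<open>Only \<open>Q\<close> is sent to \<open>R\<close>. The transported point
      therefore avoids the new starting vertex, as the induction hypothesis demands.\<close>
    have "cyc3 Q R S x \<noteq> R" using that S by (auto simp: cyc3_apply)
    thus ?thesis using \<pi>(4) edge_transport_eq[OF S(2,3,4) that] S(1) by simp
  qed
  ultimately show ?case by (intro exI[of _ "\<pi> \<circ> cyc3 Q R S"]) simp
next
  case (2 Q)
  show ?case by (rule exI[of _ id]) (simp add: permutes_id)
qed auto

abbreviation "X \<equiv> T - {P}"

definition chain_perms :: "('a \<Rightarrow> 'a) set" where "chain_perms = {chain_perm A L P ps Fs | ps Fs. spin_chain A L P ps Fs}"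

text \<open>Along a closed walk the even permutation of \<open>T\<close> fixes \<open>P\<close>, so
  it restricts to the other vertices without changing its parity.\<close>

lemma chain_perm_perm: assumes "spin_chain A L P ps Fs"
  shows "chain_perm A L P ps Fs permutes X" "evenperm (chain_perm A L P ps Fs)"
proof -
  obtain Qs where ps: "ps = P # Qs @ [P]" and w: "walk face_step ps Fs" using assms unfolding chain_walk by blast
  obtain \<pi> where \<pi>: "\<pi> permutes T" "evenperm \<pi>" "\<pi> P = P" "\<forall>x. x \<noteq> P \<longrightarrow> chain_transport ps Fs x = \<pi> x"
    using walk_perm[OF w] ps by auto
  have "chain_perm A L P ps Fs = \<pi>"
  proof
    fix x show "chain_perm A L P ps Fs x = \<pi> x"
      using \<pi>(3,4) permutes_not_in[OF \<pi>(1), of x] pts[OF PT] by (auto simp: chain_perm_def)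
  qed
  moreover have "\<pi> permutes X"
    by (rule permutes_superset[OF \<pi>(1)]) (use \<pi>(3) in auto)
  ultimately show "chain_perm A L P ps Fs permutes X" "evenperm (chain_perm A L P ps Fs)" using \<pi>(2) by auto
qed

lemma chain_perms_comp: assumes "\<pi> \<in> chain_perms" "\<sigma> \<in> chain_perms" shows "\<sigma> \<circ> \<pi> \<in> chain_perms"
proof -
  obtain ps Fs where c: "spin_chain A L P ps Fs" "\<pi> = chain_perm A L P ps Fs" using assms(1) unfolding chain_perms_def by blast
  obtain ps' Fs' where c': "spin_chain A L P ps' Fs'" "\<sigma> = chain_perm A L P ps' Fs'" using assms(2) unfolding chain_perms_def by blast
  obtain Qs where ps: "ps = P # Qs @ [P]" and w: "walk face_step ps Fs" using c(1) unfolding chain_walk by blast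
  obtain Qs' where ps': "ps' = P # Qs' @ [P]" and w': "walk face_step ps' Fs'" using c'(1) unfolding chain_walk by blast
  have lh: "last ps = hd ps'" using ps ps' by simp
  have "spin_chain A L P (ps @ tl ps') (Fs @ Fs')"
    unfolding chain_walk using walk_append[OF w w' lh] ps ps' by auto
  moreover have "chain_perm A L P (ps @ tl ps') (Fs @ Fs') = \<sigma> \<circ> \<pi>"
  proof
    fix x
    have t: "chain_transport (ps @ tl ps') (Fs @ Fs') = chain_transport ps' Fs' \<circ> chain_transport ps Fs"
      by (rule chain_transport_append[OF w w' lh])
    show "chain_perm A L P (ps @ tl ps') (Fs @ Fs') x = (\<sigma> \<circ> \<pi>) x"
    proof (cases "x \<in> X")
      case True
      \<comment> \<open>The second permutation follows the transport only on \<open>X\<close>, so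
        the first must not lead out of it.\<close>
      have "\<pi> x \<in> X" unfolding c(2) permutes_in_image[OF chain_perm_perm(1)[OF c(1)]] by (rule True)
      thus ?thesis using True t pts[OF PT] c(2) c'(2) by (simp add: chain_perm_def)
    next
      case False
      hence "x \<notin> spin_points A L P" using pts[OF PT] by blast
      thus ?thesis unfolding c(2) c'(2) chain_perm_def by simp
    qed
  qed
  ultimately show ?thesis unfolding chain_perms_def by (intro CollectI exI conjI) (auto simp only:)
qed

text \<open>Going from \<open>P\<close> to \<open>a\<close> through the face with \<open>b\<close>
  and back through the face with \<open>c\<close> composes the cycles \<open>P a b\<close> and
  \<open>a P c\<close>. The composite fixes \<open>P\<close> and sends \<open>a\<close> to
  \<open>b\<close>, \<open>b\<close> to \<open>c\<close> and \<open>c\<close> to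
  \<open>a\<close>.\<close>

lemma chain_perms_cyc3: assumes "a \<noteq> b" "b \<noteq> c" "a \<noteq> c" "{a, b, c} \<subseteq> X" shows "cyc3 a b c \<in> chain_perms"
proof -
  have T: "{a, b, c} \<subseteq> T" and P: "a \<noteq> P" "b \<noteq> P" "c \<noteq> P" using assms(4) by auto
  have w: "walk face_step [P, a, P] [{P, a, b}, {a, P, c}]"
    using face_stepI[of P a b] face_stepI[of a P c] assms P T PT by auto
  hence sc: "spin_chain A L P [P, a, P] [{P, a, b}, {a, P, c}]" unfolding chain_walk by (intro conjI exI[of _ "[a]"]) auto
  have "chain_perm A L P [P, a, P] [{P, a, b}, {a, P, c}] = cyc3 a b c"
  proof
    fix x
    show "chain_perm A L P [P, a, P] [{P, a, b}, {a, P, c}] x = cyc3 a b c x"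
    proof (cases "x \<in> X")
      case True
      hence xP: "x \<noteq> P" by blast
      have e1: "edge_transport {P, a, b} P a x = cyc3 P a b x" using edge_transport_eq[of P a b x] P assms xP by auto
      have "cyc3 P a b x \<noteq> a" using P assms xP by (auto simp: cyc3_apply)
      hence e2: "edge_transport {a, P, c} a P (cyc3 P a b x) = cyc3 a P c (cyc3 P a b x)"
        using edge_transport_eq[of a P c] P assms by auto
      have "cyc3 a P c (cyc3 P a b x) = cyc3 a b c x" using P assms xP by (auto simp: cyc3_apply)
      thus ?thesis using e1 e2 True pts[OF PT] by (simp add: chain_perm_def)
    next
      case False
      hence "x \<notin> spin_points A L P" using pts[OF PT] by blast
      thus ?thesis using permutes_not_in[OF cyc3_permutes[OF assms(4)] False] unfolding chain_perm_def by simp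
    qed
  qed
  thus ?thesis using sc unfolding chain_perms_def by (intro CollectI exI conjI) (auto simp only:)
qed

end

section \<open>Identification with the alternating group\<close>

locale spin_configuration3 = spin_configuration A L T P g
  for A :: "('a::t2_space) chart set" and L :: "('a, 'i) line_bundle" and T P g +
  assumes g3: "g \<ge> 3"
begin

lemma cX: "card X = g" "finite X" using cT PT finT by auto

text \<open>A chain lists \<open>P\<close> at both ends, and a vertex is not joined to itself, so
  there is no empty chain. The identity arises instead as the cube of a 3-cycle, available since
  \<open>g \<ge> 3\<close>.\<close>

lemma chain_perms_id: "id \<in> chain_perms"
proof -
  have "3 \<le> card X" using cX g3 by simp
  then obtain Y where "Y \<subseteq> X" "card Y = 3" by (rule obtain_subset_with_card_n)
  then obtain a b c where abc: "{a, b, c} \<subseteq> X" "a \<noteq> b" "b \<noteq> c" "a \<noteq> c" by (auto simp: card_3_iff)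
  have "cyc3 a b c \<in> chain_perms" using abc by (intro chain_perms_cyc3)
  hence "cyc3 a b c \<circ> (cyc3 a b c \<circ> cyc3 a b c) \<in> chain_perms" by (intro chain_perms_comp)
  moreover have "cyc3 a b c \<circ> (cyc3 a b c \<circ> cyc3 a b c) = id"
    using abc by (auto simp: fun_eq_iff cyc3_apply)
  ultimately show ?thesis by simp
qed

text \<open>The alternating group is generated by its 3-cycles. Relabelling by \<open>b\<close>
  turns these into 3-cycles of \<open>X\<close>, which chains realise, and products are realised by
  concatenation.\<close>

lemma alt_generated:
  assumes b: "bij_betw b {1..g} X" and \<sigma>: "\<sigma> \<in> carrier (alt_group g)"
  shows "map_permutation {1..g} b \<sigma> \<in> chain_perms"
proof -
  interpret alt: group "alt_group g" by (rule alt_group_is_group)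
  have inj: "inj_on b {1..g}" using b by (simp add: bij_betw_def)
  have cyc: "map_permutation {1..g} b (cyc3 x y z) \<in> chain_perms" if "x \<noteq> y" "y \<noteq> z" "x \<noteq> z" "{x, y, z} \<subseteq> {1..g}" for x y z
  proof -
    have p: "Transposition.transpose y z permutes {1..g}" using that by (intro permutes_swap_id) auto
    have "map_permutation {1..g} b (cyc3 x y z) = cyc3 (b x) (b y) (b z)"
      unfolding cyc3_def using map_permutation_compose'[OF inj p, of "Transposition.transpose x y"] map_permutation_transpose[OF inj] that by simp
    moreover have "cyc3 (b x) (b y) (b z) \<in> chain_perms"
    proof (rule chain_perms_cyc3)
      show "b x \<noteq> b y" "b y \<noteq> b z" "b x \<noteq> b z" using that inj_on_eq_iff[OF inj] by simp_all
      show "{b x, b y, b z} \<subseteq> X" using that(4) bij_betw_apply[OF b] by simp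
    qed
    ultimately show ?thesis by simp
  qed
  have tc: "\<exists>x y z. h = cyc3 x y z \<and> x \<noteq> y \<and> y \<noteq> z \<and> x \<noteq> z \<and> {x, y, z} \<subseteq> {1..g}" if h: "h \<in> three_cycles g" for h
  proof -
    obtain cs where cs: "h = cycle_of_list cs" "cycle cs" "length cs = 3" "set cs \<subseteq> {1..g}" using h by blast
    obtain x y z where "cs = [x, y, z]" using cs(3) by (auto simp: numeral_3_eq_3 length_Suc_conv)
    thus ?thesis using cs by (intro exI[of _ x] exI[of _ y] exI[of _ z]) (auto simp: cyc3_def)
  qed
  have "\<sigma> \<in> generate (alt_group g) (three_cycles g)" using \<sigma> alt_group_carrier_as_three_cycles by blast
  thus ?thesis
  proof induction
    case one
    show ?case using chain_perms_id unfolding alt_group_one map_permutation_id'[OF inj] .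
  next
    case (incl h)
    obtain x y z where xyz: "h = cyc3 x y z" "x \<noteq> y" "y \<noteq> z" "x \<noteq> z" "{x, y, z} \<subseteq> {1..g}" using tc[OF incl] by blast
    show ?case unfolding xyz(1) by (rule cyc[OF xyz(2-)])
  next
    case (inv h)
    obtain x y z where xyz: "h = cyc3 x y z" "x \<noteq> y" "y \<noteq> z" "x \<noteq> z" "{x, y, z} \<subseteq> {1..g}" using tc[OF inv] by blast
    \<comment> \<open>The inverse of a 3-cycle is the cycle read backwards, so generators and their
      inverses are treated alike.\<close>
    have i1: "cyc3 z y x \<circ> cyc3 x y z = id" using xyz by (auto simp: fun_eq_iff cyc3_apply)
    have hc: "h \<in> carrier (alt_group g)" using inv three_cycles_incl by blast
    have "cyc3 z y x \<in> carrier (alt_group g)"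
      unfolding alt_group_carrier using cyc3_permutes[of z y x "{1..g}"] cyc3_even[of z y x] xyz by auto
    from alt.inv_equality[OF _ hc this] i1 xyz(1) have "inv\<^bsub>alt_group g\<^esub> h = cyc3 z y x"
      by (simp add: alt_group_mult alt_group_one)
    thus ?case using cyc[of z y x] xyz by auto
  next
    case (eng h1 h2)
    have "h2 \<in> carrier (alt_group g)" using eng alt_group_carrier_as_three_cycles by blast
    hence p: "h2 permutes {1..g}" by (simp add: alt_group_carrier)
    show ?case using chain_perms_comp[OF eng(4,3)] unfolding alt_group_mult map_permutation_compose'[OF inj p, of h1] .
  qed
qed

text \<open>An even permutation of \<open>X\<close> is relabelled to one of \<open>{1..g}\<close>,
  where generation by 3-cycles applies, and then relabelled back.\<close>

lemma chain_perms_eq: "chain_perms = {\<pi>. \<pi> permutes X \<and> evenperm \<pi>}"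
proof (intro equalityI subsetI)
  fix \<pi> assume "\<pi> \<in> chain_perms"
  thus "\<pi> \<in> {\<pi>. \<pi> permutes X \<and> evenperm \<pi>}" using chain_perm_perm unfolding chain_perms_def by blast
next
  fix \<pi> assume \<pi>: "\<pi> \<in> {\<pi>. \<pi> permutes X \<and> evenperm \<pi>}"
  obtain b where b: "bij_betw b {1..g} X" using cX ex_bij_betw_nat_finite_1 by blast
  define a where "a = inv_into {1..g} b"
  have a: "bij_betw a X {1..g}" unfolding a_def by (rule bij_betw_inv_into[OF b])
  have "map_permutation X a \<pi> permutes {1..g}" using map_permutation_permutes[OF a] \<pi> by simp
  moreover have "evenperm (map_permutation X a \<pi>)"
    using evenperm_map_permutation[OF cX(2), of a \<pi>] a \<pi> by (simp add: bij_betw_def)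
  ultimately have "map_permutation {1..g} b (map_permutation X a \<pi>) \<in> chain_perms"
    by (intro alt_generated[OF b]) (simp add: alt_group_carrier)
  moreover have "map_permutation {1..g} b (map_permutation X a \<pi>) = \<pi>"
    by (rule map_permutation_compose_inv[OF a]) (use \<pi> b in \<open>auto simp: a_def bij_betw_inv_into_right\<close>)
  ultimately show "\<pi> \<in> chain_perms" by simp
qed

lemma G_simps: "carrier (spin_group A L P) = chain_perms" "mult (spin_group A L P) = (\<circ>)" "one (spin_group A L P) = id"
  by (auto simp: spin_group_def chain_perms_def)

lemma perm_X: "\<pi> permutes X \<Longrightarrow> permutation \<pi>" using cX(2) permutation_permutes by blast

lemma G_group: "group (spin_group A L P)"
proof (rule groupI)
  fix x assume "x \<in> carrier (spin_group A L P)"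
  hence x: "x permutes X" "evenperm x" by (auto simp: G_simps chain_perms_eq)
  have "Hilbert_Choice.inv x \<in> carrier (spin_group A L P)"
    using permutes_inv[OF x(1)] evenperm_inv[OF perm_X[OF x(1)]] x(2) by (simp add: G_simps chain_perms_eq)
  moreover have "Hilbert_Choice.inv x \<circ> x = id" using permutes_inv_o(2)[OF x(1)] .
  ultimately show "\<exists>y\<in>carrier (spin_group A L P). y \<otimes>\<^bsub>spin_group A L P\<^esub> x = \<one>\<^bsub>spin_group A L P\<^esub>"
    by (auto simp: G_simps)
qed (auto simp: G_simps chain_perms_comp chain_perms_id o_assoc)

lemma G_iso: "spin_group A L P \<cong> alt_group g"
proof -
  obtain b where b: "bij_betw b {1..g} X" using cX ex_bij_betw_nat_finite_1 by blast
  define a where "a = inv_into {1..g} b"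
  have a: "bij_betw a X {1..g}" unfolding a_def by (rule bij_betw_inv_into[OF b])
  have injs: "inj_on a X" "inj_on b {1..g}" using a b by (auto simp: bij_betw_def)
  have to: "map_permutation X a \<pi> \<in> carrier (alt_group g)" if "\<pi> \<in> chain_perms" for \<pi>
    using that map_permutation_permutes[OF a] evenperm_map_permutation[OF cX(2) injs(1)] by (simp add: alt_group_carrier chain_perms_eq)
  have fro: "map_permutation {1..g} b \<sigma> \<in> chain_perms" if "\<sigma> \<in> carrier (alt_group g)" for \<sigma> by (rule alt_generated[OF b that])
  have 1: "map_permutation {1..g} b (map_permutation X a \<pi>) = \<pi>" if "\<pi> \<in> chain_perms" for \<pi>
    by (rule map_permutation_compose_inv[OF a]) (use that b in \<open>auto simp: a_def bij_betw_inv_into_right chain_perms_eq\<close>)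
  have 2: "map_permutation X a (map_permutation {1..g} b \<sigma>) = \<sigma>" if "\<sigma> \<in> carrier (alt_group g)" for \<sigma>
    by (rule map_permutation_compose_inv[OF b]) (use that b in \<open>auto simp: a_def bij_betw_inv_into_left alt_group_carrier\<close>)
  have "bij_betw (map_permutation X a) chain_perms (carrier (alt_group g))"
    by (rule bij_betwI[where g = "map_permutation {1..g} b"]) (use to fro 1 2 in auto)
  moreover have "map_permutation X a (x \<circ> y) = map_permutation X a x \<circ> map_permutation X a y" if "y \<in> chain_perms" for x y
    using map_permutation_compose'[OF injs(1), of y x] that by (simp add: chain_perms_eq)
  ultimately have "map_permutation X a \<in> iso (spin_group A L P) (alt_group g)"
    using to by (auto simp: iso_def hom_def G_simps alt_group_mult)
  thus ?thesis by (rule is_isoI)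
qed

end

theorem lemma8:
  fixes A :: "('a::t2_space) chart set"
    and L :: "('a, 'i) line_bundle"
    and P :: 'a
    and g :: nat
  assumes "hyperelliptic A"
    and "genus A = enat g"
    and "g \<ge> 3"
    and "nonsingular_even_spin_bundle A L"
    and "weierstrass_point A P"
  shows "card (spin_points A L P) = g \<and>
         (\<forall>\<pi> \<in> carrier (spin_group A L P). \<pi> permutes spin_points A L P) \<and>
         group (spin_group A L P) \<and>
         spin_group A L P \<cong> alt_group g"
proof -
  have "g \<ge> 2" using assms(3) by simp
  from weierstrass_configuration[OF assms(1,2) this assms(4,5)]
  obtain T where T: "P \<in> T" "card T = g + 1" "finite T" "\<forall>Q\<in>T. spin_points A L Q = T - {Q}" by blast
  interpret spin_configuration3 A L T P g by unfold_locales (use T assms(3) in auto)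
  have pts: "spin_points A L P = X" using T(1,4) by blast
  show ?thesis unfolding pts using cX(1) G_group G_iso by (auto simp: G_simps chain_perms_eq)
qed

end
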